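(* Assume (SMO) and (SCS) hold for the limit equilibrium $\mathrm{FPPE}(b,v,s)$, and for each $t$ consider the observed equilibrium $\widehat{\mathrm{FPPE}}(b,v,t^{-1},\gamma)$, where $\gamma=(\theta^1,\dots,\theta^t)$ consists of i.i.d. draws from $s$. Let the smoothing sequence satisfy $\varepsilon_t\downarrow0$ and $\varepsilon_t\sqrt t\to\infty$. Then, as $t\to\infty$, $\hat\Sigma_\beta\to\Sigma_\beta$ in probability and $\hat\sigma^2_{\mathrm{REV}}\to\sigma^2_{\mathrm{REV}}$ in probability, where $\Sigma_\beta=\mathbb E[D_\beta(\theta) D_\beta(\theta)^\top]$ and $\sigma^2_{\mathrm{REV}}=\mathbb E[D_{\mathrm{REV}}(\theta)^2]$. Consequently, for any $\alpha\in(0,1)$, $\mathbb P(\beta^*\in\mathrm{CR}_\beta)\to1-\alpha$ and $\mathbb P(\mathrm{REV}^*\in\mathrm{CI}_{\mathrm{REV}})\to1-\alpha$.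
   Context: Market. There are $n$ buyers with budgets $b=(b_1,\dots,b_n)$, $b_i>0$, and an item space $\Theta$ with integrating measure $d\theta$. $L^p$ (resp. $L^p_+$) denotes (nonnegative) $L^p$ functions on $\Theta$; functions agreeing outside a measure-zero set are identified; $\langle f,g\rangle=\int_\Theta fg\,d\theta$. Buyer $i$ has valuation $v_i\in L^1_+$, $v=(v_1,\dots,v_n)$, with $\bar v=\max_i\sup_\theta v_i(\theta)<\infty$. The supply is $s\in L^\infty_+$ with $\int_\Theta s\,d\theta=1$. Write $\mathbb E[g]=\int g(\theta)s(\theta)\,d\theta$. Limit FPPE. $\mathrm{FPPE}(b,v,s)$ is a tuple $(\beta,p,x_1,\dots,x_n)\in[0,1]^n\times L^1_+\times(L^\infty_+)^n$ such that: (i) for all $\theta$, $p(\theta)=\max_i\beta_iv_i(\theta)$, and $x_i(\theta)>0$ implies $\beta_iv_i(\theta)=\max_k\beta_kv_k(\theta)$; (ii) for all $i$, $\int x_i p s\,d\theta\le b_i$, and for all $\theta$, $\sum_i x_i(\theta)\le1$; (iii) for all $i$, $\int x_ips\,d\theta<b_i$ implies $\beta_i=1$, and for all $\theta$, $p(\theta)>0$ implies $\sum_ix_i(\theta)=1$. It is known that it exists and $\beta^*,p^*$ are unique; limit quantities carry a superscript $*$. Define $\mathrm{REV}^*=\int p^*s\,d\theta$, leftover budgets $\delta_i^*=b_i-\langle p^*,sx_i^*\rangle$, item utilities $\bar\mu_i^*=\langle v_i,sx_i^*\rangle$, and $\mu^*(\theta)=(x_1^*(\theta)v_1(\theta),\dots,x_n^*(\theta)v_n(\theta))$.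 (Under (SMO), $\mu^*$, $\bar\mu^*$, $\delta^*$ are uniquely determined.) Observed FPPE. For items $\gamma=(\theta^1,\dots,\theta^t)$ and per-item supply $\sigma>0$, $\widehat{\mathrm{FPPE}}(b,v,\sigma,\gamma)$ consists of $\beta\in[0,1]^n$, $p\in\mathbb R_+^t$, $x_i\in[0,1]^t$ satisfying: $p(\theta^\tau)=\max_i\beta_iv_i(\theta^\tau)$ and $x_i(\theta^\tau)>0$ implies $\beta_iv_i(\theta^\tau)=\max_k\beta_kv_k(\theta^\tau)$; $\sigma\sum_\tau x_i(\theta^\tau)p(\theta^\tau)\le b_i$ and $\sum_ix_i(\theta^\tau)\le1$; $\sigma\sum_\tau x_i(\theta^\tau)p(\theta^\tau)<b_i$ implies $\beta_i=1$, and $p(\theta^\tau)>0$ implies $\sum_ix_i(\theta^\tau)=1$. With $\sigma=1/t$, quantities of an observed FPPE carry a superscript $\gamma$: $\mathrm{REV}^\gamma=\frac1t\sum_\tau p^\gamma(\theta^\tau)$, $\bar\mu_i^\gamma=\frac1t\sum_\tau v_i(\theta^\tau)x_i^\gamma(\theta^\tau)$. Dual programs. $H(\beta)=\mathbb E[\max_i\beta_iv_i(\theta)]-\sum_ib_i\log\beta_i$ and $H_t(\beta)=\frac1t\sum_{\tau=1}^t\max_i\beta_iv_i(\theta^\tau)-\sum_ib_i\log\beta_i$, for $\beta$ with positive entries; it is known that $\beta^*$ (resp. $\beta^\gamma$) is the unique minimizer of $H$ (resp. $H_t$) over $(0,1]^n$. (SMO): the map $\beta\mapsto\mathbb E[\max_i\beta_iv_i(\theta)]$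 is $C^2$ in a neighborhood of $\beta^*$. (SCS): $\beta_i^*=1$ implies $\delta_i^*>0$, for every $i$. Let $\mathcal H=\nabla^2H(\beta^* )$, $\mathcal P=\mathrm{diag}(\mathbf 1(\beta_i^*<1))$, $\mathcal H_B=\mathcal P\mathcal H\mathcal P$; $\dagger$ is the Moore–Penrose pseudo-inverse. $D_\beta(\theta)=-(\mathcal H_B)^\dagger(\mu^*(\theta)-\bar\mu^* )$, $D_{\mathrm{REV}}(\theta)=p^*(\theta)-\mathrm{REV}^*+(\bar\mu^* )^\top D_\beta(\theta)$. Estimators. $\hat{\mathcal P}=\mathrm{diag}(\mathbf 1(\beta_i^\gamma<1-\varepsilon_t))$. $\hat{\mathcal H}$ has $(i,j)$ entry $[H_t(\beta^\gamma_{++})-H_t(\beta^\gamma_{+-})-H_t(\beta^\gamma_{-+})+H_t(\beta^\gamma_{--})]/(4\varepsilon_t^2)$ with $\beta^\gamma_{\pm\pm}=\beta^\gamma\pm e_i\varepsilon_t\pm e_j\varepsilon_t$ ($e_i$ the $i$-th unit vector). $\hat{\mathcal H}_B=\hat{\mathcal P}\hat{\mathcal H}\hat{\mathcal P}$. With $\odot$ the entrywise product, $\hat D_\beta^\tau=-(\hat{\mathcal H}_B)^\dagger(x^\gamma(\theta^\tau)\odot v(\theta^\tau)-\bar\mu^\gamma)$ and $\hat D_{\mathrm{REV}}^\tau=p^\gamma(\theta^\tau)-\mathrm{REV}^\gamma+(\bar\mu^\gamma)^\top\hat D_\beta^\tau$. Then $\hat\Sigma_\beta=\frac1t\sum_\tau\hat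 D_\beta^\tau(\hat D_\beta^\tau)^\top$, $\hat\sigma^2_{\mathrm{REV}}=\frac1t\sum_\tau(\hat D_{\mathrm{REV}}^\tau)^2$. Confidence sets at level $1-\alpha$: $\mathrm{CR}_\beta=\beta^\gamma+(\chi_{n,\alpha}/\sqrt t)\,\hat\Sigma_\beta^{1/2}\mathbb B$, with $\mathbb B$ the closed Euclidean unit ball of $\mathbb R^n$ and $\chi_{n,\alpha}$ the square root of the $(1-\alpha)$-quantile of the chi-square distribution with $n$ degrees of freedom; $\mathrm{CI}_{\mathrm{REV}}=[\mathrm{REV}^\gamma-z_{\alpha/2}\hat\sigma_{\mathrm{REV}}/\sqrt t,\ \mathrm{REV}^\gamma+z_{\alpha/2}\hat\sigma_{\mathrm{REV}}/\sqrt t]$, with $z_{\alpha/2}$ the $(1-\alpha/2)$-quantile of the standard normal.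
   Formalization: Coverage of CR_β is claimed only when Σ_β is invertible and coverage of CI_REV only when σ²_REV>0; without this it fails (one buyer, v=1, s=1, b=1/2: both coverages equal 1). The observed equilibrium is taken to be measurable. *)

theory Defs
  imports "HOL-Probability.Probability"
begin

subsection \<open>Matrices and calculus on \<open>real ^ 'n\<close>\<close>

text \<open>The entrywise product of vectors is the library's \<open>*\<close> on \<open>real ^ 'n\<close>; matrix products are
  \<open>**\<close> and \<open>*v\<close>.\<close>

definition diag_mat :: "real ^ 'n \<Rightarrow> real ^ 'n ^ 'n" where
  "diag_mat d = (\<chi> i j. if i = j then d $ i else 0)"

definition outer :: "real ^ 'n \<Rightarrow> real ^ 'n \<Rightarrow> real ^ 'n ^ 'n" where
  "outer a c = (\<chi> i j. a $ i * c $ j)"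

text \<open>Moore--Penrose pseudo-inverse, by the four Penrose equations.\<close>

definition pinv :: "real ^ 'n ^ 'n \<Rightarrow> real ^ 'n ^ 'n" where
  "pinv A = (THE X. A ** X ** A = A \<and> X ** A ** X = X \<and>
                    transpose (A ** X) = A ** X \<and> transpose (X ** A) = X ** A)"

definition psd :: "real ^ 'n ^ 'n \<Rightarrow> bool" where
  "psd A \<longleftrightarrow> transpose A = A \<and> (\<forall>u. 0 \<le> u \<bullet> (A *v u))"

definition psd_sqrt :: "real ^ 'n ^ 'n \<Rightarrow> real ^ 'n ^ 'n" where
  "psd_sqrt A = (THE S. psd S \<and> S ** S = A)"

definition gradient :: "(real ^ 'n \<Rightarrow> real) \<Rightarrow> real ^ 'n \<Rightarrow> real ^ 'n" where
  "gradient f y = (\<chi> i. frechet_derivative f (at y) (axis i 1))"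

definition hessian :: "(real ^ 'n \<Rightarrow> real) \<Rightarrow> real ^ 'n \<Rightarrow> real ^ 'n ^ 'n" where
  "hessian f y = jacobian (gradient f) (at y)"

text \<open>Meant for open \<open>U\<close>.\<close>

definition C2_on :: "(real ^ 'n) set \<Rightarrow> (real ^ 'n \<Rightarrow> real) \<Rightarrow> bool" where
  "C2_on U f \<longleftrightarrow> f differentiable_on U \<and> gradient f differentiable_on U \<and>
                 continuous_on U (hessian f)"

subsection \<open>Probability\<close>

definition tendsto_in_prob ::
    "'w measure \<Rightarrow> (nat \<Rightarrow> 'w \<Rightarrow> 'b::metric_space) \<Rightarrow> 'b \<Rightarrow> bool" where
  "tendsto_in_prob M X c \<longleftrightarrow>
     (\<forall>t. X t \<in> borel_measurable M) \<and>
     (\<forall>e>0. (\<lambda>t. measure M {\<omega> \<in> space M. dist (X t \<omega>) c > e}) \<longlonglongrightarrow> 0)"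

definition quantile :: "real measure \<Rightarrow> real \<Rightarrow> real" where
  "quantile D q = Inf {z. q \<le> cdf D z}"

definition chi_square :: "nat \<Rightarrow> real measure" where
  "chi_square n =
     distr (PiM {..<n} (\<lambda>_. std_normal_distribution)) borel (\<lambda>z. \<Sum>k<n. (z k)\<^sup>2)"

subsection \<open>Market and limit equilibrium\<close>

definition L1_nonneg :: "'a measure \<Rightarrow> ('a \<Rightarrow> real) \<Rightarrow> bool" where
  "L1_nonneg \<nu> f \<longleftrightarrow> integrable \<nu> f \<and> (AE \<theta> in \<nu>. 0 \<le> f \<theta>)"

definition Linf_nonneg :: "'a measure \<Rightarrow> ('a \<Rightarrow> real) \<Rightarrow> bool" where
  "Linf_nonneg \<nu> f \<longleftrightarrow>
     f \<in> borel_measurable \<nu> \<and> (AE \<theta> in \<nu>. 0 \<le> f \<theta>) \<and> (\<exists>C. AE \<theta> in \<nu>. f \<theta> \<le> C)"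

text \<open>Buyers are the elements of the finite type \<open>'n\<close>. The measure \<open>\<nu>\<close> on the item space is the
  integrating measure, and \<open>v \<theta> $ i\<close> is the value of item \<open>\<theta>\<close> to buyer \<open>i\<close>. Functions on items
  are identified when they agree almost everywhere, so pointwise conditions on items, and the
  bound on the values, are read almost everywhere.\<close>

definition market ::
    "'a measure \<Rightarrow> real ^ 'n \<Rightarrow> ('a \<Rightarrow> real ^ 'n) \<Rightarrow> ('a \<Rightarrow> real) \<Rightarrow> bool" where
  "market \<nu> b v s \<longleftrightarrow>
     (\<forall>i. 0 < b $ i) \<and>
     (\<forall>i. L1_nonneg \<nu> (\<lambda>\<theta>. v \<theta> $ i)) \<and>
     (\<exists>C. AE \<theta> in \<nu>. \<forall>i. v \<theta> $ i \<le> C) \<and>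
     Linf_nonneg \<nu> s \<and> (\<integral>\<theta>. s \<theta> \<partial>\<nu>) = 1"

definition supply_mean ::
    "'a measure \<Rightarrow> ('a \<Rightarrow> real) \<Rightarrow> ('a \<Rightarrow> 'b::{banach, second_countable_topology}) \<Rightarrow> 'b" where
  "supply_mean \<nu> s g = (\<integral>\<theta>. s \<theta> *\<^sub>R g \<theta> \<partial>\<nu>)"

definition top_bid :: "real ^ 'n \<Rightarrow> real ^ 'n \<Rightarrow> real" where
  "top_bid \<beta> w = (MAX i. \<beta> $ i * w $ i)"

definition limit_FPPE ::
    "'a measure \<Rightarrow> real ^ 'n \<Rightarrow> ('a \<Rightarrow> real ^ 'n) \<Rightarrow> ('a \<Rightarrow> real) \<Rightarrow>
     real ^ 'n \<Rightarrow> ('a \<Rightarrow> real) \<Rightarrow> ('a \<Rightarrow> real ^ 'n) \<Rightarrow> bool" where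
  "limit_FPPE \<nu> b v s \<beta> p x \<longleftrightarrow>
     (\<forall>i. 0 \<le> \<beta> $ i \<and> \<beta> $ i \<le> 1) \<and> L1_nonneg \<nu> p \<and> (\<forall>i. Linf_nonneg \<nu> (\<lambda>\<theta>. x \<theta> $ i)) \<and>
     (AE \<theta> in \<nu>. p \<theta> = top_bid \<beta> (v \<theta>) \<and>
        (\<forall>i. 0 < x \<theta> $ i \<longrightarrow> \<beta> $ i * v \<theta> $ i = top_bid \<beta> (v \<theta>))) \<and>
     (\<forall>i. (\<integral>\<theta>. x \<theta> $ i * p \<theta> * s \<theta> \<partial>\<nu>) \<le> b $ i) \<and>
     (AE \<theta> in \<nu>. (\<Sum>i\<in>UNIV. x \<theta> $ i) \<le> 1) \<and>
     (\<forall>i. (\<integral>\<theta>. x \<theta> $ i * p \<theta> * s \<theta> \<partial>\<nu>) < b $ i \<longrightarrow> \<beta> $ i = 1) \<and>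
     (AE \<theta> in \<nu>. 0 < p \<theta> \<longrightarrow> (\<Sum>i\<in>UNIV. x \<theta> $ i) = 1)"

definition limit_revenue :: "'a measure \<Rightarrow> ('a \<Rightarrow> real) \<Rightarrow> ('a \<Rightarrow> real) \<Rightarrow> real" where
  "limit_revenue \<nu> s p = (\<integral>\<theta>. p \<theta> * s \<theta> \<partial>\<nu>)"

definition leftover ::
    "'a measure \<Rightarrow> real ^ 'n \<Rightarrow> ('a \<Rightarrow> real) \<Rightarrow> ('a \<Rightarrow> real) \<Rightarrow> ('a \<Rightarrow> real ^ 'n) \<Rightarrow> real ^ 'n" where
  "leftover \<nu> b s p x = (\<chi> i. b $ i - (\<integral>\<theta>. p \<theta> * (s \<theta> * x \<theta> $ i) \<partial>\<nu>))"

definition limit_util ::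
    "'a measure \<Rightarrow> ('a \<Rightarrow> real ^ 'n) \<Rightarrow> ('a \<Rightarrow> real) \<Rightarrow> ('a \<Rightarrow> real ^ 'n) \<Rightarrow> real ^ 'n" where
  "limit_util \<nu> v s x = (\<chi> i. \<integral>\<theta>. v \<theta> $ i * (s \<theta> * x \<theta> $ i) \<partial>\<nu>)"

text \<open>The dual objectives are only meaningful for \<open>\<beta>\<close> with positive entries (\<open>ln\<close> is total).\<close>

definition dual_obj ::
    "'a measure \<Rightarrow> real ^ 'n \<Rightarrow> ('a \<Rightarrow> real ^ 'n) \<Rightarrow> ('a \<Rightarrow> real) \<Rightarrow> real ^ 'n \<Rightarrow> real" where
  "dual_obj \<nu> b v s \<beta> =
     supply_mean \<nu> s (\<lambda>\<theta>. top_bid \<beta> (v \<theta>)) - (\<Sum>i\<in>UNIV. b $ i * ln (\<beta> $ i))"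

definition SMO ::
    "'a measure \<Rightarrow> ('a \<Rightarrow> real ^ 'n) \<Rightarrow> ('a \<Rightarrow> real) \<Rightarrow> real ^ 'n \<Rightarrow> bool" where
  "SMO \<nu> v s \<beta> \<longleftrightarrow>
     (\<exists>U. open U \<and> \<beta> \<in> U \<and> C2_on U (\<lambda>\<beta>'. supply_mean \<nu> s (\<lambda>\<theta>. top_bid \<beta>' (v \<theta>))))"

definition SCS ::
    "'a measure \<Rightarrow> real ^ 'n \<Rightarrow> ('a \<Rightarrow> real) \<Rightarrow>
     real ^ 'n \<Rightarrow> ('a \<Rightarrow> real) \<Rightarrow> ('a \<Rightarrow> real ^ 'n) \<Rightarrow> bool" where
  "SCS \<nu> b s \<beta> p x \<longleftrightarrow> (\<forall>i. \<beta> $ i = 1 \<longrightarrow> 0 < leftover \<nu> b s p x $ i)"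

definition limit_hessian_B ::
    "'a measure \<Rightarrow> real ^ 'n \<Rightarrow> ('a \<Rightarrow> real ^ 'n) \<Rightarrow> ('a \<Rightarrow> real) \<Rightarrow> real ^ 'n \<Rightarrow> real ^ 'n ^ 'n" where
  "limit_hessian_B \<nu> b v s \<beta> =
     (let P = diag_mat (\<chi> i. of_bool (\<beta> $ i < 1))
      in P ** hessian (dual_obj \<nu> b v s) \<beta> ** P)"

definition D_beta ::
    "'a measure \<Rightarrow> real ^ 'n \<Rightarrow> ('a \<Rightarrow> real ^ 'n) \<Rightarrow> ('a \<Rightarrow> real) \<Rightarrow>
     real ^ 'n \<Rightarrow> ('a \<Rightarrow> real ^ 'n) \<Rightarrow> 'a \<Rightarrow> real ^ 'n" where
  "D_beta \<nu> b v s \<beta> x \<theta> =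
     - (pinv (limit_hessian_B \<nu> b v s \<beta>) *v (x \<theta> * v \<theta> - limit_util \<nu> v s x))"

definition D_rev ::
    "'a measure \<Rightarrow> real ^ 'n \<Rightarrow> ('a \<Rightarrow> real ^ 'n) \<Rightarrow> ('a \<Rightarrow> real) \<Rightarrow>
     real ^ 'n \<Rightarrow> ('a \<Rightarrow> real) \<Rightarrow> ('a \<Rightarrow> real ^ 'n) \<Rightarrow> 'a \<Rightarrow> real" where
  "D_rev \<nu> b v s \<beta> p x \<theta> =
     p \<theta> - limit_revenue \<nu> s p + limit_util \<nu> v s x \<bullet> D_beta \<nu> b v s \<beta> x \<theta>"

definition Sigma_beta ::
    "'a measure \<Rightarrow> real ^ 'n \<Rightarrow> ('a \<Rightarrow> real ^ 'n) \<Rightarrow> ('a \<Rightarrow> real) \<Rightarrow>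
     real ^ 'n \<Rightarrow> ('a \<Rightarrow> real ^ 'n) \<Rightarrow> real ^ 'n ^ 'n" where
  "Sigma_beta \<nu> b v s \<beta> x =
     supply_mean \<nu> s (\<lambda>\<theta>. outer (D_beta \<nu> b v s \<beta> x \<theta>) (D_beta \<nu> b v s \<beta> x \<theta>))"

definition sigma2_rev ::
    "'a measure \<Rightarrow> real ^ 'n \<Rightarrow> ('a \<Rightarrow> real ^ 'n) \<Rightarrow> ('a \<Rightarrow> real) \<Rightarrow>
     real ^ 'n \<Rightarrow> ('a \<Rightarrow> real) \<Rightarrow> ('a \<Rightarrow> real ^ 'n) \<Rightarrow> real" where
  "sigma2_rev \<nu> b v s \<beta> p x = supply_mean \<nu> s (\<lambda>\<theta>. (D_rev \<nu> b v s \<beta> p x \<theta>)\<^sup>2)"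

subsection \<open>Observed equilibrium and estimators\<close>

text \<open>The items are \<open>\<gamma> 0, \<dots>, \<gamma> (t - 1)\<close>. Prices and allocations of an observed equilibrium are
  indexed by the position of an item in the sample, so a repeated item may be allocated
  differently at its different occurrences.\<close>

definition observed_FPPE ::
    "real ^ 'n \<Rightarrow> ('a \<Rightarrow> real ^ 'n) \<Rightarrow> real \<Rightarrow> nat \<Rightarrow> (nat \<Rightarrow> 'a) \<Rightarrow>
     real ^ 'n \<Rightarrow> (nat \<Rightarrow> real) \<Rightarrow> (nat \<Rightarrow> real ^ 'n) \<Rightarrow> bool" where
  "observed_FPPE b v \<sigma> t \<gamma> \<beta> p x \<longleftrightarrow>
     (\<forall>i. 0 \<le> \<beta> $ i \<and> \<beta> $ i \<le> 1) \<and> (\<forall>\<tau><t. 0 \<le> p \<tau>) \<and>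
     (\<forall>\<tau><t. \<forall>i. 0 \<le> x \<tau> $ i \<and> x \<tau> $ i \<le> 1) \<and>
     (\<forall>\<tau><t. p \<tau> = top_bid \<beta> (v (\<gamma> \<tau>)) \<and>
        (\<forall>i. 0 < x \<tau> $ i \<longrightarrow> \<beta> $ i * v (\<gamma> \<tau>) $ i = top_bid \<beta> (v (\<gamma> \<tau>)))) \<and>
     (\<forall>i. \<sigma> * (\<Sum>\<tau><t. x \<tau> $ i * p \<tau>) \<le> b $ i) \<and>
     (\<forall>\<tau><t. (\<Sum>i\<in>UNIV. x \<tau> $ i) \<le> 1) \<and>
     (\<forall>i. \<sigma> * (\<Sum>\<tau><t. x \<tau> $ i * p \<tau>) < b $ i \<longrightarrow> \<beta> $ i = 1) \<and>
     (\<forall>\<tau><t. 0 < p \<tau> \<longrightarrow> (\<Sum>i\<in>UNIV. x \<tau> $ i) = 1)"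

definition sample_mean :: "nat \<Rightarrow> (nat \<Rightarrow> 'b::real_vector) \<Rightarrow> 'b" where
  "sample_mean t f = (1 / real t) *\<^sub>R (\<Sum>\<tau><t. f \<tau>)"

definition sample_util ::
    "('a \<Rightarrow> real ^ 'n) \<Rightarrow> nat \<Rightarrow> (nat \<Rightarrow> 'a) \<Rightarrow> (nat \<Rightarrow> real ^ 'n) \<Rightarrow> real ^ 'n" where
  "sample_util v t \<gamma> x = sample_mean t (\<lambda>\<tau>. v (\<gamma> \<tau>) * x \<tau>)"

definition sample_dual_obj ::
    "real ^ 'n \<Rightarrow> ('a \<Rightarrow> real ^ 'n) \<Rightarrow> nat \<Rightarrow> (nat \<Rightarrow> 'a) \<Rightarrow> real ^ 'n \<Rightarrow> real" where
  "sample_dual_obj b v t \<gamma> \<beta> =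
     sample_mean t (\<lambda>\<tau>. top_bid \<beta> (v (\<gamma> \<tau>))) - (\<Sum>i\<in>UNIV. b $ i * ln (\<beta> $ i))"

definition fd_hessian :: "(real ^ 'n \<Rightarrow> real) \<Rightarrow> real \<Rightarrow> real ^ 'n \<Rightarrow> real ^ 'n ^ 'n" where
  "fd_hessian F e \<beta> =
     (\<chi> i j. (F (\<beta> + e *\<^sub>R axis i 1 + e *\<^sub>R axis j 1) - F (\<beta> + e *\<^sub>R axis i 1 - e *\<^sub>R axis j 1)
            - F (\<beta> - e *\<^sub>R axis i 1 + e *\<^sub>R axis j 1) + F (\<beta> - e *\<^sub>R axis i 1 - e *\<^sub>R axis j 1))
           / (4 * e\<^sup>2))"

definition hat_hessian_B ::
    "real ^ 'n \<Rightarrow> ('a \<Rightarrow> real ^ 'n) \<Rightarrow> real \<Rightarrow> nat \<Rightarrow> (nat \<Rightarrow> 'a) \<Rightarrow> real ^ 'n \<Rightarrow> real ^ 'n ^ 'n" where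
  "hat_hessian_B b v e t \<gamma> \<beta> =
     (let P = diag_mat (\<chi> i. of_bool (\<beta> $ i < 1 - e))
      in P ** fd_hessian (sample_dual_obj b v t \<gamma>) e \<beta> ** P)"

definition hat_D_beta ::
    "real ^ 'n \<Rightarrow> ('a \<Rightarrow> real ^ 'n) \<Rightarrow> real \<Rightarrow> nat \<Rightarrow> (nat \<Rightarrow> 'a) \<Rightarrow>
     real ^ 'n \<Rightarrow> (nat \<Rightarrow> real ^ 'n) \<Rightarrow> nat \<Rightarrow> real ^ 'n" where
  "hat_D_beta b v e t \<gamma> \<beta> x \<tau> =
     - (pinv (hat_hessian_B b v e t \<gamma> \<beta>) *v (x \<tau> * v (\<gamma> \<tau>) - sample_util v t \<gamma> x))"

definition hat_D_rev ::
    "real ^ 'n \<Rightarrow> ('a \<Rightarrow> real ^ 'n) \<Rightarrow> real \<Rightarrow> nat \<Rightarrow> (nat \<Rightarrow> 'a) \<Rightarrow>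
     real ^ 'n \<Rightarrow> (nat \<Rightarrow> real) \<Rightarrow> (nat \<Rightarrow> real ^ 'n) \<Rightarrow> nat \<Rightarrow> real" where
  "hat_D_rev b v e t \<gamma> \<beta> p x \<tau> =
     p \<tau> - sample_mean t p + sample_util v t \<gamma> x \<bullet> hat_D_beta b v e t \<gamma> \<beta> x \<tau>"

definition hat_Sigma_beta ::
    "real ^ 'n \<Rightarrow> ('a \<Rightarrow> real ^ 'n) \<Rightarrow> real \<Rightarrow> nat \<Rightarrow> (nat \<Rightarrow> 'a) \<Rightarrow>
     real ^ 'n \<Rightarrow> (nat \<Rightarrow> real ^ 'n) \<Rightarrow> real ^ 'n ^ 'n" where
  "hat_Sigma_beta b v e t \<gamma> \<beta> x =
     sample_mean t (\<lambda>\<tau>. outer (hat_D_beta b v e t \<gamma> \<beta> x \<tau>) (hat_D_beta b v e t \<gamma> \<beta> x \<tau>))"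

definition hat_sigma2_rev ::
    "real ^ 'n \<Rightarrow> ('a \<Rightarrow> real ^ 'n) \<Rightarrow> real \<Rightarrow> nat \<Rightarrow> (nat \<Rightarrow> 'a) \<Rightarrow>
     real ^ 'n \<Rightarrow> (nat \<Rightarrow> real) \<Rightarrow> (nat \<Rightarrow> real ^ 'n) \<Rightarrow> real" where
  "hat_sigma2_rev b v e t \<gamma> \<beta> p x = sample_mean t (\<lambda>\<tau>. (hat_D_rev b v e t \<gamma> \<beta> p x \<tau>)\<^sup>2)"

definition CR_beta ::
    "real \<Rightarrow> real ^ 'n \<Rightarrow> ('a \<Rightarrow> real ^ 'n) \<Rightarrow> real \<Rightarrow> nat \<Rightarrow> (nat \<Rightarrow> 'a) \<Rightarrow>
     real ^ 'n \<Rightarrow> (nat \<Rightarrow> real ^ 'n) \<Rightarrow> (real ^ 'n) set" where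
  "CR_beta \<alpha> b v e t \<gamma> \<beta> x =
     (\<lambda>u. \<beta> + (sqrt (quantile (chi_square CARD('n)) (1 - \<alpha>)) / sqrt (real t)) *\<^sub>R
              (psd_sqrt (hat_Sigma_beta b v e t \<gamma> \<beta> x) *v u)) ` cball 0 1"

definition CI_rev ::
    "real \<Rightarrow> real ^ 'n \<Rightarrow> ('a \<Rightarrow> real ^ 'n) \<Rightarrow> real \<Rightarrow> nat \<Rightarrow> (nat \<Rightarrow> 'a) \<Rightarrow>
     real ^ 'n \<Rightarrow> (nat \<Rightarrow> real) \<Rightarrow> (nat \<Rightarrow> real ^ 'n) \<Rightarrow> real set" where
  "CI_rev \<alpha> b v e t \<gamma> \<beta> p x =
     (let h = quantile std_normal_distribution (1 - \<alpha> / 2)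
              * sqrt (hat_sigma2_rev b v e t \<gamma> \<beta> p x) / sqrt (real t)
      in {sample_mean t p - h .. sample_mean t p + h})"

end

theory Submission imports Defs begin

text \<open>Everything is deduced from the convexity of \<open>\<beta> \<mapsto> top_bid \<beta> w\<close>. In equilibrium an item goes to its highest
  bidders, and so the value \<open>x * v\<close> that it yields to each buyer is a subgradient of the highest bid at the
  equilibrium multipliers (\<open>allocation_is_subgradient\<close>). Write \<open>m0\<close> for this subgradient in the limit
  equilibrium, \<open>\<mu>\<close> for its mean under the supply, and \<open>R y k\<close> for the error of the linear approximation of
  the highest bid on the item \<open>y\<close> at \<open>\<beta>0 + k\<close>. The error is nonnegative and at most \<open>2 L |k|\<close>, and
  smoothness of the expected highest bid gives \<open>E R(d k) / d\<^sup>2 \<longlongrightarrow> k \<bullet> A k / 2\<close>, where \<open>A\<close> is the Hessian of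
  that expectation. Hence \<open>E R(d k)\<^sup>2\<close> is at most \<open>2 L d |k| E R(d k)\<close>, which is of order \<open>d\<^sup>3\<close> although \<open>R\<close> is only Lipschitz,
  and the sample mean of \<open>R(d k) / d\<^sup>2\<close> has variance of order \<open>1 / (t d)\<close>. It therefore converges to
  \<open>k \<bullet> A k / 2\<close> in probability whenever \<open>d \<longlongrightarrow> 0\<close> and \<open>t d \<longlongrightarrow> \<infinity>\<close>, and by convexity the convergence is locally uniform
  in \<open>k\<close> (\<open>Q_pointwise\<close>, \<open>Q_uniform\<close>). This single statement, used with \<open>d = 1 / sqrt t\<close> and with
  \<open>d = \<epsilon> t\<close>, takes the place of empirical process theory.

  Subgradients of convex functions are monotone, and spending equals the budget unless
  a multiplier is \<open>1\<close>; together these bound \<open>|\<beta> - \<beta>0|\<close> by a multiple of \<open>|mbar - \<mu>|\<close>, where \<open>mbar\<close>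
  averages \<open>m0\<close> over the sample (\<open>typical_rate\<close>). So the multipliers converge at rate \<open>1 / sqrt t\<close>. On this scale the
  observed subgradients are squeezed between difference quotients of a nearly quadratic convex function, which gives
  \<open>sqrt t (\<mu>' - mbar) = A h + o(1)\<close> for \<open>h = sqrt t (\<beta> - \<beta>0)\<close> and the observed utilities \<open>\<mu>'\<close>
  (\<open>subgradient_expansion\<close>). Strict complementary slackness makes the multipliers with \<open>\<beta>0 = 1\<close>
  equal to \<open>1\<close> with probability tending to one, and on the others \<open>\<mu>' = b / \<beta>\<close>. Solving for \<open>h\<close> yields
  \<open>h = - X (sqrt t (mbar - \<mu>)) + o(1)\<close> with \<open>X\<close> the pseudo-inverse of the restricted Hessian
  (\<open>asymptotically_linear\<close>), that is, \<open>h\<close> is asymptotically the normalised sum of the \<open>D_beta\<close> of the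
  items. Inserting this in the expansion of the mean price gives the same for the revenue and \<open>D_rev\<close>.

  For the variance estimators, second differences of a function uniformly close to \<open>k \<bullet> A k / 2\<close> are close to
  those of the quadratic form, so the finite-difference Hessian is consistent; its pseudo-inverse is, too, because the set of
  buyers with multiplier one is eventually identified and the rank no longer changes. Item by item,
  \<open>\<bar>m - m0\<bar>\<close> is bounded by difference quotients of \<open>R\<close>, whence the observed allocations are on average close to
  the limit ones (\<open>allocations_close\<close>). Products and sums of bounded arrays inherit such closeness, and the law of large
  numbers does the rest.

  As to coverage, the true multipliers lie in the confidence region exactly when \<open>h \<bullet> \<Sigma>^-1 h\<close>, with the
  estimated \<open>\<Sigma>\<close>, is below the chi-square quantile (\<open>ellipsoid_membership\<close>), and this quadratic form is within \<open>o(1)\<close> of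
  the squared norm of a normalised sum of independent vectors with identity covariance. The latter is asymptotically chi-square:
  averaging the one-dimensional central limit theorem over Gaussian directions gives convergence of Laplace transforms
  (\<open>norm_squared_normalised_sum_chi_square\<close>). Events that are sandwiched between nearby sublevel sets
  of a convergent statistic have the limit probability (\<open>prob_tendsto_sandwich\<close>). The interval for the revenue is treated in
  the same way, one end at a time.\<close>

section \<open>Spectral decomposition of symmetric matrices\<close>

lemma symmetric_inner:
  fixes A :: "real ^ 'n ^ 'n"
  assumes "transpose A = A"
  shows "u \<bullet> (A *v w) = (A *v u) \<bullet> w"
  using assms by (metis dot_lmul_matrix vector_transpose_matrix)

text \<open>The Rayleigh quotient attains its maximum on the unit sphere of the subspace. Moving
  from a maximiser \<open>u\<close> in an orthogonal direction \<open>w\<close> changes it to first order by \<open>2 w \<bullet> A u\<close>, which must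
  vanish; since \<open>A u\<close> stays in the subspace, it is a multiple of \<open>u\<close>.\<close>

lemma symmetric_eigenvector_in_subspace:
  fixes A :: "real ^ 'n ^ 'n"
  assumes sym: "transpose A = A" and S: "subspace S" and inv: "\<And>u. u \<in> S \<Longrightarrow> A *v u \<in> S"
    and ne: "S \<noteq> {0}"
  obtains u l where "u \<in> S" "norm u = 1" "A *v u = l *\<^sub>R u"
proof -
  let ?q = "\<lambda>u. u \<bullet> (A *v u)"
  have qs: "?q (c *\<^sub>R y) = c\<^sup>2 * ?q y" for c y
    by (simp add: matrix_vector_mult_scaleR power2_eq_square)
  have "compact (sphere 0 1 \<inter> S)"
    by (simp add: closed_subspace S compact_Int_closed)
  moreover from S ne obtain w where w: "w \<in> S" "w \<noteq> 0" using subspace_0 by blast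
  then have "(1 / norm w) *\<^sub>R w \<in> sphere 0 1 \<inter> S" using S by (simp add: subspace_scale)
  then have "sphere 0 1 \<inter> S \<noteq> {}" by blast
  moreover have "continuous_on (sphere 0 1 \<inter> S) ?q"
    by (intro continuous_on_inner continuous_on_id matrix_vector_mult_linear_continuous_on)
  ultimately have "\<exists>u\<in>sphere 0 1 \<inter> S. \<forall>y\<in>sphere 0 1 \<inter> S. ?q y \<le> ?q u"
    by (rule continuous_attains_sup)
  then obtain u where u: "u \<in> sphere 0 1 \<inter> S" and max: "\<And>y. y \<in> sphere 0 1 \<inter> S \<Longrightarrow> ?q y \<le> ?q u"
    by blast
  define l where "l = ?q u"
  have uu: "u \<bullet> u = 1" using u by (simp add: dot_square_norm)
  have max': "?q y \<le> l * (y \<bullet> y)" if "y \<in> S" for y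
  proof (cases "y = 0")
    case False
    then have "(1 / norm y) *\<^sub>R y \<in> sphere 0 1 \<inter> S" using S that by (simp add: subspace_scale)
    from max[OF this] have "?q y / (norm y)\<^sup>2 \<le> l"
      by (simp only: qs l_def) (simp add: power_divide)
    then show ?thesis using False by (simp add: divide_le_eq power2_norm_eq_inner)
  qed simp
  have orth: "w \<bullet> (A *v u) = 0" if "w \<in> S" "u \<bullet> w = 0" for w
  proof (rule ccontr)
    assume c: "w \<bullet> (A *v u) \<noteq> 0"
    define a where "a = w \<bullet> (A *v u)"
    define q where "q = ?q w - l * (w \<bullet> w)"
    \<comment> \<open>maximality of \<open>u\<close> tested at \<open>u + t w\<close>\<close>
    have *: "2 * t * a + t\<^sup>2 * q \<le> 0" for t
    proof -
      have "u + t *\<^sub>R w \<in> S" using S u that by (simp add: subspace_add subspace_scale)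
      from max'[OF this] have "?q (u + t *\<^sub>R w) \<le> l * ((u + t *\<^sub>R w) \<bullet> (u + t *\<^sub>R w))" .
      moreover have "?q (u + t *\<^sub>R w) = l + 2 * t * a + t\<^sup>2 * ?q w"
        using symmetric_inner[OF sym, of u w]
        by (simp add: matrix_vector_right_distrib matrix_vector_mult_scaleR inner_add_left inner_add_right
            l_def a_def power2_eq_square inner_commute algebra_simps)
      moreover have "(u + t *\<^sub>R w) \<bullet> (u + t *\<^sub>R w) = 1 + t\<^sup>2 * (w \<bullet> w)"
        using uu that by (simp add: inner_add_left inner_add_right inner_commute[of w u] power2_eq_square)
      ultimately have "l + 2 * t * a + t\<^sup>2 * ?q w \<le> l * (1 + t\<^sup>2 * (w \<bullet> w))" by metis
      then show ?thesis by (simp add: q_def algebra_simps)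
    qed
    have a: "a \<noteq> 0" using c by (simp add: a_def)
    \<comment> \<open>small enough for the linear term to dominate, whatever the size of \<open>q\<close>\<close>
    define t where "t = a / (\<bar>q\<bar> + 1)"
    have t: "t * (\<bar>q\<bar> + 1) = a" by (simp add: t_def)
    have "2 * t * a = 2 * t * (t * (\<bar>q\<bar> + 1))" unfolding t ..
    then have "2 * t * a = 2 * (t\<^sup>2 * \<bar>q\<bar>) + 2 * t\<^sup>2" by (simp add: power2_eq_square algebra_simps)
    moreover have "t\<^sup>2 > 0" using a by (simp add: t_def)
    moreover have "t\<^sup>2 * q \<ge> - (t\<^sup>2 * \<bar>q\<bar>)" using mult_left_mono[of "- \<bar>q\<bar>" q "t\<^sup>2"] by simp
    moreover have "t\<^sup>2 * \<bar>q\<bar> \<ge> 0" by simp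
    ultimately show False using *[of t] by linarith
  qed
  define z where "z = A *v u - l *\<^sub>R u"
  have zS: "z \<in> S" using S u inv by (auto simp: z_def intro!: subspace_diff subspace_scale)
  have zu: "u \<bullet> z = 0" using u by (simp add: z_def inner_diff_right l_def dot_square_norm)
  have "z \<bullet> z = z \<bullet> (A *v u) - l * (z \<bullet> u)" by (simp add: z_def inner_diff_right)
  also have "\<dots> = 0" using orth[OF zS zu] zu by (simp add: inner_commute)
  finally have "z = 0" by simp
  with u show ?thesis by (intro that[of u l]) (auto simp: z_def)
qed

text \<open>Splitting off one eigenvector leaves its orthogonal complement, which is again invariant because
  \<open>A\<close> is symmetric.\<close>

lemma symmetric_eigenbasis_of_subspace:
  fixes A :: "real ^ 'n ^ 'n"
  assumes sym: "transpose A = A"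
  shows "subspace S \<Longrightarrow> (\<And>u. u \<in> S \<Longrightarrow> A *v u \<in> S) \<Longrightarrow>
    \<exists>B l. finite B \<and> B \<subseteq> S \<and> pairwise orthogonal B \<and> (\<forall>u\<in>B. norm u = 1 \<and> A *v u = l u *\<^sub>R u) \<and> span B = S"
proof (induction "dim S" arbitrary: S rule: less_induct)
  case less
  show ?case
  proof (cases "S = {0}")
    case True
    then show ?thesis by (intro exI[of _ "{}"]) (auto simp: pairwise_def)
  next
    case False
    from symmetric_eigenvector_in_subspace[OF sym less.prems(1,2) False]
    obtain u m where u: "u \<in> S" "norm u = 1" "A *v u = m *\<^sub>R u" by auto
    define T where "T = {w \<in> S. u \<bullet> w = 0}"
    have T: "subspace T" using less.prems(1)
      by (auto simp: T_def subspace_def inner_add_right)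
    have invT: "A *v w \<in> T" if "w \<in> T" for w
      using that less.prems(2) symmetric_inner[OF sym, of u w] by (auto simp: T_def u(3))
    have uT: "u \<notin> T" using u(2) by (auto simp: T_def dot_square_norm)
    have "T \<subset> S" using u(1) uT unfolding T_def by blast
    then have "span T \<subset> span S" using T less.prems(1) by (metis span_eq_iff)
    from dim_psubset[OF this] have "dim T < dim S" .
    from less.hyps[OF this T invT] obtain B l where B: "finite B" "B \<subseteq> T" "pairwise orthogonal B"
      "\<forall>u\<in>B. norm u = 1 \<and> A *v u = l u *\<^sub>R u" "span B = T" by auto
    have "span (insert u B) = S"
    proof
      show "span (insert u B) \<subseteq> S" using u(1) B(2) less.prems(1)
        by (intro span_minimal) (auto simp: T_def)
      show "S \<subseteq> span (insert u B)"
      proof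
        fix w assume w: "w \<in> S"
        have "w - (u \<bullet> w) *\<^sub>R u \<in> T" using w u less.prems(1)
          by (auto simp: T_def inner_diff_right dot_square_norm intro!: subspace_diff subspace_scale)
        then show "w \<in> span (insert u B)" using B(5) by (auto simp: span_insert)
      qed
    qed
    moreover have "pairwise orthogonal (insert u B)"
      using B(2,3) by (auto simp: pairwise_insert orthogonal_def T_def inner_commute subset_iff)
    moreover have "u \<notin> B" using uT B(2) by auto
    ultimately show ?thesis using B u
      by (intro exI[of _ "insert u B"] exI[of _ "l(u := m)"]) (auto simp: T_def)
  qed
qed

lemma symmetric_eigenbasis:
  fixes A :: "real ^ 'n ^ 'n"
  assumes "transpose A = A"
  obtains B l where "finite B" "pairwise orthogonal B" "\<And>u. u \<in> B \<Longrightarrow> norm u = 1"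
    "\<And>u. u \<in> B \<Longrightarrow> A *v u = l u *\<^sub>R u" "span B = UNIV"
  using symmetric_eigenbasis_of_subspace[OF assms, of UNIV] subspace_UNIV by blast

lemma matrix_eq_on_spanning:
  fixes A C :: "real ^ 'n ^ 'n"
  assumes "span B = UNIV" "\<And>u. u \<in> B \<Longrightarrow> A *v u = C *v u"
  shows "A = C"
proof -
  have "A *v w = C *v w" for w
    using linear_eq_on[of "(*v) A" "(*v) C" w B] assms by (auto simp: matrix_vector_mul_linear)
  then show ?thesis by (simp add: matrix_eq)
qed

text \<open>\<open>L\<close> is the spectrum of \<open>A\<close>, and \<open>\<Phi> \<phi>\<close> has the eigenvectors of \<open>A\<close> and the
  eigenvalues \<open>\<phi> l\<close>. The algebraic laws are enough to build pseudo-inverses and square roots from scalar functions, with no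
  further mention of eigenbases.\<close>

definition functional_calculus ::
    "real ^ 'n ^ 'n \<Rightarrow> ((real \<Rightarrow> real) \<Rightarrow> real ^ 'n ^ 'n) \<Rightarrow> real set \<Rightarrow> bool" where
  "functional_calculus A \<Phi> L \<longleftrightarrow>
    (\<forall>\<phi>. transpose (\<Phi> \<phi>) = \<Phi> \<phi>) \<and> (\<forall>\<phi> \<psi>. \<Phi> \<phi> ** \<Phi> \<psi> = \<Phi> (\<lambda>l. \<phi> l * \<psi> l)) \<and>
    (\<forall>\<phi> \<psi>. (\<forall>l\<in>L. \<phi> l = \<psi> l) \<longrightarrow> \<Phi> \<phi> = \<Phi> \<psi>) \<and>
    \<Phi> (\<lambda>l. l) = A \<and> \<Phi> (\<lambda>l. 1) = mat 1 \<and>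
    (\<forall>l\<in>L. \<exists>u. norm u = 1 \<and> A *v u = l *\<^sub>R u) \<and>
    (\<forall>\<phi>. (\<forall>l\<in>L. 0 \<le> \<phi> l) \<longrightarrow> (\<forall>u. 0 \<le> u \<bullet> (\<Phi> \<phi> *v u)))"

lemma symmetric_functional_calculus:
  fixes A :: "real ^ 'n ^ 'n"
  assumes sym: "transpose A = A"
  obtains \<Phi> L where "functional_calculus A \<Phi> L"
proof -
  obtain B l where B: "finite B" "pairwise orthogonal B" "\<And>u. u \<in> B \<Longrightarrow> norm u = 1"
    "\<And>u. u \<in> B \<Longrightarrow> A *v u = l u *\<^sub>R u" "span B = UNIV"
    by (rule symmetric_eigenbasis[OF sym]) (rule that; assumption)
  define \<Phi> where "\<Phi> \<phi> = (\<Sum>u\<in>B. \<phi> (l u) *\<^sub>R outer u u)" for \<phi>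
  have outer: "outer a c *v w = (c \<bullet> w) *\<^sub>R a" for a c w :: "real ^ 'n"
    by (simp add: outer_def matrix_vector_mult_def vec_eq_iff inner_vec_def sum_distrib_left algebra_simps)
  have \<Phi>v: "\<Phi> \<phi> *v w = (\<Sum>u\<in>B. (\<phi> (l u) * (u \<bullet> w)) *\<^sub>R u)" for \<phi> w
  proof -
    have "\<Phi> \<phi> *v w = (\<Sum>u\<in>B. (\<phi> (l u) *\<^sub>R outer u u) *v w)" unfolding \<Phi>_def
      using B(1) by (induction B rule: finite_induct) (auto simp: matrix_vector_mult_add_rdistrib)
    also have "\<dots> = (\<Sum>u\<in>B. (\<phi> (l u) * (u \<bullet> w)) *\<^sub>R u)"
      by (simp add: scaleR_matrix_vector_assoc[symmetric] outer)
    finally show ?thesis .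
  qed
  have \<Phi>B: "\<Phi> \<phi> *v w = \<phi> (l w) *\<^sub>R w" if "w \<in> B" for \<phi> w
  proof -
    have "\<Phi> \<phi> *v w = (\<Sum>u\<in>B. if u = w then \<phi> (l w) *\<^sub>R w else 0)" unfolding \<Phi>v
      using that B(2,3) by (intro sum.cong) (auto simp: pairwise_def orthogonal_def dot_square_norm)
    then show ?thesis using that B(1) by simp
  qed
  show ?thesis
  proof (rule that[of \<Phi> "l ` B"], unfold functional_calculus_def, intro conjI allI impI ballI)
    fix \<phi> \<psi> show "transpose (\<Phi> \<phi>) = \<Phi> \<phi>"
      by (simp add: \<Phi>_def vec_eq_iff transpose_def outer_def mult.commute)
    show "\<Phi> \<phi> ** \<Phi> \<psi> = \<Phi> (\<lambda>l. \<phi> l * \<psi> l)"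
      by (rule matrix_eq_on_spanning[OF B(5)])
         (simp add: matrix_vector_mul_assoc[symmetric] \<Phi>B matrix_vector_mult_scaleR mult.commute)
    show "\<Phi> \<phi> = \<Phi> \<psi>" if "\<forall>k\<in>l ` B. \<phi> k = \<psi> k" using that by (simp add: \<Phi>_def)
  next
    show "\<Phi> (\<lambda>l. l) = A" by (rule matrix_eq_on_spanning[OF B(5)]) (simp add: \<Phi>B B(4))
    show "\<Phi> (\<lambda>l. 1) = mat 1" by (rule matrix_eq_on_spanning[OF B(5)]) (simp add: \<Phi>B)
  next
    show "\<exists>u. norm u = 1 \<and> A *v u = k *\<^sub>R u" if "k \<in> l ` B" for k
      using that B(3,4) by auto
  next
    fix \<phi> :: "real \<Rightarrow> real" and u assume "\<forall>k\<in>l ` B. 0 \<le> \<phi> k"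
    then show "0 \<le> u \<bullet> (\<Phi> \<phi> *v u)"
      by (simp add: \<Phi>v inner_sum_right mult.assoc inner_commute[of u] sum_nonneg)
  qed
qed

lemma functional_calculusD:
  assumes "functional_calculus A \<Phi> L"
  shows "transpose (\<Phi> \<phi>) = \<Phi> \<phi>" "\<Phi> \<phi> ** \<Phi> \<psi> = \<Phi> (\<lambda>l. \<phi> l * \<psi> l)"
    "(\<And>l. l \<in> L \<Longrightarrow> \<phi> l = \<psi> l) \<Longrightarrow> \<Phi> \<phi> = \<Phi> \<psi>"
    "\<Phi> (\<lambda>l. l) = A" "\<Phi> (\<lambda>l. 1) = mat 1"
    "l \<in> L \<Longrightarrow> \<exists>u. norm u = 1 \<and> A *v u = l *\<^sub>R u"
    "(\<And>l. l \<in> L \<Longrightarrow> 0 \<le> \<phi> l) \<Longrightarrow> 0 \<le> u \<bullet> (\<Phi> \<phi> *v u)"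
  using assms unfolding functional_calculus_def by simp_all

section \<open>Pseudo-inverses, square roots and ellipsoids\<close>

definition penrose :: "real ^ 'n ^ 'n \<Rightarrow> real ^ 'n ^ 'n \<Rightarrow> bool" where
  "penrose A X \<longleftrightarrow> A ** X ** A = A \<and> X ** A ** X = X \<and>
     transpose (A ** X) = A ** X \<and> transpose (X ** A) = X ** A"

text \<open>Both products \<open>A X\<close> and \<open>X A\<close> are orthogonal projections determined by \<open>A\<close>, and
  \<open>X = X A X\<close> is determined by them.\<close>

lemma penrose_unique:
  assumes "penrose A X" "penrose A Y" shows "X = Y"
proof -
  note p = assms[unfolded penrose_def]
  have AX: "A ** X = A ** Y"
  proof -
    have "A ** X = transpose (A ** X)" using p by simp
    also have "\<dots> = transpose ((A ** Y) ** (A ** X))" using p by (simp add: matrix_mul_assoc)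
    also have "\<dots> = transpose (A ** X) ** transpose (A ** Y)" by (simp add: matrix_transpose_mul)
    also have "\<dots> = (A ** X ** A) ** Y" using p by (simp add: matrix_mul_assoc)
    finally show ?thesis using p by simp
  qed
  have XA: "X ** A = Y ** A"
  proof -
    have "X ** A = transpose (X ** A)" using p by simp
    also have "\<dots> = transpose ((X ** A) ** (Y ** A))"
      using p by (metis matrix_mul_assoc)
    also have "\<dots> = transpose (Y ** A) ** transpose (X ** A)" by (simp add: matrix_transpose_mul)
    also have "\<dots> = Y ** A ** (X ** A)" using p by simp
    also have "\<dots> = Y ** (A ** X ** A)" by (simp add: matrix_mul_assoc)
    finally show ?thesis using p by simp
  qed
  have "X = X ** (A ** X)" using p by (simp add: matrix_mul_assoc)
  also have "\<dots> = (X ** A) ** Y" by (simp add: AX matrix_mul_assoc)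
  also have "\<dots> = Y" using p by (simp add: XA)
  finally show ?thesis .
qed

lemma pinv_eqI: assumes "penrose A X" shows "pinv A = X"
  unfolding pinv_def penrose_def[symmetric]
  by (rule the_equality) (use assms penrose_unique in auto)

text \<open>Applying \<open>inverse\<close> to the eigenvalues gives a Penrose inverse even of a singular matrix, because
  \<open>inverse 0 = 0\<close>.\<close>

lemma penrose_pinv_symmetric:
  fixes A :: "real ^ 'n ^ 'n"
  assumes "transpose A = A" shows "penrose A (pinv A)"
proof -
  obtain \<Phi> L where "functional_calculus A \<Phi> L" using symmetric_functional_calculus[OF assms] .
  note F = functional_calculusD[OF this]
  have *: "(\<lambda>l::real. l * inverse l * l) = (\<lambda>l. l)" "(\<lambda>l::real. inverse l * l * inverse l) = inverse"
    by (auto simp: fun_eq_iff field_simps)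
  have "penrose A (\<Phi> inverse)" unfolding penrose_def F(4)[symmetric] F(2) F(1) * by simp
  then show ?thesis using pinv_eqI by metis
qed

text \<open>Existence applies \<open>sqrt\<close> to the eigenvalues. For uniqueness let \<open>T\<^sup>2 = S\<^sup>2\<close> and let \<open>u\<close> be an
  eigenvector of \<open>S\<close> for \<open>l\<close>: the vector \<open>w = T u - l u\<close> satisfies \<open>T w = - l w\<close>, which positivity
  of \<open>T\<close> allows only for \<open>w = 0\<close> or \<open>l = 0\<close>, and for \<open>l = 0\<close> one has
  \<open>|T u|\<^sup>2 = u \<bullet> T\<^sup>2 u = 0\<close>.\<close>

lemma psd_sqrt_exists_unique:
  fixes A :: "real ^ 'n ^ 'n"
  assumes "psd A"
  shows "\<exists>!S. psd S \<and> S ** S = A"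
proof (rule ex_ex1I)
  have sym: "transpose A = A" using assms by (simp add: psd_def)
  obtain \<Phi> L where "functional_calculus A \<Phi> L" using symmetric_functional_calculus[OF sym] .
  note F = functional_calculusD[OF this]
  have L0: "l \<ge> 0" if lL: "l \<in> L" for l
  proof -
    obtain u where "norm u = 1" "A *v u = l *\<^sub>R u" using F(6)[OF lL] by blast
    moreover have "0 \<le> u \<bullet> (A *v u)" using assms by (simp add: psd_def)
    ultimately show ?thesis by (simp add: dot_square_norm)
  qed
  have "\<Phi> (\<lambda>l. sqrt l * sqrt l) = \<Phi> (\<lambda>l. l)" by (rule F(3)) (simp add: L0)
  then have "\<Phi> sqrt ** \<Phi> sqrt = A" by (simp only: F(2,4))
  moreover have "psd (\<Phi> sqrt)" unfolding psd_def using F(1)[of sqrt] F(7)[of sqrt] L0 by simp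
  ultimately show "\<exists>S. psd S \<and> S ** S = A" by blast
next
  fix S T assume "psd S \<and> S ** S = A" "psd T \<and> T ** T = A"
  then have S: "psd S" and T: "psd T" and eq: "S ** S = T ** T" by auto
  from S have symS: "transpose S = S" by (simp add: psd_def)
  from T have symT: "transpose T = T" by (simp add: psd_def)
  obtain B l where B: "\<And>u. u \<in> B \<Longrightarrow> norm u = 1"
    "\<And>u. u \<in> B \<Longrightarrow> S *v u = l u *\<^sub>R u" "span B = UNIV"
    by (rule symmetric_eigenbasis[OF symS]) (rule that; assumption)
  have "S *v u = T *v u" if u: "u \<in> B" for u
  proof -
    have "0 \<le> u \<bullet> (S *v u)" using S by (simp add: psd_def)
    then have l: "l u \<ge> 0" using B(1,2)[OF u] by (simp add: dot_square_norm)
    have TT: "T *v (T *v u) = (l u * l u) *\<^sub>R u"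
      using arg_cong[OF eq, of "\<lambda>M. M *v u"] B(2)[OF u]
      by (simp add: matrix_vector_mul_assoc[symmetric] matrix_vector_mult_scaleR)
    define w where "w = T *v u - l u *\<^sub>R u"
    have Tw: "T *v w = - (l u *\<^sub>R w)"
      by (simp add: w_def matrix_vector_mult_diff_distrib TT matrix_vector_mult_scaleR algebra_simps)
    have "w = 0"
    proof (cases "l u = 0")
      case True
      have "(T *v u) \<bullet> (T *v u) = u \<bullet> (T *v (T *v u))" by (simp add: symmetric_inner[OF symT, of u])
      then show ?thesis using True TT by (simp add: w_def)
    next
      case False
      have "0 \<le> w \<bullet> (T *v w)" using T by (simp add: psd_def)
      then have "l u * (w \<bullet> w) \<le> 0" by (simp add: Tw)
      then have "w \<bullet> w \<le> 0" using False l by (simp add: mult_le_0_iff)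
      then show ?thesis by (metis inner_ge_zero inner_eq_zero_iff order_antisym)
    qed
    then show ?thesis using B(2)[OF u] by (simp add: w_def)
  qed
  then show "S = T" by (rule matrix_eq_on_spanning[OF B(3)])
qed

lemma psd_sqrt: assumes "psd A" shows "psd (psd_sqrt A)" "psd_sqrt A ** psd_sqrt A = A"
  using theI'[OF psd_sqrt_exists_unique[OF assms]] unfolding psd_sqrt_def by auto

lemma matrix_invI:
  fixes A X :: "real ^ 'n ^ 'n"
  assumes "A ** X = mat 1" shows "invertible A" "matrix_inv A = X"
proof -
  have XA: "X ** A = mat 1" using assms by (simp add: matrix_left_right_inverse)
  then show "invertible A" using assms by (auto simp: invertible_def)
  have "matrix_inv A ** A = mat 1"
    unfolding matrix_inv_def by (rule someI2[of _ X]) (use assms XA in auto)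
  then have "matrix_inv A ** A ** X = X" by simp
  then show "matrix_inv A = X" by (simp add: matrix_mul_assoc[symmetric] assms)
qed

lemma matrix_inv_mult:
  fixes A :: "real ^ 'n ^ 'n"
  assumes "invertible A"
  shows "A ** matrix_inv A = mat 1" "matrix_inv A ** A = mat 1"
proof -
  obtain X where X: "A ** X = mat 1" "X ** A = mat 1" using assms by (auto simp: invertible_def)
  then show "A ** matrix_inv A = mat 1" "matrix_inv A ** A = mat 1" using matrix_invI(2)[OF X(1)] by auto
qed

lemma tendsto_det:
  fixes X :: "'b \<Rightarrow> real ^ 'n ^ 'n"
  assumes "\<And>i j. ((\<lambda>z. X z $ i $ j) \<longlongrightarrow> K $ i $ j) F"
  shows "((\<lambda>z. det (X z)) \<longlongrightarrow> det K) F"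
  unfolding det_def by (intro tendsto_sum tendsto_mult tendsto_const tendsto_prod assms)

text \<open>By Cramer's rule the entries of the inverse are quotients of determinants, which are polynomials in the entries.\<close>

lemma tendsto_matrix_inv:
  fixes X :: "'b \<Rightarrow> real ^ 'n ^ 'n"
  assumes lim: "(X \<longlongrightarrow> K) F" and inv: "invertible K"
  shows "((\<lambda>z. matrix_inv (X z)) \<longlongrightarrow> matrix_inv K) F" "\<forall>\<^sub>F z in F. invertible (X z)"
proof -
  have comp: "((\<lambda>z. X z $ i $ j) \<longlongrightarrow> K $ i $ j) F" for i j
    using lim by (intro tendsto_vec_nth)
  have K: "det K \<noteq> 0" using inv by (simp add: invertible_det_nz)
  show ev: "\<forall>\<^sub>F z in F. invertible (X z)"
    using tendsto_imp_eventually_ne[OF tendsto_det[OF comp] K] by (simp add: invertible_det_nz)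
  have *: "matrix_inv A $ k $ l = det (\<chi> i j. if j = k then axis l 1 $ i else A $ i $ j) / det A"
    if "invertible A" for A :: "real ^ 'n ^ 'n" and k l
  proof -
    have 1: "A *v (matrix_inv A *v axis l 1) = axis l 1"
      using matrix_inv_mult[OF that] by (simp add: matrix_vector_mul_assoc)
    have dn: "det A \<noteq> 0" using that by (simp add: invertible_det_nz)
    have "matrix_inv A *v axis l 1 = (\<chi> k. det (\<chi> i j. if j = k then axis l 1 $ i else A $ i $ j) / det A)"
      by (rule cramer[OF dn, THEN iffD1, OF 1])
    then have "(matrix_inv A *v axis l 1) $ k = det (\<chi> i j. if j = k then axis l 1 $ i else A $ i $ j) / det A" by simp
    then show ?thesis by (simp add: matrix_vector_mult_basis column_def)
  qed
  show "((\<lambda>z. matrix_inv (X z)) \<longlongrightarrow> matrix_inv K) F"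
  proof (intro vec_tendstoI)
    fix k l
    have "((\<lambda>z. det (\<chi> i j. if j = k then axis l 1 $ i else X z $ i $ j) / det (X z)) \<longlongrightarrow>
        det (\<chi> i j. if j = k then axis l 1 $ i else K $ i $ j) / det K) F"
      by (intro tendsto_divide tendsto_det K) (auto simp: comp)
    then show "((\<lambda>z. matrix_inv (X z) $ k $ l) \<longlongrightarrow> matrix_inv K $ k $ l) F"
      unfolding *[OF inv] by (rule Lim_transform_eventually) (use ev in eventually_elim, simp add: *)
  qed
qed

lemma matrix_distribs:
  fixes A B C :: "real ^ 'n ^ 'n"
  shows "(A + B) ** C = A ** C + B ** C" "(A - B) ** C = A ** C - B ** C" "A ** (B - C) = A ** B - A ** C"
  by (simp_all add: matrix_matrix_mult_def vec_eq_iff sum.distrib[symmetric] sum_subtractf[symmetric] algebra_simps)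

text \<open>When \<open>Q\<close> is the orthogonal projection onto the kernel of \<open>A\<close>, adding it makes
  \<open>A\<close> invertible without changing it on the complement. This reduces the pseudo-inverse to an ordinary inverse.\<close>

lemma pinv_via_kernel_projection:
  fixes A Q :: "real ^ 'n ^ 'n"
  assumes Q: "Q ** Q = Q" "transpose Q = Q" and AQ: "A ** Q = 0" "Q ** A = 0"
    and inv: "invertible (A + Q)"
  shows "pinv A = matrix_inv (A + Q) - Q" "A ** pinv A = mat 1 - Q" "pinv A ** A = mat 1 - Q"
    "pinv A ** Q = 0"
proof -
  define Y where "Y = matrix_inv (A + Q)"
  note mm = matrix_add_ldistrib matrix_distribs
  have Y: "(A + Q) ** Y = mat 1" "Y ** (A + Q) = mat 1"
    using matrix_inv_mult[OF inv] by (simp_all add: Y_def)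
  have "(A + Q) ** Q = Q" by (simp add: mm Q AQ)
  then have YQ: "Y ** Q = Q" by (metis Y(2) matrix_mul_assoc matrix_mul_lid)
  have "Q ** (A + Q) = Q" by (simp add: mm Q AQ)
  then have QY: "Q ** Y = Q" by (metis Y(1) matrix_mul_assoc matrix_mul_rid)
  have AX: "A ** (Y - Q) = mat 1 - Q" using Y(1) by (simp add: mm AQ QY algebra_simps)
  have XA: "(Y - Q) ** A = mat 1 - Q" using Y(2) by (simp add: mm AQ YQ algebra_simps)
  have XQ: "(Y - Q) ** Q = 0" by (simp add: mm YQ Q)
  have "transpose (mat 1 - Q) = mat 1 - Q" using Q(2) by (simp add: transpose_def vec_eq_iff mat_def)
  then have "penrose A (Y - Q)"
    unfolding penrose_def AX XA by (simp add: matrix_distribs QY Q AQ)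
  then have "pinv A = Y - Q" by (rule pinv_eqI)
  then show "pinv A = matrix_inv (A + Q) - Q" "A ** pinv A = mat 1 - Q" "pinv A ** A = mat 1 - Q"
    "pinv A ** Q = 0"
    using AX XA XQ by (simp_all add: Y_def)
qed

text \<open>The pseudo-inverse is discontinuous where the rank jumps. It is continuous along matrices that share the kernel
  projection \<open>Q\<close>, since there it is an ordinary inverse up to a constant.\<close>

lemma tendsto_pinv:
  fixes X :: "'b \<Rightarrow> real ^ 'n ^ 'n" and A Q :: "real ^ 'n ^ 'n"
  assumes lim: "(X \<longlongrightarrow> A) F"
    and Q: "Q ** Q = Q" "transpose Q = Q" and AQ: "A ** Q = 0" "Q ** A = 0"
    and ev: "\<forall>\<^sub>F z in F. X z ** Q = 0 \<and> Q ** X z = 0"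
    and inv: "invertible (A + Q)"
  shows "((\<lambda>z. pinv (X z)) \<longlongrightarrow> pinv A) F"
proof -
  have l: "((\<lambda>z. X z + Q) \<longlongrightarrow> A + Q) F" by (intro tendsto_intros lim)
  have "((\<lambda>z. matrix_inv (X z + Q) - Q) \<longlongrightarrow> matrix_inv (A + Q) - Q) F"
    by (intro tendsto_intros tendsto_matrix_inv l inv)
  then show ?thesis
    unfolding pinv_via_kernel_projection(1)[OF Q AQ inv]
    by (rule Lim_transform_eventually)
       (use ev tendsto_matrix_inv(2)[OF l inv] in eventually_elim,
        simp add: pinv_via_kernel_projection(1)[OF Q])
qed

text \<open>The matrix \<open>W\<close> standardises a random vector with covariance \<open>A\<close>.\<close>

lemma inverse_sqrt_matrix:
  fixes A :: "real ^ 'n ^ 'n"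
  assumes psd: "psd A" and inv: "invertible A"
  obtains W where "transpose W = W" "W ** A ** W = mat 1" "W ** W = matrix_inv A"
proof -
  have sym: "transpose A = A" using psd by (simp add: psd_def)
  obtain \<Phi> L where "functional_calculus A \<Phi> L" using symmetric_functional_calculus[OF sym] .
  note F = functional_calculusD[OF this]
  have L0: "l > 0" if lL: "l \<in> L" for l
  proof -
    obtain u where u: "norm u = 1" "A *v u = l *\<^sub>R u" using F(6)[OF lL] by blast
    moreover have "0 \<le> u \<bullet> (A *v u)" using psd by (simp add: psd_def)
    ultimately have "l \<ge> 0" by (simp add: dot_square_norm)
    moreover have "l \<noteq> 0"
    proof
      assume "l = 0"
      then have "A *v u = 0" using u by simp
      then have "matrix_inv A *v (A *v u) = 0" by simp
      then have "u = 0" using matrix_inv_mult[OF inv] by (simp add: matrix_vector_mul_assoc)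
      then show False using u by simp
    qed
    ultimately show ?thesis by simp
  qed
  define r where "r = (\<lambda>l. 1 / sqrt l)"
  have "\<Phi> (\<lambda>l. r l * l * r l) = \<Phi> (\<lambda>l. 1)" "\<Phi> (\<lambda>l. l * (r l * r l)) = \<Phi> (\<lambda>l. 1)"
    by (rule F(3), drule L0, simp add: r_def field_simps)+
  note * = this
  have 1: "\<Phi> r ** A ** \<Phi> r = mat 1" "A ** (\<Phi> r ** \<Phi> r) = mat 1"
    unfolding F(4)[symmetric] F(5)[symmetric] F(2) by (rule *)+
  show ?thesis
    by (rule that[of "\<Phi> r"]) (use F(1) 1 matrix_invI(2)[OF 1(2)] in auto)
qed

text \<open>Solving for the point of the unit ball, \<open>u = - S^-1 h / sqrt q\<close> with
  \<open>h = c (y - z)\<close>, turns membership into \<open>|S^-1 h|\<^sup>2 \<le> q\<close>; for \<open>q = 0\<close> the ellipsoid is a point.\<close>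

lemma ellipsoid_membership:
  fixes S A :: "real ^ 'n ^ 'n" and y z :: "real ^ 'n"
  assumes S: "transpose S = S" "S ** S = A" and inv: "invertible A" and q: "0 \<le> q" and c: "0 < c"
  shows "z \<in> (\<lambda>u. y + (sqrt q / c) *\<^sub>R (S *v u)) ` cball 0 1 \<longleftrightarrow>
    (c *\<^sub>R (y - z)) \<bullet> (matrix_inv A *v (c *\<^sub>R (y - z))) \<le> q"
proof -
  have "S ** (S ** matrix_inv A) = mat 1" using matrix_inv_mult[OF inv] S(2) by (simp add: matrix_mul_assoc)
  from matrix_invI(1)[OF this] have invS: "invertible S" .
  define T where "T = matrix_inv S"
  have T: "S ** T = mat 1" "T ** S = mat 1" using matrix_inv_mult[OF invS] by (auto simp: T_def)
  have "transpose T ** S = mat 1"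
    using arg_cong[OF T(1), of transpose] S(1) by (simp add: matrix_transpose_mul)
  then have symT: "transpose T = T" using T by (metis matrix_mul_assoc matrix_mul_lid matrix_mul_rid)
  have TT: "T ** T = matrix_inv A"
  proof -
    have "A ** (T ** T) = mat 1" unfolding S(2)[symmetric]
      by (metis T(1) matrix_mul_assoc matrix_mul_rid)
    then show ?thesis using matrix_invI(2) by metis
  qed
  define h where "h = c *\<^sub>R (y - z)"
  have "z = y + (sqrt q / c) *\<^sub>R (S *v u) \<longleftrightarrow> - (T *v h) = sqrt q *\<^sub>R u" for u
  proof -
    have "z = y + (sqrt q / c) *\<^sub>R (S *v u) \<longleftrightarrow> c *\<^sub>R (z - y) = c *\<^sub>R ((sqrt q / c) *\<^sub>R (S *v u))"
    proof -
      have "z = y + (sqrt q / c) *\<^sub>R (S *v u) \<longleftrightarrow> z - y = (sqrt q / c) *\<^sub>R (S *v u)" by (auto simp: algebra_simps)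
      then show ?thesis using c by (metis scaleR_cancel_left less_irrefl)
    qed
    also have "\<dots> \<longleftrightarrow> - h = sqrt q *\<^sub>R (S *v u)" using c by (simp add: h_def algebra_simps)
    also have "\<dots> \<longleftrightarrow> - (T *v h) = sqrt q *\<^sub>R u"
    proof
      assume "- h = sqrt q *\<^sub>R (S *v u)"
      then have "T *v (- h) = T *v (sqrt q *\<^sub>R (S *v u))" by simp
      then show "- (T *v h) = sqrt q *\<^sub>R u"
        using T(2) by (simp add: matrix_vector_mult_scaleR matrix_vector_mul_assoc vec.neg)
    next
      assume "- (T *v h) = sqrt q *\<^sub>R u"
      then have "S *v (- (T *v h)) = S *v (sqrt q *\<^sub>R u)" by simp
      then show "- h = sqrt q *\<^sub>R (S *v u)"
        using T(1) by (simp add: matrix_vector_mult_scaleR matrix_vector_mul_assoc vec.neg)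
    qed
    finally show ?thesis .
  qed
  then have "z \<in> (\<lambda>u. y + (sqrt q / c) *\<^sub>R (S *v u)) ` cball 0 1 \<longleftrightarrow> (\<exists>u. norm u \<le> 1 \<and> - (T *v h) = sqrt q *\<^sub>R u)"
    by (auto simp: image_iff)
  also have "\<dots> \<longleftrightarrow> norm (T *v h) \<le> sqrt q"
  proof
    assume "\<exists>u. norm u \<le> 1 \<and> - (T *v h) = sqrt q *\<^sub>R u"
    then obtain u where u: "norm u \<le> 1" "- (T *v h) = sqrt q *\<^sub>R u" by auto
    have "norm (T *v h) = norm (- (T *v h))" by simp
    also have "\<dots> = sqrt q * norm u" unfolding u(2) using q by simp
    finally show "norm (T *v h) \<le> sqrt q" using u(1) q by (simp add: mult_left_le)
  next
    assume le: "norm (T *v h) \<le> sqrt q"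
    show "\<exists>u. norm u \<le> 1 \<and> - (T *v h) = sqrt q *\<^sub>R u"
    proof (cases "q = 0")
      case True
      then show ?thesis using le by (intro exI[of _ 0]) auto
    next
      case False
      then have "sqrt q > 0" using q by simp
      then show ?thesis using le by (intro exI[of _ "- ((1 / sqrt q) *\<^sub>R (T *v h))"]) (auto simp: divide_le_eq)
    qed
  qed
  also have "\<dots> \<longleftrightarrow> (norm (T *v h))\<^sup>2 \<le> q" using q by (metis norm_ge_zero real_le_rsqrt real_sqrt_pow2 power_mono sqrt_le_D)
  also have "(norm (T *v h))\<^sup>2 = h \<bullet> (matrix_inv A *v h)"
    unfolding power2_norm_eq_inner TT[symmetric] matrix_vector_mul_assoc[symmetric]
    using symmetric_inner[OF symT, of h] by simp
  finally show ?thesis unfolding h_def .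
qed

section \<open>Borel measurability by projection\<close>

text \<open>A closed set in a Euclidean space is a countable union of compact sets, and continuous images of compact sets are
  compact.\<close>

lemma closed_projection_borel:
  fixes C :: "('b::euclidean_space \<times> 'c::euclidean_space) set"
  assumes "closed C" shows "fst ` C \<in> sets borel"
proof -
  have "fst ` C = (\<Union>k::nat. fst ` (C \<inter> cball 0 (real k)))"
  proof -
    have "\<exists>k::nat. norm z \<le> real k" for z :: "'b \<times> 'c" by (rule real_arch_simple)
    then show ?thesis by (fastforce simp: image_iff)
  qed
  moreover have "closed (fst ` (C \<inter> cball 0 (real k)))" for k
    using assms by (intro compact_imp_closed compact_continuous_image continuous_intros)
      (auto intro!: closed_Int_compact)
  ultimately show ?thesis by auto
qed

text \<open>The preimage of a closed set is a projection of a closed part of the graph. This gives measurability of maps that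
  are characterised by equations, such as the pseudo-inverse, with no formula for them.\<close>

lemma borel_measurable_closed_graph:
  fixes f :: "'b::euclidean_space \<Rightarrow> 'c::euclidean_space"
  assumes "closed {z. snd z = f (fst z)}" shows "f \<in> borel_measurable borel"
proof (subst (2) borel_eq_closed, rule measurable_measure_of)
  fix S :: "'c set" assume "S \<in> Collect closed"
  then have "closed ({z. snd z = f (fst z)} \<inter> (UNIV \<times> S))"
    using assms by (intro closed_Int closed_Times) auto
  from closed_projection_borel[OF this]
  have "fst ` ({z. snd z = f (fst z)} \<inter> (UNIV \<times> S)) \<in> sets borel" .
  also have "fst ` ({z. snd z = f (fst z)} \<inter> (UNIV \<times> S)) = f -` S \<inter> space borel" by (force simp: image_iff)
  finally show "f -` S \<inter> space borel \<in> sets borel" .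
qed auto

section \<open>From pointwise to locally uniform approximation of convex functions\<close>

text \<open>Cover the ball by small cubes. A convex function is bounded above on a cube by its
  values at the finitely many corners. It is bounded below by reflecting a point at the centre \<open>g\<close> of the cube, since
  \<open>2 Q g \<le> Q h + Q (2 g - h)\<close>. So closeness at the corners and centres spreads to the whole ball, with a finite set
  that is the same for all convex \<open>Q\<close>; the set and the tolerance are chosen before \<open>Q\<close> is known.\<close>

lemma convex_close_on_finite_imp_close_on_compact:
  fixes q :: "'a::euclidean_space \<Rightarrow> real"
  assumes q: "continuous_on UNIV q" and \<eta>: "0 < \<eta>"
  obtains G \<zeta> where "finite G" "0 < \<zeta>"
    "\<And>Q h. convex_on UNIV Q \<Longrightarrow> (\<And>g. g \<in> G \<Longrightarrow> \<bar>Q g - q g\<bar> \<le> \<zeta>) \<Longrightarrow> norm h \<le> r \<Longrightarrow> \<bar>Q h - q h\<bar> \<le> \<eta>"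
proof -
  \<comment> \<open>in the lower bound, \<open>2 Q g\<close> costs \<open>2 e\<close>, the value at the reflected point \<open>2 e\<close>, and passing from \<open>q g\<close> to \<open>q h\<close> another \<open>e\<close>\<close>
  define e where "e = \<eta> / 5"
  have e: "e > 0" using \<eta> by (simp add: e_def)
  have "uniformly_continuous_on (cball 0 (r + 1)) q"
    by (rule compact_uniformly_continuous) (use q continuous_on_subset in auto)
  then obtain \<rho>0 where \<rho>0: "\<rho>0 > 0"
    "\<And>y z. y \<in> cball 0 (r+1) \<Longrightarrow> z \<in> cball 0 (r+1) \<Longrightarrow> dist z y < \<rho>0 \<Longrightarrow> dist (q z) (q y) < e"
    unfolding uniformly_continuous_on_def using e by metis
  define \<rho> where "\<rho> = min \<rho>0 1"
  have \<rho>: "\<rho> > 0" "\<rho> \<le> 1" "\<rho> \<le> \<rho>0" using \<rho>0(1) by (auto simp: \<rho>_def)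
  define d where "d = \<rho> / (2 * DIM('a))"
  have d: "d > 0" using \<rho> by (simp add: d_def)
  define cube where "cube g = cbox (g - (\<Sum>i\<in>Basis. d *\<^sub>R i)) (g + (\<Sum>i\<in>Basis. d *\<^sub>R i))" for g :: 'a
  have cube: "z \<in> cube g \<longleftrightarrow> (\<forall>i\<in>Basis. \<bar>(z - g) \<bullet> i\<bar> \<le> d)" for z g
    unfolding cube_def mem_box
    by (intro ball_cong refl) (auto simp: inner_diff_left inner_add_left inner_sum_left inner_Basis if_distrib cong: if_cong)
  have ball_cube: "ball g d \<subseteq> cube g" for g
  proof
    fix z assume "z \<in> ball g d"
    then have "norm (z - g) \<le> d" by (simp add: dist_norm norm_minus_commute)
    then show "z \<in> cube g" unfolding cube using Basis_le_norm[of _ "z - g"] by (meson order_trans)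
  qed
  have near: "dist z g < \<rho>" if "z \<in> cube g" for z g
  proof -
    have "norm (z - g) \<le> (\<Sum>i\<in>Basis. \<bar>(z - g) \<bullet> i\<bar>)" by (rule norm_le_l1)
    also have "\<dots> \<le> (\<Sum>i\<in>(Basis::'a set). d)" using that by (intro sum_mono) (auto simp: cube)
    also have "\<dots> < \<rho>" using \<rho> by (simp add: d_def)
    finally show ?thesis by (simp add: dist_norm)
  qed
  have "compact (cball (0::'a) r)" by simp
  moreover have "cball (0::'a) r \<subseteq> (\<Union>g\<in>cball 0 r. ball g d)" using d by auto
  ultimately obtain C where C: "C \<subseteq> cball 0 r" "finite C" "cball (0::'a) r \<subseteq> (\<Union>g\<in>C. ball g d)"
    using compactE_image[of "cball (0::'a) r" "cball 0 r" "\<lambda>g. ball g d"] by (metis open_ball)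
  have "\<exists>S. finite S \<and> cube g = convex hull S" for g
    unfolding cube_def by (rule cube_convex_hull[OF d]) blast
  then obtain S where S: "\<And>g. finite (S g)" "\<And>g. cube g = convex hull (S g)" by metis
  show ?thesis
  proof (rule that[of "C \<union> (\<Union>g\<in>C. S g)" e])
    show "finite (C \<union> (\<Union>g\<in>C. S g))" using C S by auto
    fix Q :: "'a \<Rightarrow> real" and h :: 'a assume Q: "convex_on UNIV Q" and h: "norm h \<le> r"
      and close: "\<And>g. g \<in> C \<union> (\<Union>g\<in>C. S g) \<Longrightarrow> \<bar>Q g - q g\<bar> \<le> e"
    from h C(3) obtain g where g: "g \<in> C" "h \<in> ball g d" by force
    have gr: "norm g \<le> r" using g C(1) by auto
    have qnear: "\<bar>q z - q g\<bar> \<le> e" if "z \<in> cube g" for z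
    proof -
      have "norm z \<le> norm g + dist z g" using norm_triangle_sub[of z g] by (simp add: dist_norm)
      then have "z \<in> cball 0 (r + 1)" using near[OF that] gr \<rho> by auto
      then show ?thesis using \<rho>0(2)[of g z] near[OF that] gr \<rho> by (force simp: dist_real_def)
    qed
    have "\<forall>z\<in>S g. Q z \<le> q g + 2 * e"
    proof
      fix z assume z: "z \<in> S g"
      then have "z \<in> cube g" using S(2) hull_subset by fastforce
      then show "Q z \<le> q g + 2 * e" using qnear close[of z] z g by fastforce
    qed
    then have up: "Q z \<le> q g + 2 * e" if "z \<in> cube g" for z
      using convex_on_convex_hull_bound[of "S g" Q] Q that S(2)
      by (metis convex_on_subset subset_UNIV convex_convex_hull)
    have hc: "h \<in> cube g" using g(2) ball_cube[of g] by blast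
    \<comment> \<open>the reflection of \<open>h\<close> at \<open>g\<close> lies in the same cube\<close>
    have "2 *\<^sub>R g - h \<in> ball g d" using g by (simp add: dist_norm scaleR_2 norm_minus_commute)
    then have "2 *\<^sub>R g - h \<in> cube g" using ball_cube[of g] by blast
    from up[OF this] have 1: "Q (2 *\<^sub>R g - h) \<le> q g + 2 * e" .
    have "Q ((1/2) *\<^sub>R h + (1/2) *\<^sub>R (2 *\<^sub>R g - h)) \<le> (1/2) * Q h + (1/2) * Q (2 *\<^sub>R g - h)"
      using convex_onD[OF Q, of "1/2" h "2 *\<^sub>R g - h"] by simp
    also have "(1/2) *\<^sub>R h + (1/2) *\<^sub>R (2 *\<^sub>R g - h) = g" by (simp add: algebra_simps)
    finally have 2: "2 * Q g \<le> Q h + Q (2 *\<^sub>R g - h)" by simp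
    have 3: "\<bar>Q g - q g\<bar> \<le> e" using close g by auto
    have "5 * e = \<eta>" by (simp add: e_def)
    then show "\<bar>Q h - q h\<bar> \<le> \<eta>" using up[OF hc] qnear[OF hc] 1 2 3 by linarith
  qed (use e in auto)
qed

section \<open>Second-order expansions\<close>

lemma linear_eq_inner_axis:
  fixes g :: "real ^ 'n \<Rightarrow> real"
  assumes "linear g" shows "g h = (\<chi> i. g (axis i 1)) \<bullet> h"
proof -
  have "g h = g (\<Sum>i\<in>UNIV. h $ i *\<^sub>R axis i 1)" by (simp add: scalar_mult_eq_scaleR[symmetric] basis_expansion)
  also have "\<dots> = (\<Sum>i\<in>UNIV. h $ i * g (axis i 1))"
    using assms by (simp add: linear_sum linear_cmul)
  finally show ?thesis by (simp add: inner_vec_def mult.commute)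
qed

lemma has_derivative_gradient:
  assumes "f differentiable at y"
  shows "(f has_derivative (\<lambda>h. gradient f y \<bullet> h)) (at y)"
proof -
  have d: "(f has_derivative frechet_derivative f (at y)) (at y)"
    using assms by (simp add: frechet_derivative_works)
  have "frechet_derivative f (at y) = (\<lambda>h. gradient f y \<bullet> h)"
    unfolding gradient_def by (rule ext, rule linear_eq_inner_axis[OF has_derivative_linear[OF d]])
  then show ?thesis using d by simp
qed

lemma gradient_eqI:
  assumes "(f has_derivative (\<lambda>h. m \<bullet> h)) (at y)"
  shows "gradient f y = m"
proof -
  have "frechet_derivative f (at y) = (\<lambda>h. m \<bullet> h)" using frechet_derivative_at[OF assms] by simp
  then show ?thesis by (simp add: gradient_def vec_eq_iff inner_axis)
qed

lemma has_derivative_hessian: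
  assumes "gradient f differentiable at y"
  shows "(gradient f has_derivative (\<lambda>h. hessian f y *v h)) (at y)"
  using assms jacobian_works unfolding hessian_def by blast

lemma hessian_eqI:
  assumes "(gradient f has_derivative (\<lambda>h. A *v h)) (at y)"
  shows "hessian f y = A"
  unfolding hessian_def jacobian_def frechet_derivative_at[OF assms, symmetric] by simp

text \<open>The difference of the function and its supporting affine function has a local minimum at \<open>x\<close>.\<close>

lemma gradient_eq_subgradient:
  fixes f :: "real ^ 'n \<Rightarrow> real"
  assumes U: "open U" "x \<in> U" and f: "f differentiable at x"
    and sub: "\<And>y. y \<in> U \<Longrightarrow> f x + m \<bullet> (y - x) \<le> f y"
  shows "gradient f x = m"
proof -
  have d: "((\<lambda>y. f y - m \<bullet> (y - x)) has_derivative (\<lambda>h. gradient f x \<bullet> h - m \<bullet> h)) (at x)"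
    by (auto intro!: derivative_eq_intros has_derivative_gradient[OF f])
  have "(\<lambda>h. gradient f x \<bullet> h - m \<bullet> h) = (\<lambda>h. 0)"
    by (rule differential_zero_maxmin[OF U(2,1) d]) (use sub in force)
  then have "gradient f x \<bullet> h - m \<bullet> h = 0" for h by (rule fun_cong)
  from this[of "gradient f x - m"] have "(gradient f x - m) \<bullet> (gradient f x - m) = 0"
    by (simp add: inner_diff_left)
  then show ?thesis by simp
qed

lemma has_derivative_along_line:
  fixes x h :: "'b::real_normed_vector"
  assumes "(f has_derivative L) (at (x + d *\<^sub>R h))"
  shows "((\<lambda>d. f (x + d *\<^sub>R h)) has_derivative (\<lambda>e. L (e *\<^sub>R h))) (at d)"
proof (rule has_derivative_compose[of "\<lambda>d. x + d *\<^sub>R h" "\<lambda>e. e *\<^sub>R h" d UNIV f L])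
  show "((\<lambda>d. x + d *\<^sub>R h) has_derivative (\<lambda>e. e *\<^sub>R h)) (at d)"
    by (auto intro!: derivative_eq_intros)
qed (rule assms)

text \<open>L'Hopital's rule along the ray reduces the claim to the derivative of the gradient at the single point
  \<open>x\<close>.\<close>

lemma second_order_expansion:
  fixes f :: "real ^ 'n \<Rightarrow> real"
  assumes U: "open U" "x \<in> U" and f: "\<And>y. y \<in> U \<Longrightarrow> f differentiable at y"
    and g: "gradient f differentiable at x"
  shows "((\<lambda>d. (f (x + d *\<^sub>R h) - f x - d * (gradient f x \<bullet> h)) / d\<^sup>2)
           \<longlongrightarrow> h \<bullet> (hessian f x *v h) / 2) (at_right 0)"
proof -
  have cont: "((\<lambda>d. x + d *\<^sub>R h) \<longlongrightarrow> x) (at 0)"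
    by (auto intro!: tendsto_eq_intros)
  have evU0: "\<forall>\<^sub>F d in at 0. x + d *\<^sub>R h \<in> U"
    using topological_tendstoD[OF cont U] .
  then have evU: "\<forall>\<^sub>F d in at_right 0. x + d *\<^sub>R h \<in> U" by (simp add: eventually_at_split)
  have der: "((\<lambda>d. f (x + d *\<^sub>R h)) has_real_derivative gradient f (x + d *\<^sub>R h) \<bullet> h) (at d)"
    if "x + d *\<^sub>R h \<in> U" for d
  proof -
    have "((\<lambda>d. f (x + d *\<^sub>R h)) has_derivative (\<lambda>e. gradient f (x + d *\<^sub>R h) \<bullet> (e *\<^sub>R h))) (at d)"
      by (rule has_derivative_along_line has_derivative_gradient f that)+
    then show ?thesis by (simp add: has_field_derivative_def mult_commute_abs)
  qed
  have dg: "((\<lambda>d. gradient f (x + d *\<^sub>R h) \<bullet> h) has_real_derivative (hessian f x *v h) \<bullet> h) (at 0)"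
  proof -
    have "((\<lambda>d. gradient f (x + d *\<^sub>R h)) has_derivative (\<lambda>e. hessian f x *v (e *\<^sub>R h))) (at 0)"
      by (rule has_derivative_along_line) (use has_derivative_hessian[OF g] in simp)
    from has_derivative_inner_left[OF this, of h] show ?thesis
      by (simp add: has_field_derivative_def matrix_vector_mult_scaleR mult_commute_abs)
  qed
  have "((\<lambda>d. (gradient f (x + d *\<^sub>R h) \<bullet> h - gradient f x \<bullet> h) / (2 * d)) \<longlongrightarrow> h \<bullet> (hessian f x *v h) / 2) (at 0)"
  proof -
    have "((\<lambda>d. ((gradient f (x + d *\<^sub>R h) \<bullet> h - gradient f x \<bullet> h) / d) / 2) \<longlongrightarrow> ((hessian f x *v h) \<bullet> h) / 2) (at 0)"
      using dg by (intro tendsto_divide tendsto_const) (auto simp: has_field_derivative_iff)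
    then show ?thesis by (simp add: inner_commute mult.commute)
  qed
  then have ratio: "((\<lambda>d. (gradient f (x + d *\<^sub>R h) \<bullet> h - gradient f x \<bullet> h) / (2 * d)) \<longlongrightarrow> h \<bullet> (hessian f x *v h) / 2) (at_right 0)"
    by (rule tendsto_mono[rotated]) (simp add: at_le)
  have c0: "isCont (\<lambda>d. f (x + d *\<^sub>R h)) 0" using DERIV_isCont[OF der[of 0]] U by simp
  have "((\<lambda>d. f (x + d *\<^sub>R h) - f x - d * (gradient f x \<bullet> h)) \<longlongrightarrow> 0) (at 0)"
    using c0 by (auto intro!: tendsto_eq_intros simp: isCont_def)
  then have num: "((\<lambda>d. f (x + d *\<^sub>R h) - f x - d * (gradient f x \<bullet> h)) \<longlongrightarrow> 0) (at_right 0)"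
    by (rule tendsto_mono[rotated]) (simp add: at_le)
  have pos: "\<forall>\<^sub>F d in at_right (0::real). d > 0" by (simp add: eventually_at_right_less)
  show ?thesis
  proof (rule lhopital_right[OF num])
    show "((\<lambda>d::real. d\<^sup>2) \<longlongrightarrow> 0) (at_right 0)" by (auto intro!: tendsto_eq_intros)
    show "\<forall>\<^sub>F d in at_right 0. d\<^sup>2 \<noteq> (0::real)" using pos by eventually_elim simp
    show "\<forall>\<^sub>F d in at_right 0. 2 * d \<noteq> (0::real)" using pos by eventually_elim simp
    show "\<forall>\<^sub>F d in at_right 0. ((\<lambda>d. f (x + d *\<^sub>R h) - f x - d * (gradient f x \<bullet> h)) has_real_derivative
        gradient f (x + d *\<^sub>R h) \<bullet> h - gradient f x \<bullet> h) (at d)"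
      using evU by eventually_elim (auto intro!: derivative_eq_intros der)
    show "\<forall>\<^sub>F d in at_right 0. ((\<lambda>d. d\<^sup>2) has_real_derivative 2 * d) (at d)"
      by (intro always_eventually allI) (auto intro!: derivative_eq_intros)
  qed (rule ratio)
qed

text \<open>The mean value theorem turns the second difference into a difference of gradients at two points near \<open>x\<close>, and
  differentiability of the gradient at \<open>x\<close> compares both with the Hessian.\<close>

lemma second_difference_bound:
  fixes f :: "real ^ 'n \<Rightarrow> real"
  assumes U: "open U" "x \<in> U" and f: "\<And>y. y \<in> U \<Longrightarrow> f differentiable at y"
    and g: "gradient f differentiable at x" and e: "0 < e"
  shows "\<forall>\<^sub>F s in at_right 0. \<bar>(f (x + s *\<^sub>R u + s *\<^sub>R w) - f (x + s *\<^sub>R u) - f (x + s *\<^sub>R w) + f x)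
           - s\<^sup>2 * ((hessian f x *v w) \<bullet> u)\<bar> \<le> 2 * e * (norm u + norm w) * norm u * s\<^sup>2"
proof -
  let ?A = "hessian f x" and ?N = "norm u + norm w"
  obtain d0 where d0: "d0 > 0" "ball x d0 \<subseteq> U" using U openE by blast
  obtain d1 where d1: "d1 > 0" "\<And>y. norm (y - x) < d1 \<Longrightarrow>
      norm (gradient f y - gradient f x - ?A *v (y - x)) \<le> e * norm (y - x)"
    using has_derivative_hessian[OF g] e unfolding has_derivative_at_alt by metis
  define D where "D = min d0 d1 / (?N + 1)"
  have N1: "?N + 1 > 0" by (simp add: add_nonneg_pos)
  have D: "D > 0" using d0 d1 N1 by (simp add: D_def)
  have small: "norm (a *\<^sub>R u + c *\<^sub>R w) \<le> s * ?N" "norm (a *\<^sub>R u + c *\<^sub>R w) < min d0 d1"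
    if "0 \<le> a" "a \<le> s" "0 \<le> c" "c \<le> s" "s < D" for a c s
  proof -
    have "norm (a *\<^sub>R u + c *\<^sub>R w) \<le> a * norm u + c * norm w"
      by (rule order_trans[OF norm_triangle_ineq]) (use that in simp)
    also have "\<dots> \<le> s * ?N" using that by (simp add: distrib_left add_mono mult_right_mono)
    finally show 1: "norm (a *\<^sub>R u + c *\<^sub>R w) \<le> s * ?N" .
    also have "\<dots> \<le> s * (?N + 1)" using that by (intro mult_left_mono) auto
    also have "\<dots> < min d0 d1" using that N1 by (simp only: D_def pos_less_divide_eq)
    finally show "norm (a *\<^sub>R u + c *\<^sub>R w) < min d0 d1" .
  qed
  have main: "\<bar>(f (x + s *\<^sub>R u + s *\<^sub>R w) - f (x + s *\<^sub>R u) - f (x + s *\<^sub>R w) + f x)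
           - s\<^sup>2 * ((?A *v w) \<bullet> u)\<bar> \<le> 2 * e * ?N * norm u * s\<^sup>2" if s: "0 < s" "s < D" for s
  proof -
    have inU: "x + (a *\<^sub>R u + c *\<^sub>R w) \<in> U" if "0 \<le> a" "a \<le> s" "0 \<le> c" "c \<le> s" for a c
    proof -
      have "dist x (x + (a *\<^sub>R u + c *\<^sub>R w)) < d0" using small(2)[OF that s(2)] unfolding dist_norm
        by (metis add_diff_cancel_left' min_less_iff_conj norm_minus_commute)
      then show ?thesis using d0(2) by (meson mem_ball subsetD)
    qed
    have der: "((\<lambda>a. f (x + (a *\<^sub>R u + c *\<^sub>R w))) has_real_derivative gradient f (x + (a *\<^sub>R u + c *\<^sub>R w)) \<bullet> u) (at a)"
      if "0 \<le> a" "a \<le> s" "0 \<le> c" "c \<le> s" for a c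
    proof -
      have "((\<lambda>a. f (x + (a *\<^sub>R u + c *\<^sub>R w))) has_derivative (\<lambda>t. gradient f (x + (a *\<^sub>R u + c *\<^sub>R w)) \<bullet> (t *\<^sub>R u))) (at a)"
      proof -
        have eq: "x + c *\<^sub>R w + a *\<^sub>R u = x + (a *\<^sub>R u + c *\<^sub>R w)" for a by (simp add: algebra_simps)
        show ?thesis
          using has_derivative_along_line[of f "\<lambda>h. gradient f (x + (a *\<^sub>R u + c *\<^sub>R w)) \<bullet> h" "x + c *\<^sub>R w" a u]
            has_derivative_gradient[OF f[OF inU[OF that]]]
          by (simp only: eq)
      qed
      then show ?thesis by (simp add: has_field_derivative_def mult_commute_abs)
    qed
    \<comment> \<open>the second difference is an increment of \<open>\<phi>\<close>\<close>
    define \<phi> where "\<phi> a = f (x + (a *\<^sub>R u + s *\<^sub>R w)) - f (x + (a *\<^sub>R u + 0 *\<^sub>R w))" for a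
    have "\<exists>z>0. z < s \<and> \<phi> s - \<phi> 0 = (s - 0) *
        (gradient f (x + (z *\<^sub>R u + s *\<^sub>R w)) \<bullet> u - gradient f (x + (z *\<^sub>R u + 0 *\<^sub>R w)) \<bullet> u)"
      by (rule MVT2) (use s in \<open>auto simp: \<phi>_def intro!: DERIV_diff der[of _ 0, simplified] der\<close>)
    then obtain z where z: "0 < z" "z < s" "\<phi> s - \<phi> 0 = s *
        ((gradient f (x + (z *\<^sub>R u + s *\<^sub>R w)) - gradient f (x + (z *\<^sub>R u + 0 *\<^sub>R w))) \<bullet> u)"
      by (auto simp: inner_diff_left)
    define k1 k2 where k: "k1 = z *\<^sub>R u + s *\<^sub>R w" "k2 = z *\<^sub>R u + 0 *\<^sub>R w"
    define r1 r2 where r: "r1 = gradient f (x + k1) - gradient f x - ?A *v k1" "r2 = gradient f (x + k2) - gradient f x - ?A *v k2"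
    have kb: "norm k1 \<le> s * ?N" "norm k2 \<le> s * ?N" "norm k1 < d1" "norm k2 < d1"
      using small[of z s s] small[of z s 0] s z by (auto simp: k)
    have rb: "norm r1 \<le> e * (s * ?N)" "norm r2 \<le> e * (s * ?N)"
      using d1(2)[of "x + k1"] d1(2)[of "x + k2"] kb e by (auto simp: r intro: order_trans mult_left_mono)
    have "?A *v k1 - ?A *v k2 = s *\<^sub>R (?A *v w)"
      by (simp add: k matrix_vector_mult_diff_distrib[symmetric] matrix_vector_mult_scaleR[symmetric])
    then have "(gradient f (x + k1) - gradient f (x + k2)) = s *\<^sub>R (?A *v w) + (r1 - r2)"
      by (simp add: r algebra_simps)
    then have "\<phi> s - \<phi> 0 = s\<^sup>2 * ((?A *v w) \<bullet> u) + s * ((r1 - r2) \<bullet> u)"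
      using z(3) unfolding k[symmetric] by (simp only: inner_add_left power2_eq_square inner_scaleR_left distrib_left mult.assoc)
    moreover have "\<phi> s - \<phi> 0 = f (x + s *\<^sub>R u + s *\<^sub>R w) - f (x + s *\<^sub>R u) - f (x + s *\<^sub>R w) + f x"
      by (simp add: \<phi>_def add.assoc)
    moreover have "\<bar>(r1 - r2) \<bullet> u\<bar> \<le> 2 * (e * (s * ?N)) * norm u"
    proof -
      have "\<bar>(r1 - r2) \<bullet> u\<bar> \<le> norm (r1 - r2) * norm u" by (rule Cauchy_Schwarz_ineq2)
      also have "\<dots> \<le> 2 * (e * (s * ?N)) * norm u"
        using norm_triangle_ineq4[of r1 r2] rb by (intro mult_right_mono) auto
      finally show ?thesis .
    qed
    then have "\<bar>s * ((r1 - r2) \<bullet> u)\<bar> \<le> s * (2 * (e * (s * ?N)) * norm u)"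
      using s by (simp add: abs_mult)
    ultimately show ?thesis by (simp add: power2_eq_square algebra_simps)
  qed
  show ?thesis unfolding eventually_at_right_field using main D by (intro exI[of _ D]) auto
qed

text \<open>The second difference is symmetric in the two directions, and so is its limit.\<close>

lemma hessian_symmetric:
  fixes f :: "real ^ 'n \<Rightarrow> real"
  assumes U: "open U" "x \<in> U" and f: "\<And>y. y \<in> U \<Longrightarrow> f differentiable at y"
    and g: "gradient f differentiable at x"
  shows "transpose (hessian f x) = hessian f x"
proof -
  let ?A = "hessian f x"
  have *: "(?A *v w) \<bullet> u = (?A *v u) \<bullet> w" for u w
  proof -
    have "\<bar>(?A *v w) \<bullet> u - (?A *v u) \<bullet> w\<bar> \<le> 0 + e" if e: "0 < e" for e
    proof -
      define N where "N = norm u + norm w"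
      define e' where "e' = e / (2 * N * N + 1)"
      have N: "N \<ge> 0" by (simp add: N_def)
      then have "2 * N * N + 1 > 0" by (simp add: add_nonneg_pos)
      then have e': "e' > 0" "e' * (2 * N * N) \<le> e" using e N by (auto simp: e'_def divide_simps)
      have "\<forall>\<^sub>F s in at_right (0::real). s > 0" by (simp add: eventually_at_right_less)
      moreover have "\<forall>\<^sub>F s in at_right 0. \<bar>(f (x + s *\<^sub>R u + s *\<^sub>R w) - f (x + s *\<^sub>R u) - f (x + s *\<^sub>R w) + f x)
           - s\<^sup>2 * ((?A *v w) \<bullet> u)\<bar> \<le> 2 * e' * (norm u + norm w) * norm u * s\<^sup>2" for u w
        by (rule second_difference_bound[OF U _ g e'(1)]) (rule f)
      note this[of u w] this[of w u]
      ultimately have "\<forall>\<^sub>F s in at_right (0::real). \<bar>(?A *v w) \<bullet> u - (?A *v u) \<bullet> w\<bar> \<le> e' * (2 * N * N)"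
      proof eventually_elim
        case (elim s)
        define \<Delta> where "\<Delta> = f (x + s *\<^sub>R u + s *\<^sub>R w) - f (x + s *\<^sub>R u) - f (x + s *\<^sub>R w) + f x"
        have "f (x + s *\<^sub>R w + s *\<^sub>R u) - f (x + s *\<^sub>R w) - f (x + s *\<^sub>R u) + f x = \<Delta>"
          by (simp add: \<Delta>_def algebra_simps)
        with elim have "\<bar>\<Delta> - s\<^sup>2 * ((?A *v w) \<bullet> u)\<bar> \<le> 2 * e' * N * norm u * s\<^sup>2"
          "\<bar>\<Delta> - s\<^sup>2 * ((?A *v u) \<bullet> w)\<bar> \<le> 2 * e' * N * norm w * s\<^sup>2"
          by (auto simp: \<Delta>_def N_def add.commute)
        then have "\<bar>s\<^sup>2 * ((?A *v w) \<bullet> u) - s\<^sup>2 * ((?A *v u) \<bullet> w)\<bar> \<le> 2 * e' * N * norm u * s\<^sup>2 + 2 * e' * N * norm w * s\<^sup>2"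
          by linarith
        also have "\<dots> = s\<^sup>2 * (e' * (2 * N * N))" by (simp add: N_def algebra_simps)
        finally have "s\<^sup>2 * \<bar>(?A *v w) \<bullet> u - (?A *v u) \<bullet> w\<bar> \<le> s\<^sup>2 * (e' * (2 * N * N))"
          by (simp add: right_diff_distrib[symmetric] abs_mult)
        then show ?case using elim by (simp add: mult_le_cancel_left)
      qed
      then have "\<bar>(?A *v w) \<bullet> u - (?A *v u) \<bullet> w\<bar> \<le> e' * (2 * N * N)" by simp
      then show ?thesis using e' by linarith
    qed
    then have "\<bar>(?A *v w) \<bullet> u - (?A *v u) \<bullet> w\<bar> \<le> 0" by (rule field_le_epsilon)
    then show ?thesis by simp
  qed
  have "?A $ i $ j = ?A $ j $ i" for i j
    using *[of "axis j 1" "axis i 1"] by (simp add: inner_axis matrix_vector_mult_basis column_def)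
  then show ?thesis by (simp add: transpose_def vec_eq_iff)
qed

text \<open>The logarithms combine to \<open>ln (1 - w)\<close> for \<open>w = 4 e\<^sup>2 / y\<^sup>2\<close>, which behaves like
  \<open>- w\<close>. This is the contribution of the budget terms \<open>b ln \<beta>\<close> to the finite-difference Hessian.\<close>

lemma tendsto_log_second_difference:
  fixes y e :: "'b \<Rightarrow> real"
  assumes y: "(y \<longlongrightarrow> c) F" and c: "0 < c" and e: "(e \<longlongrightarrow> 0) F" and e0: "\<forall>\<^sub>F z in F. 0 < e z"
  shows "((\<lambda>z. (2 * ln (y z) - ln (y z + 2 * e z) - ln (y z - 2 * e z)) / (4 * (e z)\<^sup>2)) \<longlongrightarrow> 1 / c\<^sup>2) F"
proof -
  define w where "w z = 4 * (e z)\<^sup>2 / (y z)\<^sup>2" for z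
  have ey: "\<forall>\<^sub>F z in F. y z > c / 2" using order_tendstoD(1)[OF y, of "c/2"] c by simp
  have ee: "\<forall>\<^sub>F z in F. e z < c / 4" using order_tendstoD(2)[OF e, of "c/4"] c by simp
  have w0: "(w \<longlongrightarrow> 0) F" unfolding w_def using c by (auto intro!: tendsto_eq_intros y e)
  have "((\<lambda>u::real. ln (1 - u) / u) \<longlongrightarrow> -1) (at 0)"
  proof -
    have "((\<lambda>u::real. ln (1 - u)) has_real_derivative -1) (at 0)"
      by (auto intro!: derivative_eq_intros)
    then show ?thesis by (simp add: has_field_derivative_iff)
  qed
  moreover have "filterlim w (at 0) F"
    unfolding filterlim_at
  proof
    show "\<forall>\<^sub>F z in F. w z \<in> UNIV \<and> w z \<noteq> 0"
      using ey e0 by eventually_elim (use c in \<open>auto simp: w_def\<close>)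
  qed (rule w0)
  ultimately have "((\<lambda>z. ln (1 - w z) / w z) \<longlongrightarrow> -1) F" by (rule filterlim_compose)
  then have "((\<lambda>z. - (ln (1 - w z) / w z) / (y z)\<^sup>2) \<longlongrightarrow> - (- 1) / c\<^sup>2) F"
    using c by (intro tendsto_divide tendsto_minus tendsto_power y) auto
  then have "((\<lambda>z. - (ln (1 - w z) / w z) / (y z)\<^sup>2) \<longlongrightarrow> 1 / c\<^sup>2) F" by simp
  then show ?thesis
  proof (rule Lim_transform_eventually)
    show "\<forall>\<^sub>F z in F. - (ln (1 - w z) / w z) / (y z)\<^sup>2 =
        (2 * ln (y z) - ln (y z + 2 * e z) - ln (y z - 2 * e z)) / (4 * (e z)\<^sup>2)"
      using ey e0 ee
    proof eventually_elim
      case (elim z)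
      have p: "y z > 0" "y z + 2 * e z > 0" "y z - 2 * e z > 0" using elim c by auto
      have "1 - w z = ((y z + 2 * e z) / y z) * ((y z - 2 * e z) / y z)"
        using p by (simp add: w_def field_simps power2_eq_square)
      then have "ln (1 - w z) = ln (y z + 2 * e z) - ln (y z) + (ln (y z - 2 * e z) - ln (y z))"
        using p by (simp add: ln_mult ln_div)
      then show ?case using p elim by (simp add: w_def field_simps power2_eq_square)
    qed
  qed
qed

section \<open>Convergence in probability along a filter\<close>

text \<open>Convergence along this filter on pairs of a sample size and an outcome is convergence in probability. Thus
  \<open>tendsto_intros\<close>, \<open>eventually_elim\<close> and continuity arguments apply to random sequences as they stand. Asking for
  measurable subsets \<open>A t\<close> keeps the filter meaningful for properties \<open>P\<close> that define no event.\<close>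

definition in_prob :: "'w measure \<Rightarrow> (nat \<times> 'w) filter" where
  "in_prob M = Abs_filter (\<lambda>P. \<forall>\<eta>>0. \<exists>A. (\<forall>t. A t \<in> sets M \<and> (\<forall>\<omega>\<in>A t. P (t, \<omega>))) \<and>
     (\<forall>\<^sub>F t in sequentially. 1 - \<eta> \<le> measure M (A t)))"

text \<open>Boundedness in probability, phrased with measurable subsets in accordance with \<open>in_prob\<close>.\<close>

definition tight :: "'w measure \<Rightarrow> (nat \<Rightarrow> 'w \<Rightarrow> 'b::real_normed_vector) \<Rightarrow> bool" where
  "tight M Y \<longleftrightarrow> (\<forall>\<eta>>0. \<exists>K A. (\<forall>t. A t \<in> sets M \<and> (\<forall>\<omega>\<in>A t. norm (Y t \<omega>) \<le> K)) \<and>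
     (\<forall>\<^sub>F t in sequentially. 1 - \<eta> \<le> measure M (A t)))"

context prob_space begin

lemma prob_Int_ge:
  assumes "A \<in> events" "B \<in> events" "1 - a \<le> prob A" "1 - b \<le> prob B"
  shows "1 - (a + b) \<le> prob (A \<inter> B)"
proof -
  have "prob (A - B) = prob A - prob (A \<inter> B)" using assms(1,2) by (rule finite_measure_Diff')
  moreover have "prob (A - B) \<le> prob (space M - B)"
    using assms(1,2) sets.sets_into_space by (intro finite_measure_mono) auto
  moreover have "prob (space M - B) = 1 - prob B" using assms(2) by (rule prob_compl)
  ultimately show ?thesis using assms(3,4) by linarith
qed

lemma eventually_in_prob:
  "eventually P (in_prob M) \<longleftrightarrow> (\<forall>\<eta>>0. \<exists>A. (\<forall>t. A t \<in> events \<and> (\<forall>\<omega>\<in>A t. P (t, \<omega>))) \<and>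
     (\<forall>\<^sub>F t in sequentially. 1 - \<eta> \<le> prob (A t)))"
  unfolding in_prob_def
proof (rule eventually_Abs_filter, rule is_filter.intro)
  show "\<forall>\<eta>>0. \<exists>A. (\<forall>t. A t \<in> events \<and> (\<forall>\<omega>\<in>A t. True)) \<and> (\<forall>\<^sub>F t in sequentially. 1 - \<eta> \<le> prob (A t))"
    by (intro allI impI exI[of _ "\<lambda>_. space M"]) (auto simp: prob_space)
next
  fix P Q :: "nat \<times> 'a \<Rightarrow> bool"
  assume P: "\<forall>\<eta>>0. \<exists>A. (\<forall>t. A t \<in> events \<and> (\<forall>\<omega>\<in>A t. P (t, \<omega>))) \<and> (\<forall>\<^sub>F t in sequentially. 1 - \<eta> \<le> prob (A t))"
    and Q: "\<forall>\<eta>>0. \<exists>A. (\<forall>t. A t \<in> events \<and> (\<forall>\<omega>\<in>A t. Q (t, \<omega>))) \<and> (\<forall>\<^sub>F t in sequentially. 1 - \<eta> \<le> prob (A t))"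
  show "\<forall>\<eta>>0. \<exists>A. (\<forall>t. A t \<in> events \<and> (\<forall>\<omega>\<in>A t. P (t, \<omega>) \<and> Q (t, \<omega>))) \<and> (\<forall>\<^sub>F t in sequentially. 1 - \<eta> \<le> prob (A t))"
  proof (intro allI impI)
    fix \<eta> :: real assume "\<eta> > 0"
    then have h: "\<eta> / 2 > 0" by simp
    from P h obtain A where A: "\<forall>t. A t \<in> events \<and> (\<forall>\<omega>\<in>A t. P (t, \<omega>))" "\<forall>\<^sub>F t in sequentially. 1 - \<eta> / 2 \<le> prob (A t)" by blast
    from Q h obtain B where B: "\<forall>t. B t \<in> events \<and> (\<forall>\<omega>\<in>B t. Q (t, \<omega>))" "\<forall>\<^sub>F t in sequentially. 1 - \<eta> / 2 \<le> prob (B t)" by blast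
    have "\<forall>\<^sub>F t in sequentially. 1 - \<eta> \<le> prob (A t \<inter> B t)"
      using A(2) B(2) by eventually_elim (use A B prob_Int_ge[of _ _ "\<eta>/2" "\<eta>/2"] in auto)
    then show "\<exists>A. (\<forall>t. A t \<in> events \<and> (\<forall>\<omega>\<in>A t. P (t, \<omega>) \<and> Q (t, \<omega>))) \<and> (\<forall>\<^sub>F t in sequentially. 1 - \<eta> \<le> prob (A t))"
      using A(1) B(1) by (intro exI[of _ "\<lambda>t. A t \<inter> B t"]) auto
  qed
next
  fix P Q :: "nat \<times> 'a \<Rightarrow> bool"
  assume PQ: "\<forall>x. P x \<longrightarrow> Q x"
    and P: "\<forall>\<eta>>0. \<exists>A. (\<forall>t. A t \<in> events \<and> (\<forall>\<omega>\<in>A t. P (t, \<omega>))) \<and> (\<forall>\<^sub>F t in sequentially. 1 - \<eta> \<le> prob (A t))"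
  show "\<forall>\<eta>>0. \<exists>A. (\<forall>t. A t \<in> events \<and> (\<forall>\<omega>\<in>A t. Q (t, \<omega>))) \<and> (\<forall>\<^sub>F t in sequentially. 1 - \<eta> \<le> prob (A t))"
  proof (intro allI impI)
    fix \<eta> :: real assume "\<eta> > 0"
    with P obtain A where "\<forall>t. A t \<in> events \<and> (\<forall>\<omega>\<in>A t. P (t, \<omega>))" "\<forall>\<^sub>F t in sequentially. 1 - \<eta> \<le> prob (A t)" by blast
    then show "\<exists>A. (\<forall>t. A t \<in> events \<and> (\<forall>\<omega>\<in>A t. Q (t, \<omega>))) \<and> (\<forall>\<^sub>F t in sequentially. 1 - \<eta> \<le> prob (A t))"
      using PQ by (intro exI[of _ A]) auto
  qed
qed

lemma eventually_in_probI:
  assumes "\<And>t. A t \<in> events" "(\<lambda>t. prob (A t)) \<longlonglongrightarrow> 1" "\<And>t \<omega>. \<omega> \<in> A t \<Longrightarrow> P (t, \<omega>)"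
  shows "eventually P (in_prob M)"
  unfolding eventually_in_prob
proof (intro allI impI exI[of _ A] conjI)
  fix \<eta> :: real assume "\<eta> > 0"
  then have "\<forall>\<^sub>F t in sequentially. 1 - \<eta> < prob (A t)" using order_tendstoD(1)[OF assms(2), of "1 - \<eta>"] by simp
  then show "\<forall>\<^sub>F t in sequentially. 1 - \<eta> \<le> prob (A t)" by eventually_elim simp
qed (use assms in auto)

lemma filterlim_fst_in_prob: "filterlim fst sequentially (in_prob M)"
  unfolding filterlim_iff
proof (intro allI impI)
  fix P :: "nat \<Rightarrow> bool" assume P: "eventually P sequentially"
  show "\<forall>\<^sub>F z in in_prob M. P (fst z)"
  proof (rule eventually_in_probI[where A = "\<lambda>t. if P t then space M else {}"])
    show "(\<lambda>t. prob (if P t then space M else {})) \<longlonglongrightarrow> 1"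
      by (rule tendsto_eventually) (use P in eventually_elim, simp add: prob_space)
  qed (auto split: if_splits)
qed

lemma tendsto_fst_in_prob: "(f \<longlongrightarrow> l) sequentially \<Longrightarrow> ((\<lambda>z. f (fst z)) \<longlongrightarrow> l) (in_prob M)"
  using filterlim_compose[OF _ filterlim_fst_in_prob] by blast

lemma eventually_fst_in_prob: "eventually P sequentially \<Longrightarrow> \<forall>\<^sub>F z in in_prob M. P (fst z)"
  using filterlim_fst_in_prob unfolding filterlim_iff by blast

text \<open>The sample size \<open>0\<close> is excluded, because no equilibrium is observed there.\<close>

lemma eventually_in_prob_AE:
  assumes "\<And>t. 1 \<le> t \<Longrightarrow> AE \<omega> in M. P (t, \<omega>)"
  shows "eventually P (in_prob M)"
proof -
  have "\<exists>A. A \<in> events \<and> (\<forall>\<omega>\<in>A. P (t, \<omega>)) \<and> (1 \<le> t \<longrightarrow> prob A = 1)" for t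
  proof (cases "1 \<le> t")
    case True
    from AE_E_prob[OF assms[OF this]] obtain A where "A \<subseteq> {\<omega> \<in> space M. P (t, \<omega>)}" "A \<in> events" "prob A = 1" by blast
    then show ?thesis by (intro exI[of _ A]) auto
  qed (intro exI[of _ "{}"], auto)
  then obtain A where A: "\<And>t. A t \<in> events" "\<And>t \<omega>. \<omega> \<in> A t \<Longrightarrow> P (t, \<omega>)" "\<And>t. 1 \<le> t \<Longrightarrow> prob (A t) = 1" by metis
  show ?thesis
  proof (rule eventually_in_probI[OF A(1)])
    show "(\<lambda>t. prob (A t)) \<longlonglongrightarrow> 1"
      by (rule tendsto_eventually) (use A(3) eventually_sequentially in blast)
  qed (rule A(2))
qed

text \<open>Up to an event of small probability a tight sequence is bounded by a constant, so properties may be proved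
  on each event \<open>|Y| \<le> K\<close> separately.\<close>

lemma eventually_tight:
  assumes "tight M Y" and "\<And>K. \<forall>\<^sub>F z in in_prob M. norm (Y (fst z) (snd z)) \<le> K \<longrightarrow> P z"
  shows "eventually P (in_prob M)"
  unfolding eventually_in_prob
proof (intro allI impI)
  fix \<eta> :: real assume "\<eta> > 0"
  then have h: "\<eta> / 2 > 0" by simp
  from assms(1) h obtain K A where A: "\<forall>t. A t \<in> events \<and> (\<forall>\<omega>\<in>A t. norm (Y t \<omega>) \<le> K)"
    "\<forall>\<^sub>F t in sequentially. 1 - \<eta> / 2 \<le> prob (A t)" unfolding tight_def by blast
  from assms(2)[of K] h obtain B where B: "\<forall>t. B t \<in> events \<and> (\<forall>\<omega>\<in>B t. norm (Y t \<omega>) \<le> K \<longrightarrow> P (t, \<omega>))"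
    "\<forall>\<^sub>F t in sequentially. 1 - \<eta> / 2 \<le> prob (B t)" unfolding eventually_in_prob by fastforce
  have "\<forall>\<^sub>F t in sequentially. 1 - \<eta> \<le> prob (A t \<inter> B t)"
    using A(2) B(2) by eventually_elim (use A B prob_Int_ge[of _ _ "\<eta>/2" "\<eta>/2"] in auto)
  then show "\<exists>A. (\<forall>t. A t \<in> events \<and> (\<forall>\<omega>\<in>A t. P (t, \<omega>))) \<and> (\<forall>\<^sub>F t in sequentially. 1 - \<eta> \<le> prob (A t))"
    using A(1) B(1) by (intro exI[of _ "\<lambda>t. A t \<inter> B t"]) auto
qed

text \<open>Chebyshev's inequality, in the form that feeds \<open>in_prob\<close> and \<open>tight\<close>.\<close>

lemma prob_ge_of_second_moment:
  fixes Y :: "'a \<Rightarrow> real"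
  assumes [measurable]: "Y \<in> borel_measurable M" and i: "integrable M (\<lambda>\<omega>. (Y \<omega>)\<^sup>2)"
    and b: "expectation (\<lambda>\<omega>. (Y \<omega>)\<^sup>2) \<le> B" and c: "0 < c"
  shows "1 - B / c\<^sup>2 \<le> prob {\<omega> \<in> space M. \<bar>Y \<omega>\<bar> < c}"
proof -
  have "prob {\<omega> \<in> space M. c\<^sup>2 \<le> (Y \<omega>)\<^sup>2} \<le> expectation (\<lambda>\<omega>. (Y \<omega>)\<^sup>2) / c\<^sup>2"
    by (rule integral_Markov_inequality_measure[OF i, of "{}"]) (use c in auto)
  also have "\<dots> \<le> B / c\<^sup>2" using b c by (simp add: divide_right_mono)
  also have "{\<omega> \<in> space M. c\<^sup>2 \<le> (Y \<omega>)\<^sup>2} = space M - {\<omega> \<in> space M. \<bar>Y \<omega>\<bar> < c}"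
    using c by (auto simp: not_less power2_le_iff_abs_le abs_le_square_iff[symmetric])
  also have "prob \<dots> = 1 - prob {\<omega> \<in> space M. \<bar>Y \<omega>\<bar> < c}" by (rule prob_compl) measurable
  finally show ?thesis by simp
qed

lemma tendsto_in_prob_of_second_moment:
  fixes Y :: "nat \<Rightarrow> 'a \<Rightarrow> real"
  assumes Y: "\<And>t. Y t \<in> borel_measurable M" and i: "\<And>t. integrable M (\<lambda>\<omega>. (Y t \<omega>)\<^sup>2)"
    and b: "\<forall>\<^sub>F t in sequentially. expectation (\<lambda>\<omega>. (Y t \<omega>)\<^sup>2) \<le> B t" and B: "B \<longlonglongrightarrow> 0"
  shows "((\<lambda>z. Y (fst z) (snd z)) \<longlongrightarrow> 0) (in_prob M)"
proof (rule tendstoI)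
  fix e :: real assume e: "e > 0"
  show "\<forall>\<^sub>F z in in_prob M. dist (Y (fst z) (snd z)) 0 < e"
  proof (rule eventually_in_probI[where A = "\<lambda>t. {\<omega> \<in> space M. \<bar>Y t \<omega>\<bar> < e}"])
    show "{\<omega> \<in> space M. \<bar>Y t \<omega>\<bar> < e} \<in> events" for t using Y[of t] by measurable
    show "(\<lambda>t. prob {\<omega> \<in> space M. \<bar>Y t \<omega>\<bar> < e}) \<longlonglongrightarrow> 1"
    proof (rule tendsto_sandwich)
      show "\<forall>\<^sub>F t in sequentially. 1 - B t / e\<^sup>2 \<le> prob {\<omega> \<in> space M. \<bar>Y t \<omega>\<bar> < e}"
        using b by eventually_elim (rule prob_ge_of_second_moment[OF Y i _ e])
      show "(\<lambda>t. 1 - B t / e\<^sup>2) \<longlonglongrightarrow> 1" using B e by (auto intro!: tendsto_eq_intros)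
    qed auto
  qed auto
qed

lemma tight_of_second_moment:
  fixes Y :: "nat \<Rightarrow> 'a \<Rightarrow> real"
  assumes Y: "\<And>t. Y t \<in> borel_measurable M" and i: "\<And>t. integrable M (\<lambda>\<omega>. (Y t \<omega>)\<^sup>2)"
    and b: "\<And>t. expectation (\<lambda>\<omega>. (Y t \<omega>)\<^sup>2) \<le> B"
  shows "tight M Y"
  unfolding tight_def
proof (intro allI impI)
  fix \<eta> :: real assume \<eta>: "\<eta> > 0"
  have B: "B \<ge> 0" using b[of 0] by (rule order_trans[rotated]) simp
  define K where "K = sqrt ((B + 1) / \<eta>)"
  have K: "K > 0" "B / K\<^sup>2 \<le> \<eta>" using \<eta> B by (auto simp: K_def field_simps)
  show "\<exists>K A. (\<forall>t. A t \<in> events \<and> (\<forall>\<omega>\<in>A t. norm (Y t \<omega>) \<le> K)) \<and> (\<forall>\<^sub>F t in sequentially. 1 - \<eta> \<le> prob (A t))"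
  proof (intro exI[of _ K] exI[of _ "\<lambda>t. {\<omega> \<in> space M. \<bar>Y t \<omega>\<bar> < K}"] conjI allI ballI always_eventually)
    show "{\<omega> \<in> space M. \<bar>Y t \<omega>\<bar> < K} \<in> events" for t using Y[of t] by measurable
    show "1 - \<eta> \<le> prob {\<omega> \<in> space M. \<bar>Y t \<omega>\<bar> < K}" for t
      using prob_ge_of_second_moment[OF Y i b K(1), of t] K(2) by linarith
  qed auto
qed

lemma tendsto_in_probI:
  assumes meas: "\<And>t. X t \<in> borel_measurable M"
    and lim: "((\<lambda>z. X (fst z) (snd z)) \<longlongrightarrow> (c::'b::{metric_space, second_countable_topology})) (in_prob M)"
  shows "tendsto_in_prob M X c"
  unfolding tendsto_in_prob_def
proof (intro conjI allI impI meas)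
  fix e :: real assume e: "e > 0"
  have m[measurable]: "{\<omega> \<in> space M. dist (X t \<omega>) c > e} \<in> events" for t using meas[of t] by measurable
  show "(\<lambda>t. prob {\<omega> \<in> space M. dist (X t \<omega>) c > e}) \<longlonglongrightarrow> 0"
  proof (rule LIMSEQ_I)
    fix \<eta> :: real assume \<eta>: "0 < \<eta>"
    from tendstoD[OF lim e] \<eta> obtain A where A: "\<forall>t. A t \<in> events \<and> (\<forall>\<omega>\<in>A t. dist (X t \<omega>) c < e)"
      "\<forall>\<^sub>F t in sequentially. 1 - \<eta> / 2 \<le> prob (A t)" unfolding eventually_in_prob by (force dest!: spec[of _ "\<eta>/2"])
    have "\<forall>\<^sub>F t in sequentially. prob {\<omega> \<in> space M. dist (X t \<omega>) c > e} < \<eta>"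
      using A(2)
    proof eventually_elim
      case (elim t)
      have "{\<omega> \<in> space M. dist (X t \<omega>) c > e} \<subseteq> space M - A t" using A(1) by fastforce
      then have "prob {\<omega> \<in> space M. dist (X t \<omega>) c > e} \<le> prob (space M - A t)"
        using A(1) by (intro finite_measure_mono) auto
      also have "\<dots> = 1 - prob (A t)" using A(1) by (intro prob_compl) auto
      finally show ?case using elim \<eta> by linarith
    qed
    then show "\<exists>no. \<forall>n\<ge>no. norm (prob {\<omega> \<in> space M. e < dist (X n \<omega>) c} - 0) < \<eta>"
      by (simp add: eventually_sequentially)
  qed
qed

text \<open>An event that is squeezed between \<open>S \<le> q - \<eta>\<close> and \<open>S \<le> q + \<eta>\<close>, for each \<open>\<eta>\<close> with
  probability tending to one, has the limit probability of \<open>S \<le> q\<close> at continuity points. It combines Slutsky's theorem with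
  the convergence of the distribution functions and leaves the shape of \<open>E\<close> free.\<close>

lemma prob_tendsto_sandwich:
  fixes S :: "nat \<Rightarrow> 'a \<Rightarrow> real"
  assumes S[measurable]: "\<And>t. S t \<in> borel_measurable M"
    and E: "\<forall>\<^sub>F t in sequentially. E t \<in> events"
    and F: "\<And>c. (\<lambda>t. prob {\<omega> \<in> space M. S t \<omega> \<le> c}) \<longlonglongrightarrow> F c" and cont: "isCont F q"
    and ev: "\<And>\<eta>. 0 < \<eta> \<Longrightarrow> \<forall>\<^sub>F z in in_prob M. snd z \<in> space M \<longrightarrow>
        (S (fst z) (snd z) \<le> q - \<eta> \<longrightarrow> snd z \<in> E (fst z)) \<and> (snd z \<in> E (fst z) \<longrightarrow> S (fst z) (snd z) \<le> q + \<eta>)"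
  shows "(\<lambda>t. prob (E t)) \<longlonglongrightarrow> F q"
proof (rule LIMSEQ_I)
  fix r :: real assume r: "0 < r"
  obtain d where d: "d > 0" "\<And>c. \<bar>c - q\<bar> < d \<Longrightarrow> \<bar>F c - F q\<bar> < r / 3"
    using cont[unfolded continuous_at_eps_delta] r by (metis dist_real_def zero_less_divide_iff zero_less_numeral)
  define \<eta> where "\<eta> = d / 2"
  have \<eta>: "\<eta> > 0" using d by (simp add: \<eta>_def)
  have Fq: "\<bar>F (q - \<eta>) - F q\<bar> < r / 3" "\<bar>F (q + \<eta>) - F q\<bar> < r / 3" using d by (auto simp: \<eta>_def)
  from ev[OF \<eta>] r obtain A where A: "\<forall>t. A t \<in> events \<and> (\<forall>\<omega>\<in>A t. \<omega> \<in> space M \<longrightarrow>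
        (S t \<omega> \<le> q - \<eta> \<longrightarrow> \<omega> \<in> E t) \<and> (\<omega> \<in> E t \<longrightarrow> S t \<omega> \<le> q + \<eta>))"
    "\<forall>\<^sub>F t in sequentially. 1 - r / 3 \<le> prob (A t)"
    unfolding eventually_in_prob by (force dest!: spec[of _ "r/3"])
  have 1: "\<forall>\<^sub>F t in sequentially. F (q - \<eta>) - r / 3 < prob {\<omega> \<in> space M. S t \<omega> \<le> q - \<eta>}"
    using order_tendstoD(1)[OF F[of "q - \<eta>"], of "F (q - \<eta>) - r / 3"] r by simp
  have 2: "\<forall>\<^sub>F t in sequentially. prob {\<omega> \<in> space M. S t \<omega> \<le> q + \<eta>} < F (q + \<eta>) + r / 3"
    using order_tendstoD(2)[OF F[of "q + \<eta>"], of "F (q + \<eta>) + r / 3"] r by simp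
  have "\<forall>\<^sub>F t in sequentially. \<bar>prob (E t) - F q\<bar> < r"
    using A(2) E 1 2
  proof eventually_elim
    case (elim t)
    let ?L = "{\<omega> \<in> space M. S t \<omega> \<le> q - \<eta>}" and ?U = "{\<omega> \<in> space M. S t \<omega> \<le> q + \<eta>}" and ?C = "space M - A t"
    have At: "A t \<in> events" using A by simp
    have C: "prob ?C \<le> r / 3" "?C \<in> events" using prob_compl[OF At] elim(1) At by auto
    have LM: "?L \<in> events" "?U \<in> events" by measurable
    have "?L \<subseteq> E t \<union> ?C" using A(1) by auto
    then have "prob ?L \<le> prob (E t \<union> ?C)" using elim(2) C by (intro finite_measure_mono) auto
    also have "\<dots> \<le> prob (E t) + prob ?C" using elim(2) C by (intro measure_Un_le) auto
    finally have a: "prob ?L \<le> prob (E t) + r / 3" using C by linarith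
    have "E t \<subseteq> ?U \<union> ?C" using A(1) elim(2) sets.sets_into_space by fastforce
    then have "prob (E t) \<le> prob (?U \<union> ?C)" using LM C by (intro finite_measure_mono) auto
    also have "\<dots> \<le> prob ?U + prob ?C" using LM C by (intro measure_Un_le) auto
    finally have b: "prob (E t) \<le> prob ?U + r / 3" using C by linarith
    show ?case using a b elim(3,4) Fq by linarith
  qed
  then show "\<exists>no. \<forall>n\<ge>no. norm (prob (E n) - F q) < r" by (simp add: eventually_sequentially)
qed

text \<open>Independence kills the mixed terms of the square. The second moment \<open>B\<close>, in place of the variance, is the
  quantity that is small for the remainders of the highest bid.\<close>

lemma sample_mean_second_moment:
  fixes X :: "nat \<Rightarrow> 'a \<Rightarrow> real"
  assumes ind: "indep_vars (\<lambda>_. borel) X UNIV"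
    and i: "\<And>\<tau>. integrable M (X \<tau>)" and i2: "\<And>\<tau>. integrable M (\<lambda>\<omega>. (X \<tau> \<omega>)\<^sup>2)"
    and m: "\<And>\<tau>. expectation (X \<tau>) = m" and B: "\<And>\<tau>. expectation (\<lambda>\<omega>. (X \<tau> \<omega>)\<^sup>2) \<le> B" and t: "0 < t"
  shows "integrable M (\<lambda>\<omega>. (sample_mean t (\<lambda>\<tau>. X \<tau> \<omega>) - m)\<^sup>2)"
    "expectation (\<lambda>\<omega>. (sample_mean t (\<lambda>\<tau>. X \<tau> \<omega>) - m)\<^sup>2) \<le> B / t"
proof -
  define Y where "Y \<tau> \<omega> = X \<tau> \<omega> - m" for \<tau> \<omega>
  have [measurable]: "X \<tau> \<in> borel_measurable M" for \<tau> using i by (rule borel_measurable_integrable)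
  have indY: "indep_vars (\<lambda>_. borel) Y UNIV"
    using indep_vars_compose2[OF ind, of "\<lambda>_ y. y - m" "\<lambda>_. borel"] by (simp add: Y_def[abs_def])
  have iY: "integrable M (Y \<tau>)" for \<tau> unfolding Y_def[abs_def] using i by simp
  have EY: "expectation (Y \<tau>) = 0" for \<tau> unfolding Y_def[abs_def] using i m by (simp add: prob_space)
  have sq: "(Y \<tau> \<omega>)\<^sup>2 = (X \<tau> \<omega>)\<^sup>2 - 2 * m * X \<tau> \<omega> + m\<^sup>2" for \<tau> \<omega>
    by (simp add: Y_def power2_eq_square algebra_simps)
  have iY2: "integrable M (\<lambda>\<omega>. (Y \<tau> \<omega>)\<^sup>2)" for \<tau> unfolding sq using i i2 by simp
  have BY: "expectation (\<lambda>\<omega>. (Y \<tau> \<omega>)\<^sup>2) \<le> B" for \<tau>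
  proof -
    have "expectation (\<lambda>\<omega>. (Y \<tau> \<omega>)\<^sup>2) = expectation (\<lambda>\<omega>. (X \<tau> \<omega>)\<^sup>2) - m\<^sup>2"
      unfolding sq using i i2 m by (simp add: prob_space power2_eq_square)
    then show ?thesis using B[of \<tau>] by (smt (verit) zero_le_power2)
  qed
  have pair: "integrable M (\<lambda>\<omega>. Y \<tau> \<omega> * Y \<kappa> \<omega>)" "expectation (\<lambda>\<omega>. Y \<tau> \<omega> * Y \<kappa> \<omega>) = (if \<tau> = \<kappa> then expectation (\<lambda>\<omega>. (Y \<tau> \<omega>)\<^sup>2) else 0)" for \<tau> \<kappa>
  proof -
    have "integrable M (\<lambda>\<omega>. Y \<tau> \<omega> * Y \<kappa> \<omega>) \<and> expectation (\<lambda>\<omega>. Y \<tau> \<omega> * Y \<kappa> \<omega>) = 0" if "\<tau> \<noteq> \<kappa>"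
    proof -
      have "indep_vars (\<lambda>_. borel) Y {\<tau>, \<kappa>}" using indY by (rule indep_vars_subset) simp
      from indep_vars_lebesgue_integral[OF _ this] indep_vars_integrable[OF _ this] show ?thesis
        using that iY EY by simp
    qed
    then show "integrable M (\<lambda>\<omega>. Y \<tau> \<omega> * Y \<kappa> \<omega>)" "expectation (\<lambda>\<omega>. Y \<tau> \<omega> * Y \<kappa> \<omega>) = (if \<tau> = \<kappa> then expectation (\<lambda>\<omega>. (Y \<tau> \<omega>)\<^sup>2) else 0)"
      using iY2[of \<tau>] by (auto simp: power2_eq_square)
  qed
  have "sample_mean t (\<lambda>\<tau>. X \<tau> \<omega>) - m = (\<Sum>\<tau><t. Y \<tau> \<omega>) / t" for \<omega>
    using t by (simp add: sample_mean_def Y_def sum_subtractf field_simps)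
  then have eq: "(sample_mean t (\<lambda>\<tau>. X \<tau> \<omega>) - m)\<^sup>2 = (\<Sum>\<tau><t. \<Sum>\<kappa><t. Y \<tau> \<omega> * Y \<kappa> \<omega>) / t\<^sup>2" for \<omega>
    by (simp add: power_divide power2_eq_square sum_product)
  show "integrable M (\<lambda>\<omega>. (sample_mean t (\<lambda>\<tau>. X \<tau> \<omega>) - m)\<^sup>2)"
    unfolding eq by (intro integrable_divide_zero Bochner_Integration.integrable_sum) (auto simp: pair)
  have "expectation (\<lambda>\<omega>. (sample_mean t (\<lambda>\<tau>. X \<tau> \<omega>) - m)\<^sup>2) = (\<Sum>\<tau><t. \<Sum>\<kappa><t. expectation (\<lambda>\<omega>. Y \<tau> \<omega> * Y \<kappa> \<omega>)) / t\<^sup>2"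
    unfolding eq by (simp add: Bochner_Integration.integral_sum pair(1) Bochner_Integration.integrable_sum)
  also have "\<dots> = (\<Sum>\<tau><t. expectation (\<lambda>\<omega>. (Y \<tau> \<omega>)\<^sup>2)) / t\<^sup>2" by (simp add: pair(2))
  also have "\<dots> \<le> (\<Sum>\<tau><t. B) / t\<^sup>2" by (intro divide_right_mono sum_mono BY) auto
  also have "\<dots> = B / t" using t by (simp add: power2_eq_square)
  finally show "expectation (\<lambda>\<omega>. (sample_mean t (\<lambda>\<tau>. X \<tau> \<omega>) - m)\<^sup>2) \<le> B / t" .
qed

end

section \<open>Quantiles and convergence of distribution functions\<close>

text \<open>With no atoms the distribution function is continuous, so that the infimum defining the quantile is attained with equality.\<close>

lemma cdf_quantile:
  assumes "real_distribution D" and atoms: "\<And>z. measure D {z} = 0" and q: "0 < q" "q < 1"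
  shows "cdf D (quantile D q) = q"
proof -
  interpret real_distribution D by fact
  have cont: "isCont (cdf D) z" for z by (simp add: isCont_cdf atoms)
  let ?S = "{z. q \<le> cdf D z}"
  have "\<forall>\<^sub>F z in at_top. q < cdf D z" using order_tendstoD(1)[OF cdf_lim_at_top_prob q(2)] .
  then obtain z1 where "q < cdf D z1" using eventually_happens by fastforce
  then have ne: "?S \<noteq> {}" by (auto intro: less_imp_le)
  have "\<forall>\<^sub>F z in at_bot. cdf D z < q" using order_tendstoD(2)[OF cdf_lim_at_bot q(1)] .
  then obtain z0 where z0: "cdf D z0 < q" using eventually_happens by fastforce
  have bdd: "bdd_below ?S"
  proof (rule bdd_belowI[of _ z0])
    fix z assume "z \<in> ?S"
    then show "z0 \<le> z" using z0 cdf_nondecreasing[of z z0] by (cases "z0 \<le> z") auto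
  qed
  have "closed ?S" by (intro closed_Collect_le continuous_intros) (auto simp: continuous_on_eq_continuous_at cont)
  then have "Inf ?S \<in> ?S" using ne bdd by (intro closed_contains_Inf)
  then have ge: "q \<le> cdf D (Inf ?S)" by simp
  have "\<not> q < cdf D (Inf ?S)"
  proof
    assume "q < cdf D (Inf ?S)"
    then have "\<forall>\<^sub>F z in at_left (Inf ?S). q < cdf D z"
      using cont[of "Inf ?S"] by (intro order_tendstoD(1)[where y = "cdf D (Inf ?S)"])
        (auto simp: isCont_def filterlim_at_split)
    moreover have "\<forall>\<^sub>F z in at_left (Inf ?S). z < Inf ?S" by (simp add: eventually_at_filter)
    ultimately have "\<forall>\<^sub>F z in at_left (Inf ?S). q < cdf D z \<and> z < Inf ?S" by eventually_elim simp
    then obtain z where "q < cdf D z" "z < Inf ?S" using eventually_happens by fastforce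
    then show False using cInf_lower[of z ?S] bdd by auto
  qed
  then show ?thesis using ge by (simp add: quantile_def)
qed

lemma std_normal_atomless: "measure std_normal_distribution {z} = 0"
proof -
  have "{z} \<in> null_sets (density lborel std_normal_density)"
  proof (subst null_sets_density_iff)
    have "AE y in lborel. y \<in> {z} \<longrightarrow> ennreal (std_normal_density y) = 0"
      using AE_lborel_singleton[of z] by eventually_elim simp
    then show "{z} \<in> sets lborel \<and> (AE y in lborel. y \<in> {z} \<longrightarrow> ennreal (std_normal_density y) = 0)" by simp
  qed simp
  then show ?thesis by (simp add: measure_def null_sets_def)
qed

text \<open>The characteristic function is even, so the normal distribution is symmetric by uniqueness.\<close>

lemma cdf_std_normal_minus: "cdf std_normal_distribution (- z) = 1 - cdf std_normal_distribution z"
proof -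
  let ?N = "std_normal_distribution"
  interpret real_distribution ?N by (rule real_dist_normal_dist)
  have rd: "real_distribution (distr ?N borel uminus)" by (rule real_distribution_distr) simp
  have "char (distr ?N borel uminus) u = char ?N u" for u
  proof -
    have "char (distr ?N borel uminus) u = (CLINT x|?N. iexp (u * (- x)))"
      unfolding char_def by (subst integral_distr) auto
    also have "\<dots> = char ?N (- u)" by (simp add: char_def)
    finally show ?thesis by (simp add: char_std_normal_distribution)
  qed
  then have eq: "distr ?N borel uminus = ?N"
    by (intro Levy_uniqueness rd real_dist_normal_dist ext)
  have "cdf ?N (- z) = measure (distr ?N borel uminus) {..- z}" by (simp add: eq cdf_def)
  also have "\<dots> = measure ?N {z..}"
    by (subst measure_distr) (auto intro!: arg_cong[where f = "measure ?N"])
  also have "\<dots> = measure ?N ({z<..} \<union> {z})" by (rule arg_cong[where f = "measure ?N"]) auto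
  also have "\<dots> = measure ?N {z<..} + measure ?N {z}"
    by (intro finite_measure_Union) auto
  also have "{z<..} = space ?N - {..z}" by auto
  also have "measure ?N (space ?N - {..z}) = 1 - measure ?N {..z}" by (intro prob_compl) auto
  finally show ?thesis by (simp add: cdf_def std_normal_atomless)
qed

text \<open>Convergence of moments extends to polynomials, and by the Weierstrass theorem to the continuous step functions
  that determine weak convergence.\<close>

lemma moments_on_unit_interval_imp_weak_conv:
  fixes D :: "nat \<Rightarrow> real measure"
  assumes D: "\<And>t. real_distribution (D t)" and L: "real_distribution L"
    and D01: "\<And>t. AE u in D t. 0 \<le> u \<and> u \<le> 1" and L01: "AE u in L. 0 \<le> u \<and> u \<le> 1"
    and mom: "\<And>k. (\<lambda>t. \<integral>u. u ^ k \<partial>D t) \<longlonglongrightarrow> (\<integral>u. u ^ k \<partial>L)"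
  shows "weak_conv_m D L"
proof (rule integral_cts_step_conv_imp_weak_conv[OF D L])
  fix x y :: real assume xy: "x < y"
  let ?\<phi> = "cts_step x y"
  have c\<phi>: "continuous_on UNIV ?\<phi>"
    using cts_step_uniformly_continuous[OF xy] by (rule uniformly_continuous_imp_continuous)
  have pow: "integrable P (\<lambda>u. u ^ k)" if P: "real_distribution P" "AE u in P. 0 \<le> u \<and> u \<le> 1" for P and k :: nat
  proof -
    interpret real_distribution P by fact
    have "AE u in P. norm (u ^ k) \<le> 1" using P(2) by eventually_elim (simp add: power_le_one)
    then show ?thesis by (intro integrable_const_bound[where B=1]) auto
  qed
  show "(\<lambda>t. integral\<^sup>L (D t) ?\<phi>) \<longlonglongrightarrow> integral\<^sup>L L ?\<phi>"
  proof (rule LIMSEQ_I)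
    fix r :: real assume r: "0 < r"
    \<comment> \<open>a polynomial approximation on the interval that carries all the measures\<close>
    obtain g where g: "real_polynomial_function g" "\<And>u. u \<in> {0..1} \<Longrightarrow> \<bar>?\<phi> u - g u\<bar> < r / 3"
      using Stone_Weierstrass_real_polynomial_function[of "{0..1::real}" ?\<phi> "r / 3"] r
        continuous_on_subset[OF c\<phi>] by auto
    obtain a n where ga: "g = (\<lambda>u. \<Sum>i\<le>n. a i * u ^ i)" using g(1) real_polynomial_function_iff_sum by blast
    have gi: "integrable P g" "(\<integral>u. g u \<partial>P) = (\<Sum>i\<le>n. a i * (\<integral>u. u ^ i \<partial>P))" "\<bar>integral\<^sup>L P ?\<phi> - integral\<^sup>L P g\<bar> \<le> r / 3"
      if P: "real_distribution P" "AE u in P. 0 \<le> u \<and> u \<le> 1" for P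
    proof -
      interpret real_distribution P by fact
      show i: "integrable P g" unfolding ga by (intro Bochner_Integration.integrable_sum integrable_mult_right pow P)
      show "(\<integral>u. g u \<partial>P) = (\<Sum>i\<le>n. a i * (\<integral>u. u ^ i \<partial>P))"
        unfolding ga by (subst Bochner_Integration.integral_sum) (auto intro!: pow P)
      have i\<phi>: "integrable P ?\<phi>" by (rule integrable_cts_step[OF xy])
      have ae: "AE u in P. \<bar>?\<phi> u - g u\<bar> \<le> r / 3"
        using P(2) by eventually_elim (use g(2) in \<open>force simp: less_imp_le\<close>)
      have "\<bar>integral\<^sup>L P ?\<phi> - integral\<^sup>L P g\<bar> = \<bar>\<integral>u. ?\<phi> u - g u \<partial>P\<bar>" using i i\<phi> by simp
      also have "\<dots> \<le> (\<integral>u. \<bar>?\<phi> u - g u\<bar> \<partial>P)" by (rule integral_abs_bound)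
      also have "\<dots> \<le> (\<integral>u. r / 3 \<partial>P)" using i i\<phi> ae by (intro integral_mono_AE) auto
      also have "\<dots> = r / 3" using prob_space by simp
      finally show "\<bar>integral\<^sup>L P ?\<phi> - integral\<^sup>L P g\<bar> \<le> r / 3" .
    qed
    have "(\<lambda>t. \<integral>u. g u \<partial>D t) \<longlonglongrightarrow> (\<integral>u. g u \<partial>L)"
      unfolding gi(2)[OF D D01] gi(2)[OF L L01] by (intro tendsto_sum tendsto_mult tendsto_const mom)
    from LIMSEQ_D[OF this, of "r / 3"] r obtain N where N: "\<And>t. t \<ge> N \<Longrightarrow> \<bar>(\<integral>u. g u \<partial>D t) - (\<integral>u. g u \<partial>L)\<bar> < r / 3" by auto
    have "norm (integral\<^sup>L (D t) ?\<phi> - integral\<^sup>L L ?\<phi>) < r" if "t \<ge> N" for t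
      using N[OF that] gi(3)[OF D[of t] D01] gi(3)[OF L L01] unfolding real_norm_def abs_real_def
      by (simp split: if_splits)
    then show "\<exists>no. \<forall>n\<ge>no. norm (integral\<^sup>L (D n) ?\<phi> - integral\<^sup>L L ?\<phi>) < r" by blast
  qed
qed

text \<open>The moments of \<open>exp (- S)\<close>, which lies in the unit interval, are the values of the Laplace transform of
  \<open>S\<close> at the naturals. They determine weak convergence there, and the decreasing map \<open>s \<mapsto> exp (- s)\<close> carries it back.\<close>

lemma (in prob_space) laplace_conv_imp_cdf_conv:
  fixes S :: "nat \<Rightarrow> 'a \<Rightarrow> real"
  assumes S[measurable]: "\<And>t. S t \<in> borel_measurable M" and S0: "\<And>t \<omega>. 0 \<le> S t \<omega>"
    and L: "real_distribution L" and L0: "AE y in L. 0 \<le> y"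
    and lap: "\<And>k::nat. (\<lambda>t. expectation (\<lambda>\<omega>. exp (- (real k * S t \<omega>)))) \<longlonglongrightarrow> (\<integral>y. exp (- (real k * y)) \<partial>L)"
    and atom: "measure L {c} = 0"
  shows "(\<lambda>t. prob {\<omega> \<in> space M. S t \<omega> \<le> c}) \<longlonglongrightarrow> cdf L c"
proof -
  interpret L: real_distribution L by fact
  define D where "D t = distr M borel (\<lambda>\<omega>. exp (- S t \<omega>))" for t
  define L' where "L' = distr L borel (\<lambda>y. exp (- y))"
  have rd: "real_distribution (D t)" for t unfolding D_def by (rule real_distribution_distr) measurable
  have rL: "real_distribution L'" unfolding L'_def by (rule L.real_distribution_distr) measurable
  have wc: "weak_conv_m D L'"
  proof (rule moments_on_unit_interval_imp_weak_conv[OF rd rL])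
    show "AE u in D t. 0 \<le> u \<and> u \<le> 1" for t
      unfolding D_def by (subst AE_distr_iff) (auto simp: S0)
    show "AE u in L'. 0 \<le> u \<and> u \<le> 1"
      unfolding L'_def by (subst AE_distr_iff) (use L0 in auto)
    fix k :: nat
    have "(\<integral>u. u ^ k \<partial>D t) = expectation (\<lambda>\<omega>. exp (- (real k * S t \<omega>)))" for t
      unfolding D_def by (subst integral_distr) (auto simp: exp_of_nat_mult[symmetric])
    moreover have "(\<integral>u. u ^ k \<partial>L') = (\<integral>y. exp (- (real k * y)) \<partial>L)"
      unfolding L'_def by (subst integral_distr) (auto simp: exp_of_nat_mult[symmetric])
    ultimately show "(\<lambda>t. \<integral>u. u ^ k \<partial>D t) \<longlonglongrightarrow> (\<integral>u. u ^ k \<partial>L')" using lap by simp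
  qed
  \<comment> \<open>\<open>S \<le> c\<close> is the event that \<open>exp (- S)\<close> is at least \<open>exp (- c)\<close>\<close>
  let ?A = "{exp (- c)..}"
  have fr: "frontier ?A = {exp (- c)}" by (auto simp: frontier_def interior_real_atLeast)
  have "L' (frontier ?A) = emeasure L {c}"
    unfolding fr L'_def by (subst emeasure_distr) (auto intro!: arg_cong[where f = "emeasure L"])
  then have "L' (frontier ?A) = 0" using atom by (simp add: L.emeasure_eq_measure)
  then have "(\<lambda>t. measure (D t) ?A) \<longlonglongrightarrow> measure L' ?A"
    by (intro weak_conv_imp_continuity_set_conv[OF rd rL wc]) auto
  moreover have "measure (D t) ?A = prob {\<omega> \<in> space M. S t \<omega> \<le> c}" for t
    unfolding D_def by (subst measure_distr) (auto intro!: arg_cong[where f = prob])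
  moreover have "measure L' ?A = cdf L c"
    unfolding L'_def cdf_def by (subst measure_distr) (auto intro!: arg_cong[where f = "measure L"])
  ultimately show ?thesis by simp
qed

section \<open>The chi-square distribution\<close>

lemma product_sigma_finite_std_normal: "product_sigma_finite (\<lambda>_. std_normal_distribution)"
proof -
  interpret real_distribution std_normal_distribution by (rule real_dist_normal_dist)
  show ?thesis by standard
qed

lemma prob_space_gauss: "prob_space (PiM {..<n::nat} (\<lambda>_. std_normal_distribution))"
proof -
  interpret real_distribution std_normal_distribution by (rule real_dist_normal_dist)
  show ?thesis by (rule prob_space_PiM) (rule prob_space_axioms)
qed

lemma real_distribution_chi_square: "real_distribution (chi_square n)"
proof -
  interpret prob_space "PiM {..<n::nat} (\<lambda>_. std_normal_distribution)" by (rule prob_space_gauss)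
  show ?thesis unfolding chi_square_def by (rule real_distribution_distr) measurable
qed

lemma chi_square_nonneg: "AE y in chi_square n. 0 \<le> y"
  unfolding chi_square_def by (subst AE_distr_iff) (auto intro!: sum_nonneg)

text \<open>Given the other coordinates, at most two values of the first one produce the sum \<open>c\<close>. With no coordinate the
  chi-square distribution is a point mass, whence \<open>0 < n\<close>.\<close>

lemma chi_square_atomless:
  assumes n: "0 < n" shows "measure (chi_square n) {c} = 0"
proof -
  let ?N = "std_normal_distribution"
  interpret N: real_distribution ?N by (rule real_dist_normal_dist)
  interpret product_sigma_finite "\<lambda>_::nat. ?N" by (rule product_sigma_finite_std_normal)
  define I where "I = {0<..<n}"
  have I: "{..<n} = insert 0 I" "finite I" "0 \<notin> I" using n by (auto simp: I_def)
  \<comment> \<open>integrate over the first coordinate with the others fixed\<close>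
  have inner: "(\<integral>\<^sup>+y. indicator {z. (\<Sum>k<n. (z k)\<^sup>2) = c} (x(0 := y)) \<partial>?N) = 0" for x :: "nat \<Rightarrow> real"
  proof -
    define a where "a = c - (\<Sum>k\<in>I. (x k)\<^sup>2)"
    have sub: "{y::real. y\<^sup>2 = a} \<subseteq> {sqrt a, - sqrt a}"
    proof
      fix y assume "y \<in> {y::real. y\<^sup>2 = a}"
      then have "sqrt a = \<bar>y\<bar>" by auto
      then show "y \<in> {sqrt a, - sqrt a}" by (cases "y \<ge> 0") auto
    qed
    have fin: "finite {y::real. y\<^sup>2 = a}" using sub finite_subset by blast
    have "(\<Sum>k<n. ((x(0 := y)) k)\<^sup>2) = y\<^sup>2 + (\<Sum>k\<in>I. (x k)\<^sup>2)" for y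
      using I by (simp add: I(1)) (intro sum.cong, auto)
    then have "(\<integral>\<^sup>+y. indicator {z. (\<Sum>k<n. (z k)\<^sup>2) = c} (x(0 := y)) \<partial>?N) = (\<integral>\<^sup>+y. indicator {y. y\<^sup>2 = a} y \<partial>?N)"
      by (intro nn_integral_cong) (auto simp: indicator_def a_def)
    also have "\<dots> = emeasure ?N {y. y\<^sup>2 = a}" using fin by (intro nn_integral_indicator) (auto intro: finite_imp_closed)
    also have "\<dots> \<le> emeasure ?N {sqrt a, - sqrt a}" by (rule emeasure_mono[OF sub]) auto
    also have "\<dots> \<le> emeasure ?N {sqrt a} + emeasure ?N {- sqrt a}"
      using emeasure_subadditive[of "{sqrt a}" ?N "{- sqrt a}"] by (simp add: insert_commute)
    also have "\<dots> = 0" using std_normal_atomless by (simp add: N.emeasure_eq_measure)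
    finally show ?thesis by simp
  qed
  have m: "(\<lambda>z. indicator {z. (\<Sum>k<n. (z k)\<^sup>2) = c} z :: ennreal) \<in> borel_measurable (PiM (insert 0 I) (\<lambda>_. ?N))"
  proof (rule borel_measurable_indicator')
    have "(\<lambda>z. \<Sum>k<n. (z k)\<^sup>2) \<in> borel_measurable (PiM (insert 0 I) (\<lambda>_. ?N))"
      unfolding I(1)[symmetric] by measurable
    from measurable_sets[OF this, of "{c}"]
    show "{z \<in> space (PiM (insert 0 I) (\<lambda>_. ?N)). z \<in> {z. (\<Sum>k<n. (z k)\<^sup>2) = c}} \<in> sets (PiM (insert 0 I) (\<lambda>_. ?N))"
      by (simp add: vimage_def Int_def conj_commute)
  qed
  have "emeasure (chi_square n) {c} = emeasure (PiM {..<n} (\<lambda>_. ?N)) ((\<lambda>z. \<Sum>k<n. (z k)\<^sup>2) -` {c} \<inter> space (PiM {..<n} (\<lambda>_. ?N)))"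
    unfolding chi_square_def by (rule emeasure_distr) (auto, measurable)
  also have "\<dots> = (\<integral>\<^sup>+z. indicator {z. (\<Sum>k<n. (z k)\<^sup>2) = c} z \<partial>PiM {..<n} (\<lambda>_. ?N))"
  proof -
    have ms: "(\<lambda>z. \<Sum>k<n. (z k)\<^sup>2) -` {c} \<inter> space (PiM {..<n} (\<lambda>_. ?N)) \<in> sets (PiM {..<n} (\<lambda>_. ?N))"
      by (rule measurable_sets[where A=borel]) auto
    show ?thesis
      by (subst nn_integral_indicator[OF ms, symmetric], rule nn_integral_cong) (auto simp: indicator_def)
  qed
  also have "\<dots> = (\<integral>\<^sup>+x. (\<integral>\<^sup>+y. indicator {z. (\<Sum>k<n. (z k)\<^sup>2) = c} (x(0 := y)) \<partial>?N) \<partial>PiM I (\<lambda>_. ?N))"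
    unfolding I(1) using m unfolding I(1) by (rule product_nn_integral_insert[OF I(2,3)])
  also have "\<dots> = 0" unfolding inner by simp
  finally show ?thesis by (simp add: measure_def)
qed

lemma cdf_chi_square_quantile:
  assumes "0 < n" "0 < q" "q < 1"
  shows "cdf (chi_square n) (quantile (chi_square n) q) = q"
    "isCont (cdf (chi_square n)) z" "0 \<le> quantile (chi_square n) q"
proof -
  interpret real_distribution "chi_square n" by (rule real_distribution_chi_square)
  show q: "cdf (chi_square n) (quantile (chi_square n) q) = q"
    by (rule cdf_quantile[OF real_distribution_chi_square chi_square_atomless]) (use assms in auto)
  show "isCont (cdf (chi_square n)) z" using chi_square_atomless[OF assms(1)] by (simp add: isCont_cdf)
  show "0 \<le> quantile (chi_square n) q"
  proof (rule ccontr)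
    assume neg: "\<not> 0 \<le> quantile (chi_square n) q"
    have "AE y in chi_square n. y \<notin> {..quantile (chi_square n) q}"
      using chi_square_nonneg[of n] by eventually_elim (use neg in auto)
    then have "cdf (chi_square n) (quantile (chi_square n) q) = 0"
      unfolding cdf_def by (subst prob_eq_0) auto
    then show False using q assms by simp
  qed
qed

section \<open>Central limit theorems for normalised sums\<close>

lemma Re_iexp: "Re (iexp y) = cos y"
  by (simp add: Re_exp)

text \<open>The degenerate case \<open>\<sigma> = 0\<close>, outside the central limit theorem, occurs below for the zero direction.\<close>

lemma (in prob_space) expectation_cos_normalised_sum:
  fixes X :: "nat \<Rightarrow> 'a \<Rightarrow> real"
  assumes ind: "indep_vars (\<lambda>_. borel) X UNIV" and m: "\<And>\<tau>. expectation (X \<tau>) = 0"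
    and i2: "\<And>\<tau>. integrable M (\<lambda>\<omega>. (X \<tau> \<omega>)\<^sup>2)" and v: "\<And>\<tau>. expectation (\<lambda>\<omega>. (X \<tau> \<omega>)\<^sup>2) = \<sigma>\<^sup>2" and \<sigma>: "0 \<le> \<sigma>"
    and d: "\<And>\<tau>. distr M borel (X \<tau>) = distr M borel (X 0)"
  shows "(\<lambda>t. expectation (\<lambda>\<omega>. cos ((\<Sum>\<tau><t. X \<tau> \<omega>) / sqrt t))) \<longlonglongrightarrow> exp (- (\<sigma>\<^sup>2 / 2))"
proof (cases "\<sigma> = 0")
  case True
  have [measurable]: "X \<tau> \<in> borel_measurable M" for \<tau> using ind by (simp add: indep_vars_def2)
  have "AE \<omega> in M. (X \<tau> \<omega>)\<^sup>2 = 0" for \<tau>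
    using v[of \<tau>] True i2[of \<tau>] by (subst integral_nonneg_eq_0_iff_AE[symmetric]) auto
  then have "AE \<omega> in M. \<forall>\<tau>. X \<tau> \<omega> = 0" by (simp add: AE_all_countable)
  then have "AE \<omega> in M. cos ((\<Sum>\<tau><t. X \<tau> \<omega>) / sqrt (real t)) = 1" for t :: nat by eventually_elim simp
  then have "expectation (\<lambda>\<omega>. cos ((\<Sum>\<tau><t. X \<tau> \<omega>) / sqrt (real t))) = expectation (\<lambda>_. 1)" for t :: nat
    by (intro integral_cong_AE) auto
  then show ?thesis using True by (simp add: prob_space)
next
  case False
  have [measurable]: "X \<tau> \<in> borel_measurable M" for \<tau> using ind by (simp add: indep_vars_def2)
  have \<sigma>0: "\<sigma> > 0" using False \<sigma> by simp
  let ?D = "\<lambda>t::nat. distr M borel (\<lambda>\<omega>. (\<Sum>\<tau><t. X \<tau> \<omega>) / sqrt (t * \<sigma>\<^sup>2))"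
  have wc: "weak_conv_m ?D std_normal_distribution"
    by (rule central_limit_theorem_zero_mean[OF ind m \<sigma>0 i2 _ d]) (simp add: m v)
  have rd: "real_distribution (?D t)" for t by (rule real_distribution_distr) measurable
  have "(\<lambda>t. char (?D t) \<sigma>) \<longlonglongrightarrow> char std_normal_distribution \<sigma>"
    by (rule levy_continuity1[OF rd real_dist_normal_dist wc])
  then have "(\<lambda>t. Re (char (?D t) \<sigma>)) \<longlonglongrightarrow> Re (char std_normal_distribution \<sigma>)" by (rule tendsto_Re)
  moreover have "Re (char std_normal_distribution \<sigma>) = exp (- (\<sigma>\<^sup>2 / 2))"
    by (simp add: char_std_normal_distribution)
  moreover have "Re (char (?D t) \<sigma>) = expectation (\<lambda>\<omega>. cos ((\<Sum>\<tau><t. X \<tau> \<omega>) / sqrt t))" for t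
  proof -
    have "char (?D t) \<sigma> = (CLINT \<omega>|M. iexp (\<sigma> * ((\<Sum>\<tau><t. X \<tau> \<omega>) / sqrt (t * \<sigma>\<^sup>2))))"
      unfolding char_def by (subst integral_distr) auto
    also have "\<dots> = (CLINT \<omega>|M. iexp ((\<Sum>\<tau><t. X \<tau> \<omega>) / sqrt t))"
      using \<sigma>0 by (simp add: real_sqrt_mult)
    also have "Re \<dots> = expectation (\<lambda>\<omega>. Re (iexp ((\<Sum>\<tau><t. X \<tau> \<omega>) / sqrt t)))"
      by (subst integral_Re[symmetric]) (auto intro!: integrable_const_bound[where B=1])
    finally show ?thesis by (simp only: Re_iexp)
  qed
  ultimately show ?thesis by simp
qed

text \<open>The real part of the characteristic function of a standard Gaussian vector, read backwards: it expresses
  \<open>exp (- s\<^sup>2 |z|\<^sup>2 / 2)\<close> as an average of cosines of linear functionals of \<open>z\<close>. The bijection \<open>h\<close> numbers the coordinates, as the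
  chi-square distribution is defined on sequences.\<close>

lemma gauss_expectation_cos:
  fixes z :: "real ^ 'n" and h :: "'n \<Rightarrow> nat"
  assumes h: "bij_betw h UNIV {..<CARD('n)}"
  shows "(\<integral>\<omega>. cos (s * ((\<chi> i. \<omega> (h i)) \<bullet> z)) \<partial>PiM {..<CARD('n)} (\<lambda>_. std_normal_distribution)) = exp (- (s\<^sup>2 * (z \<bullet> z) / 2))"
proof -
  let ?N = std_normal_distribution and ?I = "{..<CARD('n)}"
  interpret N: real_distribution ?N by (rule real_dist_normal_dist)
  interpret product_sigma_finite "\<lambda>_::nat. ?N" by (rule product_sigma_finite_std_normal)
  interpret G: prob_space "PiM ?I (\<lambda>_. ?N)" by (rule prob_space_gauss)
  define g where "g = inv_into UNIV h"
  have gh: "g (h i) = i" for i using h by (simp add: g_def bij_betw_def)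
  have sum: "(\<Sum>i\<in>UNIV. F i) = (\<Sum>k\<in>?I. F (g k))" for F :: "'n \<Rightarrow> real"
    using sum.reindex_bij_betw[OF h, of "\<lambda>k. F (g k)"] by (simp add: gh)
  have hg: "h (g k) = k" if "k \<in> ?I" for k using that h by (simp add: g_def bij_betw_def f_inv_into_f)
  have ip: "s * ((\<chi> i. \<omega> (h i)) \<bullet> z) = (\<Sum>k\<in>?I. s * z $ g k * \<omega> k)" for \<omega> :: "nat \<Rightarrow> real"
    unfolding inner_vec_def by (subst sum) (auto simp: sum_distrib_left hg intro!: sum.cong)
  have "(CLINT \<omega>|PiM ?I (\<lambda>_. ?N). (\<Prod>k\<in>?I. iexp (s * z $ g k * \<omega> k))) = (\<Prod>k\<in>?I. CLINT x|?N. iexp (s * z $ g k * x))"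
    by (rule product_integral_prod) (auto intro!: N.integrable_const_bound[where B=1])
  also have "\<dots> = (\<Prod>k\<in>?I. char ?N (s * z $ g k))" by (simp add: char_def)
  also have "\<dots> = complex_of_real (\<Prod>k\<in>?I. exp (- ((s * z $ g k)\<^sup>2 / 2)))"
    by (simp add: char_std_normal_distribution)
  also have "(\<Prod>k\<in>?I. exp (- ((s * z $ g k)\<^sup>2 / 2))) = exp (\<Sum>k\<in>?I. - ((s * z $ g k)\<^sup>2 / 2))"
    by (simp add: exp_sum)
  also have "(\<Sum>k\<in>?I. - ((s * z $ g k)\<^sup>2 / 2)) = (\<Sum>i\<in>UNIV. - ((s * z $ i)\<^sup>2 / 2))" by (simp add: sum)
  also have "\<dots> = - (s\<^sup>2 * (z \<bullet> z) / 2)"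
    by (simp add: inner_vec_def sum_negf sum_divide_distrib[symmetric] sum_distrib_left power2_eq_square ac_simps)
  finally have eq: "(CLINT \<omega>|PiM ?I (\<lambda>_. ?N). (\<Prod>k\<in>?I. iexp (s * z $ g k * \<omega> k))) = complex_of_real (exp (- (s\<^sup>2 * (z \<bullet> z) / 2)))" .
  have "(\<integral>\<omega>. cos (s * ((\<chi> i. \<omega> (h i)) \<bullet> z)) \<partial>PiM ?I (\<lambda>_. ?N)) = (\<integral>\<omega>. Re (\<Prod>k\<in>?I. iexp (s * z $ g k * \<omega> k)) \<partial>PiM ?I (\<lambda>_. ?N))"
  proof (rule Bochner_Integration.integral_cong[OF refl])
    fix \<omega> :: "nat \<Rightarrow> real"
    have "(\<Prod>k\<in>?I. iexp (s * z $ g k * \<omega> k)) = iexp (\<Sum>k\<in>?I. s * z $ g k * \<omega> k)"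
      by (simp add: exp_sum sum_distrib_left)
    also have "Re \<dots> = cos (\<Sum>k\<in>?I. s * z $ g k * \<omega> k)" by (rule Re_iexp)
    finally show "cos (s * ((\<chi> i. \<omega> (h i)) \<bullet> z)) = Re (\<Prod>k\<in>?I. iexp (s * z $ g k * \<omega> k))" by (simp add: ip)
  qed
  also have "\<dots> = Re (CLINT \<omega>|PiM ?I (\<lambda>_. ?N). (\<Prod>k\<in>?I. iexp (s * z $ g k * \<omega> k)))"
    by (rule integral_Re) (auto intro!: product_integrable_prod N.integrable_const_bound[where B=1])
  finally show ?thesis by (simp only: eq Re_complex_of_real)
qed

text \<open>By \<open>gauss_expectation_cos\<close> and Fubini the Laplace transform of the squared norm is a Gaussian
  average of \<open>E cos (u \<bullet> Z)\<close> over directions \<open>u\<close>. For each \<open>u\<close> the one-dimensional central limit theorem gives the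
  limit, dominated convergence the limit of the average, and the Laplace transforms determine the distribution functions. In this
  way no multivariate central limit theorem enters.\<close>

lemma (in prob_space) norm_squared_normalised_sum_chi_square:
  fixes Y :: "nat \<Rightarrow> 'a \<Rightarrow> real ^ 'n"
  assumes ind: "indep_vars (\<lambda>_. borel) Y UNIV" and m: "\<And>\<tau> u. expectation (\<lambda>\<omega>. u \<bullet> Y \<tau> \<omega>) = 0"
    and i2: "\<And>\<tau> u. integrable M (\<lambda>\<omega>. (u \<bullet> Y \<tau> \<omega>)\<^sup>2)" and v: "\<And>\<tau> u. expectation (\<lambda>\<omega>. (u \<bullet> Y \<tau> \<omega>)\<^sup>2) = u \<bullet> u"
    and d: "\<And>\<tau>. distr M borel (Y \<tau>) = distr M borel (Y 0)"
  shows "(\<lambda>t. prob {\<omega> \<in> space M. (norm ((1 / sqrt t) *\<^sub>R (\<Sum>\<tau><t. Y \<tau> \<omega>)))\<^sup>2 \<le> c}) \<longlonglongrightarrow> cdf (chi_square CARD('n)) c"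
proof -
  let ?N = std_normal_distribution and ?I = "{..<CARD('n)}"
  let ?G = "PiM ?I (\<lambda>_. ?N)"
  interpret G: prob_space ?G by (rule prob_space_gauss)
  interpret MG: pair_prob_space M ?G ..
  have [measurable]: "Y \<tau> \<in> borel_measurable M" for \<tau> using ind by (simp add: indep_vars_def2)
  define Z where "Z t \<omega> = (1 / sqrt (real t)) *\<^sub>R (\<Sum>\<tau><t. Y \<tau> \<omega>)" for t \<omega>
  have [measurable]: "Z t \<in> borel_measurable M" for t unfolding Z_def[abs_def] by measurable
  obtain h :: "'n \<Rightarrow> nat" where h: "bij_betw h UNIV {..<CARD('n)}"
    using ex_bij_betw_finite_nat[of "UNIV :: 'n set"] by (auto simp: atLeast0LessThan)
  define V where "V \<omega> = ((\<chi> i. \<omega> (h i)) :: real ^ 'n)" for \<omega> :: "nat \<Rightarrow> real"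
  have hI: "h i \<in> ?I" for i using h by (auto simp: bij_betw_def)
  have [measurable]: "V \<in> borel_measurable ?G"
  proof (subst borel_measurable_euclidean_space, intro ballI)
    fix b :: "real ^ 'n" assume "b \<in> Basis"
    then obtain i where b: "b = axis i 1" by (auto simp: Basis_vec_def)
    have "(\<lambda>\<omega>. \<omega> (h i)) \<in> borel_measurable ?G" using hI[of i] by measurable
    then show "(\<lambda>\<omega>. V \<omega> \<bullet> b) \<in> borel_measurable ?G" by (simp add: b V_def inner_axis)
  qed
  have VV: "V \<omega> \<bullet> V \<omega> = (\<Sum>k\<in>?I. (\<omega> k)\<^sup>2)" for \<omega>
    using sum.reindex_bij_betw[OF h, of "\<lambda>k. (\<omega> k)\<^sup>2"] by (simp add: V_def inner_vec_def power2_eq_square)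
  have cosZ: "(\<lambda>t. expectation (\<lambda>\<omega>. cos (u \<bullet> Z t \<omega>))) \<longlonglongrightarrow> exp (- ((u \<bullet> u) / 2))" for u
  proof -
    have "(\<lambda>t. expectation (\<lambda>\<omega>. cos ((\<Sum>\<tau><t. u \<bullet> Y \<tau> \<omega>) / sqrt t))) \<longlonglongrightarrow> exp (- ((norm u)\<^sup>2 / 2))"
    proof (rule expectation_cos_normalised_sum)
      show "indep_vars (\<lambda>_. borel) (\<lambda>\<tau> \<omega>. u \<bullet> Y \<tau> \<omega>) UNIV"
        by (rule indep_vars_compose2[OF ind]) measurable
      have "distr M borel (\<lambda>\<omega>. u \<bullet> Y \<tau> \<omega>) = distr (distr M borel (Y \<tau>)) borel (\<lambda>y. u \<bullet> y)" for \<tau>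
        by (subst distr_distr) (auto simp: comp_def)
      then show "distr M borel (\<lambda>\<omega>. u \<bullet> Y \<tau> \<omega>) = distr M borel (\<lambda>\<omega>. u \<bullet> Y 0 \<omega>)" for \<tau> by (simp only: d[of \<tau>])
    qed (auto simp: m i2 v power2_norm_eq_inner)
    then show ?thesis by (simp add: Z_def inner_sum_right power2_norm_eq_inner)
  qed
  have lap: "(\<lambda>t. expectation (\<lambda>\<omega>. exp (- (real k * (norm (Z t \<omega>))\<^sup>2)))) \<longlonglongrightarrow> (\<integral>y. exp (- (real k * y)) \<partial>chi_square CARD('n))" for k :: nat
  proof -
    \<comment> \<open>chosen so that \<open>exp (- s\<^sup>2 |Z|\<^sup>2 / 2) = exp (- k |Z|\<^sup>2)\<close>\<close>
    define s where "s = sqrt (2 * real k)"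
    have s2: "s\<^sup>2 = 2 * real k" by (simp add: s_def)
    have "expectation (\<lambda>\<omega>. exp (- (real k * (norm (Z t \<omega>))\<^sup>2))) = (\<integral>x. expectation (\<lambda>\<omega>. cos ((s *\<^sub>R V x) \<bullet> Z t \<omega>)) \<partial>?G)" for t
    proof -
      have "expectation (\<lambda>\<omega>. exp (- (real k * (norm (Z t \<omega>))\<^sup>2))) = expectation (\<lambda>\<omega>. \<integral>x. cos (s * (V x \<bullet> Z t \<omega>)) \<partial>?G)"
        unfolding V_def gauss_expectation_cos[OF h] s2 by (simp add: power2_norm_eq_inner)
      also have "\<dots> = (\<integral>x. expectation (\<lambda>\<omega>. cos (s * (V x \<bullet> Z t \<omega>))) \<partial>?G)"
        by (rule MG.Fubini_integral[symmetric]) (auto intro!: MG.P.integrable_const_bound[where B=1])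
      finally show ?thesis by simp
    qed
    moreover have "(\<lambda>t. \<integral>x. expectation (\<lambda>\<omega>. cos ((s *\<^sub>R V x) \<bullet> Z t \<omega>)) \<partial>?G) \<longlonglongrightarrow> (\<integral>x. exp (- (((s *\<^sub>R V x) \<bullet> (s *\<^sub>R V x)) / 2)) \<partial>?G)"
    proof (rule integral_dominated_convergence[where w = "\<lambda>_. 1"])
      show "AE x in ?G. norm (expectation (\<lambda>\<omega>. cos ((s *\<^sub>R V x) \<bullet> Z t \<omega>))) \<le> 1" for t
      proof (rule AE_I2)
        fix x
        have "norm (expectation (\<lambda>\<omega>. cos ((s *\<^sub>R V x) \<bullet> Z t \<omega>))) \<le> expectation (\<lambda>\<omega>. 1)"
          by (rule order_trans[OF integral_norm_bound], rule integral_mono)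
             (auto intro!: integrable_const_bound[where B=1])
        then show "norm (expectation (\<lambda>\<omega>. cos ((s *\<^sub>R V x) \<bullet> Z t \<omega>))) \<le> 1" by (simp add: prob_space)
      qed
      show "AE x in ?G. (\<lambda>t. expectation (\<lambda>\<omega>. cos ((s *\<^sub>R V x) \<bullet> Z t \<omega>))) \<longlonglongrightarrow> exp (- (((s *\<^sub>R V x) \<bullet> (s *\<^sub>R V x)) / 2))"
        by (rule AE_I2) (rule cosZ)
    qed auto
    moreover have "(\<integral>x. exp (- (((s *\<^sub>R V x) \<bullet> (s *\<^sub>R V x)) / 2)) \<partial>?G) = (\<integral>y. exp (- (real k * y)) \<partial>chi_square CARD('n))"
      unfolding chi_square_def by (subst integral_distr) (measurable, simp add: VV s2 mult.assoc[symmetric] power2_eq_square[symmetric])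
    ultimately show ?thesis by simp
  qed
  show ?thesis unfolding Z_def[symmetric]
    by (rule laplace_conv_imp_cdf_conv[OF _ _ real_distribution_chi_square chi_square_nonneg lap chi_square_atomless]) auto
qed

lemma (in prob_space) normalised_sum_std_normal_cdf:
  fixes X :: "nat \<Rightarrow> 'a \<Rightarrow> real"
  assumes ind: "indep_vars (\<lambda>_. borel) X UNIV" and m: "\<And>\<tau>. expectation (X \<tau>) = 0"
    and i2: "\<And>\<tau>. integrable M (\<lambda>\<omega>. (X \<tau> \<omega>)\<^sup>2)" and v: "\<And>\<tau>. expectation (\<lambda>\<omega>. (X \<tau> \<omega>)\<^sup>2) = \<sigma>\<^sup>2" and \<sigma>: "0 < \<sigma>"
    and d: "\<And>\<tau>. distr M borel (X \<tau>) = distr M borel (X 0)"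
  shows "(\<lambda>t. prob {\<omega> \<in> space M. (\<Sum>\<tau><t. X \<tau> \<omega>) / (sqrt t * \<sigma>) \<le> c}) \<longlonglongrightarrow> cdf std_normal_distribution c"
proof -
  interpret N: real_distribution std_normal_distribution by (rule real_dist_normal_dist)
  have [measurable]: "X \<tau> \<in> borel_measurable M" for \<tau> using ind by (simp add: indep_vars_def2)
  let ?D = "\<lambda>t::nat. distr M borel (\<lambda>\<omega>. (\<Sum>\<tau><t. X \<tau> \<omega>) / sqrt (t * \<sigma>\<^sup>2))"
  have "weak_conv_m ?D std_normal_distribution"
    by (rule central_limit_theorem_zero_mean[OF ind m \<sigma> i2 _ d]) (simp add: m v)
  moreover have "isCont (cdf std_normal_distribution) c" by (simp add: N.isCont_cdf std_normal_atomless)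
  ultimately have "(\<lambda>t. cdf (?D t) c) \<longlonglongrightarrow> cdf std_normal_distribution c"
    by (simp add: weak_conv_m_def weak_conv_def)
  moreover have "cdf (?D t) c = prob {\<omega> \<in> space M. (\<Sum>\<tau><t. X \<tau> \<omega>) / (sqrt t * \<sigma>) \<le> c}" for t
    unfolding cdf_def by (subst measure_distr) (use \<sigma> in \<open>auto intro!: arg_cong[where f = prob] simp: real_sqrt_mult\<close>)
  ultimately show ?thesis by simp
qed

section \<open>The highest bid and its subgradients\<close>

lemma top_bid_ge: "\<beta> $ i * w $ i \<le> top_bid \<beta> w"
  unfolding top_bid_def by (rule Max_ge) auto

lemma top_bid_leI: "(\<And>i. \<beta> $ i * w $ i \<le> c) \<Longrightarrow> top_bid \<beta> w \<le> c"
  unfolding top_bid_def by (subst Max_le_iff) auto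

lemma top_bid_nonneg:
  assumes "\<And>i. 0 \<le> \<beta> $ i" "\<And>i. 0 \<le> w $ i" shows "0 \<le> top_bid \<beta> w"
proof -
  have "0 \<le> \<beta> $ undefined * w $ undefined" using assms by simp
  then show ?thesis using top_bid_ge order_trans by blast
qed

lemma top_bid_lipschitz: "\<bar>top_bid \<beta> w - top_bid \<beta>' w\<bar> \<le> norm (\<beta> - \<beta>') * norm w"
proof -
  have *: "top_bid \<beta> w \<le> top_bid \<beta>' w + norm (\<beta> - \<beta>') * norm w" for \<beta> \<beta>' :: "real ^ 'a"
  proof (rule top_bid_leI)
    fix i
    have "(\<beta> - \<beta>') $ i * w $ i \<le> \<bar>(\<beta> - \<beta>') $ i\<bar> * \<bar>w $ i\<bar>" by (metis abs_ge_self abs_mult)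
    also have "\<dots> \<le> norm (\<beta> - \<beta>') * norm w" by (intro mult_mono component_le_norm_cart) auto
    finally show "\<beta> $ i * w $ i \<le> top_bid \<beta>' w + norm (\<beta> - \<beta>') * norm w"
      using top_bid_ge[of \<beta>' i w] by (simp add: algebra_simps)
  qed
  show ?thesis using *[of \<beta> \<beta>'] *[of \<beta>' \<beta>] by (simp add: norm_minus_commute)
qed

lemma top_bid_convex:
  assumes "0 \<le> u" "u \<le> 1"
  shows "top_bid ((1 - u) *\<^sub>R \<beta> + u *\<^sub>R \<beta>') w \<le> (1 - u) * top_bid \<beta> w + u * top_bid \<beta>' w"
proof (rule top_bid_leI)
  fix i
  have "((1 - u) *\<^sub>R \<beta> + u *\<^sub>R \<beta>') $ i * w $ i = (1 - u) * (\<beta> $ i * w $ i) + u * (\<beta>' $ i * w $ i)"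
    by (simp add: algebra_simps)
  also have "\<dots> \<le> (1 - u) * top_bid \<beta> w + u * top_bid \<beta>' w"
    using assms by (intro add_mono mult_left_mono top_bid_ge) auto
  finally show "((1 - u) *\<^sub>R \<beta> + u *\<^sub>R \<beta>') $ i * w $ i \<le> (1 - u) * top_bid \<beta> w + u * top_bid \<beta>' w" .
qed

text \<open>The winners' bids all equal the highest bid and their shares add up to one, so \<open>(x * w) \<bullet> \<beta>\<close>
  equals \<open>top_bid \<beta> w\<close>; at other multipliers the same weights average bids that are at most the highest. When the price is zero
  the shares may add up to less than one, but then both sides of the equality vanish.\<close>

lemma allocation_is_subgradient:
  fixes x w \<beta> \<beta>' :: "real ^ 'n"
  assumes w: "\<And>i. 0 \<le> w $ i" and x: "\<And>i. 0 \<le> x $ i" "(\<Sum>i\<in>UNIV. x $ i) \<le> 1"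
    and win: "\<And>i. 0 < x $ i \<Longrightarrow> \<beta> $ i * w $ i = top_bid \<beta> w"
    and full: "0 < top_bid \<beta> w \<Longrightarrow> (\<Sum>i\<in>UNIV. x $ i) = 1"
    and \<beta>: "\<And>i. 0 \<le> \<beta> $ i" and \<beta>': "\<And>i. 0 \<le> \<beta>' $ i"
  shows "top_bid \<beta> w + (x * w) \<bullet> (\<beta>' - \<beta>) \<le> top_bid \<beta>' w"
proof -
  have xw: "x $ i * (\<beta> $ i * w $ i) = x $ i * top_bid \<beta> w" for i
    using win[of i] x(1)[of i] by (cases "x $ i = 0") auto
  have "(x * w) \<bullet> \<beta> = (\<Sum>i\<in>UNIV. x $ i * (\<beta> $ i * w $ i))" by (simp add: inner_vec_def ac_simps)
  also have "\<dots> = (\<Sum>i\<in>UNIV. x $ i) * top_bid \<beta> w" by (simp only: xw sum_distrib_right)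
  also have "\<dots> = top_bid \<beta> w" using full top_bid_nonneg[OF \<beta> w] by (cases "top_bid \<beta> w = 0") auto
  finally have 1: "(x * w) \<bullet> \<beta> = top_bid \<beta> w" .
  have "(x * w) \<bullet> \<beta>' = (\<Sum>i\<in>UNIV. x $ i * (\<beta>' $ i * w $ i))" by (simp add: inner_vec_def ac_simps)
  also have "\<dots> \<le> (\<Sum>i\<in>UNIV. x $ i * top_bid \<beta>' w)" by (intro sum_mono mult_left_mono top_bid_ge x)
  also have "\<dots> = (\<Sum>i\<in>UNIV. x $ i) * top_bid \<beta>' w" by (simp only: sum_distrib_right)
  also have "\<dots> \<le> 1 * top_bid \<beta>' w" by (intro mult_right_mono x top_bid_nonneg \<beta>' w)
  finally show ?thesis using 1 by (simp add: inner_diff_right)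
qed

lemma borel_measurable_vecI:
  fixes f :: "'c \<Rightarrow> real ^ 'n"
  assumes "\<And>i. (\<lambda>x. f x $ i) \<in> borel_measurable M" shows "f \<in> borel_measurable M"
proof (subst borel_measurable_euclidean_space, intro ballI)
  fix c :: "real ^ 'n" assume "c \<in> Basis"
  then obtain i where "c = axis i 1" by (auto simp: Basis_vec_def)
  then show "(\<lambda>x. f x \<bullet> c) \<in> borel_measurable M" using assms[of i] by (simp add: inner_axis)
qed

lemma borel_measurable_matI:
  fixes f :: "'c \<Rightarrow> real ^ 'n ^ 'm"
  assumes "\<And>i j. (\<lambda>x. f x $ i $ j) \<in> borel_measurable M" shows "f \<in> borel_measurable M"
proof (subst borel_measurable_euclidean_space, intro ballI)
  fix c :: "real ^ 'n ^ 'm" assume "c \<in> Basis"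
  then obtain i j where "c = axis i (axis j 1)" by (auto simp: Basis_vec_def)
  then show "(\<lambda>x. f x \<bullet> c) \<in> borel_measurable M" using assms[of i j] by (simp add: inner_axis)
qed

lemma borel_measurable_vec_nth:
  fixes f :: "'c \<Rightarrow> 'd::euclidean_space ^ 'n"
  assumes "f \<in> borel_measurable M" shows "(\<lambda>x. f x $ i) \<in> borel_measurable M"
  by (rule borel_measurable_continuous_on[OF _ assms, of "\<lambda>y. y $ i"])
     (intro continuous_on_component continuous_on_id)

lemma borel_measurable_top_bid[measurable (raw)]:
  fixes f g :: "'c \<Rightarrow> real ^ 'n"
  assumes "f \<in> borel_measurable M" "g \<in> borel_measurable M"
  shows "(\<lambda>y. top_bid (f y) (g y)) \<in> borel_measurable M"
  unfolding top_bid_def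
proof -
  have eq: "(MAX i. f y $ i * g y $ i) = Max {f y $ i * g y $ i | i. i \<in> UNIV}" for y
    by (rule arg_cong[where f = Max]) auto
  have "(\<lambda>y. MAX i\<in>UNIV. f y $ i * g y $ i) \<in> borel_measurable M"
    by (rule borel_measurable_Max) (auto intro!: borel_measurable_times borel_measurable_vec_nth assms)
  then show "(\<lambda>y. MAX i. f y $ i * g y $ i) \<in> borel_measurable M" .
qed

section \<open>The limit equilibrium\<close>

locale fppe_sampling = prob_space M
  for M :: "'w measure" +
  fixes \<nu> :: "'a measure"
    and b \<beta>0 :: "real ^ 'n" and v x0 :: "'a \<Rightarrow> real ^ 'n" and s p0 :: "'a \<Rightarrow> real"
    and \<theta> :: "nat \<Rightarrow> 'w \<Rightarrow> 'a"
  assumes market: "market \<nu> b v s"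
    and limit: "limit_FPPE \<nu> b v s \<beta>0 p0 x0"
    and smo: "SMO \<nu> v s \<beta>0"
    and scs: "SCS \<nu> b s \<beta>0 p0 x0"
    and draws: "\<And>\<tau>. distributed M \<nu> (\<theta> \<tau>) (\<lambda>y. ennreal (s y))"
    and indep: "indep_vars (\<lambda>_. \<nu>) \<theta> UNIV"
begin

text \<open>The subgradient of \<open>\<beta> \<mapsto> top_bid \<beta> (v y)\<close> at \<open>\<beta>0\<close> that is selected by the limit allocation.\<close>

definition m0 :: "'a \<Rightarrow> real ^ 'n" where "m0 y = x0 y * v y"
definition \<mu> :: "real ^ 'n" where "\<mu> = limit_util \<nu> v s x0"

text \<open>A bound of the values that is also nonnegative, so that \<open>L\<close> below is positive.\<close>

definition C :: real where "C = (SOME C. 0 \<le> C \<and> (AE y in \<nu>. \<forall>i. v y $ i \<le> C))"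

text \<open>Bounds the norms of \<open>v y\<close> and \<open>m0 y\<close>, and is thereby a Lipschitz constant of the highest bid.\<close>

definition L :: real where "L = real CARD('n) * C + 1"
definition f :: "real ^ 'n \<Rightarrow> real" where "f \<beta> = supply_mean \<nu> s (\<lambda>y. top_bid \<beta> (v y))"
definition A :: "real ^ 'n ^ 'n" where "A = hessian f \<beta>0"

text \<open>The pointwise equilibrium conditions, which hold at almost every item, in one predicate.\<close>

definition good :: "'a \<Rightarrow> bool" where
  "good y \<longleftrightarrow> (\<forall>i. 0 \<le> v y $ i \<and> v y $ i \<le> C) \<and> (\<forall>i. 0 \<le> x0 y $ i) \<and> (\<Sum>i\<in>UNIV. x0 y $ i) \<le> 1 \<and>
     p0 y = top_bid \<beta>0 (v y) \<and> (\<forall>i. 0 < x0 y $ i \<longrightarrow> \<beta>0 $ i * v y $ i = top_bid \<beta>0 (v y)) \<and>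
     (0 < top_bid \<beta>0 (v y) \<longrightarrow> (\<Sum>i\<in>UNIV. x0 y $ i) = 1)"

text \<open>The error of the linear approximation with slope \<open>m0 y\<close>.\<close>

definition R :: "'a \<Rightarrow> real ^ 'n \<Rightarrow> real" where
  "R y k = top_bid (\<beta>0 + k) (v y) - top_bid \<beta>0 (v y) - m0 y \<bullet> k"

lemma b_pos: "0 < b $ i" using market by (simp add: market_def)
lemma \<beta>0_bounds: "0 \<le> \<beta>0 $ i" "\<beta>0 $ i \<le> 1" using limit by (auto simp: limit_FPPE_def)

lemma measurable_v[measurable]: "v \<in> borel_measurable \<nu>"
  using market by (intro borel_measurable_vecI) (auto simp: market_def L1_nonneg_def)
lemma measurable_x0[measurable]: "x0 \<in> borel_measurable \<nu>"
  using limit by (intro borel_measurable_vecI) (auto simp: limit_FPPE_def Linf_nonneg_def)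
lemma measurable_s[measurable]: "s \<in> borel_measurable \<nu>"
  using market by (auto simp: market_def Linf_nonneg_def)
lemma measurable_p0[measurable]: "p0 \<in> borel_measurable \<nu>"
  using limit by (auto simp: limit_FPPE_def L1_nonneg_def)
lemma measurable_m0[measurable]: "m0 \<in> borel_measurable \<nu>"
  using borel_measurable_vec_nth[OF measurable_v] borel_measurable_vec_nth[OF measurable_x0]
  by (intro borel_measurable_vecI) (simp add: m0_def)
lemma measurable_\<theta>[measurable]: "\<theta> \<tau> \<in> measurable M \<nu>"
  using draws[of \<tau>] by (rule distributed_measurable)
lemma measurable_R[measurable]: "(\<lambda>y. R y k) \<in> borel_measurable \<nu>"
  unfolding R_def by measurable
lemma s_nonneg: "AE y in \<nu>. 0 \<le> s y" using market by (auto simp: market_def Linf_nonneg_def)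

lemma C: "0 \<le> C" "AE y in \<nu>. \<forall>i. v y $ i \<le> C"
proof -
  obtain c where "AE y in \<nu>. \<forall>i. v y $ i \<le> c" using market by (auto simp: market_def)
  then have "AE y in \<nu>. \<forall>i. v y $ i \<le> max c 0" by eventually_elim (simp add: le_max_iff_disj)
  then have "\<exists>C. 0 \<le> C \<and> (AE y in \<nu>. \<forall>i. v y $ i \<le> C)" by (intro exI[of _ "max c 0"]) auto
  from someI_ex[OF this] show "0 \<le> C" "AE y in \<nu>. \<forall>i. v y $ i \<le> C" unfolding C_def by auto
qed

lemma L_pos: "0 < L" using C by (simp add: L_def add_nonneg_pos)

lemma AE_good: "AE y in \<nu>. good y"
proof -
  have "AE y in \<nu>. \<forall>i. 0 \<le> v y $ i" using market by (auto simp: market_def L1_nonneg_def AE_all_countable)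
  moreover have "AE y in \<nu>. \<forall>i. 0 \<le> x0 y $ i" using limit by (auto simp: limit_FPPE_def Linf_nonneg_def AE_all_countable)
  moreover have "AE y in \<nu>. p0 y = top_bid \<beta>0 (v y) \<and> (\<forall>i. 0 < x0 y $ i \<longrightarrow> \<beta>0 $ i * v y $ i = top_bid \<beta>0 (v y))"
    "AE y in \<nu>. (\<Sum>i\<in>UNIV. x0 y $ i) \<le> 1" "AE y in \<nu>. 0 < p0 y \<longrightarrow> (\<Sum>i\<in>UNIV. x0 y $ i) = 1"
    using limit by (simp_all add: limit_FPPE_def)
  ultimately show ?thesis using C(2) by eventually_elim (auto simp: good_def)
qed

lemma distr_\<theta>: "distr M \<nu> (\<theta> \<tau>) = density \<nu> (\<lambda>y. ennreal (s y))"
  using draws[of \<tau>] by (rule distributed_distr_eq_density)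

lemma AE_\<theta>: assumes "AE y in \<nu>. P y" shows "AE \<omega> in M. P (\<theta> \<tau> \<omega>)"
proof -
  have "AE y in distr M \<nu> (\<theta> \<tau>). P y"
    unfolding distr_\<theta> using assms by (subst AE_density) auto
  then show ?thesis by (rule AE_distrD[OF measurable_\<theta>])
qed

text \<open>All means over the item space are expectations over a single draw, so that everything below takes place on the
  probability space.\<close>

lemma supply_mean_eq_expectation:
  fixes g :: "'a \<Rightarrow> 'b::{banach, second_countable_topology}"
  assumes [measurable]: "g \<in> borel_measurable \<nu>"
  shows "supply_mean \<nu> s g = expectation (\<lambda>\<omega>. g (\<theta> \<tau> \<omega>))"
proof -
  have "expectation (\<lambda>\<omega>. g (\<theta> \<tau> \<omega>)) = integral\<^sup>L (distr M \<nu> (\<theta> \<tau>)) g" by (simp add: integral_distr)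
  also have "\<dots> = supply_mean \<nu> s g"
    unfolding distr_\<theta> supply_mean_def by (rule integral_density) (auto simp: s_nonneg)
  finally show ?thesis by simp
qed

lemma good_bounds:
  assumes "good y" shows "norm (v y) \<le> L" "norm (m0 y) \<le> L" "\<And>i. 0 \<le> m0 y $ i" "\<And>i. m0 y $ i \<le> v y $ i"
proof -
  have x1: "x0 y $ i \<le> 1" for i
  proof -
    have "x0 y $ i \<le> (\<Sum>i\<in>UNIV. x0 y $ i)" using assms by (intro member_le_sum) (auto simp: good_def)
    then show ?thesis using assms by (simp add: good_def)
  qed
  have v: "0 \<le> v y $ i" "v y $ i \<le> C" "0 \<le> x0 y $ i" for i using assms by (auto simp: good_def)
  show m: "0 \<le> m0 y $ i" "m0 y $ i \<le> v y $ i" for i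
    using v x1 by (auto simp: m0_def intro!: mult_left_le_one_le)
  have "norm (v y) \<le> (\<Sum>i\<in>UNIV. \<bar>v y $ i\<bar>)" by (rule norm_le_l1_cart)
  also have "\<dots> \<le> (\<Sum>i\<in>(UNIV::'n set). C)" using v by (intro sum_mono) auto
  finally show "norm (v y) \<le> L" by (simp add: L_def)
  have "norm (m0 y) \<le> (\<Sum>i\<in>UNIV. \<bar>m0 y $ i\<bar>)" by (rule norm_le_l1_cart)
  also have "\<dots> \<le> (\<Sum>i\<in>(UNIV::'n set). C)" using v m order_trans[OF m(2) v(2)] by (intro sum_mono) auto
  finally show "norm (m0 y) \<le> L" by (simp add: L_def)
qed

lemma integrable_bounded_item:
  fixes g :: "'a \<Rightarrow> real"
  assumes [measurable]: "g \<in> borel_measurable \<nu>" and b: "\<And>y. good y \<Longrightarrow> \<bar>g y\<bar> \<le> K"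
  shows "integrable M (\<lambda>\<omega>. g (\<theta> \<tau> \<omega>))" "integrable M (\<lambda>\<omega>. (g (\<theta> \<tau> \<omega>))\<^sup>2)"
proof -
  have ae: "AE \<omega> in M. good (\<theta> \<tau> \<omega>)" by (rule AE_\<theta>[OF AE_good])
  show "integrable M (\<lambda>\<omega>. g (\<theta> \<tau> \<omega>))"
    by (rule integrable_const_bound[where B=K]) (use ae in \<open>auto elim!: eventually_mono dest: b\<close>)
  have "AE \<omega> in M. norm ((g (\<theta> \<tau> \<omega>))\<^sup>2) \<le> K\<^sup>2"
    using ae
  proof eventually_elim
    case (elim \<omega>)
    from b[OF this] have "\<bar>g (\<theta> \<tau> \<omega>)\<bar>\<^sup>2 \<le> K\<^sup>2" by (rule power_mono) simp
    then show ?case by simp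
  qed
  then show "integrable M (\<lambda>\<omega>. (g (\<theta> \<tau> \<omega>))\<^sup>2)"
    by (rule integrable_const_bound) measurable
qed

lemma \<mu>_eq: "\<mu> $ i = expectation (\<lambda>\<omega>. m0 (\<theta> \<tau> \<omega>) $ i)"
proof -
  have "expectation (\<lambda>\<omega>. m0 (\<theta> \<tau> \<omega>) $ i) = supply_mean \<nu> s (\<lambda>y. m0 y $ i)"
    by (rule supply_mean_eq_expectation[symmetric]) (rule borel_measurable_vec_nth[OF measurable_m0])
  then show ?thesis by (simp add: \<mu>_def limit_util_def supply_mean_def m0_def ac_simps)
qed

lemma integrable_m0: "integrable M (\<lambda>\<omega>. m0 (\<theta> \<tau> \<omega>) $ i)" "integrable M (\<lambda>\<omega>. (m0 (\<theta> \<tau> \<omega>) $ i)\<^sup>2)"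
  by (rule integrable_bounded_item[where g = "\<lambda>y. m0 y $ i" and K = L];
      use good_bounds(2) component_le_norm_cart order_trans in \<open>blast intro: borel_measurable_vec_nth[OF measurable_m0]\<close>)+

lemma spending: "(\<integral>y. x0 y $ i * p0 y * s y \<partial>\<nu>) = \<beta>0 $ i * \<mu> $ i"
proof -
  have "(\<integral>y. x0 y $ i * p0 y * s y \<partial>\<nu>) = (\<integral>y. \<beta>0 $ i * (v y $ i * (s y * x0 y $ i)) \<partial>\<nu>)"
  proof (rule integral_cong_AE)
    show "AE y in \<nu>. x0 y $ i * p0 y * s y = \<beta>0 $ i * (v y $ i * (s y * x0 y $ i))"
      using AE_good
    proof eventually_elim
      case (elim y)
      then have "x0 y $ i * p0 y = x0 y $ i * (\<beta>0 $ i * v y $ i)"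
        by (cases "x0 y $ i = 0") (auto simp: good_def order_less_le)
      then show ?case by (simp add: ac_simps)
    qed
  qed (auto intro!: borel_measurable_times borel_measurable_vec_nth)
  then show ?thesis by (simp add: \<mu>_def limit_util_def)
qed

text \<open>A buyer who bids zero spends nothing, hence has money left over, hence has multiplier one.\<close>

lemma \<beta>0_pos: "0 < \<beta>0 $ i"
proof (rule ccontr)
  assume "\<not> 0 < \<beta>0 $ i"
  then have 0: "\<beta>0 $ i = 0" using \<beta>0_bounds(1)[of i] by simp
  then have "(\<integral>y. x0 y $ i * p0 y * s y \<partial>\<nu>) < b $ i" using b_pos by (simp add: spending)
  then have "\<beta>0 $ i = 1" using limit by (simp add: limit_FPPE_def)
  then show False using 0 by simp
qed

text \<open>A multiplier below one exhausts the budget, and spending is \<open>\<beta>0 $ i * \<mu> $ i\<close>.\<close>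

lemma \<mu>_interior: assumes "\<beta>0 $ i < 1" shows "\<mu> $ i = b $ i / \<beta>0 $ i"
proof -
  have "(\<integral>y. x0 y $ i * p0 y * s y \<partial>\<nu>) \<le> b $ i"
    "(\<integral>y. x0 y $ i * p0 y * s y \<partial>\<nu>) < b $ i \<Longrightarrow> \<beta>0 $ i = 1" using limit by (auto simp: limit_FPPE_def)
  then have "\<beta>0 $ i * \<mu> $ i = b $ i" using assms unfolding spending by linarith
  then show ?thesis using \<beta>0_pos[of i] by (simp add: field_simps)
qed

text \<open>This is strict complementary slackness; it separates the spending of these buyers from their budgets by a margin that survives
  sampling.\<close>

lemma \<mu>_boundary: assumes "\<beta>0 $ i = 1" shows "\<mu> $ i < b $ i"
proof -
  have "0 < leftover \<nu> b s p0 x0 $ i" using scs assms by (simp add: SCS_def)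
  moreover have "(\<integral>y. p0 y * (s y * x0 y $ i) \<partial>\<nu>) = (\<integral>y. x0 y $ i * p0 y * s y \<partial>\<nu>)" by (simp add: ac_simps)
  ultimately show ?thesis using assms by (simp add: leftover_def spending)
qed

lemma \<mu>_le: "\<mu> $ i \<le> b $ i / \<beta>0 $ i"
  using \<mu>_interior[of i] \<mu>_boundary[of i] \<beta>0_bounds(2)[of i] by (cases "\<beta>0 $ i = 1") auto

text \<open>The subgradient inequality holds at nonnegative multipliers only.\<close>

lemma R_nonneg: assumes "good y" "\<And>i. 0 \<le> (\<beta>0 + k) $ i" shows "0 \<le> R y k"
proof -
  have "top_bid \<beta>0 (v y) + (x0 y * v y) \<bullet> (\<beta>0 + k - \<beta>0) \<le> top_bid (\<beta>0 + k) (v y)"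
    by (rule allocation_is_subgradient) (use assms \<beta>0_bounds in \<open>auto simp: good_def\<close>)
  then show ?thesis by (simp add: R_def m0_def)
qed

lemma R_bound: assumes "good y" shows "\<bar>R y k\<bar> \<le> 2 * L * norm k"
proof -
  have "\<bar>top_bid (\<beta>0 + k) (v y) - top_bid \<beta>0 (v y)\<bar> \<le> norm (\<beta>0 + k - \<beta>0) * norm (v y)" by (rule top_bid_lipschitz)
  also have "\<dots> \<le> norm k * L" using good_bounds(1)[OF assms] by (simp add: mult_left_mono)
  finally have 1: "\<bar>top_bid (\<beta>0 + k) (v y) - top_bid \<beta>0 (v y)\<bar> \<le> L * norm k" by (simp add: mult.commute)
  have "\<bar>m0 y \<bullet> k\<bar> \<le> norm (m0 y) * norm k" by (rule Cauchy_Schwarz_ineq2)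
  also have "\<dots> \<le> L * norm k" using good_bounds(2)[OF assms] by (simp add: mult_right_mono)
  finally show ?thesis using 1 by (simp add: R_def)
qed

lemma R_convex: assumes "0 \<le> u" "u \<le> 1"
  shows "R y ((1 - u) *\<^sub>R k + u *\<^sub>R l) \<le> (1 - u) * R y k + u * R y l"
proof -
  have "\<beta>0 + ((1 - u) *\<^sub>R k + u *\<^sub>R l) = (1 - u) *\<^sub>R (\<beta>0 + k) + u *\<^sub>R (\<beta>0 + l)" by (simp add: algebra_simps)
  then show ?thesis using top_bid_convex[OF assms, of "\<beta>0 + k" "\<beta>0 + l" "v y"]
    by (simp add: R_def inner_add_right algebra_simps)
qed

lemma integrable_R: "integrable M (\<lambda>\<omega>. R (\<theta> \<tau> \<omega>) k)" "integrable M (\<lambda>\<omega>. (R (\<theta> \<tau> \<omega>) k)\<^sup>2)"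
  using integrable_bounded_item[OF measurable_R R_bound] by blast+

lemma top_bound: assumes "good y" shows "\<bar>top_bid \<beta> (v y)\<bar> \<le> norm \<beta> * L"
proof -
  have "top_bid 0 (v y) = 0" by (simp add: top_bid_def)
  then have "\<bar>top_bid \<beta> (v y)\<bar> \<le> norm \<beta> * norm (v y)" using top_bid_lipschitz[of \<beta> "v y" 0] by simp
  also have "\<dots> \<le> norm \<beta> * L" using good_bounds(1)[OF assms] by (simp add: mult_left_mono)
  finally show ?thesis .
qed

lemma measurable_top[measurable]: "(\<lambda>y. top_bid \<beta> (v y)) \<in> borel_measurable \<nu>" by measurable

lemma integrable_top: "integrable M (\<lambda>\<omega>. top_bid \<beta> (v (\<theta> \<tau> \<omega>)))" "integrable M (\<lambda>\<omega>. (top_bid \<beta> (v (\<theta> \<tau> \<omega>)))\<^sup>2)"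
  using integrable_bounded_item[OF measurable_top top_bound] by blast+

lemma f_eq: "f \<beta> = expectation (\<lambda>\<omega>. top_bid \<beta> (v (\<theta> \<tau> \<omega>)))"
  unfolding f_def by (rule supply_mean_eq_expectation) measurable

lemma expectation_m0_inner: "integrable M (\<lambda>\<omega>. m0 (\<theta> \<tau> \<omega>) \<bullet> k)" "expectation (\<lambda>\<omega>. m0 (\<theta> \<tau> \<omega>) \<bullet> k) = \<mu> \<bullet> k"
  unfolding inner_vec_def using integrable_m0(1) \<mu>_eq[symmetric] by simp_all

lemma expectation_R: "expectation (\<lambda>\<omega>. R (\<theta> \<tau> \<omega>) k) = f (\<beta>0 + k) - f \<beta>0 - \<mu> \<bullet> k"
  unfolding R_def using integrable_top(1) expectation_m0_inner by (simp add: f_eq[symmetric])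

text \<open>The radius of a ball around \<open>\<beta>0\<close> inside the nonnegative orthant.\<close>

definition r0 :: real where "r0 = Min (range (($) \<beta>0))"

lemma r0: "0 < r0" "norm k \<le> r0 \<Longrightarrow> 0 \<le> (\<beta>0 + k) $ i"
proof -
  show "0 < r0" unfolding r0_def by (subst Min_gr_iff) (auto simp: \<beta>0_pos)
  assume k: "norm k \<le> r0"
  have "r0 \<le> \<beta>0 $ i" unfolding r0_def by (rule Min_le) auto
  then show "0 \<le> (\<beta>0 + k) $ i" using k component_le_norm_cart[of k i] by simp
qed

lemma smo_facts:
  obtains U where "open U" "\<beta>0 \<in> U" "\<And>y. y \<in> U \<Longrightarrow> f differentiable at y" "gradient f differentiable at \<beta>0"
proof -
  have "SMO \<nu> v s \<beta>0 = (\<exists>U. open U \<and> \<beta>0 \<in> U \<and> C2_on U f)" unfolding SMO_def f_def ..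
  then obtain U where U: "open U" "\<beta>0 \<in> U" "C2_on U f" using smo by auto
  then show ?thesis
    by (intro that[of U]) (auto simp: C2_on_def differentiable_on_def at_within_open[OF _ U(1)])
qed

text \<open>Averaging the subgradient inequality shows that \<open>\<mu>\<close> is a subgradient of the smooth function \<open>f\<close>.\<close>

lemma gradient_f: "gradient f \<beta>0 = \<mu>"
proof -
  obtain U where U: "open U" "\<beta>0 \<in> U" "\<And>y. y \<in> U \<Longrightarrow> f differentiable at y" by (rule smo_facts) (rule that; assumption)
  show ?thesis
  proof (rule gradient_eq_subgradient[where U = "ball \<beta>0 r0"])
    show "f differentiable at \<beta>0" using U by simp
    fix y assume "y \<in> ball \<beta>0 r0"
    then have k: "norm (y - \<beta>0) \<le> r0" by (simp add: dist_norm norm_minus_commute)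
    \<comment> \<open>inside the ball of radius \<open>r0\<close> the remainder is nonnegative\<close>
    have "0 \<le> expectation (\<lambda>\<omega>. R (\<theta> 0 \<omega>) (y - \<beta>0))"
      using AE_\<theta>[OF AE_good, of 0] R_nonneg r0(2)[OF k] by (intro integral_nonneg_AE) (auto elim!: eventually_mono)
    then show "f \<beta>0 + \<mu> \<bullet> (y - \<beta>0) \<le> f y" by (simp add: expectation_R)
  qed (use r0 in auto)
qed

lemma A_symmetric: "transpose A = A"
proof -
  obtain U where U: "open U" "\<beta>0 \<in> U" "\<And>y. y \<in> U \<Longrightarrow> f differentiable at y" "gradient f differentiable at \<beta>0" by (rule smo_facts) (rule that; assumption)
  show ?thesis unfolding A_def by (rule hessian_symmetric[OF U])
qed

text \<open>The kinks of the highest bid, which make \<open>R\<close> of first order in \<open>k\<close> on single items, are averaged out: the mean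
  of \<open>R\<close> is of second order.\<close>

lemma expectation_R_expansion:
  "((\<lambda>d. expectation (\<lambda>\<omega>. R (\<theta> 0 \<omega>) (d *\<^sub>R h)) / d\<^sup>2) \<longlongrightarrow> h \<bullet> (A *v h) / 2) (at_right 0)"
proof -
  obtain U where U: "open U" "\<beta>0 \<in> U" "\<And>y. y \<in> U \<Longrightarrow> f differentiable at y" "gradient f differentiable at \<beta>0" by (rule smo_facts) (rule that; assumption)
  have "((\<lambda>d. (f (\<beta>0 + d *\<^sub>R h) - f \<beta>0 - d * (gradient f \<beta>0 \<bullet> h)) / d\<^sup>2) \<longlongrightarrow> h \<bullet> (hessian f \<beta>0 *v h) / 2) (at_right 0)"
    by (rule second_order_expansion[OF U])
  then show ?thesis by (simp add: expectation_R gradient_f A_def)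
qed

text \<open>\<open>A\<close> is a limit of means of the nonnegative \<open>R\<close>.\<close>

lemma A_psd: "0 \<le> h \<bullet> (A *v h)"
proof -
  have "((\<lambda>d::real. norm (d *\<^sub>R h)) \<longlongrightarrow> 0) (at_right 0)" by (auto intro!: tendsto_eq_intros)
  then have "\<forall>\<^sub>F d in at_right (0::real). norm (d *\<^sub>R h) < r0" using r0(1) by (rule order_tendstoD)
  then have "\<forall>\<^sub>F d in at_right (0::real). 0 \<le> expectation (\<lambda>\<omega>. R (\<theta> 0 \<omega>) (d *\<^sub>R h)) / d\<^sup>2"
  proof eventually_elim
    case (elim d)
    then have "0 \<le> expectation (\<lambda>\<omega>. R (\<theta> 0 \<omega>) (d *\<^sub>R h))"
      using AE_\<theta>[OF AE_good, of 0] R_nonneg r0(2)[of "d *\<^sub>R h"] by (intro integral_nonneg_AE) (auto elim!: eventually_mono)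
    then show ?case by simp
  qed
  then have "0 \<le> h \<bullet> (A *v h) / 2"
    by (intro tendsto_lowerbound[OF expectation_R_expansion]) auto
  then show ?thesis by simp
qed

definition H :: "real ^ 'n ^ 'n" where "H = A + diag_mat (\<chi> i. b $ i / (\<beta>0 $ i)\<^sup>2)"

lemma hessian_dual_obj: "hessian (dual_obj \<nu> b v s) \<beta>0 = H"
proof (rule hessian_eqI)
  obtain U where U: "open U" "\<beta>0 \<in> U" "\<And>y. y \<in> U \<Longrightarrow> f differentiable at y" "gradient f differentiable at \<beta>0" by (rule smo_facts) (rule that; assumption)
  \<comment> \<open>the logarithms are differentiable on the open positive orthant\<close>
  define W where "W = U \<inter> {y. \<forall>i. 0 < y $ i}"
  have "{y::real^'n. \<forall>i. 0 < y $ i} = (\<Inter>i\<in>UNIV. {y. 0 < y $ i})" by auto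
  then have "open {y::real^'n. \<forall>i. 0 < y $ i}"
    by (simp only:) (intro open_INT ballI open_Collect_less continuous_on_component continuous_on_const continuous_on_id; simp)
  then have W: "open W" "\<beta>0 \<in> W" using U \<beta>0_pos by (auto simp: W_def)
  have grad: "gradient (dual_obj \<nu> b v s) y = gradient f y - (\<chi> i. b $ i / y $ i)" if "y \<in> W" for y
  proof (rule gradient_eqI)
    have pos: "0 < y $ i" for i using that by (simp add: W_def)
    have fd: "(f has_derivative (\<lambda>h. gradient f y \<bullet> h)) (at y)" by (rule has_derivative_gradient[OF U(3)]) (use that in \<open>simp add: W_def\<close>)
    have ld: "((\<lambda>y. b $ i * ln (y $ i)) has_derivative (\<lambda>h. b $ i * (h $ i * inverse (y $ i)))) (at y)" for i
      by (rule has_derivative_mult_right, rule has_derivative_ln[where g = "\<lambda>y. y $ i"], rule pos,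
          rule bounded_linear_imp_has_derivative[OF bounded_linear_vec_nth])
    have "dual_obj \<nu> b v s = (\<lambda>y. f y - (\<Sum>i\<in>UNIV. b $ i * ln (y $ i)))" by (simp add: fun_eq_iff dual_obj_def f_def)
    moreover have "((\<lambda>y. f y - (\<Sum>i\<in>UNIV. b $ i * ln (y $ i))) has_derivative
        (\<lambda>h. gradient f y \<bullet> h - (\<Sum>i\<in>UNIV. b $ i * (h $ i * inverse (y $ i))))) (at y)"
      by (intro has_derivative_diff fd has_derivative_sum ld)
    moreover have "(\<Sum>i\<in>UNIV. b $ i * (h $ i * inverse (y $ i))) = (\<chi> i. b $ i / y $ i) \<bullet> h" for h
      by (simp add: inner_vec_def divide_inverse ac_simps)
    ultimately show "(dual_obj \<nu> b v s has_derivative (\<lambda>h. (gradient f y - (\<chi> i. b $ i / y $ i)) \<bullet> h)) (at y)"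
      by (simp add: inner_diff_left)
  qed
  have inv: "((\<lambda>y. b $ i / y $ i) has_derivative (\<lambda>h. - (b $ i / (\<beta>0 $ i)\<^sup>2 * h $ i))) (at \<beta>0)" for i
  proof -
    have "((\<lambda>y. y $ i) has_derivative (\<lambda>h. h $ i)) (at \<beta>0)"
      by (rule bounded_linear_imp_has_derivative[OF bounded_linear_vec_nth])
    then show ?thesis using \<beta>0_pos[of i]
      by (auto intro!: derivative_eq_intros simp: power2_eq_square field_simps)
  qed
  have "((\<lambda>y. (\<chi> i. b $ i / y $ i) :: real ^ 'n) has_derivative (\<lambda>h. (\<chi> i. - (b $ i / (\<beta>0 $ i)\<^sup>2 * h $ i)))) (at \<beta>0)"
  proof (subst has_derivative_componentwise_within, intro ballI)
    fix c :: "real ^ 'n" assume "c \<in> Basis"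
    then obtain i where "c = axis i 1" by (auto simp: Basis_vec_def)
    then show "((\<lambda>y. (\<chi> i. b $ i / y $ i) \<bullet> c) has_derivative (\<lambda>h. (\<chi> i. - (b $ i / (\<beta>0 $ i)\<^sup>2 * h $ i)) \<bullet> c)) (at \<beta>0)"
      using inv[of i] by (simp add: inner_axis)
  qed
  from has_derivative_diff[OF has_derivative_hessian[OF U(4)] this]
  have d: "((\<lambda>y. gradient f y - (\<chi> i. b $ i / y $ i)) has_derivative (\<lambda>h. A *v h - (\<chi> i. - (b $ i / (\<beta>0 $ i)\<^sup>2 * h $ i)))) (at \<beta>0)"
    by (simp add: A_def)
  have dm: "diag_mat d *v h = (\<chi> i. d $ i * h $ i)" for d h :: "real ^ 'n"
    by (simp add: diag_mat_def matrix_vector_mult_def vec_eq_iff if_distrib[of "\<lambda>x. x * _"] cong: if_cong)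
  have "(\<lambda>h. A *v h - (\<chi> i. - (b $ i / (\<beta>0 $ i)\<^sup>2 * h $ i))) = (\<lambda>h. H *v h)"
    by (simp add: H_def matrix_vector_mult_add_rdistrib dm fun_eq_iff vec_eq_iff)
  with d have d': "((\<lambda>y. gradient f y - (\<chi> i. b $ i / y $ i)) has_derivative (\<lambda>h. H *v h)) (at \<beta>0)" by simp
  show "(gradient (dual_obj \<nu> b v s) has_derivative (\<lambda>h. H *v h)) (at \<beta>0)"
    by (rule has_derivative_transform_within_open[OF d' W]) (simp add: grad)
qed

end

section \<open>Quadratic approximation of the mean highest bid\<close>

lemma sample_mean_real: "sample_mean t f = (\<Sum>\<tau><t. f \<tau>) / real t" for f :: "nat \<Rightarrow> real"
  by (simp add: sample_mean_def)

lemma sample_mean_nth: "sample_mean t f $ i = sample_mean t (\<lambda>\<tau>. f \<tau> $ i)" for f :: "nat \<Rightarrow> real ^ 'n"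
  by (simp add: sample_mean_def)

lemma sample_mean_inner: "sample_mean t f \<bullet> k = sample_mean t (\<lambda>\<tau>. f \<tau> \<bullet> k)" for f :: "nat \<Rightarrow> 'b::real_inner"
  by (simp add: sample_mean_def inner_sum_left)

lemma sample_mean_mono: "(\<And>\<tau>. \<tau> < t \<Longrightarrow> f \<tau> \<le> g \<tau>) \<Longrightarrow> sample_mean t f \<le> sample_mean t g" for f g :: "nat \<Rightarrow> real"
  unfolding sample_mean_real by (intro divide_right_mono sum_mono) auto

lemma sample_mean_add: "sample_mean t (\<lambda>\<tau>. f \<tau> + g \<tau>) = sample_mean t f + sample_mean t g"
  by (simp add: sample_mean_def sum.distrib scaleR_add_right)

lemma sample_mean_diff: "sample_mean t (\<lambda>\<tau>. f \<tau> - g \<tau>) = sample_mean t f - sample_mean t g"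
  by (simp add: sample_mean_def sum_subtractf scaleR_diff_right)

lemma sample_mean_cmult: "sample_mean t (\<lambda>\<tau>. c * f \<tau>) = c * sample_mean t f" for c :: real
  by (simp add: sample_mean_real sum_distrib_left)

lemma sample_mean_const: "0 < t \<Longrightarrow> sample_mean t (\<lambda>\<tau>. c) = c" for c :: real
  by (simp add: sample_mean_real)

lemma sample_mean_cong: "(\<And>\<tau>. \<tau> < t \<Longrightarrow> f \<tau> = g \<tau>) \<Longrightarrow> sample_mean t f = sample_mean t g"
  unfolding sample_mean_def by (intro arg_cong[where f = "\<lambda>x. _ *\<^sub>R x"] sum.cong) auto

context fppe_sampling begin

text \<open>Evaluated at \<open>h\<close>, this is the remainder of the mean highest bid at distance \<open>d\<close> in direction \<open>h\<close>, rescaled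
  so as to be comparable with the quadratic form \<open>q\<close>.\<close>

definition Q :: "real \<Rightarrow> nat \<Rightarrow> 'w \<Rightarrow> real ^ 'n \<Rightarrow> real" where
  "Q d t \<omega> h = sample_mean t (\<lambda>\<tau>. R (\<theta> \<tau> \<omega>) (d *\<^sub>R h)) / d\<^sup>2"

definition q :: "real ^ 'n \<Rightarrow> real" where "q h = h \<bullet> (A *v h) / 2"

lemma continuous_q: "continuous_on S q"
  unfolding q_def
  by (intro continuous_on_divide continuous_on_inner continuous_on_id matrix_vector_mult_linear_continuous_on continuous_on_const) auto

lemma q_bounded: obtains K where "0 < K" "\<And>h. norm h \<le> r \<Longrightarrow> \<bar>q h\<bar> \<le> K"
proof -
  have "compact (q ` cball 0 r)" by (intro compact_continuous_image continuous_q compact_cball)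
  then have "bounded (q ` cball 0 r)" by (rule compact_imp_bounded)
  then obtain K where "0 < K" "\<forall>y\<in>q ` cball 0 r. norm y \<le> K" using bounded_pos by metis
  then show ?thesis by (intro that[of K]) auto
qed

lemma indep_items:
  fixes g :: "'a \<Rightarrow> 'b::topological_space"
  assumes "g \<in> borel_measurable \<nu>"
  shows "indep_vars (\<lambda>_. borel) (\<lambda>\<tau> \<omega>. g (\<theta> \<tau> \<omega>)) UNIV"
  by (rule indep_vars_compose2[OF indep]) (use assms in auto)

lemma identically_distributed:
  assumes [measurable]: "g \<in> borel_measurable \<nu>"
  shows "distr M borel (\<lambda>\<omega>. g (\<theta> \<tau> \<omega>)) = distr M borel (\<lambda>\<omega>. g (\<theta> 0 \<omega>))"
proof -
  have "distr M borel (\<lambda>\<omega>. g (\<theta> \<tau> \<omega>)) = distr (distr M \<nu> (\<theta> \<tau>)) borel g" for \<tau>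
    by (subst distr_distr) (auto simp: comp_def)
  then show ?thesis by (simp add: distr_\<theta>)
qed

lemma sample_mean_of_items_second_moment:
  fixes g :: "'a \<Rightarrow> real"
  assumes [measurable]: "g \<in> borel_measurable \<nu>" and b: "\<And>y. good y \<Longrightarrow> \<bar>g y\<bar> \<le> K"
    and m: "expectation (\<lambda>\<omega>. g (\<theta> 0 \<omega>)) = m" and B: "expectation (\<lambda>\<omega>. (g (\<theta> 0 \<omega>))\<^sup>2) \<le> B"
  shows "(\<lambda>\<omega>. sample_mean t (\<lambda>\<tau>. g (\<theta> \<tau> \<omega>))) \<in> borel_measurable M"
    "integrable M (\<lambda>\<omega>. (sample_mean t (\<lambda>\<tau>. g (\<theta> \<tau> \<omega>)) - m)\<^sup>2)"
    "0 < t \<Longrightarrow> expectation (\<lambda>\<omega>. (sample_mean t (\<lambda>\<tau>. g (\<theta> \<tau> \<omega>)) - m)\<^sup>2) \<le> B / t"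
proof -
  have E: "expectation (\<lambda>\<omega>. g (\<theta> \<tau> \<omega>)) = m" "expectation (\<lambda>\<omega>. (g (\<theta> \<tau> \<omega>))\<^sup>2) \<le> B" for \<tau>
  proof -
    have "expectation (\<lambda>\<omega>. g (\<theta> \<tau> \<omega>)) = expectation (\<lambda>\<omega>. g (\<theta> 0 \<omega>))"
      by (simp add: supply_mean_eq_expectation[symmetric])
    then show "expectation (\<lambda>\<omega>. g (\<theta> \<tau> \<omega>)) = m" using m by simp
    have "expectation (\<lambda>\<omega>. (g (\<theta> \<tau> \<omega>))\<^sup>2) = expectation (\<lambda>\<omega>. (g (\<theta> 0 \<omega>))\<^sup>2)"
      using supply_mean_eq_expectation[of "\<lambda>y. (g y)\<^sup>2" \<tau>] supply_mean_eq_expectation[of "\<lambda>y. (g y)\<^sup>2" 0] by simp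
    then show "expectation (\<lambda>\<omega>. (g (\<theta> \<tau> \<omega>))\<^sup>2) \<le> B" using B by simp
  qed
  note int = integrable_bounded_item[OF assms(1) b]
  show "(\<lambda>\<omega>. sample_mean t (\<lambda>\<tau>. g (\<theta> \<tau> \<omega>))) \<in> borel_measurable M"
    unfolding sample_mean_def by measurable
  note sm = sample_mean_second_moment[OF indep_items[OF assms(1)] int E]
  show "integrable M (\<lambda>\<omega>. (sample_mean t (\<lambda>\<tau>. g (\<theta> \<tau> \<omega>)) - m)\<^sup>2)"
    using sm(1)[of t] by (cases "t = 0") (simp_all add: sample_mean_def)
  show "0 < t \<Longrightarrow> expectation (\<lambda>\<omega>. (sample_mean t (\<lambda>\<tau>. g (\<theta> \<tau> \<omega>)) - m)\<^sup>2) \<le> B / t"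
    using sm(2)[of t] by simp
qed

lemma law_of_large_numbers:
  fixes g :: "'a \<Rightarrow> real"
  assumes g: "g \<in> borel_measurable \<nu>" and b: "\<And>y. good y \<Longrightarrow> \<bar>g y\<bar> \<le> K"
  shows "((\<lambda>z. sample_mean (fst z) (\<lambda>\<tau>. g (\<theta> \<tau> (snd z)))) \<longlongrightarrow> expectation (\<lambda>\<omega>. g (\<theta> 0 \<omega>))) (in_prob M)"
proof -
  let ?m = "expectation (\<lambda>\<omega>. g (\<theta> 0 \<omega>))" and ?B = "expectation (\<lambda>\<omega>. (g (\<theta> 0 \<omega>))\<^sup>2)"
  note sm = sample_mean_of_items_second_moment[OF g b refl order_refl]
  have "((\<lambda>z. sample_mean (fst z) (\<lambda>\<tau>. g (\<theta> \<tau> (snd z))) - ?m) \<longlongrightarrow> 0) (in_prob M)"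
  proof (rule tendsto_in_prob_of_second_moment[where B = "\<lambda>t. ?B / t"])
    show "\<forall>\<^sub>F t in sequentially. expectation (\<lambda>\<omega>. (sample_mean t (\<lambda>\<tau>. g (\<theta> \<tau> \<omega>)) - ?m)\<^sup>2) \<le> ?B / t"
      using eventually_gt_at_top[of 0] by eventually_elim (rule sm(3))
    show "(\<lambda>t. ?B / real t) \<longlonglongrightarrow> 0" by (rule lim_const_over_n)
  qed (use sm in auto)
  then show ?thesis by (rule Lim_null[THEN iffD2])
qed

text \<open>At almost every item and for small \<open>k\<close>, \<open>0 \<le> R \<le> 2 L |k|\<close> gives \<open>E R\<^sup>2 \<le> 2 L |k| E R\<close>. With \<open>k = d h\<close> and \<open>E R\<close> of order
  \<open>d\<^sup>2\<close> the variance of \<open>Q\<close> is of order \<open>1 / (t d)\<close>, and its mean converges by \<open>expectation_R_expansion\<close>.\<close>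

lemma Q_pointwise:
  assumes d: "d \<longlonglongrightarrow> 0" "\<forall>\<^sub>F t in sequentially. 0 < d t" "filterlim (\<lambda>t. real t * d t) at_top sequentially"
  shows "((\<lambda>z. Q (d (fst z)) (fst z) (snd z) h) \<longlongrightarrow> q h) (in_prob M)"
proof -
  define e where "e t = expectation (\<lambda>\<omega>. R (\<theta> 0 \<omega>) (d t *\<^sub>R h))" for t
  define D where "D t = e t / (d t)\<^sup>2" for t
  have dr: "filterlim d (at_right 0) sequentially"
    unfolding filterlim_at using d by (auto elim: eventually_mono)
  have D: "D \<longlonglongrightarrow> q h"
    using filterlim_compose[OF expectation_R_expansion[of h] dr] by (simp add: D_def[abs_def] e_def q_def)
  have n0: "(\<lambda>t. norm (d t *\<^sub>R h)) \<longlonglongrightarrow> 0" using d(1) by (auto intro!: tendsto_eq_intros)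
  have small: "\<forall>\<^sub>F t in sequentially. norm (d t *\<^sub>R h) < r0" by (rule order_tendstoD(2)[OF n0 r0(1)])
  have sm: "(\<lambda>\<omega>. sample_mean t (\<lambda>\<tau>. R (\<theta> \<tau> \<omega>) k)) \<in> borel_measurable M"
      "integrable M (\<lambda>\<omega>. (sample_mean t (\<lambda>\<tau>. R (\<theta> \<tau> \<omega>) k) - m)\<^sup>2)"
      "0 < t \<Longrightarrow> expectation (\<lambda>\<omega>. (sample_mean t (\<lambda>\<tau>. R (\<theta> \<tau> \<omega>) k) - m)\<^sup>2) \<le> B / t"
    if "expectation (\<lambda>\<omega>. R (\<theta> 0 \<omega>) k) = m" "expectation (\<lambda>\<omega>. (R (\<theta> 0 \<omega>) k)\<^sup>2) \<le> B" for t k m B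
    using sample_mean_of_items_second_moment[OF measurable_R R_bound that] by auto
  have "((\<lambda>z. (\<lambda>t \<omega>. Q (d t) t \<omega> h - D t) (fst z) (snd z)) \<longlongrightarrow> 0) (in_prob M)"
  proof (rule tendsto_in_prob_of_second_moment[where B = "\<lambda>t. 2 * L * norm h * D t / (t * d t)"])
    have eq: "Q (d t) t \<omega> h - D t = (sample_mean t (\<lambda>\<tau>. R (\<theta> \<tau> \<omega>) (d t *\<^sub>R h)) - e t) / (d t)\<^sup>2" for t \<omega>
      by (simp add: Q_def D_def diff_divide_distrib)
    show "(\<lambda>\<omega>. Q (d t) t \<omega> h - D t) \<in> borel_measurable M" for t
      unfolding eq using sm(1)[OF refl order_refl, of t "d t *\<^sub>R h"] by measurable
    show "integrable M (\<lambda>\<omega>. (Q (d t) t \<omega> h - D t)\<^sup>2)" for t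
      unfolding eq power_divide e_def using sm(2)[OF refl order_refl, of t "d t *\<^sub>R h"] by (rule integrable_divide_zero) 
    show "\<forall>\<^sub>F t in sequentially. expectation (\<lambda>\<omega>. (Q (d t) t \<omega> h - D t)\<^sup>2) \<le> 2 * L * norm h * D t / (t * d t)"
      using small d(2) eventually_gt_at_top[of 0]
    proof eventually_elim
      case (elim t)
      let ?k = "d t *\<^sub>R h"
      \<comment> \<open>one factor \<open>R\<close> is bounded, the other is kept for its small mean\<close>
      have "expectation (\<lambda>\<omega>. (R (\<theta> 0 \<omega>) ?k)\<^sup>2) \<le> expectation (\<lambda>\<omega>. 2 * L * norm ?k * R (\<theta> 0 \<omega>) ?k)"
      proof (rule integral_mono_AE)
        show "AE \<omega> in M. (R (\<theta> 0 \<omega>) ?k)\<^sup>2 \<le> 2 * L * norm ?k * R (\<theta> 0 \<omega>) ?k"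
          using AE_\<theta>[OF AE_good, of 0]
        proof eventually_elim
          case (elim \<omega>)
          have "0 \<le> R (\<theta> 0 \<omega>) ?k" by (rule R_nonneg[OF elim], rule r0(2)) (use \<open>norm ?k < r0\<close> in simp)
          then show ?case using R_bound[OF elim, of ?k] unfolding power2_eq_square by (intro mult_right_mono) auto
        qed
      qed (use integrable_R in auto)
      also have "\<dots> = 2 * L * norm ?k * e t" by (simp add: e_def)
      finally have "expectation (\<lambda>\<omega>. (sample_mean t (\<lambda>\<tau>. R (\<theta> \<tau> \<omega>) ?k) - e t)\<^sup>2) \<le> 2 * L * norm ?k * e t / t"
        using elim by (intro sm(3)) (auto simp: e_def)
      then have "expectation (\<lambda>\<omega>. (sample_mean t (\<lambda>\<tau>. R (\<theta> \<tau> \<omega>) ?k) - e t)\<^sup>2) / ((d t)\<^sup>2)\<^sup>2 \<le> 2 * L * norm ?k * e t / t / ((d t)\<^sup>2)\<^sup>2"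
        by (rule divide_right_mono) simp
      also have "\<dots> = 2 * L * norm h * D t / (t * d t)"
        using elim by (simp add: D_def power2_eq_square ac_simps)
      finally show ?case unfolding eq power_divide by simp
    qed
    have "(\<lambda>t. inverse (real t * d t)) \<longlonglongrightarrow> 0" using d(3) by (rule tendsto_inverse_0_at_top)
    from tendsto_mult[OF tendsto_mult[OF tendsto_const[of "2 * L * norm h"] D] this]
    show "(\<lambda>t. 2 * L * norm h * D t / (real t * d t)) \<longlonglongrightarrow> 0" by (simp add: divide_inverse)
  qed
  from tendsto_add[OF this tendsto_fst_in_prob[OF D]] show ?thesis by simp
qed

lemma Q_convex: "convex_on UNIV (Q d t \<omega>)"
proof (rule convex_onI)
  fix u :: real and k l :: "real ^ 'n" assume u: "0 < u" "u < 1"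
  have "sample_mean t (\<lambda>\<tau>. R (\<theta> \<tau> \<omega>) (d *\<^sub>R ((1 - u) *\<^sub>R k + u *\<^sub>R l)))
      \<le> sample_mean t (\<lambda>\<tau>. (1 - u) * R (\<theta> \<tau> \<omega>) (d *\<^sub>R k) + u * R (\<theta> \<tau> \<omega>) (d *\<^sub>R l))"
  proof (rule sample_mean_mono)
    fix \<tau>
    have "d *\<^sub>R ((1 - u) *\<^sub>R k + u *\<^sub>R l) = (1 - u) *\<^sub>R (d *\<^sub>R k) + u *\<^sub>R (d *\<^sub>R l)" by (simp add: algebra_simps)
    then show "R (\<theta> \<tau> \<omega>) (d *\<^sub>R ((1 - u) *\<^sub>R k + u *\<^sub>R l)) \<le> (1 - u) * R (\<theta> \<tau> \<omega>) (d *\<^sub>R k) + u * R (\<theta> \<tau> \<omega>) (d *\<^sub>R l)"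
      by (simp only:) (rule R_convex, use u in auto)
  qed
  then show "Q d t \<omega> ((1 - u) *\<^sub>R k + u *\<^sub>R l) \<le> (1 - u) * Q d t \<omega> k + u * Q d t \<omega> l"
    unfolding Q_def sample_mean_add sample_mean_cmult
    by (simp add: divide_right_mono add_divide_distrib[symmetric])
qed simp

lemma Q_uniform:
  assumes d: "d \<longlonglongrightarrow> 0" "\<forall>\<^sub>F t in sequentially. 0 < d t" "filterlim (\<lambda>t. real t * d t) at_top sequentially"
    and e: "0 < e"
  shows "\<forall>\<^sub>F z in in_prob M. \<forall>h. norm h \<le> r \<longrightarrow> \<bar>Q (d (fst z)) (fst z) (snd z) h - q h\<bar> \<le> e"
proof -
  obtain J \<zeta> where J: "finite J" "0 < \<zeta>"
    "\<And>Q h. convex_on UNIV Q \<Longrightarrow> (\<And>g. g \<in> J \<Longrightarrow> \<bar>Q g - q g\<bar> \<le> \<zeta>) \<Longrightarrow> norm h \<le> r \<Longrightarrow> \<bar>Q h - q h\<bar> \<le> e"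
    using convex_close_on_finite_imp_close_on_compact[OF continuous_q e] by metis
  have "\<forall>\<^sub>F z in in_prob M. \<bar>Q (d (fst z)) (fst z) (snd z) g - q g\<bar> \<le> \<zeta>" for g
    using tendstoD[OF Q_pointwise[OF d, of g] J(2)] by eventually_elim (simp add: dist_real_def)
  then have "\<forall>\<^sub>F z in in_prob M. \<forall>g\<in>J. \<bar>Q (d (fst z)) (fst z) (snd z) g - q g\<bar> \<le> \<zeta>"
    using J(1) by (simp add: eventually_ball_finite)
  then show ?thesis by eventually_elim (use J(3) Q_convex in blast)
qed

end

section \<open>Observed equilibria\<close>

locale fppe_observations = fppe_sampling M \<nu> b \<beta>0 v x0 s p0 \<theta>
  for M :: "'w measure" and \<nu> :: "'a measure"
    and b \<beta>0 :: "real ^ 'n" and v x0 :: "'a \<Rightarrow> real ^ 'n" and s p0 :: "'a \<Rightarrow> real"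
    and \<theta> :: "nat \<Rightarrow> 'w \<Rightarrow> 'a" +
  fixes \<epsilon> :: "nat \<Rightarrow> real"
    and \<beta> :: "nat \<Rightarrow> 'w \<Rightarrow> real ^ 'n" and p :: "nat \<Rightarrow> 'w \<Rightarrow> nat \<Rightarrow> real"
    and x :: "nat \<Rightarrow> 'w \<Rightarrow> nat \<Rightarrow> real ^ 'n"
  assumes observed: "\<And>t. 1 \<le> t \<Longrightarrow>
          AE \<omega> in M. observed_FPPE b v (1 / real t) t (\<lambda>\<tau>. \<theta> \<tau> \<omega>) (\<beta> t \<omega>) (p t \<omega>) (x t \<omega>)"
    and measurable_beta: "\<And>t. 1 \<le> t \<Longrightarrow> \<beta> t \<in> borel_measurable M"
    and measurable_price: "\<And>t \<tau>. \<tau> < t \<Longrightarrow> (\<lambda>\<omega>. p t \<omega> \<tau>) \<in> borel_measurable M"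
    and measurable_alloc: "\<And>t \<tau>. \<tau> < t \<Longrightarrow> (\<lambda>\<omega>. x t \<omega> \<tau>) \<in> borel_measurable M"
    and smoothing: "decseq \<epsilon>" "\<epsilon> \<longlonglongrightarrow> 0" "filterlim (\<lambda>t. \<epsilon> t * sqrt (real t)) at_top sequentially"
begin

text \<open>The observed analogues of \<open>m0\<close> and \<open>\<mu>\<close> are \<open>m\<close> and \<open>\<mu>'\<close>, whereas \<open>mbar\<close> averages the limit
  subgradients over the sample. The errors of the multipliers and of \<open>mbar\<close>, on the scale \<open>sqrt t\<close>, are \<open>h\<close> and
  \<open>G\<close>; the aim is to express \<open>h\<close> by \<open>G\<close>, which is a normalised sum of independent vectors.\<close>

definition m :: "nat \<Rightarrow> 'w \<Rightarrow> nat \<Rightarrow> real ^ 'n" where "m t \<omega> \<tau> = x t \<omega> \<tau> * v (\<theta> \<tau> \<omega>)"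
definition \<mu>' :: "nat \<Rightarrow> 'w \<Rightarrow> real ^ 'n" where "\<mu>' t \<omega> = sample_util v t (\<lambda>\<tau>. \<theta> \<tau> \<omega>) (x t \<omega>)"
definition mbar :: "nat \<Rightarrow> 'w \<Rightarrow> real ^ 'n" where "mbar t \<omega> = sample_mean t (\<lambda>\<tau>. m0 (\<theta> \<tau> \<omega>))"
definition \<Delta> :: "nat \<Rightarrow> 'w \<Rightarrow> real ^ 'n" where "\<Delta> t \<omega> = \<beta> t \<omega> - \<beta>0"
definition h :: "nat \<Rightarrow> 'w \<Rightarrow> real ^ 'n" where "h t \<omega> = sqrt t *\<^sub>R \<Delta> t \<omega>"
definition G :: "nat \<Rightarrow> 'w \<Rightarrow> real ^ 'n" where "G t \<omega> = sqrt t *\<^sub>R (mbar t \<omega> - \<mu>)"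

text \<open>The remainder on the scale \<open>1 / sqrt t\<close> of the multipliers.\<close>

definition Q1 :: "nat \<Rightarrow> 'w \<Rightarrow> real ^ 'n \<Rightarrow> real" where "Q1 t = Q (1 / sqrt t) t"

text \<open>All conditions that hold almost surely, so that the arguments on single outcomes below are deterministic.\<close>

definition typical :: "nat \<Rightarrow> 'w \<Rightarrow> bool" where
  "typical t \<omega> \<longleftrightarrow> 1 \<le> t \<and> observed_FPPE b v (1 / real t) t (\<lambda>\<tau>. \<theta> \<tau> \<omega>) (\<beta> t \<omega>) (p t \<omega>) (x t \<omega>) \<and> (\<forall>\<tau>. good (\<theta> \<tau> \<omega>))"

lemma eventually_typical: "\<forall>\<^sub>F z in in_prob M. typical (fst z) (snd z)"
proof -
  have "\<forall>\<^sub>F z in in_prob M. 1 \<le> fst z \<longrightarrow> typical (fst z) (snd z)"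
  proof (rule eventually_in_prob_AE)
    fix t :: nat assume t: "1 \<le> t"
    have "AE \<omega> in M. \<forall>\<tau>. good (\<theta> \<tau> \<omega>)" using AE_\<theta>[OF AE_good] by (simp add: AE_all_countable)
    with observed[OF t] show "AE \<omega> in M. 1 \<le> fst (t, \<omega>) \<longrightarrow> typical (fst (t, \<omega>)) (snd (t, \<omega>))"
      by eventually_elim (simp add: typical_def)
  qed
  moreover have "\<forall>\<^sub>F z in in_prob M. 1 \<le> fst z" by (rule eventually_fst_in_prob) (rule eventually_ge_at_top)
  ultimately show ?thesis by eventually_elim simp
qed

lemma \<mu>'_eq: "\<mu>' t \<omega> = sample_mean t (m t \<omega>)"
  by (simp add: \<mu>'_def sample_util_def m_def[abs_def] mult.commute)

lemma typical_allocation: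
  assumes "typical t \<omega>" "\<tau> < t"
  shows "0 \<le> x t \<omega> \<tau> $ i" "x t \<omega> \<tau> $ i \<le> 1" "0 \<le> m t \<omega> \<tau> $ i" "m t \<omega> \<tau> $ i \<le> C" "p t \<omega> \<tau> = top_bid (\<beta> t \<omega>) (v (\<theta> \<tau> \<omega>))"
    "x t \<omega> \<tau> $ i * p t \<omega> \<tau> = \<beta> t \<omega> $ i * m t \<omega> \<tau> $ i"
proof -
  have v: "0 \<le> v (\<theta> \<tau> \<omega>) $ i" "v (\<theta> \<tau> \<omega>) $ i \<le> C" using assms by (auto simp: typical_def good_def)
  show x: "0 \<le> x t \<omega> \<tau> $ i" "x t \<omega> \<tau> $ i \<le> 1" using assms by (auto simp: typical_def observed_FPPE_def)
  show "0 \<le> m t \<omega> \<tau> $ i" "m t \<omega> \<tau> $ i \<le> C"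
    using x v mult_left_le_one_le[of "v (\<theta> \<tau> \<omega>) $ i" "x t \<omega> \<tau> $ i"] by (auto simp: m_def)
  show p: "p t \<omega> \<tau> = top_bid (\<beta> t \<omega>) (v (\<theta> \<tau> \<omega>))" using assms by (auto simp: typical_def observed_FPPE_def)
  show "x t \<omega> \<tau> $ i * p t \<omega> \<tau> = \<beta> t \<omega> $ i * m t \<omega> \<tau> $ i"
  proof (cases "x t \<omega> \<tau> $ i = 0")
    case False
    then have "0 < x t \<omega> \<tau> $ i" using x(1) by simp
    then have "\<beta> t \<omega> $ i * v (\<theta> \<tau> \<omega>) $ i = p t \<omega> \<tau>"
      using assms unfolding p typical_def observed_FPPE_def by blast
    from this[symmetric] show ?thesis by (simp add: m_def)
  qed (simp add: m_def)
qed

text \<open>Spending is \<open>\<beta> * \<mu>'\<close>, as in the limit: it respects the budget, and meets it unless the multiplier is one.\<close>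

lemma typical_\<beta>:
  assumes typical: "typical t \<omega>"
  shows "0 < \<beta> t \<omega> $ i" "\<beta> t \<omega> $ i \<le> 1" "\<mu>' t \<omega> $ i \<le> b $ i / \<beta> t \<omega> $ i"
    "\<beta> t \<omega> $ i < 1 \<Longrightarrow> \<mu>' t \<omega> $ i = b $ i / \<beta> t \<omega> $ i"
proof -
  have "(\<Sum>\<tau><t. x t \<omega> \<tau> $ i * p t \<omega> \<tau>) = (\<Sum>\<tau><t. \<beta> t \<omega> $ i * m t \<omega> \<tau> $ i)"
    by (rule sum.cong) (use typical_allocation(6)[OF typical] in auto)
  then have sp: "1 / real t * (\<Sum>\<tau><t. x t \<omega> \<tau> $ i * p t \<omega> \<tau>) = \<beta> t \<omega> $ i * \<mu>' t \<omega> $ i"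
    unfolding \<mu>'_eq sample_mean_nth sample_mean_real sum_distrib_left[symmetric] by simp
  have 1: "0 \<le> \<beta> t \<omega> $ i" "\<beta> t \<omega> $ i \<le> 1" "\<beta> t \<omega> $ i * \<mu>' t \<omega> $ i \<le> b $ i"
    "\<beta> t \<omega> $ i * \<mu>' t \<omega> $ i < b $ i \<Longrightarrow> \<beta> t \<omega> $ i = 1"
    unfolding sp[symmetric] using typical by (auto simp: typical_def observed_FPPE_def)
  show "\<beta> t \<omega> $ i \<le> 1" by fact
  show pos: "0 < \<beta> t \<omega> $ i" using 1 b_pos[of i] by (cases "\<beta> t \<omega> $ i = 0") auto
  show "\<mu>' t \<omega> $ i \<le> b $ i / \<beta> t \<omega> $ i" using 1(3) pos by (simp add: field_simps)
  show "\<mu>' t \<omega> $ i = b $ i / \<beta> t \<omega> $ i" if "\<beta> t \<omega> $ i < 1"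
    using 1(3,4) pos that by (cases "\<beta> t \<omega> $ i * \<mu>' t \<omega> $ i < b $ i") (auto simp: field_simps)
qed

lemma typical_subgradient:
  assumes typical: "typical t \<omega>" "\<tau> < t" and \<beta>': "\<And>i. 0 \<le> \<beta>' $ i"
  shows "top_bid (\<beta> t \<omega>) (v (\<theta> \<tau> \<omega>)) + m t \<omega> \<tau> \<bullet> (\<beta>' - \<beta> t \<omega>) \<le> top_bid \<beta>' (v (\<theta> \<tau> \<omega>))"
  unfolding m_def
proof (rule allocation_is_subgradient)
  show "0 \<le> v (\<theta> \<tau> \<omega>) $ i" for i using typical by (auto simp: typical_def good_def)
  show "0 \<le> \<beta> t \<omega> $ i" for i using typical_\<beta>(1)[OF typical(1), of i] by simp
qed (use typical typical_allocation[OF typical] \<beta>' in \<open>auto simp: typical_def observed_FPPE_def\<close>)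

text \<open>Adding the subgradient inequality of the observed allocation to the definition of \<open>R\<close> bounds the change of
  subgradient by an increment of \<open>R\<close>. This is the link between allocations and the remainders.\<close>

lemma typical_R:
  assumes typical: "typical t \<omega>" "\<tau> < t"
  shows "0 \<le> R (\<theta> \<tau> \<omega>) (\<Delta> t \<omega>)"
    "(\<And>i. 0 \<le> (\<beta> t \<omega> + k) $ i) \<Longrightarrow> (m t \<omega> \<tau> - m0 (\<theta> \<tau> \<omega>)) \<bullet> k \<le> R (\<theta> \<tau> \<omega>) (\<Delta> t \<omega> + k) - R (\<theta> \<tau> \<omega>) (\<Delta> t \<omega>)"
proof -
  show "0 \<le> R (\<theta> \<tau> \<omega>) (\<Delta> t \<omega>)"
    by (rule R_nonneg) (use typical typical_\<beta>(1)[OF typical(1)] in \<open>auto simp: typical_def \<Delta>_def less_imp_le\<close>)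
  assume k: "\<And>i. 0 \<le> (\<beta> t \<omega> + k) $ i"
  have eq: "\<beta>0 + (\<Delta> t \<omega> + k) = \<beta> t \<omega> + k" "\<beta>0 + \<Delta> t \<omega> = \<beta> t \<omega>" by (auto simp: \<Delta>_def)
  show "(m t \<omega> \<tau> - m0 (\<theta> \<tau> \<omega>)) \<bullet> k \<le> R (\<theta> \<tau> \<omega>) (\<Delta> t \<omega> + k) - R (\<theta> \<tau> \<omega>) (\<Delta> t \<omega>)"
    using typical_subgradient[OF typical k] unfolding R_def eq by (simp add: inner_add_right inner_diff_left)
qed

text \<open>The modulus of strong monotonicity of the budget terms \<open>\<beta> \<mapsto> - b / \<beta>\<close> on \<open>(0, 1]\<close>.\<close>

definition c0 :: real where "c0 = Min (range (($) b))"

lemma c0: "0 < c0" "c0 \<le> b $ i"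
proof -
  show "0 < c0" unfolding c0_def by (subst Min_gr_iff) (auto simp: b_pos)
  show "c0 \<le> b $ i" unfolding c0_def by (rule Min_le) auto
qed

text \<open>The observed and the limit subgradients satisfy \<open>(\<mu>' - mbar) \<bullet> \<Delta> \<ge> 0\<close> by monotonicity, and
  \<open>(\<mu>' - \<mu>) \<bullet> \<Delta> \<le> - c0 |\<Delta>|\<^sup>2\<close> by the budget conditions, where a multiplier equal to one yields an inequality of the right
  sign. The difference of the two is controlled by Cauchy-Schwarz.\<close>

lemma typical_rate:
  assumes typical: "typical t \<omega>" shows "c0 * norm (\<Delta> t \<omega>) \<le> norm (mbar t \<omega> - \<mu>)"
proof -
  have "(m t \<omega> \<tau> - m0 (\<theta> \<tau> \<omega>)) \<bullet> (- \<Delta> t \<omega>) \<le> 0" if "\<tau> < t" for \<tau>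
  proof -
    have "R (\<theta> \<tau> \<omega>) (\<Delta> t \<omega> + - \<Delta> t \<omega>) = 0" by (simp add: R_def)
    moreover have nn: "0 \<le> (\<beta> t \<omega> + - \<Delta> t \<omega>) $ i" for i using \<beta>0_bounds by (simp add: \<Delta>_def)
    ultimately show ?thesis using typical_R(2)[OF typical that nn] typical_R(1)[OF typical that] by linarith
  qed
  then have "sample_mean t (\<lambda>\<tau>. (m t \<omega> \<tau> - m0 (\<theta> \<tau> \<omega>)) \<bullet> (- \<Delta> t \<omega>)) \<le> sample_mean t (\<lambda>\<tau>. 0)"
    by (rule sample_mean_mono)
  \<comment> \<open>monotonicity of the subgradients\<close>
  then have mono: "0 \<le> (\<mu>' t \<omega> - mbar t \<omega>) \<bullet> \<Delta> t \<omega>"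
    unfolding sample_mean_inner[symmetric] sample_mean_diff \<mu>'_eq[symmetric] mbar_def[symmetric]
    by (simp add: sample_mean_real)
  \<comment> \<open>the budget conditions, buyer by buyer\<close>
  have comp: "(\<mu>' t \<omega> - \<mu>) $ i * \<Delta> t \<omega> $ i \<le> - (c0 * (\<Delta> t \<omega> $ i)\<^sup>2)" for i
  proof -
    let ?B = "\<beta> t \<omega> $ i" and ?Z = "\<beta>0 $ i"
    have B: "0 < ?B" "?B \<le> 1" "0 < ?Z" "?Z \<le> 1" using typical_\<beta>(1,2)[OF typical, of i] \<beta>0_pos[of i] \<beta>0_bounds(2)[of i] by simp_all
    have D: "\<Delta> t \<omega> $ i = ?B - ?Z" by (simp add: \<Delta>_def)
    have "(\<mu>' t \<omega> - \<mu>) $ i * \<Delta> t \<omega> $ i \<le> (b $ i / ?B - b $ i / ?Z) * \<Delta> t \<omega> $ i"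
    proof (cases "?B" ?Z rule: linorder_cases)
      case less
      then have "\<mu>' t \<omega> $ i = b $ i / ?B" using typical_\<beta>(4)[OF typical, of i] B by simp
      then show ?thesis using \<mu>_le[of i] less by (simp add: D mult_right_mono_neg)
    next
      case greater
      then have "\<mu> $ i = b $ i / ?Z" using \<mu>_interior[of i] B by simp
      then show ?thesis using typical_\<beta>(3)[OF typical, of i] greater by (simp add: D mult_right_mono)
    next
      case equal
      then show ?thesis by (simp add: D)
    qed
    also have "\<dots> = - (b $ i / (?B * ?Z) * (\<Delta> t \<omega> $ i)\<^sup>2)" using B by (simp add: D field_simps power2_eq_square)
    also have "\<dots> \<le> - (c0 * (\<Delta> t \<omega> $ i)\<^sup>2)"
    proof -
      have "?B * ?Z \<le> 1" using B by (simp add: mult_le_one)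
      moreover have "0 < ?B * ?Z" using B by simp
      ultimately have "b $ i \<le> b $ i / (?B * ?Z)" using b_pos[of i] by (simp add: pos_le_divide_eq mult_left_le)
      then have "c0 \<le> b $ i / (?B * ?Z)" using c0(2)[of i] by linarith
      then show ?thesis by (simp only: neg_le_iff_le) (rule mult_right_mono, simp_all)
    qed
    finally show ?thesis .
  qed
  have "(\<mu>' t \<omega> - \<mu>) \<bullet> \<Delta> t \<omega> \<le> (\<Sum>i\<in>UNIV. - (c0 * (\<Delta> t \<omega> $ i)\<^sup>2))"
    unfolding inner_vec_def by (rule sum_mono) (use comp in simp)
  also have "\<dots> = - (c0 * (norm (\<Delta> t \<omega>))\<^sup>2)"
    unfolding power2_norm_eq_inner by (simp add: sum_negf sum_distrib_left[symmetric] inner_vec_def power2_eq_square)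
  finally have "c0 * (norm (\<Delta> t \<omega>))\<^sup>2 \<le> - ((mbar t \<omega> - \<mu>) \<bullet> \<Delta> t \<omega>)"
    using mono by (simp add: inner_diff_left)
  also have "\<dots> \<le> norm (mbar t \<omega> - \<mu>) * norm (\<Delta> t \<omega>)"
    using Cauchy_Schwarz_ineq2[of "mbar t \<omega> - \<mu>" "\<Delta> t \<omega>"] by linarith
  finally show ?thesis by (cases "norm (\<Delta> t \<omega>) = 0") (auto simp: power2_eq_square)
qed

lemma typical_h_le: assumes "typical t \<omega>" shows "norm (h t \<omega>) \<le> norm (G t \<omega>) / c0"
proof -
  have "sqrt t * (c0 * norm (\<Delta> t \<omega>)) \<le> sqrt t * norm (mbar t \<omega> - \<mu>)" by (intro mult_left_mono typical_rate assms) auto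
  then show ?thesis using c0(1) by (simp add: h_def G_def pos_le_divide_eq ac_simps)
qed

lemma Q1_eq: "1 \<le> t \<Longrightarrow> sample_mean t (\<lambda>\<tau>. R (\<theta> \<tau> \<omega>) ((1 / sqrt t) *\<^sub>R k)) = Q1 t \<omega> k / t"
  by (simp add: Q1_def Q_def power_divide)

text \<open>The sample mean of \<open>typical_R\<close>: the vector \<open>sqrt t (\<mu>' - mbar)\<close> is a subgradient of the convex function \<open>Q1\<close>
  at \<open>h\<close>, relative to nonnegative multipliers.\<close>

lemma typical_Q1:
  assumes typical: "typical t \<omega>" and k: "\<And>i. 0 \<le> (\<beta> t \<omega> + (1 / sqrt t) *\<^sub>R k) $ i"
  shows "sqrt t * ((\<mu>' t \<omega> - mbar t \<omega>) \<bullet> k) \<le> Q1 t \<omega> (h t \<omega> + k) - Q1 t \<omega> (h t \<omega>)"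
proof -
  have t: "1 \<le> t" using typical by (simp add: typical_def)
  have h: "(1 / sqrt t) *\<^sub>R h t \<omega> = \<Delta> t \<omega>" using t by (simp add: h_def)
  have "sample_mean t (\<lambda>\<tau>. (m t \<omega> \<tau> - m0 (\<theta> \<tau> \<omega>)) \<bullet> ((1 / sqrt t) *\<^sub>R k))
      \<le> sample_mean t (\<lambda>\<tau>. R (\<theta> \<tau> \<omega>) (\<Delta> t \<omega> + (1 / sqrt t) *\<^sub>R k) - R (\<theta> \<tau> \<omega>) (\<Delta> t \<omega>))"
    by (intro sample_mean_mono typical_R(2)[OF typical] k)
  also have "\<dots> = (Q1 t \<omega> (h t \<omega> + k) - Q1 t \<omega> (h t \<omega>)) / t"
    unfolding sample_mean_diff h[symmetric] scaleR_add_right[symmetric] Q1_eq[OF t] by (simp add: diff_divide_distrib)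
  finally have "((\<mu>' t \<omega> - mbar t \<omega>) \<bullet> k) / sqrt t \<le> (Q1 t \<omega> (h t \<omega> + k) - Q1 t \<omega> (h t \<omega>)) / t"
    unfolding sample_mean_inner[symmetric] sample_mean_diff \<mu>'_eq[symmetric] mbar_def[symmetric] by simp
  then have "t * (((\<mu>' t \<omega> - mbar t \<omega>) \<bullet> k) / sqrt t) \<le> Q1 t \<omega> (h t \<omega> + k) - Q1 t \<omega> (h t \<omega>)"
    using t by (simp add: pos_le_divide_eq mult.commute)
  moreover have "real t * (((\<mu>' t \<omega> - mbar t \<omega>) \<bullet> k) / sqrt t) = sqrt t * ((\<mu>' t \<omega> - mbar t \<omega>) \<bullet> k)"
    using real_div_sqrt[of "real t"] by (metis of_nat_0_le_iff times_divide_eq_left times_divide_eq_right)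
  ultimately show ?thesis by simp
qed

text \<open>The two perturbations \<open>\<plusminus> axis i 1\<close> in \<open>typical_R\<close> bound \<open>m - m0\<close> from both sides at the level of single
  items, so the absolute values may be averaged.\<close>

lemma typical_L1:
  assumes typical: "typical t \<omega>" and k: "\<And>j. 0 \<le> (\<beta> t \<omega> + (1 / sqrt t) *\<^sub>R axis i 1) $ j" "\<And>j. 0 \<le> (\<beta> t \<omega> + (1 / sqrt t) *\<^sub>R (- axis i 1)) $ j"
  shows "sample_mean t (\<lambda>\<tau>. \<bar>m t \<omega> \<tau> $ i - m0 (\<theta> \<tau> \<omega>) $ i\<bar>) \<le> (Q1 t \<omega> (h t \<omega> + axis i 1) + Q1 t \<omega> (h t \<omega> - axis i 1)) / sqrt t"
proof -
  have t: "1 \<le> t" using typical by (simp add: typical_def)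
  have h: "(1 / sqrt t) *\<^sub>R h t \<omega> = \<Delta> t \<omega>" using t by (simp add: h_def)
  let ?r = "1 / sqrt t"
  have item: "?r * \<bar>m t \<omega> \<tau> $ i - m0 (\<theta> \<tau> \<omega>) $ i\<bar> \<le> R (\<theta> \<tau> \<omega>) (\<Delta> t \<omega> + ?r *\<^sub>R axis i 1) + R (\<theta> \<tau> \<omega>) (\<Delta> t \<omega> + ?r *\<^sub>R (- axis i 1))"
    if "\<tau> < t" for \<tau>
  proof -
    have g: "good (\<theta> \<tau> \<omega>)" using typical by (simp add: typical_def)
    have eq: "\<beta>0 + (\<Delta> t \<omega> + k) = \<beta> t \<omega> + k" for k by (simp add: \<Delta>_def)
    have nn: "0 \<le> R (\<theta> \<tau> \<omega>) (\<Delta> t \<omega> + ?r *\<^sub>R axis i 1)" "0 \<le> R (\<theta> \<tau> \<omega>) (\<Delta> t \<omega> + ?r *\<^sub>R (- axis i 1))"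
      by (rule R_nonneg[OF g], unfold eq, rule k)+
    have "?r * (m t \<omega> \<tau> $ i - m0 (\<theta> \<tau> \<omega>) $ i) \<le> R (\<theta> \<tau> \<omega>) (\<Delta> t \<omega> + ?r *\<^sub>R axis i 1)"
      using typical_R(2)[OF typical that k(1)] typical_R(1)[OF typical that] by (simp add: inner_axis)
    moreover have "?r * - (m t \<omega> \<tau> $ i - m0 (\<theta> \<tau> \<omega>) $ i) \<le> R (\<theta> \<tau> \<omega>) (\<Delta> t \<omega> + ?r *\<^sub>R (- axis i 1))"
      using typical_R(2)[OF typical that k(2)] typical_R(1)[OF typical that] by (simp add: inner_axis diff_divide_distrib)
    ultimately show ?thesis using nn by (cases "0 \<le> m t \<omega> \<tau> $ i - m0 (\<theta> \<tau> \<omega>) $ i") auto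
  qed
  have "sample_mean t (\<lambda>\<tau>. ?r * \<bar>m t \<omega> \<tau> $ i - m0 (\<theta> \<tau> \<omega>) $ i\<bar>) \<le> sample_mean t (\<lambda>\<tau>. R (\<theta> \<tau> \<omega>) (\<Delta> t \<omega> + ?r *\<^sub>R axis i 1) + R (\<theta> \<tau> \<omega>) (\<Delta> t \<omega> + ?r *\<^sub>R (- axis i 1)))"
    by (intro sample_mean_mono item)
  also have "\<dots> = (Q1 t \<omega> (h t \<omega> + axis i 1) + Q1 t \<omega> (h t \<omega> - axis i 1)) / t"
    unfolding sample_mean_add h[symmetric] scaleR_add_right[symmetric] Q1_eq[OF t] by (simp add: add_divide_distrib)
  finally have le: "sample_mean t (\<lambda>\<tau>. \<bar>m t \<omega> \<tau> $ i - m0 (\<theta> \<tau> \<omega>) $ i\<bar>) / sqrt t \<le> (Q1 t \<omega> (h t \<omega> + axis i 1) + Q1 t \<omega> (h t \<omega> - axis i 1)) / t"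
    unfolding sample_mean_cmult by simp
  have cancel: "S \<le> X / r" if "S / r \<le> X / (r * r)" "0 < r" for S X r :: real
    using that by (simp add: divide_simps split: if_splits)
  show ?thesis by (rule cancel) (use le t in auto)
qed

end

section \<open>The pseudo-inverse of the restricted Hessian\<close>

lemma tendsto_zero_mult_bounded:
  fixes f g :: "'c \<Rightarrow> real"
  assumes f: "(f \<longlongrightarrow> 0) F" and g: "\<forall>\<^sub>F z in F. \<bar>g z\<bar> \<le> K"
  shows "((\<lambda>z. f z * g z) \<longlongrightarrow> 0) F"
proof (rule Lim_null_comparison)
  show "\<forall>\<^sub>F z in F. norm (f z * g z) \<le> \<bar>f z\<bar> * K"
    using g by eventually_elim (simp add: abs_mult mult_left_mono)
  show "((\<lambda>z. \<bar>f z\<bar> * K) \<longlongrightarrow> 0) F" using f by (auto intro!: tendsto_eq_intros)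
qed

lemma diag_mat_mult:
  fixes X :: "real ^ 'n ^ 'n"
  shows "(diag_mat d ** X) $ i $ j = d $ i * X $ i $ j" "(X ** diag_mat d) $ i $ j = X $ i $ j * d $ j"
  by (simp_all add: diag_mat_def matrix_matrix_mult_def if_distrib[of "\<lambda>x. x * _"] if_distrib[of "\<lambda>x. _ * x"] cong: if_cong)

lemma diag_mat_mult_vec: "(diag_mat d *v u) $ i = d $ i * u $ i"
  by (simp add: diag_mat_def matrix_vector_mult_def if_distrib[of "\<lambda>x. x * _"] cong: if_cong)

lemma tendsto_matrix_mult:
  fixes X Y :: "'c \<Rightarrow> real ^ 'n ^ 'n"
  assumes "(X \<longlongrightarrow> A) F" "(Y \<longlongrightarrow> B) F" shows "((\<lambda>z. X z ** Y z) \<longlongrightarrow> A ** B) F"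
proof (intro vec_tendstoI)
  fix i j
  have "((\<lambda>z. \<Sum>k\<in>UNIV. X z $ i $ k * Y z $ k $ j) \<longlongrightarrow> (\<Sum>k\<in>UNIV. A $ i $ k * B $ k $ j)) F"
    by (intro tendsto_sum tendsto_mult tendsto_vec_nth assms)
  then show "((\<lambda>z. (X z ** Y z) $ i $ j) \<longlongrightarrow> (A ** B) $ i $ j) F" by (simp add: matrix_matrix_mult_def)
qed

lemma tendsto_matrix_vector_mult:
  fixes X :: "'c \<Rightarrow> real ^ 'n ^ 'n"
  assumes "(X \<longlongrightarrow> A) F" "(y \<longlongrightarrow> c) F" shows "((\<lambda>z. X z *v y z) \<longlongrightarrow> A *v c) F"
proof (intro vec_tendstoI)
  fix i
  have "((\<lambda>z. \<Sum>k\<in>UNIV. X z $ i $ k * y z $ k) \<longlongrightarrow> (\<Sum>k\<in>UNIV. A $ i $ k * c $ k)) F"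
    by (intro tendsto_sum tendsto_mult tendsto_vec_nth assms)
  then show "((\<lambda>z. (X z *v y z) $ i) \<longlongrightarrow> (A *v c) $ i) F" by (simp add: matrix_vector_mult_def)
qed

context fppe_sampling begin

text \<open>\<open>P\<close> projects onto the buyers whose multiplier is below one, \<open>N\<close> onto the others, and \<open>X\<close> is the pseudo-inverse in
  \<open>D_beta\<close>.\<close>

definition P :: "real ^ 'n ^ 'n" where "P = diag_mat (\<chi> i. of_bool (\<beta>0 $ i < 1))"
definition N :: "real ^ 'n ^ 'n" where "N = mat 1 - P"
definition X :: "real ^ 'n ^ 'n" where "X = pinv (P ** H ** P)"

lemma limit_hessian_B_eq: "limit_hessian_B \<nu> b v s \<beta>0 = P ** H ** P"
  by (simp add: limit_hessian_B_def P_def hessian_dual_obj Let_def)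

lemma N_eq: "N = diag_mat (\<chi> i. of_bool (\<not> \<beta>0 $ i < 1))"
  by (simp add: N_def P_def vec_eq_iff diag_mat_def mat_def)

lemma P_comp: "(P *v u) $ i = of_bool (\<beta>0 $ i < 1) * u $ i" by (simp add: P_def diag_mat_mult_vec)

lemma PN: "P ** N = 0" "N ** P = 0" "N ** N = N" "transpose N = N" "P ** P = P" "transpose P = P"
  by (simp_all add: vec_eq_iff N_eq P_def diag_mat_mult) (auto simp: diag_mat_def transpose_def)

lemma PZP_N: "(P ** Z ** P) ** N = 0" "N ** (P ** Z ** P) = 0"
proof -
  show "(P ** Z ** P) ** N = 0" by (simp add: matrix_mul_assoc[symmetric] PN)
  show "N ** (P ** Z ** P) = 0" by (simp add: matrix_mul_assoc PN)
qed

text \<open>The budget terms contribute a positive diagonal to the positive semidefinite \<open>A\<close>.\<close>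

lemma H_positive_definite: assumes "u \<noteq> 0" shows "0 < u \<bullet> (H *v u)"
proof -
  have "u \<bullet> (H *v u) = u \<bullet> (A *v u) + (\<Sum>i\<in>UNIV. b $ i / (\<beta>0 $ i)\<^sup>2 * (u $ i)\<^sup>2)"
    unfolding H_def matrix_vector_mult_add_rdistrib inner_add_right
    by (simp add: inner_vec_def diag_mat_mult_vec power2_eq_square ac_simps)
  moreover obtain i where "u $ i \<noteq> 0" using assms by (auto simp: vec_eq_iff)
  then have "0 < (\<Sum>i\<in>UNIV. b $ i / (\<beta>0 $ i)\<^sup>2 * (u $ i)\<^sup>2)"
    using b_pos \<beta>0_pos less_imp_neq[OF \<beta>0_pos[of i]]
    by (intro sum_pos2[of _ i]) (auto simp: less_imp_le intro!: divide_pos_pos mult_pos_pos)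
  ultimately show ?thesis using A_psd[of u] by simp
qed

text \<open>On the range of \<open>P\<close> the form \<open>P H P\<close> is positive definite, and \<open>N\<close> is the identity on the complement. Thus \<open>N\<close>
  is the kernel projection to which \<open>pinv_via_kernel_projection\<close> applies.\<close>

lemma invertible_PHP_N: "invertible (P ** H ** P + N)"
proof -
  let ?K = "P ** H ** P + N"
  have "u = 0" if "?K *v u = 0" for u
  proof -
    let ?a = "P *v u" and ?c = "N *v u"
    have "N *v (?K *v u) = ?c"
      by (simp add: matrix_vector_mult_add_rdistrib matrix_vector_right_distrib matrix_vector_mul_assoc matrix_mul_assoc PN)
    then have c: "?c = 0" using that by simp
    have "P *v (H *v ?a) = 0" using that c by (simp add: matrix_vector_mult_add_rdistrib matrix_vector_mul_assoc[symmetric])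
    then have "u \<bullet> (P *v (H *v ?a)) = 0" by simp
    then have "?a \<bullet> (H *v ?a) = 0" by (simp add: symmetric_inner[OF PN(6), of u])
    then have "?a = 0" using H_positive_definite by force
    moreover have "u = ?a + ?c" by (simp add: N_def matrix_vector_mult_diff_rdistrib)
    ultimately show ?thesis using c by simp
  qed
  then have "\<exists>B. B ** ?K = mat 1" using matrix_left_invertible_ker[of ?K] by blast
  then show ?thesis using invertible_left_inverse by blast
qed

lemmas X_pinv = pinv_via_kernel_projection[OF PN(3,4) PZP_N invertible_PHP_N, folded X_def]

lemma X_PHP: "X *v (P *v (H *v (P *v u))) = P *v u"
  using X_pinv(3) by (simp add: matrix_vector_mul_assoc matrix_mul_assoc N_def)

lemma X_P: "X *v (P *v u) = X *v u"
proof -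
  have "X ** P = X ** mat 1 - X ** N" by (simp add: N_def matrix_distribs)
  then show ?thesis using X_pinv(4) by (simp add: matrix_vector_mul_assoc)
qed

lemma D_beta_eq: "D_beta \<nu> b v s \<beta>0 x0 y = - (X *v (m0 y - \<mu>))"
  by (simp add: D_beta_def limit_hessian_B_eq X_def m0_def \<mu>_def)

end

section \<open>Root-t consistency of the observed equilibria\<close>

context fppe_observations begin

lemma measurable_mbar: "(\<lambda>\<omega>. mbar t \<omega> $ i) \<in> borel_measurable M"
proof -
  have [measurable]: "(\<lambda>y. m0 y $ i) \<in> borel_measurable \<nu>" by (rule borel_measurable_vec_nth[OF measurable_m0])
  show ?thesis unfolding mbar_def sample_mean_nth unfolding sample_mean_def by measurable
qed

text \<open>\<open>G\<close> is a normalised sum of bounded independent centred vectors.\<close>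

lemma tight_G: "tight M (\<lambda>t \<omega>. norm (G t \<omega>))"
proof (rule tight_of_second_moment[where B = "\<Sum>i\<in>(UNIV::'n set). L\<^sup>2"])
  have sq: "(norm (G t \<omega>))\<^sup>2 = (\<Sum>i\<in>UNIV. real t * (sample_mean t (\<lambda>\<tau>. m0 (\<theta> \<tau> \<omega>) $ i) - \<mu> $ i)\<^sup>2)" for t \<omega>
    by (simp add: power2_norm_eq_inner inner_vec_def G_def mbar_def sample_mean_nth power2_eq_square[symmetric] power_mult_distrib sum_distrib_left)
  have m[measurable]: "(\<lambda>y. m0 y $ i) \<in> borel_measurable \<nu>" for i using borel_measurable_vec_nth[OF measurable_m0] .
  have bd: "\<bar>m0 y $ i\<bar> \<le> L" if "good y" for y i
    using good_bounds(2)[OF that] component_le_norm_cart[of "m0 y" i] by linarith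
  have "expectation (\<lambda>\<omega>. (m0 (\<theta> 0 \<omega>) $ i)\<^sup>2) \<le> expectation (\<lambda>\<omega>. L\<^sup>2)" for i
  proof (rule integral_mono_AE)
    show "AE \<omega> in M. (m0 (\<theta> 0 \<omega>) $ i)\<^sup>2 \<le> L\<^sup>2"
      using AE_\<theta>[OF AE_good, of 0] by eventually_elim (metis bd abs_ge_zero power2_abs power_mono)
  qed (use integrable_m0 in auto)
  then have B: "expectation (\<lambda>\<omega>. (m0 (\<theta> 0 \<omega>) $ i)\<^sup>2) \<le> L\<^sup>2" for i by (simp add: prob_space)
  note sm = sample_mean_of_items_second_moment[OF m bd \<mu>_eq[symmetric] B]
  show "integrable M (\<lambda>\<omega>. (norm (G t \<omega>))\<^sup>2)" for t
    unfolding sq by (intro Bochner_Integration.integrable_sum integrable_mult_right sm(2))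
  show "(\<lambda>\<omega>. norm (G t \<omega>)) \<in> borel_measurable M" for t
  proof -
    have [measurable]: "G t \<in> borel_measurable M"
      by (rule borel_measurable_vecI) (use measurable_mbar in \<open>auto simp: G_def\<close>)
    show ?thesis by measurable
  qed
  show "expectation (\<lambda>\<omega>. (norm (G t \<omega>))\<^sup>2) \<le> (\<Sum>i\<in>(UNIV::'n set). L\<^sup>2)" for t
  proof (cases "t = 0")
    case True
    then show ?thesis by (simp add: G_def)
  next
    case False
    have "expectation (\<lambda>\<omega>. (norm (G t \<omega>))\<^sup>2) = (\<Sum>i\<in>UNIV. real t * expectation (\<lambda>\<omega>. (sample_mean t (\<lambda>\<tau>. m0 (\<theta> \<tau> \<omega>) $ i) - \<mu> $ i)\<^sup>2))"
      unfolding sq by (subst Bochner_Integration.integral_sum) (auto intro!: integrable_mult_right sm(2))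
    also have "\<dots> \<le> (\<Sum>i\<in>(UNIV::'n set). real t * (L\<^sup>2 / t))"
      using False by (intro sum_mono mult_left_mono sm(3)) auto
    finally show ?thesis using False by simp
  qed
qed

text \<open>Convergence in probability restricted to \<open>|G| \<le> K\<close>. Because \<open>G\<close> is tight, results along all \<open>F K\<close> hold along
  \<open>in_prob M\<close>, and under \<open>F K\<close> the error \<open>h\<close> is bounded by the constant \<open>K / c0\<close>.\<close>

definition F :: "real \<Rightarrow> (nat \<times> 'w) filter" where
  "F K = inf (in_prob M) (principal {z. norm (G (fst z) (snd z)) \<le> K})"

lemma F_le: "F K \<le> in_prob M" by (simp add: F_def)

lemma eventually_F: "eventually \<Phi> (in_prob M) \<Longrightarrow> eventually \<Phi> (F K)"
  using F_le filter_leD by blast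

lemma tendsto_F: "(\<phi> \<longlongrightarrow> l) (in_prob M) \<Longrightarrow> (\<phi> \<longlongrightarrow> l) (F K)"
  using F_le by (rule tendsto_mono)

lemma eventually_in_probI_F:
  assumes "\<And>K. 0 < K \<Longrightarrow> eventually \<Phi> (F K)" shows "eventually \<Phi> (in_prob M)"
proof (rule eventually_tight[OF tight_G])
  fix K
  have "eventually \<Phi> (F (max K 1))" by (rule assms) simp
  then have "\<forall>\<^sub>F z in in_prob M. norm (G (fst z) (snd z)) \<le> max K 1 \<longrightarrow> \<Phi> z"
    by (simp add: F_def eventually_inf_principal)
  then show "\<forall>\<^sub>F z in in_prob M. norm (norm (G (fst z) (snd z))) \<le> K \<longrightarrow> \<Phi> z" by eventually_elim auto
qed

lemma tendsto_in_probI_F: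
  assumes "\<And>K. 0 < K \<Longrightarrow> (\<phi> \<longlongrightarrow> l) (F K)" shows "(\<phi> \<longlongrightarrow> l) (in_prob M)"
  unfolding tendsto_def
  using assms topological_tendstoD by (intro allI impI eventually_in_probI_F) blast

lemma F_G: "\<forall>\<^sub>F z in F K. norm (G (fst z) (snd z)) \<le> K"
  by (simp add: F_def eventually_inf_principal)

lemma F_h: "\<forall>\<^sub>F z in F K. norm (h (fst z) (snd z)) \<le> K / c0"
  using F_G eventually_F[OF eventually_typical]
proof eventually_elim
  case (elim z)
  then show ?case using typical_h_le[OF elim(2)] c0(1) by (meson divide_right_mono less_imp_le order_trans)
qed

lemma F_h_comp: "\<forall>\<^sub>F z in F K. \<bar>h (fst z) (snd z) $ i\<bar> \<le> K / c0"
  using F_h by eventually_elim (use component_le_norm_cart order_trans in blast)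

lemma sqrt_fst: "((\<lambda>z. 1 / sqrt (real (fst z))) \<longlongrightarrow> 0) (in_prob M)"
proof (rule tendsto_fst_in_prob)
  show "(\<lambda>t. 1 / sqrt (real t)) \<longlonglongrightarrow> 0" by real_asymp
qed

text \<open>The product \<open>\<epsilon> t sqrt t\<close> is eventually positive, and \<open>\<epsilon>\<close> decreases.\<close>

lemma \<epsilon>_pos: "0 < \<epsilon> t"
proof -
  have "\<forall>\<^sub>F u in sequentially. 0 < \<epsilon> u * sqrt (real u) \<and> t \<le> u"
    using filterlim_at_top_dense[THEN iffD1, OF smoothing(3)] eventually_ge_at_top[of t]
    by (intro eventually_conj) auto
  then obtain u where "0 < \<epsilon> u * sqrt (real u)" "t \<le> u" by (auto dest: eventually_happens)
  then have "0 < \<epsilon> u" by (metis mult_pos_pos not_less_iff_gr_or_eq of_nat_0_le_iff real_sqrt_ge_zero zero_less_mult_pos2 mult_zero_right order_le_less)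
  then show ?thesis using decseqD[OF smoothing(1) \<open>t \<le> u\<close>] by linarith
qed

text \<open>The smoothing sequence decreases more slowly than the error of the multipliers. Hence the finite differences, taken
  around \<open>\<beta>\<close>, look on their own scale as if taken around \<open>\<beta>0\<close>.\<close>

lemma \<Delta>_over_\<epsilon>: "((\<lambda>z. norm (\<Delta> (fst z) (snd z)) / \<epsilon> (fst z)) \<longlongrightarrow> 0) (in_prob M)"
proof (rule tendsto_in_probI_F)
  fix K :: real assume "0 < K"
  have inv: "((\<lambda>z. 1 / (\<epsilon> (fst z) * sqrt (real (fst z)))) \<longlongrightarrow> 0) (F K)"
    by (intro tendsto_F tendsto_fst_in_prob tendsto_divide_0[OF tendsto_const] filterlim_at_top_imp_at_infinity smoothing)
  have "((\<lambda>z. 1 / (\<epsilon> (fst z) * sqrt (real (fst z))) * norm (h (fst z) (snd z))) \<longlongrightarrow> 0) (F K)"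
    by (rule tendsto_zero_mult_bounded[OF inv, where K = "K / c0"]) (use F_h in simp)
  then show "((\<lambda>z. norm (\<Delta> (fst z) (snd z)) / \<epsilon> (fst z)) \<longlongrightarrow> 0) (F K)"
  proof (rule Lim_transform_eventually)
    show "\<forall>\<^sub>F z in F K. 1 / (\<epsilon> (fst z) * sqrt (real (fst z))) * norm (h (fst z) (snd z)) = norm (\<Delta> (fst z) (snd z)) / \<epsilon> (fst z)"
      using eventually_F[OF eventually_typical] by eventually_elim (auto simp: h_def typical_def)
  qed
qed

lemma \<Delta>_tendsto: "((\<lambda>z. \<Delta> (fst z) (snd z)) \<longlongrightarrow> 0) (in_prob M)"
proof -
  have "((\<lambda>z. norm (\<Delta> (fst z) (snd z)) / \<epsilon> (fst z) * \<epsilon> (fst z)) \<longlongrightarrow> 0 * 0) (in_prob M)"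
    by (intro tendsto_mult \<Delta>_over_\<epsilon> tendsto_fst_in_prob smoothing)
  then have "((\<lambda>z. norm (\<Delta> (fst z) (snd z))) \<longlongrightarrow> 0) (in_prob M)"
    using \<epsilon>_pos by (simp add: less_imp_neq[symmetric])
  then show ?thesis by (rule tendsto_norm_zero_cancel)
qed

lemma \<beta>_tendsto: "((\<lambda>z. \<beta> (fst z) (snd z)) \<longlongrightarrow> \<beta>0) (in_prob M)"
  using tendsto_add[OF \<Delta>_tendsto tendsto_const[of \<beta>0]] by (simp add: \<Delta>_def)

lemma \<beta>_perturbed_nonneg:
  "\<forall>\<^sub>F z in in_prob M. \<forall>k. norm k \<le> 1 \<longrightarrow> (\<forall>i. 0 \<le> (\<beta> (fst z) (snd z) + (1 / sqrt (fst z)) *\<^sub>R k) $ i)"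
proof -
  have "((\<lambda>z. norm (\<Delta> (fst z) (snd z)) + 1 / sqrt (fst z)) \<longlongrightarrow> 0) (in_prob M)"
    using tendsto_add[OF tendsto_norm_zero[OF \<Delta>_tendsto] sqrt_fst] by simp
  then have "\<forall>\<^sub>F z in in_prob M. norm (\<Delta> (fst z) (snd z)) + 1 / sqrt (fst z) < r0" using r0(1) by (rule order_tendstoD)
  then show ?thesis
  proof eventually_elim
    case (elim z)
    show ?case
    proof (intro allI impI)
      fix k :: "real ^ 'n" and i assume "norm k \<le> 1"
      then have "norm ((1 / sqrt (fst z)) *\<^sub>R k) \<le> 1 / sqrt (fst z)" by (simp add: divide_right_mono)
      then have "norm (\<Delta> (fst z) (snd z) + (1 / sqrt (fst z)) *\<^sub>R k) \<le> r0"
        using elim norm_triangle_ineq[of "\<Delta> (fst z) (snd z)" "(1 / sqrt (fst z)) *\<^sub>R k"] by linarith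
      from r0(2)[OF this, of i] show "0 \<le> (\<beta> (fst z) (snd z) + (1 / sqrt (fst z)) *\<^sub>R k) $ i" by (simp add: \<Delta>_def)
    qed
  qed
qed

lemma Q1_uniform:
  assumes "0 < e" shows "\<forall>\<^sub>F z in in_prob M. \<forall>k. norm k \<le> r \<longrightarrow> \<bar>Q1 (fst z) (snd z) k - q k\<bar> \<le> e"
  unfolding Q1_def
proof (rule Q_uniform[where d = "\<lambda>t. 1 / sqrt (real t)", OF _ _ _ assms])
  show "(\<lambda>t. 1 / sqrt (real t)) \<longlonglongrightarrow> 0" by real_asymp
  show "\<forall>\<^sub>F t in sequentially. 0 < 1 / sqrt (real t)" using eventually_gt_at_top[of 0] by eventually_elim simp
  show "filterlim (\<lambda>t. real t * (1 / sqrt (real t))) at_top sequentially" by real_asymp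
qed

lemma Q_\<epsilon>_uniform:
  assumes "0 < e" shows "\<forall>\<^sub>F z in in_prob M. \<forall>k. norm k \<le> r \<longrightarrow> \<bar>Q (\<epsilon> (fst z)) (fst z) (snd z) k - q k\<bar> \<le> e"
proof (rule Q_uniform[OF smoothing(2) _ _ assms])
  show "\<forall>\<^sub>F t in sequentially. 0 < \<epsilon> t" using \<epsilon>_pos by simp
  have "filterlim (\<lambda>t. (\<epsilon> t * sqrt (real t)) * sqrt (real t)) at_top sequentially"
    by (rule filterlim_at_top_mult_at_top[OF smoothing(3)]) real_asymp
  moreover have "(\<epsilon> t * sqrt (real t)) * sqrt (real t) = real t * \<epsilon> t" for t
    by (metis mult.assoc mult.commute real_sqrt_mult_self abs_of_nat)
  ultimately show "filterlim (\<lambda>t. real t * \<epsilon> t) at_top sequentially" by simp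
qed

text \<open>By \<open>typical_L1\<close> the mean deviation is at most \<open>1 / sqrt t\<close> times values of \<open>Q1\<close> near \<open>h\<close>, and these are bounded
  because \<open>h\<close> and the quadratic limit are.\<close>

lemma allocations_close:
  "((\<lambda>z. sample_mean (fst z) (\<lambda>\<tau>. \<bar>m (fst z) (snd z) \<tau> $ i - m0 (\<theta> \<tau> (snd z)) $ i\<bar>)) \<longlongrightarrow> 0) (in_prob M)"
proof (rule tendsto_in_probI_F)
  fix K :: real assume K: "0 < K"
  obtain B where B: "0 < B" "\<And>k. norm k \<le> K / c0 + 1 \<Longrightarrow> \<bar>q k\<bar> \<le> B" using q_bounded by metis
  show "((\<lambda>z. sample_mean (fst z) (\<lambda>\<tau>. \<bar>m (fst z) (snd z) \<tau> $ i - m0 (\<theta> \<tau> (snd z)) $ i\<bar>)) \<longlongrightarrow> 0) (F K)"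
  proof (rule Lim_null_comparison)
    show "((\<lambda>z. 1 / sqrt (real (fst z)) * (2 * (B + 1))) \<longlongrightarrow> 0) (F K)"
      using tendsto_mult[OF tendsto_F[OF sqrt_fst] tendsto_const[of "2 * (B + 1)"]] by simp
    show "\<forall>\<^sub>F z in F K. norm (sample_mean (fst z) (\<lambda>\<tau>. \<bar>m (fst z) (snd z) \<tau> $ i - m0 (\<theta> \<tau> (snd z)) $ i\<bar>))
        \<le> 1 / sqrt (real (fst z)) * (2 * (B + 1))"
      using F_h eventually_F[OF eventually_typical] eventually_F[OF \<beta>_perturbed_nonneg] eventually_F[OF Q1_uniform[where e = 1 and r = "K / c0 + 1", simplified]]
    proof eventually_elim
      case (elim z)
      let ?h = "h (fst z) (snd z)" and ?Q = "Q1 (fst z) (snd z)"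
      have n: "norm (?h + axis i 1) \<le> K / c0 + 1" "norm (?h - axis i 1) \<le> K / c0 + 1"
        using elim(1) norm_triangle_ineq[of ?h "axis i 1"] norm_triangle_ineq4[of ?h "axis i 1"] by (auto simp: norm_axis_1)
      have "?Q (?h + axis i 1) \<le> B + 1" "?Q (?h - axis i 1) \<le> B + 1"
        using elim(4)[rule_format, OF n(1)] elim(4)[rule_format, OF n(2)] B(2)[OF n(1)] B(2)[OF n(2)] by linarith+
      then have "(?Q (?h + axis i 1) + ?Q (?h - axis i 1)) / sqrt (fst z) \<le> 2 * (B + 1) / sqrt (fst z)"
        by (intro divide_right_mono) auto
      moreover have "sample_mean (fst z) (\<lambda>\<tau>. \<bar>m (fst z) (snd z) \<tau> $ i - m0 (\<theta> \<tau> (snd z)) $ i\<bar>) \<le> (?Q (?h + axis i 1) + ?Q (?h - axis i 1)) / sqrt (fst z)"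
        by (rule typical_L1[OF elim(2)]; rule elim(3)[rule_format]; simp add: norm_axis_1)
      moreover have "0 \<le> sample_mean (fst z) (\<lambda>\<tau>. \<bar>m (fst z) (snd z) \<tau> $ i - m0 (\<theta> \<tau> (snd z)) $ i\<bar>)"
        by (simp add: sample_mean_real sum_nonneg)
      ultimately show ?case by simp
    qed
  qed
qed

lemma mbar_tendsto: "((\<lambda>z. mbar (fst z) (snd z) $ i) \<longlongrightarrow> \<mu> $ i) (in_prob M)"
  unfolding mbar_def sample_mean_nth \<mu>_eq[of i 0]
  by (rule law_of_large_numbers[where K = L])
     (use borel_measurable_vec_nth[OF measurable_m0] good_bounds(2) component_le_norm_cart order_trans in blast)+

lemma \<mu>'_tendsto: "((\<lambda>z. \<mu>' (fst z) (snd z) $ i) \<longlongrightarrow> \<mu> $ i) (in_prob M)"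
proof -
  have "((\<lambda>z. \<mu>' (fst z) (snd z) $ i - mbar (fst z) (snd z) $ i) \<longlongrightarrow> 0) (in_prob M)"
  proof (rule Lim_null_comparison[OF _ allocations_close[of i]], intro always_eventually allI)
    fix z
    show "norm (\<mu>' (fst z) (snd z) $ i - mbar (fst z) (snd z) $ i) \<le> sample_mean (fst z) (\<lambda>\<tau>. \<bar>m (fst z) (snd z) \<tau> $ i - m0 (\<theta> \<tau> (snd z)) $ i\<bar>)"
      unfolding \<mu>'_eq mbar_def sample_mean_nth sample_mean_diff[symmetric] unfolding sample_mean_real
      by (simp only: real_norm_def abs_divide abs_of_nat) (rule divide_right_mono[OF sum_abs], simp)
  qed
  from tendsto_add[OF this mbar_tendsto[of i]] show ?thesis by simp
qed

text \<open>A buyer with \<open>\<beta>0 = 1\<close> has \<open>\<mu> < b\<close>, so eventually \<open>\<mu>' < b\<close>, while an observed multiplier below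
  one would force \<open>\<mu>' = b / \<beta> \<ge> b\<close>. The other buyers keep a fixed distance from one, which eventually exceeds \<open>\<epsilon>\<close>.\<close>

lemma active_set_identified:
  "\<forall>\<^sub>F z in in_prob M. \<forall>i. (\<beta>0 $ i = 1 \<longrightarrow> \<beta> (fst z) (snd z) $ i = 1) \<and> (\<beta>0 $ i < 1 \<longrightarrow> \<beta> (fst z) (snd z) $ i < 1 - \<epsilon> (fst z))"
proof -
  have "\<forall>\<^sub>F z in in_prob M. (\<beta>0 $ i = 1 \<longrightarrow> \<beta> (fst z) (snd z) $ i = 1) \<and> (\<beta>0 $ i < 1 \<longrightarrow> \<beta> (fst z) (snd z) $ i < 1 - \<epsilon> (fst z))" for i
  proof (cases "\<beta>0 $ i = 1")
    case True
    have "\<forall>\<^sub>F z in in_prob M. \<mu>' (fst z) (snd z) $ i < b $ i"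
      by (rule order_tendstoD(2)[OF \<mu>'_tendsto \<mu>_boundary[OF True]])
    with eventually_typical show ?thesis
    proof eventually_elim
      case (elim z)
      note B = typical_\<beta>[OF elim(1), of i]
      have "\<not> \<beta> (fst z) (snd z) $ i < 1"
      proof
        assume "\<beta> (fst z) (snd z) $ i < 1"
        then have "\<mu>' (fst z) (snd z) $ i = b $ i / \<beta> (fst z) (snd z) $ i" by (rule B(4))
        moreover have "b $ i \<le> b $ i / \<beta> (fst z) (snd z) $ i"
          using B(1,2) b_pos[of i] by (simp add: pos_le_divide_eq mult_left_le)
        ultimately show False using elim(2) by simp
      qed
      then show ?case using B(2) True by simp
    qed
  next
    case False
    then have lt: "\<beta>0 $ i < 1" using \<beta>0_bounds(2)[of i] by simp
    have "((\<lambda>z. \<beta> (fst z) (snd z) $ i + \<epsilon> (fst z)) \<longlongrightarrow> \<beta>0 $ i + 0) (in_prob M)"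
      by (intro tendsto_add tendsto_vec_nth \<beta>_tendsto tendsto_fst_in_prob smoothing)
    then have "\<forall>\<^sub>F z in in_prob M. \<beta> (fst z) (snd z) $ i + \<epsilon> (fst z) < 1"
      by (rule order_tendstoD) (use lt in simp)
    then show ?thesis by eventually_elim (use False in auto)
  qed
  then show ?thesis by (rule eventually_all_finite)
qed

end

section \<open>Asymptotic linearity of the multipliers\<close>

context fppe_sampling begin

lemma A_sym_inner: "u \<bullet> (A *v w) = w \<bullet> (A *v u)"
  using symmetric_inner[OF A_symmetric, of u w] by (simp add: inner_commute)

lemma q_add: "q (w + k) = q w + k \<bullet> (A *v w) + q k"
  unfolding q_def using A_sym_inner[of w k]
  by (simp add: matrix_vector_right_distrib inner_add_left inner_add_right field_simps)

lemma q_minus: "q (- w) = q w"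
  by (simp add: q_def vec.neg)

lemma q_axis: "q (c *\<^sub>R axis i 1) = c\<^sup>2 * A $ i $ i / 2"
  by (simp add: q_def matrix_vector_mult_scaleR matrix_vector_mult_basis column_def inner_axis' power2_eq_square)

lemma q_second_difference: "q (w + a + c) - q (w + a - c) - q (w - a + c) + q (w - a - c) = 4 * (a \<bullet> (A *v c))"
proof -
  have "q (w + a + c) = q w + a \<bullet> (A *v w) + q a + c \<bullet> (A *v w) + c \<bullet> (A *v a) + q c" for w a c
    by (simp add: q_add[of "w + a" c] q_add[of w a] matrix_vector_right_distrib inner_add_right)
  from this[of w a c] this[of w a "- c"] this[of w "- a" c] this[of w "- a" "- c"] A_sym_inner[of a c]
  show ?thesis by (simp add: q_minus vec.neg)
qed

end

context fppe_observations begin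

text \<open>Since \<open>sqrt t (\<mu>' - mbar)\<close> is a subgradient of \<open>Q1\<close> at \<open>h\<close>, difference quotients with a small fixed step
  \<open>a\<close> in the directions \<open>\<plusminus> axis i 1\<close> squeeze its coordinates. As \<open>Q1\<close> is uniformly close to \<open>q\<close>, these
  quotients are close to the derivative \<open>A h\<close> of \<open>q\<close>, with an error proportional to \<open>a\<close>.\<close>

lemma subgradient_expansion:
  "((\<lambda>z. sqrt (real (fst z)) * (\<mu>' (fst z) (snd z) - mbar (fst z) (snd z)) $ i - (A *v h (fst z) (snd z)) $ i) \<longlongrightarrow> 0) (in_prob M)"
proof (rule tendsto_in_probI_F, rule tendstoI)
  fix K e :: real assume K: "0 < K" and e: "0 < e"
  \<comment> \<open>small enough for the curvature term \<open>a * A $ i $ i\<close> of the difference quotient to be below \<open>e / 2\<close>\<close>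
  define a where "a = min 1 (e / (2 * (\<bar>A $ i $ i\<bar> + 1)))"
  have a: "0 < a" "a \<le> 1" using e by (auto simp: a_def)
  have "a * (\<bar>A $ i $ i\<bar> + 1) \<le> e / (2 * (\<bar>A $ i $ i\<bar> + 1)) * (\<bar>A $ i $ i\<bar> + 1)"
    by (intro mult_right_mono) (auto simp: a_def)
  also have "\<dots> = e / 2"
  proof -
    have "e / (2 * n) * n = e / 2" if "n \<noteq> 0" for n :: real using that by simp
    moreover have "\<bar>A $ i $ i\<bar> + 1 \<noteq> 0" by linarith
    ultimately show ?thesis by blast
  qed
  finally have aA: "a * \<bar>A $ i $ i\<bar> \<le> e / 2" using a by (simp add: distrib_left)
  \<comment> \<open>after division by the step \<open>a\<close>, the two uniform errors contribute \<open>2 \<zeta> / a = e / 4\<close>\<close>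
  define \<zeta> where "\<zeta> = a * e / 8"
  have \<zeta>: "0 < \<zeta>" using a e by (simp add: \<zeta>_def)
  show "\<forall>\<^sub>F z in F K. dist (sqrt (real (fst z)) * (\<mu>' (fst z) (snd z) - mbar (fst z) (snd z)) $ i - (A *v h (fst z) (snd z)) $ i) 0 < e"
    using F_h eventually_F[OF eventually_typical] eventually_F[OF \<beta>_perturbed_nonneg] eventually_F[OF Q1_uniform[OF \<zeta>, of "K / c0 + 1"]]
  proof eventually_elim
    case (elim z)
    let ?h = "h (fst z) (snd z)" and ?Q = "Q1 (fst z) (snd z)" and ?d = "\<mu>' (fst z) (snd z) - mbar (fst z) (snd z)"
    define Y where "Y = sqrt (real (fst z)) * ?d $ i - (A *v ?h) $ i"
    have main: "c * Y \<le> a * (3 * e / 8 + e / 8)" if c: "\<bar>c\<bar> = a" for c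
    proof -
      let ?k = "c *\<^sub>R axis i (1::real)"
      have nk: "norm ?k \<le> 1" using c a by (simp add: norm_axis_1)
      have n: "norm (?h + ?k) \<le> K / c0 + 1" "norm ?h \<le> K / c0 + 1"
        using elim(1) nk norm_triangle_ineq[of ?h ?k] by auto
      have "sqrt (real (fst z)) * (?d \<bullet> ?k) \<le> ?Q (?h + ?k) - ?Q ?h"
        by (rule typical_Q1[OF elim(2)]) (rule elim(3)[rule_format, OF nk])
      also have "\<dots> \<le> q (?h + ?k) - q ?h + 2 * \<zeta>"
        using elim(4)[rule_format, OF n(1)] elim(4)[rule_format, OF n(2)] by linarith
      also have "\<dots> = c * (A *v ?h) $ i + c\<^sup>2 * A $ i $ i / 2 + 2 * \<zeta>"
        unfolding q_add q_axis by (simp add: inner_axis')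
      finally have "c * Y \<le> c\<^sup>2 * A $ i $ i / 2 + 2 * \<zeta>"
        by (simp add: Y_def inner_axis algebra_simps)
      also have "c\<^sup>2 = a * a" using c by (metis power2_abs power2_eq_square)
      also have "a * a * A $ i $ i \<le> a * (a * \<bar>A $ i $ i\<bar>)" using a by (simp add: mult.assoc mult_left_mono)
      also have "\<dots> \<le> a * (e / 2)" using a aA by (intro mult_left_mono) auto
      finally show ?thesis by (simp add: \<zeta>_def field_simps)
    qed
    have "a * Y \<le> a * (e / 2)" "a * (- Y) \<le> a * (e / 2)" using main[of a] main[of "- a"] a by simp_all
    then have "Y \<le> e / 2" "- Y \<le> e / 2" using a by (simp_all only: mult_le_cancel_left_pos)
    then show ?case using e unfolding Y_def[symmetric] by (simp add: dist_real_def)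
  qed
qed

text \<open>For buyers with multiplier below one, \<open>\<mu>' - \<mu> = b / \<beta> - b / \<beta>0\<close>, which linearises to minus the diagonal part of \<open>H\<close> applied to
  \<open>\<Delta>\<close>; the expansion of \<open>\<mu>' - mbar\<close> supplies the part \<open>A\<close>.\<close>

lemma first_order_condition:
  assumes i: "\<beta>0 $ i < 1"
  shows "((\<lambda>z. (G (fst z) (snd z) + H *v h (fst z) (snd z)) $ i) \<longlongrightarrow> 0) (in_prob M)"
proof (rule tendsto_in_probI_F)
  fix K :: real assume "0 < K"
  let ?Y = "\<lambda>z. sqrt (real (fst z)) * (\<mu>' (fst z) (snd z) - mbar (fst z) (snd z)) $ i - (A *v h (fst z) (snd z)) $ i"
  \<comment> \<open>the error of replacing \<open>1 / (\<beta> \<beta>0)\<close> by \<open>1 / \<beta>0\<^sup>2\<close> in the linearisation\<close>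
  let ?r = "\<lambda>z. b $ i * (1 / (\<beta>0 $ i)\<^sup>2 - 1 / (\<beta> (fst z) (snd z) $ i * \<beta>0 $ i))"
  have "(?r \<longlongrightarrow> b $ i * (1 / (\<beta>0 $ i)\<^sup>2 - 1 / (\<beta>0 $ i * \<beta>0 $ i))) (F K)"
    using \<beta>0_pos[of i] by (intro tendsto_intros tendsto_F \<beta>_tendsto) auto
  then have r: "(?r \<longlongrightarrow> 0) (F K)" by (simp add: power2_eq_square)
  have "((\<lambda>z. - ?Y z + ?r z * h (fst z) (snd z) $ i) \<longlongrightarrow> - 0 + 0) (F K)"
    by (intro tendsto_add tendsto_minus tendsto_F subgradient_expansion tendsto_zero_mult_bounded[OF r F_h_comp])
  then have "((\<lambda>z. - ?Y z + ?r z * h (fst z) (snd z) $ i) \<longlongrightarrow> 0) (F K)" by simp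
  then show "((\<lambda>z. (G (fst z) (snd z) + H *v h (fst z) (snd z)) $ i) \<longlongrightarrow> 0) (F K)"
  proof (rule Lim_transform_eventually)
    show "\<forall>\<^sub>F z in F K. - ?Y z + ?r z * h (fst z) (snd z) $ i = (G (fst z) (snd z) + H *v h (fst z) (snd z)) $ i"
      using eventually_F[OF eventually_typical] eventually_F[OF active_set_identified]
    proof eventually_elim
      case (elim z)
      let ?B = "\<beta> (fst z) (snd z) $ i" and ?t = "fst z"
      have B: "0 < ?B" "?B < 1" using typical_\<beta>(1)[OF elim(1), of i] elim(2) i \<epsilon>_pos[of "fst z"] by (auto simp: algebra_simps dest: less_trans)
      have "\<mu>' ?t (snd z) $ i - \<mu> $ i = b $ i / ?B - b $ i / \<beta>0 $ i"
        using typical_\<beta>(4)[OF elim(1) B(2)] \<mu>_interior[OF i] by simp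
      also have "\<dots> = - (b $ i / (?B * \<beta>0 $ i) * \<Delta> ?t (snd z) $ i)"
        using B \<beta>0_pos[of i] by (simp add: \<Delta>_def field_simps)
      finally have "sqrt ?t * (\<mu>' ?t (snd z) $ i - \<mu> $ i) = - (b $ i / (?B * \<beta>0 $ i) * h ?t (snd z) $ i)"
        by (simp add: h_def)
      then have "G ?t (snd z) $ i = - (b $ i / (?B * \<beta>0 $ i) * h ?t (snd z) $ i) - sqrt ?t * (\<mu>' ?t (snd z) - mbar ?t (snd z)) $ i"
        by (simp add: G_def algebra_simps)
      moreover have "(H *v h ?t (snd z)) $ i = (A *v h ?t (snd z)) $ i + b $ i / (\<beta>0 $ i)\<^sup>2 * h ?t (snd z) $ i"
        by (simp add: H_def matrix_vector_mult_add_rdistrib diag_mat_mult_vec)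
      ultimately show ?case by (simp add: algebra_simps)
    qed
  qed
qed

text \<open>The coordinates of \<open>h\<close> with \<open>\<beta>0 = 1\<close> are eventually zero, so \<open>P h = h\<close> and applying \<open>X\<close> to
  \<open>P (G + H h) = o(1)\<close> solves for \<open>h\<close>.\<close>

lemma asymptotically_linear:
  "((\<lambda>z. h (fst z) (snd z) + X *v G (fst z) (snd z)) \<longlongrightarrow> 0) (in_prob M)"
proof -
  have "((\<lambda>z. P *v (G (fst z) (snd z) + H *v h (fst z) (snd z))) \<longlongrightarrow> 0) (in_prob M)"
  proof (intro vec_tendstoI)
    fix i
    show "((\<lambda>z. (P *v (G (fst z) (snd z) + H *v h (fst z) (snd z))) $ i) \<longlongrightarrow> (0 :: real ^ 'n) $ i) (in_prob M)"
      unfolding P_comp using first_order_condition[of i] by (cases "\<beta>0 $ i < 1") simp_all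
  qed
  then have "((\<lambda>z. X *v (P *v (G (fst z) (snd z) + H *v h (fst z) (snd z)))) \<longlongrightarrow> X *v 0) (in_prob M)"
    by (rule tendsto_matrix_vector_mult[OF tendsto_const])
  then have "((\<lambda>z. X *v (P *v (G (fst z) (snd z) + H *v h (fst z) (snd z)))) \<longlongrightarrow> 0) (in_prob M)" by simp
  then show ?thesis
  proof (rule Lim_transform_eventually)
    show "\<forall>\<^sub>F z in in_prob M. X *v (P *v (G (fst z) (snd z) + H *v h (fst z) (snd z))) = h (fst z) (snd z) + X *v G (fst z) (snd z)"
      using active_set_identified
    proof eventually_elim
      case (elim z)
      have "h (fst z) (snd z) $ i = 0" if "\<not> \<beta>0 $ i < 1" for i
      proof -
        have "\<beta>0 $ i = 1" using that \<beta>0_bounds(2)[of i] by simp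
        then show ?thesis using elim by (simp add: h_def \<Delta>_def)
      qed
      then have "P *v h (fst z) (snd z) = h (fst z) (snd z)" by (auto simp: vec_eq_iff P_comp)
      then have "X *v (P *v (H *v h (fst z) (snd z))) = h (fst z) (snd z)" using X_PHP[of "h (fst z) (snd z)"] by simp
      then show ?case by (simp add: matrix_vector_right_distrib X_P)
    qed
  qed
qed

section \<open>Consistency of the finite-difference Hessian\<close>

text \<open>\<open>fdH\<close> is the finite-difference Hessian before the estimated projection.\<close>

definition Hhat :: "nat \<Rightarrow> 'w \<Rightarrow> real ^ 'n ^ 'n" where
  "Hhat t \<omega> = hat_hessian_B b v (\<epsilon> t) t (\<lambda>\<tau>. \<theta> \<tau> \<omega>) (\<beta> t \<omega>)"
definition Xhat :: "nat \<Rightarrow> 'w \<Rightarrow> real ^ 'n ^ 'n" where "Xhat t \<omega> = pinv (Hhat t \<omega>)"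
definition fdH :: "nat \<Rightarrow> 'w \<Rightarrow> real ^ 'n ^ 'n" where
  "fdH t \<omega> = fd_hessian (sample_dual_obj b v t (\<lambda>\<tau>. \<theta> \<tau> \<omega>)) (\<epsilon> t) (\<beta> t \<omega>)"

text \<open>The affine part of this decomposition is invisible to second differences, and the rest is \<open>Q\<close> at the smoothing scale and the
  logarithms.\<close>

lemma sample_dual_obj_eq:
  "sample_dual_obj b v t (\<lambda>\<tau>. \<theta> \<tau> \<omega>) (\<beta> t \<omega> + k) =
     sample_mean t (\<lambda>\<tau>. top_bid \<beta>0 (v (\<theta> \<tau> \<omega>))) + mbar t \<omega> \<bullet> (\<Delta> t \<omega> + k) +
     (\<epsilon> t)\<^sup>2 * Q (\<epsilon> t) t \<omega> ((1 / \<epsilon> t) *\<^sub>R (\<Delta> t \<omega> + k)) - (\<Sum>l\<in>UNIV. b $ l * ln ((\<beta> t \<omega> + k) $ l))"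
proof -
  have eq: "\<beta>0 + (\<Delta> t \<omega> + k) = \<beta> t \<omega> + k" by (simp add: \<Delta>_def)
  have "top_bid (\<beta> t \<omega> + k) (v y) = top_bid \<beta>0 (v y) + m0 y \<bullet> (\<Delta> t \<omega> + k) + R y (\<Delta> t \<omega> + k)" for y
    unfolding R_def eq by simp
  then show ?thesis
    using \<epsilon>_pos[of t] unfolding sample_dual_obj_def Q_def mbar_def sample_mean_inner
    by (simp add: sample_mean_add)
qed

lemma fdH_component:
  "fdH t \<omega> $ i $ j =
     (let w = (1 / \<epsilon> t) *\<^sub>R \<Delta> t \<omega>; u = axis i 1; c = axis j 1; Z = Q (\<epsilon> t) t \<omega>
      in Z (w + u + c) - Z (w + u - c) - Z (w - u + c) + Z (w - u - c)) / 4
     + (if i = j then b $ i * ((2 * ln (\<beta> t \<omega> $ i) - ln (\<beta> t \<omega> $ i + 2 * \<epsilon> t) - ln (\<beta> t \<omega> $ i - 2 * \<epsilon> t)) / (4 * (\<epsilon> t)\<^sup>2)) else 0)"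
proof -
  let ?e = "\<epsilon> t" and ?B = "\<beta> t \<omega>"
  let ?a = "axis i 1 :: real ^ 'n" and ?c = "axis j 1 :: real ^ 'n"
  let ?w = "(1 / ?e) *\<^sub>R \<Delta> t \<omega>" and ?Z = "Q ?e t \<omega>"
  have e: "?e > 0" by (rule \<epsilon>_pos)
  define S where "S k = sample_dual_obj b v t (\<lambda>\<tau>. \<theta> \<tau> \<omega>) (?B + ?e *\<^sub>R k)" for k
  define Lg where "Lg k = (\<Sum>l\<in>UNIV. b $ l * ln ((?B + ?e *\<^sub>R k) $ l))" for k
  define T where "T = sample_mean t (\<lambda>\<tau>. top_bid \<beta>0 (v (\<theta> \<tau> \<omega>))) + mbar t \<omega> \<bullet> \<Delta> t \<omega>"
  have S: "S k = T + ?e * (mbar t \<omega> \<bullet> k) + ?e\<^sup>2 * ?Z (?w + k) - Lg k" for k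
  proof -
    have "(1 / ?e) *\<^sub>R (\<Delta> t \<omega> + ?e *\<^sub>R k) = ?w + k" using e by (simp add: scaleR_add_right)
    then show ?thesis unfolding S_def sample_dual_obj_eq T_def Lg_def by (simp add: inner_add_right)
  qed
  define D where "D = ?Z (?w + ?a + ?c) - ?Z (?w + ?a - ?c) - ?Z (?w - ?a + ?c) + ?Z (?w - ?a - ?c)"
  define E where "E = Lg (?a + ?c) - Lg (?a - ?c) - Lg (- ?a + ?c) + Lg (- ?a - ?c)"
  have "S (?a + ?c) - S (?a - ?c) - S (- ?a + ?c) + S (- ?a - ?c) = ?e\<^sup>2 * D - E"
  proof -
    have w: "?w + (?a + ?c) = ?w + ?a + ?c" "?w + (?a - ?c) = ?w + ?a - ?c"
      "?w + (- ?a + ?c) = ?w - ?a + ?c" "?w + (- ?a - ?c) = ?w - ?a - ?c" by simp_all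
    \<comment> \<open>the affine part cancels\<close>
    have collect: "(T + r * (\<alpha> + \<gamma>) + z * Z1 - L1) - (T + r * (\<alpha> - \<gamma>) + z * Z2 - L2) - (T + r * (- \<alpha> + \<gamma>) + z * Z3 - L3)
        + (T + r * (- \<alpha> - \<gamma>) + z * Z4 - L4) = z * (Z1 - Z2 - Z3 + Z4) - (L1 - L2 - L3 + L4)"
      for r \<alpha> \<gamma> z Z1 Z2 Z3 Z4 L1 L2 L3 L4 :: real by (simp add: algebra_simps)
    show ?thesis unfolding S D_def E_def w inner_add_right inner_diff_right inner_minus_right by (rule collect)
  qed
  moreover have "fdH t \<omega> $ i $ j = (S (?a + ?c) - S (?a - ?c) - S (- ?a + ?c) + S (- ?a - ?c)) / (4 * ?e\<^sup>2)"
  proof -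
    have arg: "?B + ?e *\<^sub>R (?a + ?c) = ?B + ?e *\<^sub>R ?a + ?e *\<^sub>R ?c" "?B + ?e *\<^sub>R (?a - ?c) = ?B + ?e *\<^sub>R ?a - ?e *\<^sub>R ?c"
      "?B + ?e *\<^sub>R (- ?a + ?c) = ?B - ?e *\<^sub>R ?a + ?e *\<^sub>R ?c" "?B + ?e *\<^sub>R (- ?a - ?c) = ?B - ?e *\<^sub>R ?a - ?e *\<^sub>R ?c"
      by (simp_all add: algebra_simps)
    show ?thesis unfolding S_def arg by (simp add: fdH_def fd_hessian_def)
  qed
  ultimately have 1: "fdH t \<omega> $ i $ j = D / 4 - E / (4 * ?e\<^sup>2)" using e by (simp add: diff_divide_distrib)
  have "E = (\<Sum>l\<in>UNIV. b $ l * (ln ((?B + ?e *\<^sub>R (?a + ?c)) $ l) - ln ((?B + ?e *\<^sub>R (?a - ?c)) $ l)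
      - ln ((?B + ?e *\<^sub>R (- ?a + ?c)) $ l) + ln ((?B + ?e *\<^sub>R (- ?a - ?c)) $ l)))"
    unfolding E_def Lg_def by (simp only: right_diff_distrib distrib_left sum.distrib sum_subtractf)
  also have "\<dots> = (\<Sum>l\<in>UNIV. if l = i then (if i = j then b $ i * (ln (?B $ i + 2 * ?e) - 2 * ln (?B $ i) + ln (?B $ i - 2 * ?e)) else 0) else 0)"
    by (rule sum.cong) (auto simp: axis_def mult.commute[of "\<epsilon> t" 2])
  also have "\<dots> = (if i = j then b $ i * (ln (?B $ i + 2 * ?e) - 2 * ln (?B $ i) + ln (?B $ i - 2 * ?e)) else 0)"
    by simp
  finally have 2: "E = \<dots>" .
  have neg: "d / 4 - c * (p1 - 2 * l + p2) / k = d / 4 + c * ((2 * l - p1 - p2) / k)" for d c p1 p2 l k :: real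
    by (simp add: diff_divide_distrib add_divide_distrib algebra_simps)
  show ?thesis
  proof (cases "i = j")
    case True
    then show ?thesis unfolding 1 2 Let_def D_def by (simp only: if_True neg simp_thms)
  next
    case False
    then show ?thesis unfolding 1 2 Let_def D_def by simp
  qed
qed

text \<open>The second differences of \<open>Q\<close> stay within the ball of radius \<open>3\<close>, because \<open>\<Delta> / \<epsilon> \<longlongrightarrow> 0\<close>; uniform closeness
  to \<open>q\<close> on that ball transfers them to the exact second differences of \<open>q\<close>, which are the entries of \<open>A\<close>.\<close>

lemma fdH_tendsto: "((\<lambda>z. fdH (fst z) (snd z)) \<longlongrightarrow> H) (in_prob M)"
proof (intro vec_tendstoI)
  fix i j
  let ?a = "axis i 1 :: real ^ 'n" and ?c = "axis j 1 :: real ^ 'n"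
  define D where "D z = (let w = (1 / \<epsilon> (fst z)) *\<^sub>R \<Delta> (fst z) (snd z); u = axis i 1; c = axis j 1; Z = Q (\<epsilon> (fst z)) (fst z) (snd z)
      in Z (w + u + c) - Z (w + u - c) - Z (w - u + c) + Z (w - u - c)) / 4" for z
  define E where "E z = (2 * ln (\<beta> (fst z) (snd z) $ i) - ln (\<beta> (fst z) (snd z) $ i + 2 * \<epsilon> (fst z)) - ln (\<beta> (fst z) (snd z) $ i - 2 * \<epsilon> (fst z))) / (4 * (\<epsilon> (fst z))\<^sup>2)" for z
  have D: "(D \<longlongrightarrow> A $ i $ j) (in_prob M)"
  proof (rule tendstoI)
    fix e :: real assume e: "0 < e"
    have "\<forall>\<^sub>F z in in_prob M. norm (\<Delta> (fst z) (snd z)) / \<epsilon> (fst z) < 1"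
      by (rule order_tendstoD(2)[OF \<Delta>_over_\<epsilon>]) simp
    moreover have "\<forall>\<^sub>F z in in_prob M. \<forall>k. norm k \<le> 3 \<longrightarrow> \<bar>Q (\<epsilon> (fst z)) (fst z) (snd z) k - q k\<bar> \<le> e / 2"
      using e by (intro Q_\<epsilon>_uniform) simp
    ultimately show "\<forall>\<^sub>F z in in_prob M. dist (D z) (A $ i $ j) < e"
    proof eventually_elim
      case (elim z)
      define w where "w = (1 / \<epsilon> (fst z)) *\<^sub>R \<Delta> (fst z) (snd z)"
      let ?Z = "Q (\<epsilon> (fst z)) (fst z) (snd z)"
      have "norm w \<le> 1" using elim(1) \<epsilon>_pos[of "fst z"] by (simp add: w_def)
      then have n: "norm (w + u + k) \<le> 3" if "norm u \<le> 1" "norm k \<le> 1" for u k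
        using that norm_triangle_ineq[of "w + u" k] norm_triangle_ineq[of w u] by linarith
      have close: "\<bar>?Z (w + u + k) - q (w + u + k)\<bar> \<le> e / 2" if "norm u \<le> 1" "norm k \<le> 1" for u k
        by (rule elim(2)[rule_format, OF n[OF that]])
      have "4 * D z = ?Z (w + ?a + ?c) - ?Z (w + ?a - ?c) - ?Z (w - ?a + ?c) + ?Z (w - ?a - ?c)"
        by (simp add: D_def Let_def w_def)
      moreover have "q (w + ?a + ?c) - q (w + ?a - ?c) - q (w - ?a + ?c) + q (w - ?a - ?c) = 4 * A $ i $ j"
        unfolding q_second_difference by (simp add: matrix_vector_mult_basis column_def inner_axis')
      moreover have "\<bar>?Z (w + ?a + ?c) - q (w + ?a + ?c)\<bar> \<le> e / 2" "\<bar>?Z (w + ?a - ?c) - q (w + ?a - ?c)\<bar> \<le> e / 2"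
        "\<bar>?Z (w - ?a + ?c) - q (w - ?a + ?c)\<bar> \<le> e / 2" "\<bar>?Z (w - ?a - ?c) - q (w - ?a - ?c)\<bar> \<le> e / 2"
        using close[of ?a ?c] close[of ?a "- ?c"] close[of "- ?a" ?c] close[of "- ?a" "- ?c"] by (simp_all add: norm_axis_1)
      ultimately have "\<bar>4 * D z - 4 * A $ i $ j\<bar> \<le> 4 * (e / 2)" by linarith
      then show ?case using e by (simp add: dist_real_def)
    qed
  qed
  have E: "(E \<longlongrightarrow> 1 / (\<beta>0 $ i)\<^sup>2) (in_prob M)"
    unfolding E_def
  proof (rule tendsto_log_second_difference)
    show "((\<lambda>z. \<beta> (fst z) (snd z) $ i) \<longlongrightarrow> \<beta>0 $ i) (in_prob M)" by (rule tendsto_vec_nth[OF \<beta>_tendsto])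
    show "((\<lambda>z. \<epsilon> (fst z)) \<longlongrightarrow> 0) (in_prob M)" by (rule tendsto_fst_in_prob[OF smoothing(2)])
  qed (use \<beta>0_pos \<epsilon>_pos in auto)
  have "((\<lambda>z. D z + (if i = j then b $ i * E z else 0)) \<longlongrightarrow> A $ i $ j + (if i = j then b $ i * (1 / (\<beta>0 $ i)\<^sup>2) else 0)) (in_prob M)"
  proof (cases "i = j")
    case True
    then show ?thesis using tendsto_add[OF D tendsto_mult[OF tendsto_const[of "b $ i"] E]] by simp
  next
    case False
    then show ?thesis using D by simp
  qed
  moreover have "fdH (fst z) (snd z) $ i $ j = D z + (if i = j then b $ i * E z else 0)" for z
    unfolding fdH_component D_def E_def ..
  moreover have "H $ i $ j = A $ i $ j + (if i = j then b $ i * (1 / (\<beta>0 $ i)\<^sup>2) else 0)"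
    by (simp add: H_def diag_mat_def)
  ultimately show "((\<lambda>z. fdH (fst z) (snd z) $ i $ j) \<longlongrightarrow> H $ i $ j) (in_prob M)" by simp
qed

lemma Hhat_eq: "\<forall>\<^sub>F z in in_prob M. Hhat (fst z) (snd z) = P ** fdH (fst z) (snd z) ** P"
  using active_set_identified
proof eventually_elim
  case (elim z)
  have "(\<beta> (fst z) (snd z) $ i < 1 - \<epsilon> (fst z)) = (\<beta>0 $ i < 1)" for i
    using elim[rule_format, of i] \<epsilon>_pos[of "fst z"] \<beta>0_bounds(2)[of i] by (cases "\<beta>0 $ i = 1") auto
  then show ?case by (simp add: Hhat_def hat_hessian_B_def Let_def P_def fdH_def)
qed

lemma Xhat_tendsto: "((\<lambda>z. Xhat (fst z) (snd z)) \<longlongrightarrow> X) (in_prob M)"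
  unfolding Xhat_def X_def
proof (rule tendsto_pinv[where Q = N])
  have "((\<lambda>z. P ** fdH (fst z) (snd z) ** P) \<longlongrightarrow> P ** H ** P) (in_prob M)"
    by (intro tendsto_matrix_mult tendsto_const fdH_tendsto)
  then show "((\<lambda>z. Hhat (fst z) (snd z)) \<longlongrightarrow> P ** H ** P) (in_prob M)"
    by (rule Lim_transform_eventually) (use Hhat_eq in eventually_elim, simp)
  show "\<forall>\<^sub>F z in in_prob M. Hhat (fst z) (snd z) ** N = 0 \<and> N ** Hhat (fst z) (snd z) = 0"
    using Hhat_eq by eventually_elim (simp add: PZP_N)
qed (use PN PZP_N invertible_PHP_N in auto)

section \<open>Random arrays that are close in sample mean\<close>

text \<open>Arrays depend on the sample \<open>z = (t, \<omega>)\<close> and on the index \<open>\<tau>\<close> of an item. Boundedness is part of the notion in order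
  that products preserve it.\<close>

definition mean_close :: "(nat \<times> 'w \<Rightarrow> nat \<Rightarrow> real) \<Rightarrow> (nat \<times> 'w \<Rightarrow> nat \<Rightarrow> real) \<Rightarrow> bool" where
  "mean_close a a' \<longleftrightarrow> (\<exists>C. \<forall>\<^sub>F z in in_prob M. \<forall>\<tau><fst z. \<bar>a z \<tau>\<bar> \<le> C \<and> \<bar>a' z \<tau>\<bar> \<le> C) \<and>
     ((\<lambda>z. sample_mean (fst z) (\<lambda>\<tau>. \<bar>a z \<tau> - a' z \<tau>\<bar>)) \<longlongrightarrow> 0) (in_prob M)"

lemma mean_closeI:
  assumes "\<forall>\<^sub>F z in in_prob M. \<forall>\<tau><fst z. \<bar>a z \<tau>\<bar> \<le> B \<and> \<bar>a' z \<tau>\<bar> \<le> B"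
    "(c \<longlongrightarrow> 0) (in_prob M)" "\<forall>\<^sub>F z in in_prob M. sample_mean (fst z) (\<lambda>\<tau>. \<bar>a z \<tau> - a' z \<tau>\<bar>) \<le> c z"
  shows "mean_close a a'"
proof -
  have "((\<lambda>z. sample_mean (fst z) (\<lambda>\<tau>. \<bar>a z \<tau> - a' z \<tau>\<bar>)) \<longlongrightarrow> 0) (in_prob M)"
  proof (rule Lim_null_comparison[OF _ assms(2)])
    show "\<forall>\<^sub>F z in in_prob M. norm (sample_mean (fst z) (\<lambda>\<tau>. \<bar>a z \<tau> - a' z \<tau>\<bar>)) \<le> c z"
      using assms(3) by eventually_elim (simp add: sample_mean_real sum_nonneg)
  qed
  then show ?thesis using assms(1) unfolding mean_close_def by blast
qed

lemma mean_close_const: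
  assumes "(c \<longlongrightarrow> l) (in_prob M)" shows "mean_close (\<lambda>z \<tau>. c z) (\<lambda>z \<tau>. l)"
proof (rule mean_closeI[where B = "\<bar>l\<bar> + 1" and c = "\<lambda>z. \<bar>c z - l\<bar>"])
  show "\<forall>\<^sub>F z in in_prob M. \<forall>\<tau><fst z. \<bar>c z\<bar> \<le> \<bar>l\<bar> + 1 \<and> \<bar>l\<bar> \<le> \<bar>l\<bar> + 1"
    using tendstoD[OF assms, of 1, simplified] by eventually_elim (auto simp: dist_real_def)
  show "((\<lambda>z. \<bar>c z - l\<bar>) \<longlongrightarrow> 0) (in_prob M)" using assms by (auto intro!: tendsto_eq_intros)
  show "\<forall>\<^sub>F z in in_prob M. sample_mean (fst z) (\<lambda>\<tau>. \<bar>c z - l\<bar>) \<le> \<bar>c z - l\<bar>"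
    by (intro always_eventually allI) (simp add: sample_mean_real)
qed

lemma mean_closeE:
  assumes "mean_close a a'"
  obtains C where "0 \<le> C" "\<forall>\<^sub>F z in in_prob M. \<forall>\<tau><fst z. \<bar>a z \<tau>\<bar> \<le> C \<and> \<bar>a' z \<tau>\<bar> \<le> C"
    "((\<lambda>z. sample_mean (fst z) (\<lambda>\<tau>. \<bar>a z \<tau> - a' z \<tau>\<bar>)) \<longlongrightarrow> 0) (in_prob M)"
proof -
  obtain C where C: "\<forall>\<^sub>F z in in_prob M. \<forall>\<tau><fst z. \<bar>a z \<tau>\<bar> \<le> C \<and> \<bar>a' z \<tau>\<bar> \<le> C"
    "((\<lambda>z. sample_mean (fst z) (\<lambda>\<tau>. \<bar>a z \<tau> - a' z \<tau>\<bar>)) \<longlongrightarrow> 0) (in_prob M)"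
    using assms unfolding mean_close_def by blast
  have "\<forall>\<^sub>F z in in_prob M. \<forall>\<tau><fst z. \<bar>a z \<tau>\<bar> \<le> max C 0 \<and> \<bar>a' z \<tau>\<bar> \<le> max C 0"
    using C(1) by eventually_elim (auto simp: le_max_iff_disj)
  then show ?thesis using that[of "max C 0"] C(2) by simp
qed

lemma mean_close_add:
  assumes "mean_close a a'" "mean_close c c'" shows "mean_close (\<lambda>z \<tau>. a z \<tau> + c z \<tau>) (\<lambda>z \<tau>. a' z \<tau> + c' z \<tau>)"
proof -
  obtain K where K: "\<forall>\<^sub>F z in in_prob M. \<forall>\<tau><fst z. \<bar>a z \<tau>\<bar> \<le> K \<and> \<bar>a' z \<tau>\<bar> \<le> K"
    "((\<lambda>z. sample_mean (fst z) (\<lambda>\<tau>. \<bar>a z \<tau> - a' z \<tau>\<bar>)) \<longlongrightarrow> 0) (in_prob M)" using assms(1) by (rule mean_closeE) 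
  obtain K' where K': "\<forall>\<^sub>F z in in_prob M. \<forall>\<tau><fst z. \<bar>c z \<tau>\<bar> \<le> K' \<and> \<bar>c' z \<tau>\<bar> \<le> K'"
    "((\<lambda>z. sample_mean (fst z) (\<lambda>\<tau>. \<bar>c z \<tau> - c' z \<tau>\<bar>)) \<longlongrightarrow> 0) (in_prob M)" using assms(2) by (rule mean_closeE)
  show ?thesis
  proof (rule mean_closeI[where B = "K + K'"])
    show "\<forall>\<^sub>F z in in_prob M. \<forall>\<tau><fst z. \<bar>a z \<tau> + c z \<tau>\<bar> \<le> K + K' \<and> \<bar>a' z \<tau> + c' z \<tau>\<bar> \<le> K + K'"
      using K(1) K'(1)
    proof eventually_elim
      case (elim z)
      show ?case
      proof (intro allI impI)
        fix \<tau> assume "\<tau> < fst z"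
        with elim show "\<bar>a z \<tau> + c z \<tau>\<bar> \<le> K + K' \<and> \<bar>a' z \<tau> + c' z \<tau>\<bar> \<le> K + K'"
          using abs_triangle_ineq[of "a z \<tau>" "c z \<tau>"] abs_triangle_ineq[of "a' z \<tau>" "c' z \<tau>"] by fastforce
      qed
    qed
    show "((\<lambda>z. sample_mean (fst z) (\<lambda>\<tau>. \<bar>a z \<tau> - a' z \<tau>\<bar>) + sample_mean (fst z) (\<lambda>\<tau>. \<bar>c z \<tau> - c' z \<tau>\<bar>)) \<longlongrightarrow> 0) (in_prob M)"
      using tendsto_add[OF K(2) K'(2)] by simp
    show "\<forall>\<^sub>F z in in_prob M. sample_mean (fst z) (\<lambda>\<tau>. \<bar>a z \<tau> + c z \<tau> - (a' z \<tau> + c' z \<tau>)\<bar>)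
        \<le> sample_mean (fst z) (\<lambda>\<tau>. \<bar>a z \<tau> - a' z \<tau>\<bar>) + sample_mean (fst z) (\<lambda>\<tau>. \<bar>c z \<tau> - c' z \<tau>\<bar>)"
      unfolding sample_mean_add[symmetric] by (intro always_eventually allI sample_mean_mono) linarith
  qed
qed

lemma mean_close_mult:
  assumes "mean_close a a'" "mean_close c c'" shows "mean_close (\<lambda>z \<tau>. a z \<tau> * c z \<tau>) (\<lambda>z \<tau>. a' z \<tau> * c' z \<tau>)"
proof -
  obtain K where K: "0 \<le> K" "\<forall>\<^sub>F z in in_prob M. \<forall>\<tau><fst z. \<bar>a z \<tau>\<bar> \<le> K \<and> \<bar>a' z \<tau>\<bar> \<le> K"
    "((\<lambda>z. sample_mean (fst z) (\<lambda>\<tau>. \<bar>a z \<tau> - a' z \<tau>\<bar>)) \<longlongrightarrow> 0) (in_prob M)" using assms(1) by (rule mean_closeE) 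
  obtain K' where K': "0 \<le> K'" "\<forall>\<^sub>F z in in_prob M. \<forall>\<tau><fst z. \<bar>c z \<tau>\<bar> \<le> K' \<and> \<bar>c' z \<tau>\<bar> \<le> K'"
    "((\<lambda>z. sample_mean (fst z) (\<lambda>\<tau>. \<bar>c z \<tau> - c' z \<tau>\<bar>)) \<longlongrightarrow> 0) (in_prob M)" using assms(2) by (rule mean_closeE)
  show ?thesis
  proof (rule mean_closeI[where B = "K * K'"])
    show "\<forall>\<^sub>F z in in_prob M. \<forall>\<tau><fst z. \<bar>a z \<tau> * c z \<tau>\<bar> \<le> K * K' \<and> \<bar>a' z \<tau> * c' z \<tau>\<bar> \<le> K * K'"
      using K(2) K'(2) by eventually_elim (auto simp: abs_mult intro!: mult_mono K(1))
    have "((\<lambda>z. K' * sample_mean (fst z) (\<lambda>\<tau>. \<bar>a z \<tau> - a' z \<tau>\<bar>) + K * sample_mean (fst z) (\<lambda>\<tau>. \<bar>c z \<tau> - c' z \<tau>\<bar>)) \<longlongrightarrow> K' * 0 + K * 0) (in_prob M)"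
      by (intro tendsto_intros K(3) K'(3))
    then show "((\<lambda>z. K' * sample_mean (fst z) (\<lambda>\<tau>. \<bar>a z \<tau> - a' z \<tau>\<bar>) + K * sample_mean (fst z) (\<lambda>\<tau>. \<bar>c z \<tau> - c' z \<tau>\<bar>)) \<longlongrightarrow> 0) (in_prob M)" by simp
    show "\<forall>\<^sub>F z in in_prob M. sample_mean (fst z) (\<lambda>\<tau>. \<bar>a z \<tau> * c z \<tau> - a' z \<tau> * c' z \<tau>\<bar>)
        \<le> K' * sample_mean (fst z) (\<lambda>\<tau>. \<bar>a z \<tau> - a' z \<tau>\<bar>) + K * sample_mean (fst z) (\<lambda>\<tau>. \<bar>c z \<tau> - c' z \<tau>\<bar>)"
      using K(2) K'(2)
    proof eventually_elim
      case (elim z)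
      show ?case
        unfolding sample_mean_cmult[symmetric] sample_mean_add[symmetric]
      proof (rule sample_mean_mono)
        fix \<tau> assume t: "\<tau> < fst z"
        have "a z \<tau> * c z \<tau> - a' z \<tau> * c' z \<tau> = c z \<tau> * (a z \<tau> - a' z \<tau>) + a' z \<tau> * (c z \<tau> - c' z \<tau>)"
          by (simp add: algebra_simps)
        then have "\<bar>a z \<tau> * c z \<tau> - a' z \<tau> * c' z \<tau>\<bar> \<le> \<bar>c z \<tau>\<bar> * \<bar>a z \<tau> - a' z \<tau>\<bar> + \<bar>a' z \<tau>\<bar> * \<bar>c z \<tau> - c' z \<tau>\<bar>"
          by (metis abs_mult abs_triangle_ineq)
        also have "\<dots> \<le> K' * \<bar>a z \<tau> - a' z \<tau>\<bar> + K * \<bar>c z \<tau> - c' z \<tau>\<bar>"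
          using elim t by (intro add_mono mult_right_mono) auto
        finally show "\<bar>a z \<tau> * c z \<tau> - a' z \<tau> * c' z \<tau>\<bar> \<le> K' * \<bar>a z \<tau> - a' z \<tau>\<bar> + K * \<bar>c z \<tau> - c' z \<tau>\<bar>" .
      qed
    qed
  qed
qed

lemma mean_close_sum:
  fixes J :: "'j set"
  assumes "finite J" "\<And>j. j \<in> J \<Longrightarrow> mean_close (a j) (a' j)"
  shows "mean_close (\<lambda>z \<tau>. \<Sum>j\<in>J. a j z \<tau>) (\<lambda>z \<tau>. \<Sum>j\<in>J. a' j z \<tau>)"
  using assms
proof (induction J rule: finite_induct)
  case empty
  show ?case using mean_close_const[OF tendsto_const[of 0]] by simp
next
  case (insert j J)
  then show ?case using mean_close_add[of "a j" "a' j"] by simp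
qed

lemma mean_close_diff:
  assumes "mean_close a a'" "mean_close c c'" shows "mean_close (\<lambda>z \<tau>. a z \<tau> - c z \<tau>) (\<lambda>z \<tau>. a' z \<tau> - c' z \<tau>)"
  using mean_close_add[OF assms(1) mean_close_mult[OF mean_close_const[OF tendsto_const[of "-1"]] assms(2)]] by simp

lemma mean_close_limit:
  assumes "mean_close a a'" "((\<lambda>z. sample_mean (fst z) (a' z)) \<longlongrightarrow> l) (in_prob M)"
  shows "((\<lambda>z. sample_mean (fst z) (a z)) \<longlongrightarrow> l) (in_prob M)"
proof -
  obtain K where "((\<lambda>z. sample_mean (fst z) (\<lambda>\<tau>. \<bar>a z \<tau> - a' z \<tau>\<bar>)) \<longlongrightarrow> 0) (in_prob M)" using assms(1) by (rule mean_closeE)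
  then have "((\<lambda>z. sample_mean (fst z) (a z) - sample_mean (fst z) (a' z)) \<longlongrightarrow> 0) (in_prob M)"
  proof (rule Lim_null_comparison[rotated], intro always_eventually allI)
    fix z
    show "norm (sample_mean (fst z) (a z) - sample_mean (fst z) (a' z)) \<le> sample_mean (fst z) (\<lambda>\<tau>. \<bar>a z \<tau> - a' z \<tau>\<bar>)"
      unfolding sample_mean_diff[symmetric] unfolding sample_mean_real
      by (simp only: real_norm_def abs_divide abs_of_nat) (rule divide_right_mono[OF sum_abs], simp)
  qed
  from tendsto_add[OF this assms(2)] show ?thesis by simp
qed

end

section \<open>Influence functions and consistency of the variance estimators\<close>

lemma quadratic_form_sum: "u \<bullet> (Z *v w) = (\<Sum>i\<in>UNIV. \<Sum>j\<in>UNIV. Z $ i $ j * (u $ i * w $ j))"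
  for u w :: "real ^ 'n" and Z :: "real ^ 'n ^ 'n"
  by (simp add: inner_vec_def matrix_vector_mult_def sum_distrib_left ac_simps)

context fppe_sampling begin

text \<open>The influence functions of the multipliers and of the revenue.\<close>

definition D :: "'a \<Rightarrow> real ^ 'n" where "D y = D_beta \<nu> b v s \<beta>0 x0 y"
definition Dr :: "'a \<Rightarrow> real" where "Dr y = D_rev \<nu> b v s \<beta>0 p0 x0 y"
definition REV :: real where "REV = limit_revenue \<nu> s p0"

lemma D_eq: "D y = - (X *v (m0 y - \<mu>))" by (simp add: D_def D_beta_eq)

lemma D_comp: "D y $ i = - (\<Sum>j\<in>UNIV. X $ i $ j * (m0 y $ j - \<mu> $ j))"
  by (simp add: D_eq matrix_vector_mult_def)

lemma Dr_eq: "Dr y = p0 y - REV + \<mu> \<bullet> D y" by (simp add: Dr_def D_rev_def REV_def D_def \<mu>_def)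

lemma measurable_D[measurable]: "D \<in> borel_measurable \<nu>"
proof (rule borel_measurable_vecI)
  fix i
  have [measurable]: "(\<lambda>y. m0 y $ j) \<in> borel_measurable \<nu>" for j by (rule borel_measurable_vec_nth[OF measurable_m0])
  show "(\<lambda>y. D y $ i) \<in> borel_measurable \<nu>" unfolding D_comp by measurable
qed

lemma measurable_D_comp[measurable]: "(\<lambda>y. D y $ i) \<in> borel_measurable \<nu>"
  by (rule borel_measurable_vec_nth[OF measurable_D])

lemma measurable_Dr[measurable]: "Dr \<in> borel_measurable \<nu>"
proof -
  have "Dr = (\<lambda>y. p0 y - REV + \<mu> \<bullet> D y)" by (simp add: Dr_eq fun_eq_iff)
  then show ?thesis by (simp only:) measurable
qed

definition KD :: real where "KD = onorm ((*v) X) * (L + norm \<mu>)"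

lemma D_bound: assumes "good y" shows "norm (D y) \<le> KD" "\<bar>D y $ i\<bar> \<le> KD"
proof -
  have bl: "bounded_linear ((*v) X)" by (rule matrix_vector_mul_bounded_linear)
  have "norm (X *v (m0 y - \<mu>)) \<le> onorm ((*v) X) * norm (m0 y - \<mu>)" by (rule onorm[OF bl])
  also have "\<dots> \<le> onorm ((*v) X) * (L + norm \<mu>)"
    using good_bounds(2)[OF assms] norm_triangle_ineq4[of "m0 y" \<mu>] onorm_pos_le[OF bl] by (intro mult_left_mono) auto
  finally show "norm (D y) \<le> KD" by (simp add: D_eq KD_def)
  then show "\<bar>D y $ i\<bar> \<le> KD" using component_le_norm_cart order_trans by blast
qed

definition KR :: real where "KR = norm \<beta>0 * L + \<bar>REV\<bar> + norm \<mu> * KD"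

lemma Dr_bound: assumes "good y" shows "\<bar>Dr y\<bar> \<le> KR"
proof -
  have "\<bar>p0 y\<bar> \<le> norm \<beta>0 * L" using top_bound[OF assms, of \<beta>0] assms by (simp add: good_def)
  moreover have "\<bar>\<mu> \<bullet> D y\<bar> \<le> norm \<mu> * KD"
    by (rule order_trans[OF Cauchy_Schwarz_ineq2]) (intro mult_left_mono D_bound assms norm_ge_zero)
  ultimately show ?thesis by (simp add: Dr_eq KR_def)
qed

lemma REV_eq: "expectation (\<lambda>\<omega>. p0 (\<theta> \<tau> \<omega>)) = REV"
  using supply_mean_eq_expectation[OF measurable_p0, of \<tau>]
  by (simp add: REV_def limit_revenue_def supply_mean_def mult.commute)

lemma D_bound_mult: assumes "good y" shows "\<bar>D y $ i * D y $ j\<bar> \<le> KD * KD"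
  unfolding abs_mult using D_bound(2)[OF assms] by (intro mult_mono) (auto intro: order_trans[OF abs_ge_zero])

lemma integrable_D: "integrable M (\<lambda>\<omega>. D (\<theta> \<tau> \<omega>) $ i)" "integrable M (\<lambda>\<omega>. D (\<theta> \<tau> \<omega>) $ i * D (\<theta> \<tau> \<omega>) $ j)"
proof -
  show "integrable M (\<lambda>\<omega>. D (\<theta> \<tau> \<omega>) $ i)"
    by (rule integrable_bounded_item(1)[OF measurable_D_comp D_bound(2)])
  show "integrable M (\<lambda>\<omega>. D (\<theta> \<tau> \<omega>) $ i * D (\<theta> \<tau> \<omega>) $ j)"
    by (rule integrable_bounded_item(1)[where g = "\<lambda>y. D y $ i * D y $ j", OF _ D_bound_mult]) measurable
qed

lemma integrable_Dr: "integrable M (\<lambda>\<omega>. Dr (\<theta> \<tau> \<omega>))" "integrable M (\<lambda>\<omega>. (Dr (\<theta> \<tau> \<omega>))\<^sup>2)"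
  using integrable_bounded_item[OF measurable_Dr Dr_bound] by blast+

lemma integrable_p0: "integrable M (\<lambda>\<omega>. p0 (\<theta> \<tau> \<omega>))"
proof (rule integrable_bounded_item(1)[OF measurable_p0])
  show "\<bar>p0 y\<bar> \<le> norm \<beta>0 * L" if "good y" for y using top_bound[OF that, of \<beta>0] that by (simp add: good_def)
qed

lemma expectation_D: "expectation (\<lambda>\<omega>. D (\<theta> \<tau> \<omega>) $ i) = 0"
proof -
  have "expectation (\<lambda>\<omega>. D (\<theta> \<tau> \<omega>) $ i) = - (\<Sum>j\<in>UNIV. X $ i $ j * (expectation (\<lambda>\<omega>. m0 (\<theta> \<tau> \<omega>) $ j) - \<mu> $ j))"
    unfolding D_comp using integrable_m0(1) by (simp add: Bochner_Integration.integral_sum prob_space)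
  then show ?thesis by (simp add: \<mu>_eq[symmetric])
qed

lemma expectation_D_inner: "expectation (\<lambda>\<omega>. u \<bullet> D (\<theta> \<tau> \<omega>)) = 0" "integrable M (\<lambda>\<omega>. u \<bullet> D (\<theta> \<tau> \<omega>))"
  unfolding inner_vec_def using integrable_D(1) expectation_D by (simp_all add: Bochner_Integration.integral_sum)

lemma expectation_Dr: "expectation (\<lambda>\<omega>. Dr (\<theta> \<tau> \<omega>)) = 0"
  unfolding Dr_eq using integrable_p0 expectation_D_inner by (simp add: REV_eq prob_space)

abbreviation \<Sigma> :: "real ^ 'n ^ 'n" where "\<Sigma> \<equiv> Sigma_beta \<nu> b v s \<beta>0 x0"
abbreviation \<sigma>2 :: real where "\<sigma>2 \<equiv> sigma2_rev \<nu> b v s \<beta>0 p0 x0"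

text \<open>Matrix-valued integrals are taken entrywise by writing the outer product in the basis of matrix units.\<close>

lemma Sigma_component: "\<Sigma> $ i $ j = expectation (\<lambda>\<omega>. D (\<theta> \<tau> \<omega>) $ i * D (\<theta> \<tau> \<omega>) $ j)"
proof -
  define E where "E = (\<lambda>k l. axis k (axis l 1) :: real ^ 'n ^ 'n)"
  have outer: "outer c c = (\<Sum>k\<in>UNIV. \<Sum>l\<in>UNIV. (c $ k * c $ l) *\<^sub>R E k l)" for c :: "real ^ 'n"
  proof -
    have "(\<Sum>k\<in>UNIV. \<Sum>l\<in>UNIV. (c $ k * c $ l) *\<^sub>R E k l) $ i $ j = (\<Sum>k\<in>UNIV. \<Sum>l\<in>UNIV. if k = i then (if l = j then c $ i * c $ j else 0) else 0)" for i j
      unfolding sum_component by (intro sum.cong refl) (auto simp: E_def axis_def)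
    also have "\<dots> i j = (\<Sum>k\<in>UNIV. if k = i then (\<Sum>l\<in>UNIV. if l = j then c $ i * c $ j else 0) else 0)" for i j
      by (rule sum.cong) auto
    also have "\<dots> i j = outer c c $ i $ j" for i j by (simp add: outer_def)
    finally show ?thesis by (simp add: vec_eq_iff)
  qed
  have [measurable]: "(\<lambda>y. outer (D y) (D y)) \<in> borel_measurable \<nu>"
    by (rule borel_measurable_matI) (simp add: outer_def)
  have "\<Sigma> = expectation (\<lambda>\<omega>. outer (D (\<theta> \<tau> \<omega>)) (D (\<theta> \<tau> \<omega>)))"
    unfolding Sigma_beta_def D_def[symmetric] by (rule supply_mean_eq_expectation) measurable
  also have "\<dots> = (\<Sum>k\<in>UNIV. \<Sum>l\<in>UNIV. expectation (\<lambda>\<omega>. D (\<theta> \<tau> \<omega>) $ k * D (\<theta> \<tau> \<omega>) $ l) *\<^sub>R E k l)"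
    unfolding outer
    by (simp add: Bochner_Integration.integral_sum Bochner_Integration.integrable_sum integrable_scaleR_left integral_scaleR_left integrable_D(2))
  also have "\<dots> $ i $ j = (\<Sum>k\<in>UNIV. \<Sum>l\<in>UNIV. if k = i then (if l = j then expectation (\<lambda>\<omega>. D (\<theta> \<tau> \<omega>) $ i * D (\<theta> \<tau> \<omega>) $ j) else 0) else 0)"
    unfolding sum_component by (intro sum.cong refl) (auto simp: E_def axis_def)
  also have "\<dots> = (\<Sum>k\<in>UNIV. if k = i then (\<Sum>l\<in>UNIV. if l = j then expectation (\<lambda>\<omega>. D (\<theta> \<tau> \<omega>) $ i * D (\<theta> \<tau> \<omega>) $ j) else 0) else 0)"
    by (rule sum.cong) auto
  also have "\<dots> = expectation (\<lambda>\<omega>. D (\<theta> \<tau> \<omega>) $ i * D (\<theta> \<tau> \<omega>) $ j)" by simp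
  finally show ?thesis .
qed

lemma sigma2_eq: "\<sigma>2 = expectation (\<lambda>\<omega>. (Dr (\<theta> \<tau> \<omega>))\<^sup>2)"
  unfolding sigma2_rev_def Dr_def[symmetric] by (rule supply_mean_eq_expectation) measurable

lemma expectation_D_inner_squared:
  "integrable M (\<lambda>\<omega>. (u \<bullet> D (\<theta> \<tau> \<omega>))\<^sup>2)" "expectation (\<lambda>\<omega>. (u \<bullet> D (\<theta> \<tau> \<omega>))\<^sup>2) = u \<bullet> (\<Sigma> *v u)"
proof -
  have sq: "(u \<bullet> c)\<^sup>2 = (\<Sum>i\<in>UNIV. \<Sum>j\<in>UNIV. (u $ i * u $ j) * (c $ i * c $ j))" for c :: "real ^ 'n"
    by (simp add: inner_vec_def power2_eq_square sum_product ac_simps)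
  show "integrable M (\<lambda>\<omega>. (u \<bullet> D (\<theta> \<tau> \<omega>))\<^sup>2)"
    unfolding sq by (intro Bochner_Integration.integrable_sum integrable_mult_right integrable_D)
  show "expectation (\<lambda>\<omega>. (u \<bullet> D (\<theta> \<tau> \<omega>))\<^sup>2) = u \<bullet> (\<Sigma> *v u)"
    unfolding sq quadratic_form_sum
    by (simp add: Bochner_Integration.integral_sum Bochner_Integration.integrable_sum integrable_D(2) Sigma_component[of _ _ \<tau>] ac_simps)
qed

lemma psd_Sigma: "psd \<Sigma>"
  unfolding psd_def
proof (intro conjI allI)
  show "transpose \<Sigma> = \<Sigma>" by (simp add: vec_eq_iff transpose_def Sigma_component[of _ _ 0] mult.commute)
  show "0 \<le> u \<bullet> (\<Sigma> *v u)" for u unfolding expectation_D_inner_squared(2)[of u 0, symmetric] by simp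
qed

text \<open>Up to sign and the factor \<open>sqrt t\<close>, the vector \<open>X G\<close> is the sample mean of the influence function.\<close>

lemma sample_mean_D: "sample_mean t (\<lambda>\<tau>. D (\<theta> \<tau> \<omega>)) = - (X *v (sample_mean t (\<lambda>\<tau>. m0 (\<theta> \<tau> \<omega>)) - \<mu>))" if "0 < t"
proof -
  have lin: "linear ((*v) X)" by (rule matrix_vector_mul_linear)
  have "(\<Sum>\<tau><t. D (\<theta> \<tau> \<omega>)) = - (X *v (\<Sum>\<tau><t. m0 (\<theta> \<tau> \<omega>) - \<mu>))"
    unfolding D_eq sum_negf linear_sum[OF lin] ..
  also have "(\<Sum>\<tau><t. m0 (\<theta> \<tau> \<omega>) - \<mu>) = real t *\<^sub>R (sample_mean t (\<lambda>\<tau>. m0 (\<theta> \<tau> \<omega>)) - \<mu>)"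
    using that by (simp add: sample_mean_def sum_subtractf scaleR_diff_right sum_constant_scaleR del: sum_constant)
  finally show ?thesis using that by (simp add: sample_mean_def matrix_vector_mult_scaleR)
qed

end

context fppe_observations begin

definition Dhat :: "nat \<times> 'w \<Rightarrow> nat \<Rightarrow> real ^ 'n" where
  "Dhat z \<tau> = hat_D_beta b v (\<epsilon> (fst z)) (fst z) (\<lambda>\<tau>. \<theta> \<tau> (snd z)) (\<beta> (fst z) (snd z)) (x (fst z) (snd z)) \<tau>"
definition Drhat :: "nat \<times> 'w \<Rightarrow> nat \<Rightarrow> real" where
  "Drhat z \<tau> = hat_D_rev b v (\<epsilon> (fst z)) (fst z) (\<lambda>\<tau>. \<theta> \<tau> (snd z)) (\<beta> (fst z) (snd z)) (p (fst z) (snd z)) (x (fst z) (snd z)) \<tau>"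

lemma Dhat_eq: "Dhat z \<tau> = - (Xhat (fst z) (snd z) *v (m (fst z) (snd z) \<tau> - \<mu>' (fst z) (snd z)))"
  by (simp add: Dhat_def hat_D_beta_def Xhat_def Hhat_def m_def \<mu>'_def)

lemma Drhat_eq: "Drhat z \<tau> = p (fst z) (snd z) \<tau> - sample_mean (fst z) (p (fst z) (snd z)) + \<mu>' (fst z) (snd z) \<bullet> Dhat z \<tau>"
  by (simp add: Drhat_def hat_D_rev_def Dhat_def \<mu>'_def)

text \<open>This is \<open>allocations_close\<close>, supplemented by a common bound.\<close>

lemma mean_close_m: "mean_close (\<lambda>z \<tau>. m (fst z) (snd z) \<tau> $ i) (\<lambda>z \<tau>. m0 (\<theta> \<tau> (snd z)) $ i)"
proof (rule mean_closeI[OF _ allocations_close[of i]])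
  have CL: "C \<le> L"
  proof -
    have "1 * C \<le> real CARD('n) * C" using C(1) by (intro mult_right_mono) (auto simp: Suc_leI)
    then show ?thesis by (simp add: L_def)
  qed
  show "\<forall>\<^sub>F z in in_prob M. \<forall>\<tau><fst z. \<bar>m (fst z) (snd z) \<tau> $ i\<bar> \<le> L \<and> \<bar>m0 (\<theta> \<tau> (snd z)) $ i\<bar> \<le> L"
    using eventually_typical
  proof eventually_elim
    case (elim z)
    show ?case
    proof (intro allI impI conjI)
      fix \<tau> assume t: "\<tau> < fst z"
      show "\<bar>m (fst z) (snd z) \<tau> $ i\<bar> \<le> L" using typical_allocation(3,4)[OF elim t, of i] CL by simp
      have "good (\<theta> \<tau> (snd z))" using elim by (simp add: typical_def)
      then show "\<bar>m0 (\<theta> \<tau> (snd z)) $ i\<bar> \<le> L" using good_bounds(2) component_le_norm_cart order_trans by blast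
    qed
  qed
qed simp

text \<open>The estimated influence function is a polynomial in quantities that are close to or converge to their limits.\<close>

lemma mean_close_Dhat: "mean_close (\<lambda>z \<tau>. Dhat z \<tau> $ i) (\<lambda>z \<tau>. D (\<theta> \<tau> (snd z)) $ i)"
proof -
  have "mean_close (\<lambda>z \<tau>. \<Sum>j\<in>UNIV. (- Xhat (fst z) (snd z) $ i $ j) * (m (fst z) (snd z) \<tau> $ j - \<mu>' (fst z) (snd z) $ j))
     (\<lambda>z \<tau>. \<Sum>j\<in>UNIV. (- X $ i $ j) * (m0 (\<theta> \<tau> (snd z)) $ j - \<mu> $ j))"
    by (intro mean_close_sum finite_class.finite_UNIV mean_close_mult mean_close_diff mean_close_m mean_close_const \<mu>'_tendsto tendsto_minus tendsto_vec_nth Xhat_tendsto)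
  then show ?thesis by (simp add: Dhat_eq D_comp matrix_vector_mult_def sum_negf)
qed

text \<open>The highest bid is Lipschitz in the multipliers, uniformly over the items.\<close>

lemma mean_close_p: "mean_close (\<lambda>z \<tau>. p (fst z) (snd z) \<tau>) (\<lambda>z \<tau>. p0 (\<theta> \<tau> (snd z)))"
proof (rule mean_closeI[where c = "\<lambda>z. norm (\<Delta> (fst z) (snd z)) * L" and B = "(norm \<beta>0 + 1) * L"])
  have "((\<lambda>z. norm (\<Delta> (fst z) (snd z)) * L) \<longlongrightarrow> 0 * L) (in_prob M)"
    by (intro tendsto_mult tendsto_const tendsto_norm_zero \<Delta>_tendsto)
  then show "((\<lambda>z. norm (\<Delta> (fst z) (snd z)) * L) \<longlongrightarrow> 0) (in_prob M)" by simp
  have n1: "\<forall>\<^sub>F z in in_prob M. norm (\<Delta> (fst z) (snd z)) < 1"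
    by (rule order_tendstoD(2)[OF tendsto_norm_zero[OF \<Delta>_tendsto]]) simp
  show "\<forall>\<^sub>F z in in_prob M. \<forall>\<tau><fst z. \<bar>p (fst z) (snd z) \<tau>\<bar> \<le> (norm \<beta>0 + 1) * L \<and> \<bar>p0 (\<theta> \<tau> (snd z))\<bar> \<le> (norm \<beta>0 + 1) * L"
    using n1 eventually_typical
  proof eventually_elim
    case (elim z)
    show ?case
    proof (intro allI impI conjI)
      fix \<tau> assume t: "\<tau> < fst z"
      have g: "good (\<theta> \<tau> (snd z))" using elim by (simp add: typical_def)
      have nb: "norm (\<beta> (fst z) (snd z)) \<le> norm \<beta>0 + 1"
        using elim(1) norm_triangle_sub[of "\<beta> (fst z) (snd z)" \<beta>0] by (simp add: \<Delta>_def)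
      have "norm (\<beta> (fst z) (snd z)) * L \<le> (norm \<beta>0 + 1) * L" "norm \<beta>0 * L \<le> (norm \<beta>0 + 1) * L"
        using nb L_pos by (auto intro!: mult_right_mono)
      then show "\<bar>p (fst z) (snd z) \<tau>\<bar> \<le> (norm \<beta>0 + 1) * L" "\<bar>p0 (\<theta> \<tau> (snd z))\<bar> \<le> (norm \<beta>0 + 1) * L"
        using top_bound[OF g, of "\<beta> (fst z) (snd z)"] top_bound[OF g, of \<beta>0] typical_allocation(5)[OF elim(2) t] g
        by (auto simp: good_def)
    qed
  qed
  show "\<forall>\<^sub>F z in in_prob M. sample_mean (fst z) (\<lambda>\<tau>. \<bar>p (fst z) (snd z) \<tau> - p0 (\<theta> \<tau> (snd z))\<bar>) \<le> norm (\<Delta> (fst z) (snd z)) * L"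
    using eventually_typical
  proof eventually_elim
    case (elim z)
    have "sample_mean (fst z) (\<lambda>\<tau>. \<bar>p (fst z) (snd z) \<tau> - p0 (\<theta> \<tau> (snd z))\<bar>) \<le> sample_mean (fst z) (\<lambda>\<tau>. norm (\<Delta> (fst z) (snd z)) * L)"
    proof (rule sample_mean_mono)
      fix \<tau> assume t: "\<tau> < fst z"
      have g: "good (\<theta> \<tau> (snd z))" using elim by (simp add: typical_def)
      have "\<bar>p (fst z) (snd z) \<tau> - p0 (\<theta> \<tau> (snd z))\<bar> \<le> norm (\<Delta> (fst z) (snd z)) * norm (v (\<theta> \<tau> (snd z)))"
        using top_bid_lipschitz[of "\<beta> (fst z) (snd z)" "v (\<theta> \<tau> (snd z))" \<beta>0] typical_allocation(5)[OF elim t] g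
        by (simp add: good_def \<Delta>_def)
      also have "\<dots> \<le> norm (\<Delta> (fst z) (snd z)) * L" using good_bounds(1)[OF g] by (intro mult_left_mono) auto
      finally show "\<bar>p (fst z) (snd z) \<tau> - p0 (\<theta> \<tau> (snd z))\<bar> \<le> norm (\<Delta> (fst z) (snd z)) * L" .
    qed
    also have "\<dots> = norm (\<Delta> (fst z) (snd z)) * L" using elim by (intro sample_mean_const) (simp add: typical_def)
    finally show ?case .
  qed
qed

lemma REV_tendsto: "((\<lambda>z. sample_mean (fst z) (p (fst z) (snd z))) \<longlongrightarrow> REV) (in_prob M)"
proof (rule mean_close_limit[OF mean_close_p])
  show "((\<lambda>z. sample_mean (fst z) (\<lambda>\<tau>. p0 (\<theta> \<tau> (snd z)))) \<longlongrightarrow> REV) (in_prob M)"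
    unfolding REV_eq[of 0, symmetric]
  proof (rule law_of_large_numbers[OF measurable_p0])
    show "\<bar>p0 y\<bar> \<le> norm \<beta>0 * L" if "good y" for y using top_bound[OF that, of \<beta>0] that by (simp add: good_def)
  qed
qed

lemma mean_close_Drhat: "mean_close Drhat (\<lambda>z \<tau>. Dr (\<theta> \<tau> (snd z)))"
proof -
  have "mean_close (\<lambda>z \<tau>. p (fst z) (snd z) \<tau> - sample_mean (fst z) (p (fst z) (snd z)) + (\<Sum>i\<in>UNIV. \<mu>' (fst z) (snd z) $ i * Dhat z \<tau> $ i))
     (\<lambda>z \<tau>. p0 (\<theta> \<tau> (snd z)) - REV + (\<Sum>i\<in>UNIV. \<mu> $ i * D (\<theta> \<tau> (snd z)) $ i))"
    by (intro mean_close_add mean_close_diff mean_close_sum finite_class.finite_UNIV mean_close_mult mean_close_p mean_close_const REV_tendsto \<mu>'_tendsto mean_close_Dhat)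
  then show ?thesis by (simp add: Drhat_eq[abs_def] Dr_eq inner_vec_def)
qed

definition Shat :: "nat \<Rightarrow> 'w \<Rightarrow> real ^ 'n ^ 'n" where
  "Shat t \<omega> = hat_Sigma_beta b v (\<epsilon> t) t (\<lambda>\<tau>. \<theta> \<tau> \<omega>) (\<beta> t \<omega>) (x t \<omega>)"
definition shat :: "nat \<Rightarrow> 'w \<Rightarrow> real" where
  "shat t \<omega> = hat_sigma2_rev b v (\<epsilon> t) t (\<lambda>\<tau>. \<theta> \<tau> \<omega>) (\<beta> t \<omega>) (p t \<omega>) (x t \<omega>)"

lemma Shat_component: "Shat t \<omega> $ i $ j = sample_mean t (\<lambda>\<tau>. Dhat (t, \<omega>) \<tau> $ i * Dhat (t, \<omega>) \<tau> $ j)"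
  by (simp add: Shat_def hat_Sigma_beta_def Dhat_def sample_mean_def outer_def)

lemma shat_eq: "shat t \<omega> = sample_mean t (\<lambda>\<tau>. Drhat (t, \<omega>) \<tau> * Drhat (t, \<omega>) \<tau>)"
  by (simp add: shat_def hat_sigma2_rev_def Drhat_def power2_eq_square)

lemma Shat_tendsto: "((\<lambda>z. Shat (fst z) (snd z)) \<longlongrightarrow> \<Sigma>) (in_prob M)"
proof (intro vec_tendstoI)
  fix i j
  have "((\<lambda>z. sample_mean (fst z) (\<lambda>\<tau>. D (\<theta> \<tau> (snd z)) $ i * D (\<theta> \<tau> (snd z)) $ j)) \<longlongrightarrow> \<Sigma> $ i $ j) (in_prob M)"
    unfolding Sigma_component[of i j 0]
    by (rule law_of_large_numbers[where g = "\<lambda>y. D y $ i * D y $ j", OF _ D_bound_mult]) measurable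
  from mean_close_limit[OF mean_close_mult[OF mean_close_Dhat mean_close_Dhat] this]
  show "((\<lambda>z. Shat (fst z) (snd z) $ i $ j) \<longlongrightarrow> \<Sigma> $ i $ j) (in_prob M)"
    by (simp add: Shat_component)
qed

lemma shat_tendsto: "((\<lambda>z. shat (fst z) (snd z)) \<longlongrightarrow> \<sigma>2) (in_prob M)"
proof -
  have "((\<lambda>z. sample_mean (fst z) (\<lambda>\<tau>. Dr (\<theta> \<tau> (snd z)) * Dr (\<theta> \<tau> (snd z)))) \<longlongrightarrow> \<sigma>2) (in_prob M)"
    unfolding sigma2_eq[of 0] power2_eq_square
  proof (rule law_of_large_numbers[where g = "\<lambda>y. Dr y * Dr y" and K = "KR * KR"])
    show "\<bar>Dr y * Dr y\<bar> \<le> KR * KR" if "good y" for y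
      unfolding abs_mult using Dr_bound[OF that] by (intro mult_mono) (auto intro: order_trans[OF abs_ge_zero])
  qed measurable
  from mean_close_limit[OF mean_close_mult[OF mean_close_Drhat mean_close_Drhat] this] show ?thesis by (simp add: shat_eq)
qed

section \<open>Asymptotic linearity of the revenue\<close>

text \<open>Summing \<open>p = p0 + m0 \<bullet> \<Delta> + R \<Delta>\<close> over the sample, the remainder contributes \<open>Q1 h / t\<close>, which is
  negligible against \<open>1 / sqrt t\<close>; the linear term is \<open>\<mu> \<bullet> \<Delta>\<close> up to a product of two small factors, and \<open>\<Delta>\<close>
  is replaced by its expansion.\<close>

lemma revenue_asymptotically_linear:
  "((\<lambda>z. sqrt (real (fst z)) * (sample_mean (fst z) (p (fst z) (snd z)) - REV)
       - sqrt (real (fst z)) * sample_mean (fst z) (\<lambda>\<tau>. Dr (\<theta> \<tau> (snd z)))) \<longlongrightarrow> 0) (in_prob M)"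
proof (rule tendsto_in_probI_F)
  fix K :: real assume K: "0 < K"
  obtain B where B: "0 < B" "\<And>k. norm k \<le> K / c0 \<Longrightarrow> \<bar>q k\<bar> \<le> B" using q_bounded by metis
  \<comment> \<open>the three error terms: the fluctuation of the slope, the linearisation of \<open>h\<close>, and the remainder\<close>
  let ?r = "\<lambda>z. (\<Sum>i\<in>UNIV. (mbar (fst z) (snd z) $ i - \<mu> $ i) * h (fst z) (snd z) $ i)
      + \<mu> \<bullet> (h (fst z) (snd z) + X *v G (fst z) (snd z)) + 1 / sqrt (real (fst z)) * Q1 (fst z) (snd z) (h (fst z) (snd z))"
  have "(?r \<longlongrightarrow> (\<Sum>i\<in>(UNIV::'n set). 0) + \<mu> \<bullet> 0 + 0) (F K)"
  proof (intro tendsto_add tendsto_sum tendsto_inner tendsto_const)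
    show "((\<lambda>z. h (fst z) (snd z) + X *v G (fst z) (snd z)) \<longlongrightarrow> 0) (F K)" by (rule tendsto_F[OF asymptotically_linear])
    show "((\<lambda>z. (mbar (fst z) (snd z) $ i - \<mu> $ i) * h (fst z) (snd z) $ i) \<longlongrightarrow> 0) (F K)" for i
      by (rule tendsto_zero_mult_bounded[OF _ F_h_comp]) (rule tendsto_F, rule Lim_null[THEN iffD1], rule mbar_tendsto)
    have "\<forall>\<^sub>F z in F K. \<bar>Q1 (fst z) (snd z) (h (fst z) (snd z))\<bar> \<le> B + 1"
      using F_h eventually_F[OF Q1_uniform[OF zero_less_one, of "K / c0"]]
    proof eventually_elim
      case (elim z)
      show ?case using elim(2)[rule_format, OF elim(1)] B(2)[OF elim(1)] by linarith
    qed
    then show "((\<lambda>z. 1 / sqrt (real (fst z)) * Q1 (fst z) (snd z) (h (fst z) (snd z))) \<longlongrightarrow> 0) (F K)"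
      by (rule tendsto_zero_mult_bounded[OF tendsto_F[OF sqrt_fst]])
  qed
  then have "(?r \<longlongrightarrow> 0) (F K)" by simp
  then show "((\<lambda>z. sqrt (real (fst z)) * (sample_mean (fst z) (p (fst z) (snd z)) - REV)
       - sqrt (real (fst z)) * sample_mean (fst z) (\<lambda>\<tau>. Dr (\<theta> \<tau> (snd z)))) \<longlongrightarrow> 0) (F K)"
  proof (rule Lim_transform_eventually)
    show "\<forall>\<^sub>F z in F K. ?r z = sqrt (real (fst z)) * (sample_mean (fst z) (p (fst z) (snd z)) - REV)
       - sqrt (real (fst z)) * sample_mean (fst z) (\<lambda>\<tau>. Dr (\<theta> \<tau> (snd z)))"
      using eventually_F[OF eventually_typical]
    proof eventually_elim
      case (elim z)
      obtain t \<omega> where z: "z = (t, \<omega>)" by (cases z)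
      have typical: "typical t \<omega>" using elim z by simp
      have t: "1 \<le> t" using typical by (simp add: typical_def)
      let ?P = "sample_mean t (\<lambda>\<tau>. p0 (\<theta> \<tau> \<omega>))"
      have "sample_mean t (p t \<omega>) = sample_mean t (\<lambda>\<tau>. p0 (\<theta> \<tau> \<omega>) + m0 (\<theta> \<tau> \<omega>) \<bullet> \<Delta> t \<omega> + R (\<theta> \<tau> \<omega>) (\<Delta> t \<omega>))"
      proof (rule sample_mean_cong)
        fix \<tau> assume "\<tau> < t"
        then have "p t \<omega> \<tau> = top_bid (\<beta> t \<omega>) (v (\<theta> \<tau> \<omega>))" by (rule typical_allocation(5)[OF typical])
        moreover have "p0 (\<theta> \<tau> \<omega>) = top_bid \<beta>0 (v (\<theta> \<tau> \<omega>))" using typical by (simp add: typical_def good_def)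
        ultimately show "p t \<omega> \<tau> = p0 (\<theta> \<tau> \<omega>) + m0 (\<theta> \<tau> \<omega>) \<bullet> \<Delta> t \<omega> + R (\<theta> \<tau> \<omega>) (\<Delta> t \<omega>)"
          by (simp add: R_def \<Delta>_def)
      qed
      also have "\<dots> = ?P + mbar t \<omega> \<bullet> \<Delta> t \<omega> + Q1 t \<omega> (h t \<omega>) / t"
        using Q1_eq[OF t, of \<omega> "h t \<omega>"] t by (simp add: sample_mean_add sample_mean_inner[symmetric] mbar_def h_def)
      finally have 1: "sample_mean t (p t \<omega>) = ?P + mbar t \<omega> \<bullet> \<Delta> t \<omega> + Q1 t \<omega> (h t \<omega>) / t" .
      have "sample_mean t (\<lambda>\<tau>. Dr (\<theta> \<tau> \<omega>)) = sample_mean t (\<lambda>\<tau>. p0 (\<theta> \<tau> \<omega>) - REV + D (\<theta> \<tau> \<omega>) \<bullet> \<mu>)"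
        by (simp add: Dr_eq inner_commute)
      also have "\<dots> = ?P - REV + \<mu> \<bullet> (- (X *v (mbar t \<omega> - \<mu>)))"
      proof -
        have "sample_mean t (\<lambda>\<tau>. D (\<theta> \<tau> \<omega>) \<bullet> \<mu>) = - (X *v (mbar t \<omega> - \<mu>)) \<bullet> \<mu>"
          unfolding sample_mean_inner[symmetric] mbar_def using sample_mean_D[of t \<omega>] t by simp
        then show ?thesis
          using t unfolding sample_mean_add sample_mean_diff by (simp add: sample_mean_const inner_commute)
      qed
      finally have 2: "sample_mean t (\<lambda>\<tau>. Dr (\<theta> \<tau> \<omega>)) = ?P - REV - \<mu> \<bullet> (X *v (mbar t \<omega> - \<mu>))" by simp
      have s: "sqrt t * (Q1 t \<omega> (h t \<omega>) / t) = 1 / sqrt t * Q1 t \<omega> (h t \<omega>)"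
      proof -
        have "r * (c / (r * r)) = 1 / r * c" if "r \<noteq> 0" for r c :: real using that by simp
        from this[of "sqrt t" "Q1 t \<omega> (h t \<omega>)"] show ?thesis using t by simp
      qed
      have XG: "X *v G t \<omega> = sqrt t *\<^sub>R (X *v (mbar t \<omega> - \<mu>))" by (simp add: G_def matrix_vector_mult_scaleR)
      have "(\<Sum>i\<in>UNIV. (mbar t \<omega> $ i - \<mu> $ i) * h t \<omega> $ i) = (mbar t \<omega> - \<mu>) \<bullet> h t \<omega>" by (simp add: inner_vec_def)
      also have "\<dots> = sqrt t * (mbar t \<omega> \<bullet> \<Delta> t \<omega> - \<mu> \<bullet> \<Delta> t \<omega>)" by (simp add: h_def inner_diff_left)
      finally have 3: "(\<Sum>i\<in>UNIV. (mbar t \<omega> $ i - \<mu> $ i) * h t \<omega> $ i) = \<dots>" .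
      have 4: "\<mu> \<bullet> (h t \<omega> + sqrt t *\<^sub>R (X *v (mbar t \<omega> - \<mu>))) = sqrt t * (\<mu> \<bullet> \<Delta> t \<omega>) + sqrt t * (\<mu> \<bullet> (X *v (mbar t \<omega> - \<mu>)))"
        by (simp add: h_def inner_add_right)
      have collect: "r * (B - c) + (r * c + r * e) + r * w = r * (l + B + w - d) - r * (l - d - e)" for r B c e w l d :: real
        by (simp add: algebra_simps)
      show ?case unfolding z fst_conv snd_conv XG 1 2 3 4 s[symmetric] by (rule collect)
    qed
  qed
qed

end

section \<open>Measurability of the estimators\<close>

lemma continuous_on_matrix_mult:
  fixes X Y :: "'c::topological_space \<Rightarrow> real ^ 'n ^ 'n"
  assumes "continuous_on S X" "continuous_on S Y" shows "continuous_on S (\<lambda>z. X z ** Y z)"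
  using assms unfolding continuous_on_def by (auto intro: tendsto_matrix_mult)

lemma continuous_on_matrix_vector_mult:
  fixes X :: "'c::topological_space \<Rightarrow> real ^ 'n ^ 'n"
  assumes "continuous_on S X" "continuous_on S y" shows "continuous_on S (\<lambda>z. X z *v y z)"
  using assms unfolding continuous_on_def by (auto intro: tendsto_matrix_vector_mult)

lemma continuous_on_transpose:
  fixes X :: "'c::topological_space \<Rightarrow> real ^ 'n ^ 'n"
  assumes "continuous_on S X" shows "continuous_on S (\<lambda>z. transpose (X z))"
proof -
  have "((\<lambda>z. transpose (X z)) \<longlongrightarrow> transpose (X c)) (at c within S)" if "c \<in> S" for c
  proof (intro vec_tendstoI)
    fix i j
    have "(X \<longlongrightarrow> X c) (at c within S)" using assms that by (simp add: continuous_on_def)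
    then show "((\<lambda>z. transpose (X z) $ i $ j) \<longlongrightarrow> transpose (X c) $ i $ j) (at c within S)"
      by (simp add: transpose_def tendsto_vec_nth)
  qed
  then show ?thesis by (simp add: continuous_on_def)
qed

lemmas continuous_matrix_intros =
  continuous_on_matrix_mult continuous_on_matrix_vector_mult continuous_on_transpose
  continuous_on_fst continuous_on_snd continuous_on_id

text \<open>The graph of the pseudo-inverse is closed where it is given by the Penrose equations, that is, on symmetric
  matrices. Composing with the symmetrisation extends the statement to a map on all matrices.\<close>

lemma borel_measurable_pinv_symmetric:
  "(\<lambda>S. pinv ((1 / 2) *\<^sub>R (S + transpose S))) \<in> borel_measurable (borel :: (real ^ 'n ^ 'n) measure)"
proof (rule borel_measurable_closed_graph)
  let ?s = "\<lambda>z :: (real ^ 'n ^ 'n) \<times> (real ^ 'n ^ 'n). (1 / 2) *\<^sub>R (fst z + transpose (fst z))"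
  have sym: "transpose (?s z) = ?s z" for z by (simp add: transpose_def vec_eq_iff add.commute)
  have "snd z = pinv (?s z) \<longleftrightarrow> penrose (?s z) (snd z)" for z
    using penrose_pinv_symmetric[OF sym[of z]] pinv_eqI by metis
  then have eq: "{z. snd z = pinv (?s z)} =
      {z. ?s z ** snd z ** ?s z = ?s z} \<inter> {z. snd z ** ?s z ** snd z = snd z} \<inter>
      {z. transpose (?s z ** snd z) = ?s z ** snd z} \<inter> {z. transpose (snd z ** ?s z) = snd z ** ?s z}"
    unfolding penrose_def by blast
  have c: "continuous_on UNIV ?s"
    by (intro continuous_on_scaleR continuous_on_const continuous_on_add continuous_matrix_intros)
  show "closed {z. snd z = pinv (?s z)}"
    unfolding eq by (intro closed_Int closed_Collect_eq continuous_matrix_intros c)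
qed

lemma closed_psd: "closed {S :: real ^ 'n ^ 'n. psd S}"
proof -
  have eq: "{S :: real ^ 'n ^ 'n. psd S} = {S. transpose S = S} \<inter> (\<Inter>u. {S. 0 \<le> u \<bullet> (S *v u)})"
    by (auto simp: psd_def)
  show ?thesis unfolding eq
    by (intro closed_Int closed_INT ballI closed_Collect_eq closed_Collect_le continuous_matrix_intros continuous_on_inner continuous_on_const)
qed

text \<open>The square root is eliminated by a quantifier over pairs of a root \<open>T\<close> and a point \<open>u\<close> of the ball; the event is the
  projection of the closed set of solutions.\<close>

lemma borel_ellipsoid_membership:
  "{w :: (real ^ 'n) \<times> (real ^ 'n ^ 'n). psd (snd w) \<and> c \<in> (\<lambda>u. fst w + r *\<^sub>R (psd_sqrt (snd w) *v u)) ` cball 0 1} \<in> sets borel"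
proof -
  let ?C = "{((y, S), (T, u)) :: ((real ^ 'n) \<times> (real ^ 'n ^ 'n)) \<times> ((real ^ 'n ^ 'n) \<times> (real ^ 'n)) | y S T u.
     psd T \<and> T ** T = S \<and> norm u \<le> 1 \<and> c = y + r *\<^sub>R (T *v u)}"
  have C: "?C = {z. psd (fst (snd z))} \<inter> {z. fst (snd z) ** fst (snd z) = snd (fst z)} \<inter> {z. norm (snd (snd z)) \<le> 1}
     \<inter> {z. c = fst (fst z) + r *\<^sub>R (fst (snd z) *v snd (snd z))}" by force
  have "closed ((\<lambda>z. fst (snd z)) -` {S :: real ^ 'n ^ 'n. psd S} :: (((real ^ 'n) \<times> (real ^ 'n ^ 'n)) \<times> ((real ^ 'n ^ 'n) \<times> (real ^ 'n))) set)"
    by (intro continuous_closed_vimage closed_psd) (intro continuous_intros)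
  then have "closed {z :: ((real ^ 'n) \<times> (real ^ 'n ^ 'n)) \<times> ((real ^ 'n ^ 'n) \<times> (real ^ 'n)). psd (fst (snd z))}"
    by (simp add: vimage_def)
  then have "closed ?C"
    unfolding C by (intro closed_Int closed_Collect_eq closed_Collect_le continuous_matrix_intros continuous_on_norm continuous_on_const continuous_on_add continuous_on_scaleR)
  from closed_projection_borel[OF this] have "fst ` ?C \<in> sets borel" .
  also have "fst ` ?C = {w. psd (snd w) \<and> c \<in> (\<lambda>u. fst w + r *\<^sub>R (psd_sqrt (snd w) *v u)) ` cball 0 1}"
  proof (intro set_eqI iffI)
    fix w assume "w \<in> fst ` ?C"
    then obtain y S T u where w: "w = (y, S)" "psd T" "T ** T = S" "norm u \<le> 1" "c = y + r *\<^sub>R (T *v u)" by auto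
    have "u' \<bullet> (S *v u') = (T *v u') \<bullet> (T *v u')" for u'
      using w(2,3) symmetric_inner[of T u' "T *v u'"] by (auto simp: psd_def matrix_vector_mul_assoc[symmetric])
    then have "psd S" using w(2,3) by (auto simp: psd_def matrix_transpose_mul)
    moreover from this have "psd_sqrt S = T" using psd_sqrt_exists_unique psd_sqrt w(2,3) by metis
    ultimately show "w \<in> {w. psd (snd w) \<and> c \<in> (\<lambda>u. fst w + r *\<^sub>R (psd_sqrt (snd w) *v u)) ` cball 0 1}"
      using w by (auto intro!: image_eqI[of _ _ u])
  next
    fix w assume "w \<in> {w. psd (snd w) \<and> c \<in> (\<lambda>u. fst w + r *\<^sub>R (psd_sqrt (snd w) *v u)) ` cball 0 1}"
    then obtain u where u: "psd (snd w)" "norm u \<le> 1" "c = fst w + r *\<^sub>R (psd_sqrt (snd w) *v u)" by auto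
    then have "(w, (psd_sqrt (snd w), u)) \<in> ?C" using psd_sqrt[OF u(1)] by (cases w) auto
    then show "w \<in> fst ` ?C" by force
  qed
  finally show ?thesis .
qed

context fppe_observations begin

lemma measurable_x: "\<tau> < t \<Longrightarrow> (\<lambda>\<omega>. x t \<omega> \<tau> $ i) \<in> borel_measurable M"
  using borel_measurable_vec_nth[OF measurable_alloc] by blast

lemma measurable_v\<theta>: "(\<lambda>\<omega>. v (\<theta> \<tau> \<omega>)) \<in> borel_measurable M" by measurable

lemma measurable_v\<theta>_nth: "(\<lambda>\<omega>. v (\<theta> \<tau> \<omega>) $ i) \<in> borel_measurable M"
  by (rule borel_measurable_vec_nth[OF measurable_v\<theta>])

lemma measurable_m: "\<tau> < t \<Longrightarrow> (\<lambda>\<omega>. m t \<omega> \<tau> $ i) \<in> borel_measurable M"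
  using measurable_x[of \<tau> t i] measurable_v\<theta>_nth[of \<tau> i] by (simp add: m_def)

lemma measurable_sample_mean:
  fixes g :: "nat \<Rightarrow> 'w \<Rightarrow> real"
  assumes "\<And>\<tau>. \<tau> < t \<Longrightarrow> g \<tau> \<in> borel_measurable M"
  shows "(\<lambda>\<omega>. sample_mean t (\<lambda>\<tau>. g \<tau> \<omega>)) \<in> borel_measurable M"
  unfolding sample_mean_real by (intro borel_measurable_divide borel_measurable_sum borel_measurable_const) (use assms in auto)

lemma measurable_\<mu>': "(\<lambda>\<omega>. \<mu>' t \<omega> $ i) \<in> borel_measurable M"
  unfolding \<mu>'_eq sample_mean_nth by (rule measurable_sample_mean) (rule measurable_m)

lemma transpose_Hhat: "transpose (Hhat t \<omega>) = Hhat t \<omega>"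
proof -
  have "fdH t \<omega> $ i $ j = fdH t \<omega> $ j $ i" for i j
    by (simp add: fdH_def fd_hessian_def algebra_simps)
  then show ?thesis
    by (simp add: vec_eq_iff transpose_def Hhat_def hat_hessian_B_def Let_def diag_mat_mult fdH_def[symmetric])
qed

lemma measurable_Hhat: assumes "1 \<le> t" shows "Hhat t \<in> borel_measurable M"
proof (rule borel_measurable_matI)
  fix i j
  have \<beta>[measurable]: "\<beta> t \<in> borel_measurable M" by (rule measurable_beta[OF assms])
  have \<beta>i[measurable]: "(\<lambda>\<omega>. \<beta> t \<omega> $ i) \<in> borel_measurable M" for i by (rule borel_measurable_vec_nth[OF \<beta>])
  have [measurable]: "(\<lambda>\<omega>. v (\<theta> \<tau> \<omega>)) \<in> borel_measurable M" for \<tau> by (rule measurable_v\<theta>)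
  have S: "(\<lambda>\<omega>. sample_dual_obj b v t (\<lambda>\<tau>. \<theta> \<tau> \<omega>) (y \<omega>)) \<in> borel_measurable M"
    if [measurable]: "y \<in> borel_measurable M" for y
  proof -
    have [measurable]: "(\<lambda>\<omega>. y \<omega> $ l) \<in> borel_measurable M" for l by (rule borel_measurable_vec_nth[OF that])
    show ?thesis unfolding sample_dual_obj_def sample_mean_def by measurable
  qed
  have fd: "(\<lambda>\<omega>. fdH t \<omega> $ i $ j) \<in> borel_measurable M" for i j
    unfolding fdH_def fd_hessian_def
    by (simp only: vec_lambda_beta) (intro borel_measurable_divide borel_measurable_add borel_measurable_diff borel_measurable_const S \<beta>)
  have ind: "(\<lambda>\<omega>. of_bool (\<beta> t \<omega> $ k < 1 - \<epsilon> t) :: real) \<in> borel_measurable M" for k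
    unfolding of_bool_def by measurable
  have "(\<lambda>\<omega>. Hhat t \<omega> $ i $ j) = (\<lambda>\<omega>. of_bool (\<beta> t \<omega> $ i < 1 - \<epsilon> t) * fdH t \<omega> $ i $ j * of_bool (\<beta> t \<omega> $ j < 1 - \<epsilon> t))"
    by (simp add: Hhat_def hat_hessian_B_def Let_def diag_mat_mult fdH_def)
  then show "(\<lambda>\<omega>. Hhat t \<omega> $ i $ j) \<in> borel_measurable M"
    by (simp only:) (intro borel_measurable_times ind fd)
qed

text \<open>The estimated Hessian is symmetric, so symmetrisation leaves it unchanged.\<close>

lemma measurable_Xhat: assumes "1 \<le> t" shows "(\<lambda>\<omega>. Xhat t \<omega> $ i $ j) \<in> borel_measurable M"
proof -
  have "(\<lambda>\<omega>. pinv ((1 / 2) *\<^sub>R (Hhat t \<omega> + transpose (Hhat t \<omega>)))) \<in> borel_measurable M"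
    by (rule measurable_compose[OF measurable_Hhat[OF assms] borel_measurable_pinv_symmetric])
  moreover have "(1 / 2) *\<^sub>R (Hhat t \<omega> + transpose (Hhat t \<omega>)) = Hhat t \<omega>" for \<omega>
    unfolding transpose_Hhat by (simp add: scaleR_2[symmetric])
  ultimately have "(\<lambda>\<omega>. Xhat t \<omega>) \<in> borel_measurable M" by (simp add: Xhat_def)
  then show ?thesis by (intro borel_measurable_vec_nth)
qed

lemma measurable_Dhat: assumes "\<tau> < t" shows "(\<lambda>\<omega>. Dhat (t, \<omega>) \<tau> $ i) \<in> borel_measurable M"
proof -
  have "(\<lambda>\<omega>. Dhat (t, \<omega>) \<tau> $ i) = (\<lambda>\<omega>. - (\<Sum>j\<in>UNIV. Xhat t \<omega> $ i $ j * (m t \<omega> \<tau> $ j - \<mu>' t \<omega> $ j)))"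
    by (simp add: Dhat_eq matrix_vector_mult_def)
  then show ?thesis
    using assms by (simp only:) (intro borel_measurable_uminus borel_measurable_sum borel_measurable_times
      borel_measurable_diff measurable_Xhat measurable_m measurable_\<mu>'; simp)
qed

lemma measurable_revenue: "(\<lambda>\<omega>. sample_mean t (p t \<omega>)) \<in> borel_measurable M"
  using measurable_sample_mean[of t "\<lambda>\<tau> \<omega>. p t \<omega> \<tau>"] measurable_price by simp

lemma measurable_Drhat: assumes "\<tau> < t" shows "(\<lambda>\<omega>. Drhat (t, \<omega>) \<tau>) \<in> borel_measurable M"
proof -
  have "(\<lambda>\<omega>. Drhat (t, \<omega>) \<tau>) = (\<lambda>\<omega>. p t \<omega> \<tau> - sample_mean t (p t \<omega>) + (\<Sum>i\<in>UNIV. \<mu>' t \<omega> $ i * Dhat (t, \<omega>) \<tau> $ i))"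
    by (simp add: Drhat_eq inner_vec_def)
  then show ?thesis
    using assms by (simp only:) (intro borel_measurable_add borel_measurable_sum borel_measurable_times
      borel_measurable_diff measurable_Dhat measurable_price measurable_\<mu>' measurable_revenue; simp)
qed

lemma measurable_Shat: "Shat t \<in> borel_measurable M"
  by (rule borel_measurable_matI, unfold Shat_component)
     (intro measurable_sample_mean borel_measurable_times measurable_Dhat)

lemma measurable_shat: "shat t \<in> borel_measurable M"
  unfolding shat_eq[abs_def] by (intro measurable_sample_mean borel_measurable_times measurable_Drhat)

lemma psd_Shat: "psd (Shat t \<omega>)"
  unfolding psd_def
proof (intro conjI allI)
  show "transpose (Shat t \<omega>) = Shat t \<omega>" by (simp add: vec_eq_iff transpose_def Shat_component mult.commute)
  fix u
  have "u \<bullet> (Shat t \<omega> *v u) = sample_mean t (\<lambda>\<tau>. (u \<bullet> Dhat (t, \<omega>) \<tau>)\<^sup>2)"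
  proof -
    have "u \<bullet> (Shat t \<omega> *v u) = (\<Sum>i\<in>UNIV. \<Sum>j\<in>UNIV. (\<Sum>\<tau><t. Dhat (t, \<omega>) \<tau> $ i * Dhat (t, \<omega>) \<tau> $ j * (u $ i * u $ j))) / t"
      by (simp add: quadratic_form_sum Shat_component sample_mean_real sum_divide_distrib sum_distrib_right)
    also have "\<dots> = (\<Sum>\<tau><t. (\<Sum>i\<in>UNIV. \<Sum>j\<in>UNIV. Dhat (t, \<omega>) \<tau> $ i * Dhat (t, \<omega>) \<tau> $ j * (u $ i * u $ j))) / t"
      by (subst sum.swap[of _ "{..<t}"]) (simp add: sum.swap[of _ "{..<t}"])
    also have "\<dots> = sample_mean t (\<lambda>\<tau>. (u \<bullet> Dhat (t, \<omega>) \<tau>)\<^sup>2)"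
      by (simp add: sample_mean_real inner_vec_def power2_eq_square sum_product ac_simps)
    finally show ?thesis .
  qed
  then show "0 \<le> u \<bullet> (Shat t \<omega> *v u)" by (simp add: sample_mean_real sum_nonneg)
qed

section \<open>Coverage of the confidence sets\<close>

lemma covariance_consistent: "tendsto_in_prob M Shat \<Sigma>"
  by (rule tendsto_in_probI[OF measurable_Shat Shat_tendsto])

lemma variance_consistent: "tendsto_in_prob M shat \<sigma>2"
  by (rule tendsto_in_probI[OF measurable_shat shat_tendsto])

text \<open>Both vectors are bounded under \<open>F K\<close>, so replacing first the matrix and then the vectors, one factor at a time, costs
  \<open>o(1)\<close>.\<close>

lemma quadratic_forms_close:
  assumes B: "((\<lambda>z. B z) \<longlongrightarrow> B0) (in_prob M)"
  shows "((\<lambda>z. h (fst z) (snd z) \<bullet> (B z *v h (fst z) (snd z))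
     - (- (X *v G (fst z) (snd z))) \<bullet> (B0 *v (- (X *v G (fst z) (snd z))))) \<longlongrightarrow> 0) (in_prob M)"
proof (rule tendsto_in_probI_F)
  fix K :: real assume "0 < K"
  let ?h = "\<lambda>z. h (fst z) (snd z)" and ?g = "\<lambda>z. - (X *v G (fst z) (snd z))"
  have d: "((\<lambda>z. ?h z $ i - ?g z $ i) \<longlongrightarrow> 0) (F K)" for i
    using tendsto_vec_nth[OF tendsto_F[OF asymptotically_linear, where K = K], of i] by simp
  have gb: "\<forall>\<^sub>F z in F K. \<bar>?g z $ i\<bar> \<le> K / c0 + 1" for i
    using F_h_comp[where i = i and K = K] tendstoD[OF d[of i] zero_less_one] by eventually_elim (simp add: dist_real_def)
  have hb: "\<forall>\<^sub>F z in F K. \<bar>?h z $ i\<bar> \<le> K / c0" for i by (rule F_h_comp)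
  have summand: "((\<lambda>z. (B z $ i $ j - B0 $ i $ j) * (?h z $ i * ?h z $ j) + B0 $ i $ j * ((?h z $ i - ?g z $ i) * ?h z $ j)
     + B0 $ i $ j * ((?h z $ j - ?g z $ j) * ?g z $ i)) \<longlongrightarrow> 0 + B0 $ i $ j * 0 + B0 $ i $ j * 0) (F K)" for i j
  proof (intro tendsto_add tendsto_mult tendsto_const)
    have "((\<lambda>z. B z $ i $ j - B0 $ i $ j) \<longlongrightarrow> 0) (F K)"
      by (rule Lim_null[THEN iffD1]) (intro tendsto_vec_nth tendsto_F B)
    then show "((\<lambda>z. (B z $ i $ j - B0 $ i $ j) * (?h z $ i * ?h z $ j)) \<longlongrightarrow> 0) (F K)"
    proof (rule tendsto_zero_mult_bounded)
      show "\<forall>\<^sub>F z in F K. \<bar>?h z $ i * ?h z $ j\<bar> \<le> K / c0 * (K / c0)"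
        using hb[of i] hb[of j]
      proof eventually_elim
        case (elim z)
        then show ?case unfolding abs_mult by (intro mult_mono) (auto intro: order_trans[OF abs_ge_zero])
      qed
    qed
    show "((\<lambda>z. (?h z $ i - ?g z $ i) * ?h z $ j) \<longlongrightarrow> 0) (F K)" by (rule tendsto_zero_mult_bounded[OF d hb])
    show "((\<lambda>z. (?h z $ j - ?g z $ j) * ?g z $ i) \<longlongrightarrow> 0) (F K)" by (rule tendsto_zero_mult_bounded[OF d gb])
  qed
  have "((\<lambda>z. \<Sum>i\<in>UNIV. \<Sum>j\<in>UNIV. ((B z $ i $ j - B0 $ i $ j) * (?h z $ i * ?h z $ j) + B0 $ i $ j * ((?h z $ i - ?g z $ i) * ?h z $ j)
     + B0 $ i $ j * ((?h z $ j - ?g z $ j) * ?g z $ i))) \<longlongrightarrow> (\<Sum>i\<in>(UNIV :: 'n set). \<Sum>j\<in>(UNIV :: 'n set). 0)) (F K)"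
    by (intro tendsto_sum) (use summand in simp)
  note lim = this
  have eq: "(B z $ i $ j - B0 $ i $ j) * (?h z $ i * ?h z $ j) + B0 $ i $ j * ((?h z $ i - ?g z $ i) * ?h z $ j)
     + B0 $ i $ j * ((?h z $ j - ?g z $ j) * ?g z $ i) = B z $ i $ j * (?h z $ i * ?h z $ j) - B0 $ i $ j * (?g z $ i * ?g z $ j)" for z i j
    by (simp add: algebra_simps)
  show "((\<lambda>z. ?h z \<bullet> (B z *v ?h z) - ?g z \<bullet> (B0 *v ?g z)) \<longlongrightarrow> 0) (F K)"
    unfolding quadratic_form_sum sum_subtractf[symmetric] using lim by (simp only: eq sum.neutral_const)
qed

text \<open>By \<open>ellipsoid_membership\<close> the event is \<open>h \<bullet> Shat^-1 h \<le> q\<close>, where \<open>q\<close> is the quantile. This form differs by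
  \<open>o(1)\<close> from \<open>S = |W Z|\<^sup>2\<close>, where \<open>Z\<close> is the normalised sum of the influence functions and \<open>W\<close> the inverse root of \<open>\<Sigma>\<close>,
  and \<open>S\<close> is asymptotically chi-square.\<close>

lemma confidence_region_coverage:
  assumes \<alpha>: "0 < \<alpha>" "\<alpha> < 1" and inv: "invertible \<Sigma>"
  shows "(\<lambda>t. prob {\<omega> \<in> space M. \<beta>0 \<in> CR_beta \<alpha> b v (\<epsilon> t) t (\<lambda>\<tau>. \<theta> \<tau> \<omega>) (\<beta> t \<omega>) (x t \<omega>)}) \<longlonglongrightarrow> 1 - \<alpha>"
proof -
  let ?k = "quantile (chi_square CARD('n)) (1 - \<alpha>)"
  have k: "cdf (chi_square CARD('n)) ?k = 1 - \<alpha>" "isCont (cdf (chi_square CARD('n))) z" "0 \<le> ?k" for z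
    using cdf_chi_square_quantile[of "CARD('n)" "1 - \<alpha>"] \<alpha> by auto
  obtain W where W: "transpose W = W" "W ** \<Sigma> ** W = mat 1" "W ** W = matrix_inv \<Sigma>"
    using inverse_sqrt_matrix[OF psd_Sigma inv] .
  \<comment> \<open>standardised influence vectors, with identity covariance\<close>
  define Y where "Y \<tau> \<omega> = W *v D (\<theta> \<tau> \<omega>)" for \<tau> \<omega>
  have uY: "u \<bullet> Y \<tau> \<omega> = (W *v u) \<bullet> D (\<theta> \<tau> \<omega>)" for u \<tau> \<omega> by (simp add: Y_def symmetric_inner[OF W(1)])
  have [measurable]: "(\<lambda>y. W *v D y) \<in> borel_measurable \<nu>"
  proof (rule borel_measurable_vecI)
    show "(\<lambda>y. (W *v D y) $ i) \<in> borel_measurable \<nu>" for i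
      unfolding matrix_vector_mult_def by simp
  qed
  define S where "S t \<omega> = (norm ((1 / sqrt (real t)) *\<^sub>R (\<Sum>\<tau><t. Y \<tau> \<omega>)))\<^sup>2" for t \<omega>
  have clt: "(\<lambda>t. prob {\<omega> \<in> space M. S t \<omega> \<le> c}) \<longlonglongrightarrow> cdf (chi_square CARD('n)) c" for c
    unfolding S_def
  proof (rule norm_squared_normalised_sum_chi_square)
    show "indep_vars (\<lambda>_. borel) Y UNIV" unfolding Y_def[abs_def] by (rule indep_items) measurable
    show "expectation (\<lambda>\<omega>. u \<bullet> Y \<tau> \<omega>) = 0" for \<tau> u unfolding uY by (rule expectation_D_inner(1))
    show "integrable M (\<lambda>\<omega>. (u \<bullet> Y \<tau> \<omega>)\<^sup>2)" for \<tau> u unfolding uY by (rule expectation_D_inner_squared(1))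
    show "expectation (\<lambda>\<omega>. (u \<bullet> Y \<tau> \<omega>)\<^sup>2) = u \<bullet> u" for \<tau> u
    proof -
      have "W *v (\<Sigma> *v (W *v u)) = u" using W(2) by (simp add: matrix_vector_mul_assoc matrix_mul_assoc)
      then have "(W *v u) \<bullet> (\<Sigma> *v (W *v u)) = u \<bullet> u"
        using symmetric_inner[OF W(1), of u "\<Sigma> *v (W *v u)"] by simp
      then show ?thesis unfolding uY expectation_D_inner_squared(2) .
    qed
    show "distr M borel (Y \<tau>) = distr M borel (Y 0)" for \<tau>
      unfolding Y_def[abs_def] by (rule identically_distributed) measurable
  qed
  have S_eq: "S t \<omega> = (- (X *v G t \<omega>)) \<bullet> (matrix_inv \<Sigma> *v (- (X *v G t \<omega>)))" if t: "0 < t" for t \<omega>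
  proof -
    have lin: "linear ((*v) W)" by (rule matrix_vector_mul_linear)
    have r: "(1 / r) * (r * r) = r" if "r \<noteq> 0" for r :: real using that by simp
    have "(\<Sum>\<tau><t. Y \<tau> \<omega>) = W *v (real t *\<^sub>R sample_mean t (\<lambda>\<tau>. D (\<theta> \<tau> \<omega>)))"
      using t by (simp add: Y_def linear_sum[OF lin, symmetric] sample_mean_def)
    also have "\<dots> = real t *\<^sub>R (W *v (- (X *v (mbar t \<omega> - \<mu>))))"
      unfolding sample_mean_D[OF t] mbar_def[symmetric] matrix_vector_mult_scaleR ..
    finally have "(1 / sqrt (real t)) *\<^sub>R (\<Sum>\<tau><t. Y \<tau> \<omega>) = sqrt t *\<^sub>R (W *v (- (X *v (mbar t \<omega> - \<mu>))))"
      using t r[of "sqrt (real t)"] by simp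
    also have "\<dots> = W *v (- (X *v G t \<omega>))" by (simp add: G_def matrix_vector_mult_scaleR vec.neg)
    finally show ?thesis unfolding S_def power2_norm_eq_inner W(3)[symmetric] matrix_vector_mul_assoc[symmetric]
      by (simp only: symmetric_inner[OF W(1), of "- (X *v G t \<omega>)"])
  qed
  have CR: "CR_beta \<alpha> b v (\<epsilon> t) t (\<lambda>\<tau>. \<theta> \<tau> \<omega>) (\<beta> t \<omega>) (x t \<omega>) =
      (\<lambda>u. \<beta> t \<omega> + (sqrt ?k / sqrt (real t)) *\<^sub>R (psd_sqrt (Shat t \<omega>) *v u)) ` cball 0 1" for t \<omega>
    by (simp add: CR_beta_def Shat_def)
  define E where "E t = {\<omega> \<in> space M. \<beta>0 \<in> CR_beta \<alpha> b v (\<epsilon> t) t (\<lambda>\<tau>. \<theta> \<tau> \<omega>) (\<beta> t \<omega>) (x t \<omega>)}" for t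
  have "(\<lambda>t. prob (E t)) \<longlonglongrightarrow> cdf (chi_square CARD('n)) ?k"
  proof (rule prob_tendsto_sandwich[OF _ _ clt k(2)])
    show "S t \<in> borel_measurable M" for t
    proof -
      have [measurable]: "Y \<tau> \<in> borel_measurable M" for \<tau> unfolding Y_def[abs_def] by measurable
      show ?thesis unfolding S_def[abs_def] by measurable
    qed
    show "\<forall>\<^sub>F t in sequentially. E t \<in> events"
      using eventually_ge_at_top[of 1]
    proof eventually_elim
      case (elim t)
      have pair: "(\<lambda>\<omega>. (\<beta> t \<omega>, Shat t \<omega>)) \<in> borel_measurable M"
        by (intro borel_measurable_Pair measurable_beta elim measurable_Shat)
      have "E t = (\<lambda>\<omega>. (\<beta> t \<omega>, Shat t \<omega>)) -` {w. psd (snd w) \<and> \<beta>0 \<in> (\<lambda>u. fst w + (sqrt ?k / sqrt (real t)) *\<^sub>R (psd_sqrt (snd w) *v u)) ` cball 0 1} \<inter> space M"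
        unfolding E_def CR by (auto simp: psd_Shat)
      then show ?case using measurable_sets[OF pair borel_ellipsoid_membership] by simp
    qed
    fix \<eta> :: real assume \<eta>: "0 < \<eta>"
    have "\<forall>\<^sub>F z in in_prob M. invertible (Shat (fst z) (snd z))" by (rule tendsto_matrix_inv(2)[OF Shat_tendsto inv])
    moreover have "\<forall>\<^sub>F z in in_prob M. dist (h (fst z) (snd z) \<bullet> (matrix_inv (Shat (fst z) (snd z)) *v h (fst z) (snd z))
      - (- (X *v G (fst z) (snd z))) \<bullet> (matrix_inv \<Sigma> *v (- (X *v G (fst z) (snd z))))) 0 < \<eta>"
      by (rule tendstoD[OF quadratic_forms_close[OF tendsto_matrix_inv(1)[OF Shat_tendsto inv]] \<eta>])
    ultimately show "\<forall>\<^sub>F z in in_prob M. snd z \<in> space M \<longrightarrow>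
        (S (fst z) (snd z) \<le> ?k - \<eta> \<longrightarrow> snd z \<in> E (fst z)) \<and> (snd z \<in> E (fst z) \<longrightarrow> S (fst z) (snd z) \<le> ?k + \<eta>)"
      using eventually_typical
    proof eventually_elim
      case (elim z)
      obtain t \<omega> where z: "z = (t, \<omega>)" by (cases z)
      have t: "0 < t" using elim(3) z by (simp add: typical_def)
      have "\<omega> \<in> E t \<longleftrightarrow> h t \<omega> \<bullet> (matrix_inv (Shat t \<omega>) *v h t \<omega>) \<le> ?k" if "\<omega> \<in> space M"
      proof -
        have sq: "transpose (psd_sqrt (Shat t \<omega>)) = psd_sqrt (Shat t \<omega>)" "psd_sqrt (Shat t \<omega>) ** psd_sqrt (Shat t \<omega>) = Shat t \<omega>"
          using psd_sqrt[OF psd_Shat] by (auto simp: psd_def)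
        have "invertible (Shat t \<omega>)" using elim(1) z by simp
        from ellipsoid_membership[OF sq this k(3), of "sqrt (real t)" \<beta>0 "\<beta> t \<omega>"]
        show ?thesis using that t by (simp add: E_def CR h_def \<Delta>_def)
      qed
      then show ?case using elim(2) S_eq[OF t, of \<omega>] unfolding z by (auto simp: dist_real_def)
    qed
  qed
  then show ?thesis by (simp add: k(1) E_def)
qed

text \<open>The event is a difference of two one-sided events for the standardised error, one per end of the interval. Each has
  the probability given by the limiting normal distribution.\<close>

lemma confidence_interval_coverage:
  assumes \<alpha>: "0 < \<alpha>" "\<alpha> < 1" and pos: "0 < \<sigma>2"
  shows "(\<lambda>t. prob {\<omega> \<in> space M. REV \<in> CI_rev \<alpha> b v (\<epsilon> t) t (\<lambda>\<tau>. \<theta> \<tau> \<omega>) (\<beta> t \<omega>) (p t \<omega>) (x t \<omega>)}) \<longlonglongrightarrow> 1 - \<alpha>"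
proof -
  let ?\<Phi> = "cdf std_normal_distribution"
  interpret N: real_distribution std_normal_distribution by (rule real_dist_normal_dist)
  define k where "k = quantile std_normal_distribution (1 - \<alpha> / 2)"
  have k: "?\<Phi> k = 1 - \<alpha> / 2"
    unfolding k_def by (rule cdf_quantile[OF real_dist_normal_dist std_normal_atomless]) (use \<alpha> in auto)
  have cont: "isCont ?\<Phi> c" for c by (simp add: N.isCont_cdf std_normal_atomless)
  have k0: "0 \<le> k"
  proof (rule ccontr)
    assume "\<not> 0 \<le> k"
    then have "?\<Phi> k \<le> ?\<Phi> 0" by (intro N.cdf_nondecreasing) simp
    then show False using cdf_std_normal_minus[of 0] k \<alpha> by simp
  qed
  define \<sigma> where "\<sigma> = sqrt \<sigma>2"
  have \<sigma>: "0 < \<sigma>" "\<sigma>\<^sup>2 = \<sigma>2" using pos by (auto simp: \<sigma>_def)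
  define S where "S t \<omega> = (\<Sum>\<tau><t. Dr (\<theta> \<tau> \<omega>)) / (sqrt (real t) * \<sigma>)" for t \<omega>
  define T where "T t \<omega> = sqrt (real t) * (sample_mean t (p t \<omega>) - REV)" for t \<omega>
  have clt: "(\<lambda>t. prob {\<omega> \<in> space M. S t \<omega> \<le> c}) \<longlonglongrightarrow> ?\<Phi> c" for c
    unfolding S_def
  proof (rule normalised_sum_std_normal_cdf[OF _ _ _ _ \<sigma>(1)])
    show "indep_vars (\<lambda>_. borel) (\<lambda>\<tau> \<omega>. Dr (\<theta> \<tau> \<omega>)) UNIV" by (rule indep_items) measurable
    show "distr M borel (\<lambda>\<omega>. Dr (\<theta> \<tau> \<omega>)) = distr M borel (\<lambda>\<omega>. Dr (\<theta> 0 \<omega>))" for \<tau> by (rule identically_distributed) measurable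
  qed (use expectation_Dr integrable_Dr sigma2_eq \<sigma> in auto)
  have mS: "S t \<in> borel_measurable M" for t unfolding S_def[abs_def] by measurable
  have mT: "T t \<in> borel_measurable M" for t
    unfolding T_def[abs_def] by (intro borel_measurable_times borel_measurable_diff borel_measurable_const measurable_revenue)
  have ms: "(\<lambda>\<omega>. sqrt (shat t \<omega>)) \<in> borel_measurable M" for t using measurable_shat[of t] by measurable
  have close: "\<forall>\<^sub>F z in in_prob M. \<bar>T (fst z) (snd z) - c * sqrt (shat (fst z) (snd z)) - \<sigma> * (S (fst z) (snd z) - c)\<bar> < \<sigma> * \<eta>"
    if \<eta>: "0 < \<eta>" for c \<eta>
  proof -
    have "((\<lambda>z. (sqrt (real (fst z)) * (sample_mean (fst z) (p (fst z) (snd z)) - REV)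
       - sqrt (real (fst z)) * sample_mean (fst z) (\<lambda>\<tau>. Dr (\<theta> \<tau> (snd z)))) + c * (\<sigma> - sqrt (shat (fst z) (snd z)))) \<longlongrightarrow> 0 + c * (\<sigma> - \<sigma>)) (in_prob M)"
      unfolding \<sigma>_def by (intro tendsto_add tendsto_mult tendsto_diff tendsto_const tendsto_real_sqrt revenue_asymptotically_linear shat_tendsto)
    then have "((\<lambda>z. (sqrt (real (fst z)) * (sample_mean (fst z) (p (fst z) (snd z)) - REV)
       - sqrt (real (fst z)) * sample_mean (fst z) (\<lambda>\<tau>. Dr (\<theta> \<tau> (snd z)))) + c * (\<sigma> - sqrt (shat (fst z) (snd z)))) \<longlongrightarrow> 0) (in_prob M)" by simp
    moreover have "0 < \<sigma> * \<eta>" using \<sigma>(1) \<eta> by simp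
    ultimately have "\<forall>\<^sub>F z in in_prob M. dist ((sqrt (real (fst z)) * (sample_mean (fst z) (p (fst z) (snd z)) - REV)
       - sqrt (real (fst z)) * sample_mean (fst z) (\<lambda>\<tau>. Dr (\<theta> \<tau> (snd z)))) + c * (\<sigma> - sqrt (shat (fst z) (snd z)))) 0 < \<sigma> * \<eta>"
      by (rule tendstoD)
    with eventually_typical show ?thesis
    proof eventually_elim
      case (elim z)
      have t: "1 \<le> fst z" using elim(1) by (simp add: typical_def)
      have r: "r * (c / (r * r)) = c / r" if "r \<noteq> 0" for r c :: real using that by simp
      have "sqrt (real (fst z)) * sample_mean (fst z) (\<lambda>\<tau>. Dr (\<theta> \<tau> (snd z))) = \<sigma> * S (fst z) (snd z)"
        using r[of "sqrt (real (fst z))"] t \<sigma>(1) by (simp add: S_def sample_mean_real)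
      then show ?case using elim(2) by (simp add: T_def dist_real_def algebra_simps)
    qed
  qed
  \<comment> \<open>the upper bound holds on \<open>E1\<close> and the lower bound fails on \<open>E2\<close>\<close>
  define E1 where "E1 t = {\<omega> \<in> space M. T t \<omega> \<le> k * sqrt (shat t \<omega>)}" for t
  define E2 where "E2 t = {\<omega> \<in> space M. T t \<omega> < (- k) * sqrt (shat t \<omega>)}" for t
  have E1: "E1 t \<in> events" for t unfolding E1_def using mT[of t] ms[of t] by measurable
  have E2: "E2 t \<in> events" for t unfolding E2_def using mT[of t] ms[of t] by measurable
  have sgn: "(y \<le> c - \<eta> \<longrightarrow> a - w < 0) \<and> (a - w \<le> 0 \<longrightarrow> y \<le> c + \<eta>)"
    if "\<bar>a - w - \<sigma> * (y - c)\<bar> < \<sigma> * \<eta>" for a w y c \<eta>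
  proof (intro conjI impI)
    assume "y \<le> c - \<eta>"
    then have "\<sigma> * (y - c) \<le> \<sigma> * (- \<eta>)" using \<sigma>(1) by (intro mult_left_mono) auto
    then show "a - w < 0" using that by simp
  next
    assume "a - w \<le> 0"
    then have "\<sigma> * (y - c) < \<sigma> * \<eta>" using that by linarith
    then show "y \<le> c + \<eta>" using \<sigma>(1) by (simp add: mult_less_cancel_left_pos)
  qed
  have P1: "(\<lambda>t. prob (E1 t)) \<longlonglongrightarrow> ?\<Phi> k"
  proof (rule prob_tendsto_sandwich[OF mS _ clt cont])
    fix \<eta> :: real assume "0 < \<eta>"
    from close[OF this, of k] show "\<forall>\<^sub>F z in in_prob M. snd z \<in> space M \<longrightarrow>
        (S (fst z) (snd z) \<le> k - \<eta> \<longrightarrow> snd z \<in> E1 (fst z)) \<and> (snd z \<in> E1 (fst z) \<longrightarrow> S (fst z) (snd z) \<le> k + \<eta>)"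
    proof eventually_elim
      case (elim z)
      from sgn[OF elim] show ?case by (auto simp: E1_def)
    qed
  qed (simp add: E1)
  have P2: "(\<lambda>t. prob (E2 t)) \<longlonglongrightarrow> ?\<Phi> (- k)"
  proof (rule prob_tendsto_sandwich[OF mS _ clt cont])
    fix \<eta> :: real assume "0 < \<eta>"
    from close[OF this, of "- k"] show "\<forall>\<^sub>F z in in_prob M. snd z \<in> space M \<longrightarrow>
        (S (fst z) (snd z) \<le> - k - \<eta> \<longrightarrow> snd z \<in> E2 (fst z)) \<and> (snd z \<in> E2 (fst z) \<longrightarrow> S (fst z) (snd z) \<le> - k + \<eta>)"
    proof eventually_elim
      case (elim z)
      from sgn[OF elim] show ?case by (auto simp: E2_def)
    qed
  qed (simp add: E2)
  \<comment> \<open>the quantile \<open>k\<close> is nonnegative\<close>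
  have "E2 t \<subseteq> E1 t" for t
  proof
    fix \<omega> assume "\<omega> \<in> E2 t"
    moreover have "0 \<le> shat t \<omega>" by (simp add: shat_eq sample_mean_real sum_nonneg)
    then have "0 \<le> k * sqrt (shat t \<omega>)" using k0 by simp
    ultimately show "\<omega> \<in> E1 t" by (simp add: E1_def E2_def)
  qed
  then have diff: "prob (E1 t - E2 t) = prob (E1 t) - prob (E2 t)" for t using E1 E2 by (intro finite_measure_Diff) auto
  have "(\<lambda>t. prob (E1 t - E2 t)) \<longlonglongrightarrow> ?\<Phi> k - ?\<Phi> (- k)" unfolding diff by (intro tendsto_diff P1 P2)
  also have "?\<Phi> k - ?\<Phi> (- k) = 1 - \<alpha>" by (simp add: cdf_std_normal_minus k)
  finally have lim: "(\<lambda>t. prob (E1 t - E2 t)) \<longlonglongrightarrow> 1 - \<alpha>" .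
  have "{\<omega> \<in> space M. REV \<in> CI_rev \<alpha> b v (\<epsilon> t) t (\<lambda>\<tau>. \<theta> \<tau> \<omega>) (\<beta> t \<omega>) (p t \<omega>) (x t \<omega>)} = E1 t - E2 t" if t: "1 \<le> t" for t
  proof -
    have "REV \<in> CI_rev \<alpha> b v (\<epsilon> t) t (\<lambda>\<tau>. \<theta> \<tau> \<omega>) (\<beta> t \<omega>) (p t \<omega>) (x t \<omega>) \<longleftrightarrow>
        T t \<omega> \<le> k * sqrt (shat t \<omega>) \<and> - (k * sqrt (shat t \<omega>)) \<le> T t \<omega>" for \<omega>
    proof -
      have r: "0 < sqrt (real t)" using t by simp
      have "REV \<in> CI_rev \<alpha> b v (\<epsilon> t) t (\<lambda>\<tau>. \<theta> \<tau> \<omega>) (\<beta> t \<omega>) (p t \<omega>) (x t \<omega>) \<longleftrightarrow>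
          sample_mean t (p t \<omega>) - REV \<le> k * sqrt (shat t \<omega>) / sqrt (real t) \<and> - (k * sqrt (shat t \<omega>)) / sqrt (real t) \<le> sample_mean t (p t \<omega>) - REV"
        by (auto simp: CI_rev_def Let_def k_def shat_def)
      also have "\<dots> \<longleftrightarrow> T t \<omega> \<le> k * sqrt (shat t \<omega>) \<and> - (k * sqrt (shat t \<omega>)) \<le> T t \<omega>"
        using r by (simp only: pos_le_divide_eq pos_divide_le_eq T_def mult.commute)
      finally show ?thesis .
    qed
    note iff = this
    show ?thesis
    proof (rule set_eqI)
      fix \<omega>
      show "\<omega> \<in> {\<omega> \<in> space M. REV \<in> CI_rev \<alpha> b v (\<epsilon> t) t (\<lambda>\<tau>. \<theta> \<tau> \<omega>) (\<beta> t \<omega>) (p t \<omega>) (x t \<omega>)} \<longleftrightarrow> \<omega> \<in> E1 t - E2 t"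
        unfolding E1_def E2_def mem_Collect_eq Diff_iff iff by (simp only: minus_mult_left[symmetric] not_less[symmetric]) blast
    qed
  qed
  note event_eq = this
  have "\<forall>\<^sub>F t in sequentially. prob (E1 t - E2 t) = prob {\<omega> \<in> space M. REV \<in> CI_rev \<alpha> b v (\<epsilon> t) t (\<lambda>\<tau>. \<theta> \<tau> \<omega>) (\<beta> t \<omega>) (p t \<omega>) (x t \<omega>)}"
    using eventually_ge_at_top[of 1] by eventually_elim (simp only: event_eq)
  with lim show ?thesis by (rule Lim_transform_eventually)
qed

end

theorem theorem3:
  fixes M :: "'w measure" and \<nu> :: "'a measure"
    and b \<beta>0 :: "real ^ 'n" and v x0 :: "'a \<Rightarrow> real ^ 'n" and s p0 :: "'a \<Rightarrow> real"
    and \<theta> :: "nat \<Rightarrow> 'w \<Rightarrow> 'a" and \<epsilon> :: "nat \<Rightarrow> real"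
    and \<beta> :: "nat \<Rightarrow> 'w \<Rightarrow> real ^ 'n" and p :: "nat \<Rightarrow> 'w \<Rightarrow> nat \<Rightarrow> real"
    and x :: "nat \<Rightarrow> 'w \<Rightarrow> nat \<Rightarrow> real ^ 'n"
  assumes market: "market \<nu> b v s"
    and limit: "limit_FPPE \<nu> b v s \<beta>0 p0 x0"
    and smo: "SMO \<nu> v s \<beta>0"
    and scs: "SCS \<nu> b s \<beta>0 p0 x0"
    and prob: "prob_space M"
    and draws: "\<And>\<tau>. distributed M \<nu> (\<theta> \<tau>) (\<lambda>y. ennreal (s y))"
    and indep: "prob_space.indep_vars M (\<lambda>_. \<nu>) \<theta> UNIV"
    and observed: "\<And>t. 1 \<le> t \<Longrightarrow>
          AE \<omega> in M. observed_FPPE b v (1 / real t) t (\<lambda>\<tau>. \<theta> \<tau> \<omega>) (\<beta> t \<omega>) (p t \<omega>) (x t \<omega>)"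
    and measurable_beta: "\<And>t. 1 \<le> t \<Longrightarrow> \<beta> t \<in> borel_measurable M"
    and measurable_price: "\<And>t \<tau>. \<tau> < t \<Longrightarrow> (\<lambda>\<omega>. p t \<omega> \<tau>) \<in> borel_measurable M"
    and measurable_alloc: "\<And>t \<tau>. \<tau> < t \<Longrightarrow> (\<lambda>\<omega>. x t \<omega> \<tau>) \<in> borel_measurable M"
    and smoothing: "decseq \<epsilon>" "\<epsilon> \<longlonglongrightarrow> 0" "filterlim (\<lambda>t. \<epsilon> t * sqrt (real t)) at_top sequentially"
  shows "tendsto_in_prob M
           (\<lambda>t \<omega>. hat_Sigma_beta b v (\<epsilon> t) t (\<lambda>\<tau>. \<theta> \<tau> \<omega>) (\<beta> t \<omega>) (x t \<omega>))
           (Sigma_beta \<nu> b v s \<beta>0 x0)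
       \<and> tendsto_in_prob M
           (\<lambda>t \<omega>. hat_sigma2_rev b v (\<epsilon> t) t (\<lambda>\<tau>. \<theta> \<tau> \<omega>) (\<beta> t \<omega>) (p t \<omega>) (x t \<omega>))
           (sigma2_rev \<nu> b v s \<beta>0 p0 x0)
       \<and> (\<forall>\<alpha>. 0 < \<alpha> \<and> \<alpha> < 1 \<longrightarrow>
            (invertible (Sigma_beta \<nu> b v s \<beta>0 x0) \<longrightarrow>
              (\<lambda>t. measure M {\<omega> \<in> space M.
                 \<beta>0 \<in> CR_beta \<alpha> b v (\<epsilon> t) t (\<lambda>\<tau>. \<theta> \<tau> \<omega>) (\<beta> t \<omega>) (x t \<omega>)})
              \<longlonglongrightarrow> 1 - \<alpha>) \<and>
            (0 < sigma2_rev \<nu> b v s \<beta>0 p0 x0 \<longrightarrow>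
              (\<lambda>t. measure M {\<omega> \<in> space M.
                 limit_revenue \<nu> s p0
                   \<in> CI_rev \<alpha> b v (\<epsilon> t) t (\<lambda>\<tau>. \<theta> \<tau> \<omega>) (\<beta> t \<omega>) (p t \<omega>) (x t \<omega>)})
              \<longlonglongrightarrow> 1 - \<alpha>))"
proof -
  interpret prob_space M by (rule prob)
  interpret fppe_observations M \<nu> b \<beta>0 v x0 s p0 \<theta> \<epsilon> \<beta> p x
    by unfold_locales (fact assms)+
  show ?thesis
    using covariance_consistent variance_consistent confidence_region_coverage confidence_interval_coverage
    unfolding Shat_def[abs_def] shat_def[abs_def] REV_def by blast
qed

end
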